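(* Let $d\ge1$ and $\alpha\in(1,2)$. Let $\varepsilon>0$ be such that for all initial data $(\rho_0,u_0)$ with $u_0,\nabla u_0\in\dot B^{2-\alpha}_{d,1}$, $\rho_0-1,\nabla\rho_0\in\dot B^1_{d,1}$ and $\|u_0\|_{\dot B^{2-\alpha}_{d,1}}+\|\rho_0-1\|_{\dot B^1_{d,1}}<\varepsilon$, the fractional Euler system $$\rho_t+\operatorname{div}(\rho u)=0,\qquad \rho u_t+\rho(u\cdot\nabla)u=\int_{\mathbb R^d}\frac{u(t,y)-u(t,x)}{|y-x|^{d+\alpha}}\,\rho(t,x)\rho(t,y)\,\mathrm dy$$ has a unique global solution $(\rho,u)$ with initial data $(\rho_0,u_0)$ satisfying $$u,\nabla u\in \mathcal C_b(\mathbb R_+;\dot B^{2-\alpha}_{d,1})\cap L^1(\mathbb R_+;\dot B^2_{d,1}),\qquad (\rho-1),\nabla\rho\in\mathcal C_b(\mathbb R_+;\dot B^1_{d,1})$$ (such an $\varepsilon$ exists). Let $(\rho,u)$ be such a global solution, for initial data satisfying these conditions. Then $$\|u(t)\|_{L^\infty(\mathbb R^d)}\to0\quad\text{as } t\to\infty.$$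
   Context: Homogeneous Besov spaces on $\mathbb R^d$: let $\chi$ be a smooth function supported in the ball $B(0,\frac43)$ with $\chi=1$ on $B(0,\frac34)$, and $\varphi(\xi):=\chi(\xi/2)-\chi(\xi)$, so that $\varphi$ is smooth, supported in $B(0,\frac83)\setminus B(0,\frac34)$ and $\sum_{j\in\mathbb Z}\varphi(2^{-j}\xi)=1$ for $\xi\neq0$. Let $\mathcal F$ be the Fourier transform in space, $\dot\Delta_j u:=\mathcal F^{-1}(\varphi(2^{-j}\cdot)\mathcal F u)$ and $\dot S_j u:=\mathcal F^{-1}(\chi(2^{-j}\cdot)\mathcal F u)$. For $s\in\mathbb R$, $p\in[1,\infty]$, $\|u\|_{\dot B^s_{p,1}}:=\sum_{j\in\mathbb Z}2^{js}\|\dot\Delta_j u\|_{L^p(\mathbb R^d)}$, and $\dot B^s_{p,1}$ is the set of tempered distributions $u$ with $\|u\|_{\dot B^s_{p,1}}<\infty$ and $\lim_{j\to-\infty}\|\dot S_ju\|_{L^\infty}=0$ (vector-valued functions are treated componentwise). $\mathcal C_b(I;X)$ denotes bounded continuous functions from $I$ to $X$; $\mathbb R_+=[0,\infty)$. Unknowns: $\rho(t,x)\in\mathbb R_+$ (density) and $u(t,x)\in\mathbb R^d$ (velocity). In this regularity class the system is understood through its renormalized form for $\sigma:=\rho-1$, in the sense of distributions: $$\sigma_t+\operatorname{div}(\sigma u)=-\operatorname{div}u,\qquad u_t+\mu(-\Delta)^{\alpha/2}u=I_\alpha(u,\sigma)-\mu\,\sigma(-\Delta)^{\alpha/2}u-(u\cdot\nabla)u,$$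 where $$I_\alpha(u,\sigma)(x):=\mathrm{pv}\int_{\mathbb R^d}\frac{u(x+y)-u(x)}{|y|^{d+\alpha}}\bigl(\sigma(x+y)-\sigma(x)\bigr)\,\mathrm dy,$$ $(-\Delta)^{\alpha/2}$ is the Fourier multiplier with symbol $|\xi|^\alpha$, and $\mu=\mu(d,\alpha)>0$ is the constant such that $\mathrm{pv}\int_{\mathbb R^d}\frac{u(x+y)-u(x)}{|y|^{d+\alpha}}\mathrm dy=-\mu(-\Delta)^{\alpha/2}u(x)$ for smooth $u$ decaying at infinity. (This is obtained from the original system by dividing the second equation by $\rho$; the integral in the original system is taken in the principal value sense.) *)

theory Defs
  imports "HOL-Probability.Probability"
begin

section \<open>Smooth functions, Schwartz functions, tempered distributions\<close>

definition dderiv :: "'a::euclidean_space \<Rightarrow> ('a \<Rightarrow> 'b::real_normed_vector) \<Rightarrow> 'a \<Rightarrow> 'b" where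
  "dderiv v f x = frechet_derivative f (at x) v"

definition iter_dderiv :: "'a::euclidean_space list \<Rightarrow> ('a \<Rightarrow> 'b::real_normed_vector) \<Rightarrow> 'a \<Rightarrow> 'b" where
  "iter_dderiv bs f = foldr dderiv bs f"

definition smooth :: "('a::euclidean_space \<Rightarrow> 'b::real_normed_vector) \<Rightarrow> bool" where
  "smooth f \<longleftrightarrow> (\<forall>bs. set bs \<subseteq> Basis \<longrightarrow> (\<forall>x. iter_dderiv bs f differentiable (at x)))"

definition schwartz :: "('a::euclidean_space \<Rightarrow> complex) \<Rightarrow> bool" where
  "schwartz \<psi> \<longleftrightarrow> smooth \<psi> \<and>
     (\<forall>bs k. set bs \<subseteq> Basis \<longrightarrow>
        bounded (range (\<lambda>x. (1 + norm x) ^ k *\<^sub>R iter_dderiv bs \<psi> x)))"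

definition schwartz_norm :: "nat \<Rightarrow> ('a::euclidean_space \<Rightarrow> complex) \<Rightarrow> real" where
  "schwartz_norm N \<psi> =
     (SUP (bs, x) \<in> {bs. set bs \<subseteq> Basis \<and> length bs \<le> N} \<times> UNIV.
        (1 + norm x) ^ N * norm (iter_dderiv bs \<psi> x))"

text \<open>A distribution is a functional on functions; only its values on Schwartz functions matter.
  In particular two functionals that agree on Schwartz functions are the same distribution.\<close>

type_synonym 'a functional = "('a \<Rightarrow> complex) \<Rightarrow> complex"

definition tempered :: "'a::euclidean_space functional \<Rightarrow> bool" where
  "tempered T \<longleftrightarrow>
     (\<forall>\<psi> \<eta> a b. schwartz \<psi> \<longrightarrow> schwartz \<eta> \<longrightarrow>
        T (\<lambda>x. a * \<psi> x + b * \<eta> x) = a * T \<psi> + b * T \<eta>) \<and>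
     (\<exists>C N. \<forall>\<psi>. schwartz \<psi> \<longrightarrow> norm (T \<psi>) \<le> C * schwartz_norm N \<psi>)"

definition pairing :: "('a::euclidean_space \<Rightarrow> complex) \<Rightarrow> 'a functional" where
  "pairing f = (\<lambda>\<psi>. LINT x|lborel. f x * \<psi> x)"

abbreviation rpairing :: "('a::euclidean_space \<Rightarrow> real) \<Rightarrow> 'a functional" where
  "rpairing f \<equiv> pairing (\<lambda>x. complex_of_real (f x))"

text \<open>The functions that can be paired with every Schwartz function; since Schwartz functions
  without zeros exist, such a function is automatically Borel measurable.\<close>

definition pairable :: "('a::euclidean_space \<Rightarrow> complex) \<Rightarrow> bool" where
  "pairable f \<longleftrightarrow> (\<forall>\<psi>. schwartz \<psi> \<longrightarrow> integrable lborel (\<lambda>x. f x * \<psi> x))"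

abbreviation rpairable :: "('a::euclidean_space \<Rightarrow> real) \<Rightarrow> bool" where
  "rpairable f \<equiv> pairable (\<lambda>x. complex_of_real (f x))"

definition represents :: "('a::euclidean_space \<Rightarrow> complex) \<Rightarrow> 'a functional \<Rightarrow> bool" where
  "represents f T \<longleftrightarrow> pairable f \<and> (\<forall>\<psi>. schwartz \<psi> \<longrightarrow> T \<psi> = pairing f \<psi>)"

abbreviation rrepresents :: "('a::euclidean_space \<Rightarrow> real) \<Rightarrow> 'a functional \<Rightarrow> bool" where
  "rrepresents f T \<equiv> represents (\<lambda>x. complex_of_real (f x)) T"

definition dist_deriv :: "'n::finite \<Rightarrow> (real^'n) functional \<Rightarrow> (real^'n) functional" where
  "dist_deriv k T = (\<lambda>\<psi>. - T (dderiv (axis k 1) \<psi>))"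

section \<open>Fourier transform and Fourier multipliers\<close>

definition fourier :: "(real^'n::finite \<Rightarrow> complex) \<Rightarrow> real^'n \<Rightarrow> complex" where
  "fourier f \<xi> = (LINT x|lborel. cis (- (x \<bullet> \<xi>)) * f x)"

definition inv_fourier :: "(real^'n::finite \<Rightarrow> complex) \<Rightarrow> real^'n \<Rightarrow> complex" where
  "inv_fourier f x = (LINT \<xi>|lborel. cis (x \<bullet> \<xi>) * f \<xi>) / complex_of_real ((2 * pi) ^ CARD('n))"

text \<open>The multiplier \<open>T \<mapsto> inv_fourier (m \<cdot> fourier T)\<close> on distributions, by transposition:
  \<open>\<langle>F\<^sup>-\<^sup>1 (m F T), \<psi>\<rangle> = \<langle>T, F (m F\<^sup>-\<^sup>1 \<psi>)\<rangle>\<close>.  If \<open>m\<close> is smooth with compact support, \<open>F (m F\<^sup>-\<^sup>1 \<psi>)\<close> is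
  again a Schwartz function.  For \<open>m = |\<xi>|^\<alpha>\<close> it is only \<open>O(|x|^(-d-\<alpha>))\<close>, which can still be
  paired with bounded functions, so the formula is then meaningful for \<open>T = pairing u\<close> with
  \<open>u\<close> bounded.\<close>

definition multiplier :: "(real^'n::finite \<Rightarrow> real) \<Rightarrow> (real^'n) functional \<Rightarrow> (real^'n) functional" where
  "multiplier m T = (\<lambda>\<psi>. T (fourier (\<lambda>\<xi>. complex_of_real (m \<xi>) * inv_fourier \<psi> \<xi>)))"

definition frac_lap :: "real \<Rightarrow> (real^'n::finite) functional \<Rightarrow> (real^'n) functional" where
  "frac_lap \<alpha> = multiplier (\<lambda>\<xi>. norm \<xi> powr \<alpha>)"

definition frac_lap_fun :: "real \<Rightarrow> (real^'n::finite \<Rightarrow> complex) \<Rightarrow> real^'n \<Rightarrow> complex" where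
  "frac_lap_fun \<alpha> f = inv_fourier (\<lambda>\<xi>. complex_of_real (norm \<xi> powr \<alpha>) * fourier f \<xi>)"

section \<open>Homogeneous Besov spaces\<close>

definition cutoff :: "(real^'n::finite \<Rightarrow> real) \<Rightarrow> bool" where
  "cutoff chi \<longleftrightarrow> smooth chi \<and> closure {\<xi>. chi \<xi> \<noteq> 0} \<subseteq> cball 0 (4/3) \<and> (\<forall>\<xi>\<in>ball 0 (3/4). chi \<xi> = 1)"

definition LP_phi :: "(real^'n::finite \<Rightarrow> real) \<Rightarrow> real^'n \<Rightarrow> real" where
  "LP_phi chi \<xi> = chi (\<xi> /\<^sub>R 2) - chi \<xi>"

definition LP_block :: "(real^'n::finite \<Rightarrow> real) \<Rightarrow> int \<Rightarrow> (real^'n) functional \<Rightarrow> (real^'n) functional" where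
  "LP_block chi j = multiplier (\<lambda>\<xi>. LP_phi chi ((2 powr (- real_of_int j)) *\<^sub>R \<xi>))"

definition LP_low :: "(real^'n::finite \<Rightarrow> real) \<Rightarrow> int \<Rightarrow> (real^'n) functional \<Rightarrow> (real^'n) functional" where
  "LP_low chi j = multiplier (\<lambda>\<xi>. chi ((2 powr (- real_of_int j)) *\<^sub>R \<xi>))"

text \<open>Meant for Borel functions and \<open>1 \<le> p \<le> \<infinity>\<close>.\<close>

definition Lp_norm :: "ennreal \<Rightarrow> ('a::euclidean_space \<Rightarrow> 'b::real_normed_vector) \<Rightarrow> ennreal" where
  "Lp_norm p f =
     (if p = \<infinity> then esssup lborel (\<lambda>x. ennreal (norm (f x)))
      else let I = (\<integral>\<^sup>+x. ennreal (norm (f x) powr enn2real p) \<partial>lborel)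
           in if I = \<infinity> then \<infinity> else ennreal (enn2real I powr (1 / enn2real p)))"

text \<open>The infimum is over the (a.e. unique) functions representing \<open>T\<close>; it is \<open>\<infinity>\<close> if \<open>T\<close> is not
  given by a function.\<close>

definition dist_Lp_norm :: "ennreal \<Rightarrow> 'a::euclidean_space functional \<Rightarrow> ennreal" where
  "dist_Lp_norm p T = (INF f \<in> {f. represents f T}. Lp_norm p f)"

definition besov_norm ::
  "(real^'n::finite \<Rightarrow> real) \<Rightarrow> real \<Rightarrow> ennreal \<Rightarrow> (real^'n) functional \<Rightarrow> ennreal" where
  "besov_norm chi s p T =
     (\<Sum>\<^sub>\<infinity>j::int. ennreal (2 powr (real_of_int j * s)) * dist_Lp_norm p (LP_block chi j T))"

definition besov ::
  "(real^'n::finite \<Rightarrow> real) \<Rightarrow> real \<Rightarrow> ennreal \<Rightarrow> (real^'n) functional set" where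
  "besov chi s p = {T. tempered T \<and> besov_norm chi s p T < \<infinity> \<and>
     ((\<lambda>j. dist_Lp_norm \<infinity> (LP_low chi j T)) \<longlongrightarrow> 0) at_bot}"

definition Cb_besov ::
  "(real^'n::finite \<Rightarrow> real) \<Rightarrow> real \<Rightarrow> ennreal \<Rightarrow> (real \<Rightarrow> (real^'n) functional) set" where
  "Cb_besov chi s p = {T.
     (\<forall>t\<ge>0. T t \<in> besov chi s p) \<and>
     (\<exists>M::real. \<forall>t\<ge>0. besov_norm chi s p (T t) \<le> ennreal M) \<and>
     (\<forall>t\<ge>0. ((\<lambda>r. besov_norm chi s p (\<lambda>\<psi>. T r \<psi> - T t \<psi>)) \<longlongrightarrow> 0) (at t within {0..}))}"

text \<open>Bochner integrability on \<open>[0,\<infinity>)\<close>: the map is a.e. the limit of simple functions, and its norm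
  is integrable.  (The library's Bochner integral needs a normed vector space as a type.)\<close>

definition L1_besov ::
  "(real^'n::finite \<Rightarrow> real) \<Rightarrow> real \<Rightarrow> ennreal \<Rightarrow> (real \<Rightarrow> (real^'n) functional) set" where
  "L1_besov chi s p = {T.
     (AE t in lebesgue. 0 \<le> t \<longrightarrow> T t \<in> besov chi s p) \<and>
     (\<exists>S :: nat \<Rightarrow> real \<Rightarrow> (real^'n) functional.
        (\<forall>n. finite (S n ` {0..}) \<and> S n ` {0..} \<subseteq> besov chi s p \<and>
             (\<forall>a. {t\<in>{0..}. S n t = a} \<in> sets lebesgue)) \<and>
        (AE t in lebesgue. 0 \<le> t \<longrightarrow>
             (\<lambda>n. besov_norm chi s p (\<lambda>\<psi>. S n t \<psi> - T t \<psi>)) \<longlonglongrightarrow> 0)) \<and>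
     (\<integral>\<^sup>+t\<in>{0..}. besov_norm chi s p (T t) \<partial>lebesgue) < \<infinity>}"

section \<open>Principal values and the constant \<open>\<mu>(d,\<alpha>)\<close>\<close>

definition has_pv :: "('a::euclidean_space \<Rightarrow> 'b::{banach, second_countable_topology}) \<Rightarrow> 'b \<Rightarrow> bool" where
  "has_pv g l \<longleftrightarrow>
     (\<forall>\<delta>>0. set_integrable lborel {y. norm y > \<delta>} g) \<and>
     ((\<lambda>\<delta>. LINT y:{y. norm y > \<delta>}|lborel. g y) \<longlongrightarrow> l) (at_right 0)"

definition mu_const :: "'n::finite itself \<Rightarrow> real \<Rightarrow> real" where
  "mu_const _ \<alpha> = (THE \<mu>. \<mu> > 0 \<and>
     (\<forall>f :: real^'n \<Rightarrow> complex. schwartz f \<longrightarrow>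
        (\<forall>x. has_pv (\<lambda>y. (f (x + y) - f x) /\<^sub>R norm y powr (real CARD('n) + \<alpha>))
                    (- (\<mu> *\<^sub>R frac_lap_fun \<alpha> f x)))))"

section \<open>The fractional Euler system\<close>

definition test_fun :: "(real \<times> (real^'n::finite) \<Rightarrow> real) \<Rightarrow> bool" where
  "test_fun \<phi> \<longleftrightarrow> smooth \<phi> \<and> compact (closure {z. \<phi> z \<noteq> 0}) \<and> closure {z. \<phi> z \<noteq> 0} \<subseteq> {0<..} \<times> UNIV"

definition dt :: "(real \<times> (real^'n::finite) \<Rightarrow> real) \<Rightarrow> real \<Rightarrow> real^'n \<Rightarrow> real" where
  "dt \<phi> t x = dderiv (1, 0) \<phi> (t, x)"

definition grad :: "(real \<times> (real^'n::finite) \<Rightarrow> real) \<Rightarrow> real \<Rightarrow> real^'n \<Rightarrow> real^'n" where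
  "grad \<phi> t x = (\<chi> k. dderiv (0, axis k 1) \<phi> (t, x))"

text \<open>Iterated rather than double integrals: solutions are given by a representative at each time,
  so joint measurability in \<open>(t, x)\<close> is not available.\<close>

definition spacetime_integral_zero ::
  "(real \<Rightarrow> real^'n::finite \<Rightarrow> 'b::{banach, second_countable_topology}) \<Rightarrow> bool" where
  "spacetime_integral_zero F \<longleftrightarrow>
     (AE t in lborel. t > 0 \<longrightarrow> integrable lborel (F t)) \<and>
     set_integrable lborel {0<..} (\<lambda>t. LINT x|lborel. F t x) \<and>
     (LINT t:{0<..}|lborel. LINT x|lborel. F t x) = 0"

text \<open>\<open>\<sigma>\<^sub>t + div (\<sigma> u) = - div u\<close> in the sense of distributions on \<open>(0,\<infinity>) \<times> \<real>\<^sup>d\<close>.\<close>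

definition weak_continuity_eq ::
  "(real \<Rightarrow> real^'n::finite \<Rightarrow> real) \<Rightarrow> (real \<Rightarrow> real^'n \<Rightarrow> real^'n) \<Rightarrow> bool" where
  "weak_continuity_eq \<sigma> u \<longleftrightarrow>
     (\<forall>\<phi>. test_fun \<phi> \<longrightarrow> spacetime_integral_zero
        (\<lambda>t x. \<sigma> t x * dt \<phi> t x + \<sigma> t x * (u t x \<bullet> grad \<phi> t x) + u t x \<bullet> grad \<phi> t x))"

text \<open>\<open>u\<^sub>t + \<mu> (-\<Delta>)^(\<alpha>/2) u = I\<^sub>\<alpha>(u,\<sigma>) - \<mu> \<sigma> (-\<Delta>)^(\<alpha>/2) u - (u \<cdot> \<nabla>) u\<close> in the sense of distributions.
  Here \<open>A\<close>, \<open>G\<close>, \<open>J\<close> are the functions \<open>(-\<Delta>)^(\<alpha>/2) u\<close>, \<open>\<nabla>u\<close> (with \<open>G t x $ i $ k = \<partial>\<^sub>k u\<^sub>i\<close>) and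
  \<open>I\<^sub>\<alpha>(u,\<sigma>)\<close>; in the solution class below these exist for almost every time.\<close>

definition weak_momentum_eq ::
  "real \<Rightarrow> (real \<Rightarrow> real^'n::finite \<Rightarrow> real) \<Rightarrow> (real \<Rightarrow> real^'n \<Rightarrow> real^'n) \<Rightarrow> bool" where
  "weak_momentum_eq \<alpha> \<sigma> u \<longleftrightarrow>
     (\<exists>(A :: real \<Rightarrow> real^'n \<Rightarrow> real^'n) (G :: real \<Rightarrow> real^'n \<Rightarrow> real^'n^'n) (J :: real \<Rightarrow> real^'n \<Rightarrow> real^'n).
        (AE t in lborel. t > 0 \<longrightarrow>
           (\<forall>i. rrepresents (\<lambda>x. A t x $ i) (frac_lap \<alpha> (rpairing (\<lambda>x. u t x $ i)))) \<and>
           (\<forall>i k. rrepresents (\<lambda>x. G t x $ i $ k) (dist_deriv k (rpairing (\<lambda>x. u t x $ i)))) \<and>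
           (AE x in lborel. has_pv
              (\<lambda>y. ((\<sigma> t (x + y) - \<sigma> t x) / norm y powr (real CARD('n) + \<alpha>)) *\<^sub>R (u t (x + y) - u t x))
              (J t x))) \<and>
        (\<forall>\<phi>. test_fun \<phi> \<longrightarrow> spacetime_integral_zero
           (\<lambda>t x. dt \<phi> t x *\<^sub>R u t x
              + \<phi> (t, x) *\<^sub>R (- (mu_const TYPE('n) \<alpha> *\<^sub>R A t x) + J t x
                  - (mu_const TYPE('n) \<alpha> * \<sigma> t x) *\<^sub>R A t x - G t x *v u t x))))"

definition admissible_data ::
  "(real^'n::finite \<Rightarrow> real) \<Rightarrow> real \<Rightarrow> real \<Rightarrow> (real^'n \<Rightarrow> real) \<Rightarrow> (real^'n \<Rightarrow> real^'n) \<Rightarrow> bool" where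
  "admissible_data chi \<alpha> \<epsilon> \<rho>0 u0 \<longleftrightarrow>
     (AE x in lborel. \<rho>0 x \<ge> 0) \<and>
     rpairable \<rho>0 \<and> (\<forall>i. rpairable (\<lambda>x. u0 x $ i)) \<and>
     (\<forall>i. rpairing (\<lambda>x. u0 x $ i) \<in> besov chi (2 - \<alpha>) (of_nat CARD('n))) \<and>
     (\<forall>i k. dist_deriv k (rpairing (\<lambda>x. u0 x $ i)) \<in> besov chi (2 - \<alpha>) (of_nat CARD('n))) \<and>
     rpairing (\<lambda>x. \<rho>0 x - 1) \<in> besov chi 1 (of_nat CARD('n)) \<and>
     (\<forall>k. dist_deriv k (rpairing \<rho>0) \<in> besov chi 1 (of_nat CARD('n))) \<and>
     (\<Sum>i\<in>UNIV. besov_norm chi (2 - \<alpha>) (of_nat CARD('n)) (rpairing (\<lambda>x. u0 x $ i)))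
       + besov_norm chi 1 (of_nat CARD('n)) (rpairing (\<lambda>x. \<rho>0 x - 1)) < ennreal \<epsilon>"

definition global_solution ::
  "(real^'n::finite \<Rightarrow> real) \<Rightarrow> real \<Rightarrow> (real^'n \<Rightarrow> real) \<Rightarrow> (real^'n \<Rightarrow> real^'n) \<Rightarrow>
   (real \<Rightarrow> real^'n \<Rightarrow> real) \<Rightarrow> (real \<Rightarrow> real^'n \<Rightarrow> real^'n) \<Rightarrow> bool" where
  "global_solution chi \<alpha> \<rho>0 u0 \<rho> u \<longleftrightarrow>
     (\<forall>t\<ge>0. (AE x in lborel. \<rho> t x \<ge> 0) \<and> rpairable (\<rho> t) \<and> (\<forall>i. rpairable (\<lambda>x. u t x $ i))) \<and>
     (\<forall>i. (\<lambda>t. rpairing (\<lambda>x. u t x $ i))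
        \<in> Cb_besov chi (2 - \<alpha>) (of_nat CARD('n)) \<inter> L1_besov chi 2 (of_nat CARD('n))) \<and>
     (\<forall>i k. (\<lambda>t. dist_deriv k (rpairing (\<lambda>x. u t x $ i)))
        \<in> Cb_besov chi (2 - \<alpha>) (of_nat CARD('n)) \<inter> L1_besov chi 2 (of_nat CARD('n))) \<and>
     (\<lambda>t. rpairing (\<lambda>x. \<rho> t x - 1)) \<in> Cb_besov chi 1 (of_nat CARD('n)) \<and>
     (\<forall>k. (\<lambda>t. dist_deriv k (rpairing (\<rho> t))) \<in> Cb_besov chi 1 (of_nat CARD('n))) \<and>
     weak_continuity_eq (\<lambda>t x. \<rho> t x - 1) u \<and>
     weak_momentum_eq \<alpha> (\<lambda>t x. \<rho> t x - 1) u \<and>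
     (AE x in lborel. \<rho> 0 x = \<rho>0 x \<and> u 0 x = u0 x)"

text \<open>Uniqueness is equality almost everywhere in space, for every time.\<close>

definition well_posedness_threshold :: "(real^'n::finite \<Rightarrow> real) \<Rightarrow> real \<Rightarrow> real \<Rightarrow> bool" where
  "well_posedness_threshold chi \<alpha> \<epsilon> \<longleftrightarrow>
     (\<forall>\<rho>0 u0. admissible_data chi \<alpha> \<epsilon> \<rho>0 u0 \<longrightarrow>
        (\<exists>\<rho> u. global_solution chi \<alpha> \<rho>0 u0 \<rho> u) \<and>
        (\<forall>\<rho> u \<rho>' u'. global_solution chi \<alpha> \<rho>0 u0 \<rho> u \<longrightarrow> global_solution chi \<alpha> \<rho>0 u0 \<rho>' u' \<longrightarrow>
           (\<forall>t\<ge>0. AE x in lborel. \<rho> t x = \<rho>' t x \<and> u t x = u' t x)))"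

end

theory Submission
  imports Defs
begin

text \<open>The velocity decays because its high frequencies are integrable in time while its low frequencies are
  bounded in a space of negative regularity.

  All spatial norms are expressed through \<open>dnorm T\<close>, the norm of a distribution \<open>T\<close> as a functional on
  Schwartz functions with the \<open>L\<^sup>1\<close> norm, which is the \<open>L\<^sup>\<infinity>\<close> norm when \<open>T\<close> is a function.  A Fourier
  multiplier with a compactly supported smooth symbol acts by convolution with a kernel whose \<open>L\<^sup>1\<close> norm is
  invariant under dilation of the symbol, so that multipliers on dyadic blocks are bounded for \<open>dnorm\<close>
  uniformly in the frequency, by duality.  Bernstein's inequality (\<open>bernstein\<close>) turns the norms of
  \<open>B\<^sup>s\<^sub>d\<^sub>,\<^sub>1\<close> into the norms \<open>bsum (s - 1)\<close>, that is \<open>B\<^sup>s\<^sup>-\<^sup>1\<close> based on \<open>L\<^sup>\<infinity>\<close> with summability one: each of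
  \<open>u\<close> and \<open>\<nabla>u\<close> is bounded in time with values in regularity \<open>1 - \<alpha>\<close> and integrable in time with values in
  regularity \<open>1\<close>; each of \<open>\<sigma> = \<rho> - 1\<close> and \<open>\<nabla>\<rho>\<close> is bounded with regularity \<open>0\<close>.  In particular \<open>u\<close>, \<open>\<sigma>\<close> and
  \<open>\<nabla>\<rho>\<close> are bounded functions, uniformly in time (\<open>dnorm_reconstruct\<close>).

  These bounds make the right-hand side of
  \<open>u\<^sub>t = - \<mu> (1 + \<sigma>) (-\<Delta>)\<^sup>\<alpha>\<^sup>/\<^sup>2 u + I\<^sub>\<alpha>(u, \<sigma>) - (u \<cdot> \<nabla>) u\<close>
  integrable in time with values in \<open>L\<^sup>\<infinity>\<close> (\<open>rhs_bound\<close>): the fractional Laplacian costs regularity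
  \<open>\<alpha>\<close>, which lies between the regularities \<open>1\<close> and \<open>2\<close> in which \<open>u\<close> is integrable (\<open>dnorm_frac_lap\<close>); the
  kernel of \<open>I\<^sub>\<alpha>\<close> is absolutely integrable against two Lipschitz increments near the origin and against
  one of them at infinity, because \<open>1 < \<alpha> < 2\<close> (\<open>has_pv_bound\<close>); and \<open>\<nabla>u\<close> is bounded by its regularity \<open>0\<close>
  norm.  Let \<open>h(t)\<close> be the resulting integrable majorant.  Testing the equation with a smoothed indicator
  of a time interval times a mollifier gives, for \<open>2 \<le> s \<le> t\<close>, that mollifications of \<open>u(t) - u(s)\<close> are at most a
  constant times the integral of \<open>h\<close> over \<open>[s - 1, \<infinity>)\<close> (\<open>weak_increment_bound\<close>).

  Since \<open>h\<close> is integrable, this tail tends to 0 and \<open>h(s)\<close> is arbitrarily small for some arbitrarily late \<open>s\<close>.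
  At such a time, split the frequencies at \<open>2\<^sup>-\<^sup>l\<close> with \<open>l > 0\<close>: the low part of \<open>u(s)\<close> is at most
  \<open>2\<^sup>-\<^sup>(\<^sup>\<alpha>\<^sup>-\<^sup>1\<^sup>)\<^sup>l\<close> times the bound in regularity \<open>1 - \<alpha> < 0\<close>, which is small once \<open>l\<close> is large, and the rest
  is at most \<open>2\<^sup>l h(s)\<close>, which is small once \<open>s\<close> is chosen after \<open>l\<close> (\<open>bsum_split\<close>).  So \<open>u(s)\<close> is small
  for some late \<open>s\<close> and stays small afterwards (\<open>velocity_decay\<close>).\<close>

section \<open>Smooth functions\<close>

text \<open>Smoothness speaks about lists of directions; counting the derivatives instead makes
  closure properties provable by induction on the order, through the product and chain rules.\<close>

primrec Cn :: "nat \<Rightarrow> ('a::euclidean_space \<Rightarrow> 'b::real_normed_vector) \<Rightarrow> bool" where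
  "Cn 0 f = (\<forall>x. f differentiable (at x))"
| "Cn (Suc n) f = ((\<forall>x. f differentiable (at x)) \<and> (\<forall>b\<in>Basis. Cn n (dderiv b f)))"

lemma iter_dderiv_Nil [simp]: "iter_dderiv [] f = f"
  by (simp add: iter_dderiv_def)

lemma iter_dderiv_Cons [simp]: "iter_dderiv (b # bs) f = dderiv b (iter_dderiv bs f)"
  by (simp add: iter_dderiv_def)

lemma iter_dderiv_append: "iter_dderiv (bs @ cs) f = iter_dderiv bs (iter_dderiv cs f)"
  by (induction bs) auto

lemma Cn_iff:
  "Cn n f \<longleftrightarrow> (\<forall>bs. set bs \<subseteq> Basis \<and> length bs \<le> n \<longrightarrow> (\<forall>x. iter_dderiv bs f differentiable (at x)))"
proof (induction n arbitrary: f)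
  case 0
  then show ?case by auto
next
  case (Suc n)
  show ?case
  proof safe
    fix bs x assume C: "Cn (Suc n) f" and bs: "set bs \<subseteq> (Basis::'a set)" "length bs \<le> Suc n"
    show "iter_dderiv bs f differentiable (at x)"
    proof (cases bs rule: rev_cases)
      case Nil
      then show ?thesis using C by simp
    next
      case (snoc cs b)
      then have "Cn n (dderiv b f)" using C bs by auto
      then show ?thesis using Suc bs snoc by (simp add: iter_dderiv_append)
    qed
  next
    assume H: "\<forall>bs. set bs \<subseteq> Basis \<and> length bs \<le> Suc n \<longrightarrow> (\<forall>x. iter_dderiv bs f differentiable (at x))"
    have "f differentiable (at x)" for x
      using H[rule_format, of "[]"] by simp
    moreover have "Cn n (dderiv b f)" if b: "b \<in> Basis" for b
      unfolding Suc
    proof safe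
      fix bs x assume "set bs \<subseteq> (Basis::'a set)" "length bs \<le> n"
      then show "iter_dderiv bs (dderiv b f) differentiable (at x)"
        using H[rule_format, of "bs @ [b]" x] b by (simp add: iter_dderiv_append)
    qed
    ultimately show "Cn (Suc n) f" by simp
  qed
qed

lemma smooth_iff_Cn: "smooth f \<longleftrightarrow> (\<forall>n. Cn n f)"
  unfolding smooth_def Cn_iff by auto

lemma Cn_differentiable: "Cn n f \<Longrightarrow> f differentiable (at x)"
  by (cases n) auto

lemma Cn_SucD: "Cn (Suc n) f \<Longrightarrow> Cn n f"
  unfolding Cn_iff by auto

lemma smooth_differentiable: "smooth f \<Longrightarrow> f differentiable (at x)"
  using Cn_differentiable smooth_iff_Cn by blast

lemma smooth_dderiv: "smooth f \<Longrightarrow> b \<in> Basis \<Longrightarrow> smooth (dderiv b f)"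
  unfolding smooth_iff_Cn by (metis Cn.simps(2))

lemma smooth_iter_dderiv: "smooth f \<Longrightarrow> set bs \<subseteq> Basis \<Longrightarrow> smooth (iter_dderiv bs f)"
  by (induction bs) (auto intro: smooth_dderiv)

lemma has_derivative_dderiv: "f differentiable (at x) \<Longrightarrow> (f has_derivative (\<lambda>v. dderiv v f x)) (at x)"
  unfolding dderiv_def by (simp add: frechet_derivative_works[symmetric])

lemma dderiv_eqI: "(f has_derivative D) (at x) \<Longrightarrow> dderiv v f x = D v"
  unfolding dderiv_def by (metis frechet_derivative_at)

lemma dderiv_linear: "f differentiable (at x) \<Longrightarrow> linear (\<lambda>v. dderiv v f x)"
  using has_derivative_dderiv has_derivative_linear by blast

lemma dderiv_Basis_sum:
  "f differentiable (at x) \<Longrightarrow> dderiv v f x = (\<Sum>b\<in>Basis. (v \<bullet> b) *\<^sub>R dderiv b f x)"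
proof -
  assume "f differentiable (at x)"
  then interpret linear "\<lambda>v. dderiv v f x" by (rule dderiv_linear)
  have "dderiv v f x = dderiv (\<Sum>b\<in>Basis. (v \<bullet> b) *\<^sub>R b) f x"
    by (simp add: euclidean_representation)
  also have "\<dots> = (\<Sum>b\<in>Basis. (v \<bullet> b) *\<^sub>R dderiv b f x)"
    by (simp add: sum scale)
  finally show ?thesis .
qed

lemma smooth_continuous: "smooth f \<Longrightarrow> continuous_on S f"
  by (meson continuous_at_imp_continuous_on differentiable_imp_continuous_within smooth_differentiable)

lemma Cn_const: "Cn n (\<lambda>x. c)"
proof (induction n arbitrary: c)
  case (Suc n)
  have "dderiv b (\<lambda>x. c) = (\<lambda>x. 0)" for b :: 'a
    by (rule ext, rule dderiv_eqI) auto
  with Suc show ?case by simp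
qed simp

lemma Cn_add: "Cn n f \<Longrightarrow> Cn n g \<Longrightarrow> Cn n (\<lambda>x. f x + g x)"
proof (induction n arbitrary: f g)
  case (Suc n)
  have "dderiv b (\<lambda>x. f x + g x) = (\<lambda>x. dderiv b f x + dderiv b g x)" for b :: 'a
    by (rule ext, rule dderiv_eqI, intro has_derivative_add has_derivative_dderiv)
       (use Suc.prems in auto)
  with Suc show ?case by auto
qed auto

lemma (in bounded_linear) Cn_image: "Cn n g \<Longrightarrow> Cn n (\<lambda>x. f (g x))"
proof (induction n arbitrary: g)
  case 0
  then show ?case by (auto simp: differentiable_def intro: has_derivative)
next
  case (Suc n)
  have "dderiv b (\<lambda>x. f (g x)) = (\<lambda>x. f (dderiv b g x))" for b
    by (rule ext, rule dderiv_eqI, intro has_derivative has_derivative_dderiv)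
       (use Suc.prems in auto)
  moreover have "(\<lambda>x. f (g x)) differentiable (at x)" for x
    using has_derivative[OF has_derivative_dderiv, of g x] Suc.prems
    by (auto simp: differentiable_def[of "\<lambda>x. f (g x)"])
  ultimately show ?case using Suc by simp
qed

lemma (in bounded_bilinear) Cn_prod: "Cn n f \<Longrightarrow> Cn n g \<Longrightarrow> Cn n (\<lambda>x. prod (f x) (g x))"
proof (induction n arbitrary: f g)
  case 0
  then show ?case using FDERIV by (simp add: differentiable_def) blast
next
  case (Suc n)
  have *: "dderiv b (\<lambda>x. prod (f x) (g x)) = (\<lambda>x. prod (f x) (dderiv b g x) + prod (dderiv b f x) (g x))" for b
    by (rule ext, rule dderiv_eqI, intro FDERIV has_derivative_dderiv)
       (use Suc.prems in auto)
  have "(\<lambda>x. prod (f x) (g x)) differentiable (at x)" for x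
    using FDERIV[OF has_derivative_dderiv has_derivative_dderiv, of f x g] Suc.prems
    by (auto simp: differentiable_def[of "\<lambda>x. prod (f x) (g x)"])
  moreover have "Cn n (\<lambda>x. prod (f x) (dderiv b g x) + prod (dderiv b f x) (g x))" if "b \<in> Basis" for b
    using Suc.prems that by (intro Cn_add Suc.IH) (auto intro: Cn_SucD)
  ultimately show ?case by (simp add: *)
qed

lemma smooth_const [intro]: "smooth (\<lambda>x. c)"
  by (simp add: smooth_iff_Cn Cn_const)

lemma smooth_add [intro]: "smooth f \<Longrightarrow> smooth g \<Longrightarrow> smooth (\<lambda>x. f x + g x)"
  by (simp add: smooth_iff_Cn Cn_add)

lemma (in bounded_linear) smooth_image: "smooth g \<Longrightarrow> smooth (\<lambda>x. f (g x))"
  by (simp add: smooth_iff_Cn Cn_image)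

lemma (in bounded_bilinear) smooth_prod: "smooth f \<Longrightarrow> smooth g \<Longrightarrow> smooth (\<lambda>x. prod (f x) (g x))"
  by (simp add: smooth_iff_Cn Cn_prod)

lemmas smooth_mult [intro] = bounded_bilinear.smooth_prod[OF bounded_bilinear_mult]
lemmas smooth_of_real [intro] = bounded_linear.smooth_image[OF bounded_linear_of_real]
lemmas smooth_minus [intro] = bounded_linear.smooth_image[OF bounded_linear_minus[OF bounded_linear_ident]]

lemma smooth_diff [intro]:
  "smooth f \<Longrightarrow> smooth g \<Longrightarrow> smooth (\<lambda>x. f x - g x)"
  using smooth_add[OF _ smooth_minus, of f g] by simp

lemma smooth_sum [intro]: "(\<And>i. i \<in> I \<Longrightarrow> smooth (f i)) \<Longrightarrow> smooth (\<lambda>x. \<Sum>i\<in>I. f i x)"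
  by (induction I rule: infinite_finite_induct) auto

lemma smooth_linear:
  assumes "bounded_linear (f :: 'a::euclidean_space \<Rightarrow> 'b::real_normed_vector)"
  shows "smooth f"
proof -
  have d: "(f has_derivative f) (at x)" for x
    using assms by (rule bounded_linear_imp_has_derivative)
  have "Cn n f" for n
  proof (cases n)
    case (Suc m)
    have "dderiv b f = (\<lambda>x. f b)" for b
      by (rule ext, rule dderiv_eqI, rule d)
    then show ?thesis using d by (auto simp: differentiable_def Suc Cn_const)
  qed (use d in \<open>auto simp: differentiable_def\<close>)
  then show ?thesis by (simp add: smooth_iff_Cn)
qed

lemma smooth_inner_const [intro]: "smooth (\<lambda>x. x \<bullet> v)"
  by (rule smooth_linear) (rule bounded_linear_inner_left)

lemma Cn_compose_affine:
  fixes L :: "'a::euclidean_space \<Rightarrow> 'c::euclidean_space"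
  assumes L: "bounded_linear L"
  shows "Cn n f \<Longrightarrow> Cn n (\<lambda>x. f (c + L x))"
proof (induction n arbitrary: f)
  case 0
  have "((\<lambda>x. f (c + L x)) has_derivative (\<lambda>v. dderiv (L v) f (c + L x))) (at x)" for x
  proof -
    have 1: "((\<lambda>x. c + L x) has_derivative L) (at x)"
      by (auto intro!: derivative_eq_intros bounded_linear_imp_has_derivative[OF L])
    show ?thesis
      using has_derivative_compose[OF 1 has_derivative_dderiv[of f "c + L x"]] 0 by simp
  qed
  then show ?case by (auto simp: differentiable_def)
next
  case (Suc n)
  have d: "((\<lambda>x. f (c + L x)) has_derivative (\<lambda>v. dderiv (L v) f (c + L x))) (at x)" for x
  proof -
    have 1: "((\<lambda>x. c + L x) has_derivative L) (at x)"
      by (auto intro!: derivative_eq_intros bounded_linear_imp_has_derivative[OF L])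
    show ?thesis
      using has_derivative_compose[OF 1 has_derivative_dderiv[of f "c + L x"]] Suc.prems by simp
  qed
  have *: "dderiv b (\<lambda>x. f (c + L x)) = (\<lambda>x. \<Sum>b'\<in>Basis. (L b \<bullet> b') *\<^sub>R dderiv b' f (c + L x))" for b
    apply (rule ext, subst dderiv_eqI[OF d])
    apply (rule dderiv_Basis_sum) using Suc.prems by simp
  have sum: "Cn n (\<lambda>x. \<Sum>i\<in>I. h i x)" if "finite I" "\<And>i. i \<in> I \<Longrightarrow> Cn n (h i)"
    for I :: "'c set" and h :: "'c \<Rightarrow> 'a \<Rightarrow> 'b"
    using that by (induction I) (auto intro: Cn_add Cn_const)
  have "Cn n (\<lambda>x. \<Sum>b'\<in>Basis. (L b \<bullet> b') *\<^sub>R dderiv b' f (c + L x))" for b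
    by (intro sum finite_Basis bounded_linear.Cn_image[OF bounded_linear_scaleR_right] Suc.IH)
       (use Suc.prems in auto)
  then show ?case using d by (auto simp: differentiable_def *)
qed

lemma smooth_compose_affine:
  "smooth f \<Longrightarrow> bounded_linear L \<Longrightarrow> smooth (\<lambda>x. f (c + L x))"
  for L :: "'a::euclidean_space \<Rightarrow> 'c::euclidean_space"
  by (simp add: smooth_iff_Cn Cn_compose_affine)

lemma dderiv_compose_affine:
  fixes L :: "'a::euclidean_space \<Rightarrow> 'c::euclidean_space"
  assumes L: "bounded_linear L" and f: "smooth f"
  shows "dderiv b (\<lambda>x. f (c + L x)) x = dderiv (L b) f (c + L x)"
proof -
  have 1: "((\<lambda>x. c + L x) has_derivative L) (at x)"
    by (auto intro!: derivative_eq_intros bounded_linear_imp_has_derivative[OF L])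
  show ?thesis
    by (rule dderiv_eqI) (rule has_derivative_compose[OF 1 has_derivative_dderiv[OF smooth_differentiable[OF f]]])
qed

lemma smooth_translate: "smooth f \<Longrightarrow> smooth (\<lambda>x. f (x - c))"
  using smooth_compose_affine[of f "\<lambda>x. x" "- c"] by (simp add: bounded_linear_ident)

lemma dderiv_translate: "smooth f \<Longrightarrow> dderiv b (\<lambda>x. f (x - c)) x = dderiv b f (x - c)"
  using dderiv_compose_affine[of "\<lambda>x. x" f b "- c" x] by (simp add: bounded_linear_ident)

lemma smooth_dilate: "smooth f \<Longrightarrow> smooth (\<lambda>x. f (r *\<^sub>R x))"
  using smooth_compose_affine[of f "\<lambda>x. r *\<^sub>R x" 0] by (simp add: bounded_linear_scaleR_right)

text \<open>Differentiating \<open>w powr s\<close> gives \<open>w powr (s - 1)\<close> times a smooth function, so the induction hypothesis must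
  hold for all exponents.\<close>

lemma Cn_powr:
  fixes w :: "'a::euclidean_space \<Rightarrow> real"
  assumes w: "smooth w" and pos: "\<And>x. w x > 0"
  shows "Cn n (\<lambda>x. w x powr s)"
proof (induction n arbitrary: s)
  case 0
  have "((\<lambda>x. w x powr s) has_derivative (\<lambda>v. dderiv v w x * (s * w x powr (s - 1)))) (at x)" for x
    using has_derivative_dderiv[OF smooth_differentiable[OF w], of x] pos[of x]
    by (auto intro!: derivative_eq_intros simp: powr_diff field_simps)
  then show ?case by (auto simp: differentiable_def)
next
  case (Suc n)
  have d: "((\<lambda>x. w x powr s) has_derivative (\<lambda>v. dderiv v w x * (s * w x powr (s - 1)))) (at x)" for x
    using has_derivative_dderiv[OF smooth_differentiable[OF w], of x] pos[of x]
    by (auto intro!: derivative_eq_intros simp: powr_diff field_simps)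
  have "dderiv b (\<lambda>x. w x powr s) = (\<lambda>x. dderiv b w x * (s * w x powr (s - 1)))" for b
    by (rule ext, rule dderiv_eqI[OF d])
  moreover have "Cn n (\<lambda>x. dderiv b w x * (s * w x powr (s - 1)))" if "b \<in> Basis" for b
    using smooth_dderiv[OF w that] Suc.IH[of "s - 1"]
    by (intro bounded_bilinear.Cn_prod[OF bounded_bilinear_mult] Cn_const) (auto simp: smooth_iff_Cn)
  ultimately show ?case using d by (auto simp: differentiable_def)
qed

lemma smooth_powr:
  fixes w :: "'a::euclidean_space \<Rightarrow> real"
  shows "smooth w \<Longrightarrow> (\<And>x. w x > 0) \<Longrightarrow> smooth (\<lambda>x. w x powr s)"
  by (simp add: smooth_iff_Cn Cn_powr)

lemma smooth_antiderivative:
  fixes f g :: "real \<Rightarrow> real"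
  assumes "\<And>t. (f has_real_derivative g t) (at t)" "smooth g"
  shows "smooth f"
proof -
  have d: "(f has_derivative (\<lambda>v. v * g t)) (at t)" for t
    using assms(1)[of t] by (simp add: has_field_derivative_def mult_commute_abs)
  have "dderiv 1 f = g"
    by (rule ext, subst dderiv_eqI[OF d]) simp
  then have "Cn n f" for n
    using assms(2) d by (cases n) (auto simp: differentiable_def smooth_iff_Cn)
  then show ?thesis by (simp add: smooth_iff_Cn)
qed

section \<open>Integration over Euclidean space\<close>

lemma nn_integral_affine:
  fixes f :: "'a::euclidean_space \<Rightarrow> ennreal"
  assumes [measurable]: "f \<in> borel_measurable borel" and c: "c \<noteq> 0"
  shows "(\<integral>\<^sup>+x. f x \<partial>lborel) = ennreal (\<bar>c\<bar> ^ DIM('a)) * (\<integral>\<^sup>+x. f (t + c *\<^sub>R x) \<partial>lborel)"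
  by (subst lborel_affine[OF c, of t])
     (simp add: nn_integral_density nn_integral_distr nn_integral_cmult)

lemma integrable_affine:
  fixes f :: "'a::euclidean_space \<Rightarrow> 'b::{banach, second_countable_topology}"
  assumes f: "integrable lborel f" and c: "c \<noteq> 0"
  shows "integrable lborel (\<lambda>x. f (t + c *\<^sub>R x))"
proof -
  have [measurable]: "f \<in> borel_measurable borel" using f by auto
  have "ennreal (\<bar>c\<bar> ^ DIM('a)) * (\<integral>\<^sup>+x. norm (f (t + c *\<^sub>R x)) \<partial>lborel) < \<infinity>"
    using f c by (subst nn_integral_affine[symmetric]) (auto simp: integrable_iff_bounded)
  moreover have "\<not> \<bar>c\<bar> ^ DIM('a) \<le> 0" using c by (simp add: not_le)
  ultimately show ?thesis by (auto simp: integrable_iff_bounded ennreal_mult_less_top ennreal_eq_0_iff)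
qed

lemma integral_affine:
  fixes f :: "'a::euclidean_space \<Rightarrow> 'b::{banach, second_countable_topology}"
  assumes [measurable]: "f \<in> borel_measurable borel" and c: "c \<noteq> 0"
  shows "(LINT x|lborel. f x) = \<bar>c\<bar> ^ DIM('a) *\<^sub>R (LINT x|lborel. f (t + c *\<^sub>R x))"
  by (subst lborel_affine[OF c, of t])
     (simp add: integral_density integral_distr)

lemma integral_translate:
  fixes f :: "'a::euclidean_space \<Rightarrow> 'b::{banach, second_countable_topology}"
  assumes "f \<in> borel_measurable borel"
  shows "(LINT x|lborel. f (x + a)) = (LINT x|lborel. f x)"
    and "(LINT x|lborel. f (x - a)) = (LINT x|lborel. f x)"
    and "(LINT x|lborel. f (a - x)) = (LINT x|lborel. f x)"
  using integral_affine[OF assms, of 1 a] integral_affine[OF assms, of 1 "- a"] integral_affine[OF assms, of "-1" a]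
  by (simp_all add: add.commute)

lemma integrable_translate:
  fixes f :: "'a::euclidean_space \<Rightarrow> 'b::{banach, second_countable_topology}"
  assumes "integrable lborel f"
  shows "integrable lborel (\<lambda>x. f (x + a))"
    and "integrable lborel (\<lambda>x. f (x - a))"
    and "integrable lborel (\<lambda>x. f (a - x))"
  using integrable_affine[OF assms, of 1 a] integrable_affine[OF assms, of 1 "- a"] integrable_affine[OF assms, of "-1" a]
  by (simp_all add: add.commute)

lemma nn_integral_translate:
  fixes f :: "'a::euclidean_space \<Rightarrow> ennreal"
  assumes "f \<in> borel_measurable borel"
  shows "(\<integral>\<^sup>+x. f (x + a) \<partial>lborel) = (\<integral>\<^sup>+x. f x \<partial>lborel)"
    and "(\<integral>\<^sup>+x. f (x - a) \<partial>lborel) = (\<integral>\<^sup>+x. f x \<partial>lborel)"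
    and "(\<integral>\<^sup>+x. f (a - x) \<partial>lborel) = (\<integral>\<^sup>+x. f x \<partial>lborel)"
  using nn_integral_affine[OF assms, of 1 a] nn_integral_affine[OF assms, of 1 "- a"] nn_integral_affine[OF assms, of "-1" a]
  by (simp_all add: add.commute)

text \<open>Dyadic annuli are dilates of one another, so the integral of a power of the norm over them is a
  geometric sequence; this replaces polar coordinates.\<close>

lemma nn_integral_annulus:
  fixes p r :: real
  assumes r: "r > 0"
  shows "(\<integral>\<^sup>+(y::'a::euclidean_space). ennreal (norm y powr p) * indicator {y. r < norm y \<and> norm y \<le> 2 * r} y \<partial>lborel)
     = ennreal (r powr (real DIM('a) + p)) *
       (\<integral>\<^sup>+(y::'a). ennreal (norm y powr p) * indicator {y. 1 < norm y \<and> norm y \<le> 2} y \<partial>lborel)"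
proof -
  have "(\<integral>\<^sup>+(y::'a). ennreal (norm y powr p) * indicator {y. r < norm y \<and> norm y \<le> 2 * r} y \<partial>lborel)
    = ennreal (r ^ DIM('a)) * (\<integral>\<^sup>+(y::'a). ennreal (norm (r *\<^sub>R y) powr p) * indicator {y. r < norm y \<and> norm y \<le> 2 * r} (r *\<^sub>R y) \<partial>lborel)"
    using nn_integral_affine[where c = r and t = 0 and f = "\<lambda>y::'a. ennreal (norm y powr p) * indicator {y. r < norm y \<and> norm y \<le> 2 * r} y"] r
    by simp
  also have "(\<lambda>y::'a. ennreal (norm (r *\<^sub>R y) powr p) * indicator {y. r < norm y \<and> norm y \<le> 2 * r} (r *\<^sub>R y))
     = (\<lambda>y. ennreal (r powr p) * (ennreal (norm y powr p) * indicator {y. 1 < norm y \<and> norm y \<le> 2} y))"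
    using r by (auto simp: fun_eq_iff indicator_def powr_mult ennreal_mult)
  also have "(\<integral>\<^sup>+y. ennreal (r powr p) * (ennreal (norm y powr p) * indicator {y::'a. 1 < norm y \<and> norm y \<le> 2} y) \<partial>lborel)
     = ennreal (r powr p) * (\<integral>\<^sup>+y. ennreal (norm y powr p) * indicator {y::'a. 1 < norm y \<and> norm y \<le> 2} y \<partial>lborel)"
    by (rule nn_integral_cmult) measurable
  finally show ?thesis using r
    by (simp add: mult.assoc[symmetric] ennreal_mult[symmetric] powr_add powr_realpow)
qed

lemma nn_integral_unit_annulus:
  "(\<integral>\<^sup>+(y::'a::euclidean_space). ennreal (norm y powr p) * indicator {y. 1 < norm y \<and> norm y \<le> 2} y \<partial>lborel) < \<infinity>"
proof -
  have "(\<integral>\<^sup>+(y::'a). ennreal (norm y powr p) * indicator {y. 1 < norm y \<and> norm y \<le> 2} y \<partial>lborel)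
     \<le> (\<integral>\<^sup>+(y::'a). ennreal (2 powr \<bar>p\<bar>) * indicator (cball 0 2) y \<partial>lborel)"
  proof (intro nn_integral_mono)
    fix y :: 'a
    have "norm y powr p \<le> 2 powr \<bar>p\<bar>" if "1 < norm y" "norm y \<le> 2"
      using that by (smt (verit) powr_mono powr_mono2)
    then show "ennreal (norm y powr p) * indicator {y. 1 < norm y \<and> norm y \<le> 2} y
        \<le> ennreal (2 powr \<bar>p\<bar>) * indicator (cball 0 2) y"
      by (auto simp: indicator_def)
  qed
  also have "\<dots> = ennreal (2 powr \<bar>p\<bar>) * emeasure lborel (cball (0::'a) 2)"
    by (simp add: nn_integral_cmult_indicator)
  also have "\<dots> < \<infinity>"
    using emeasure_lborel_cball_finite[of "0::'a" 2] by (simp add: ennreal_mult_less_top)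
  finally show ?thesis .
qed

text \<open>The radii \<open>2 powr (s * n)\<close> grow or shrink with the sign of \<open>s\<close>; the condition on \<open>p\<close> is that the integrals
  over the annuli decrease geometrically in \<open>n\<close>.\<close>

lemma nn_integral_dyadic:
  fixes p s :: real
  assumes s: "s * (real DIM('a::euclidean_space) + p) < 0" and S: "S \<subseteq> (\<Union>n::nat. {y::'a. 2 powr (s * n) < norm y \<and> norm y \<le> 2 * 2 powr (s * n)})"
  shows "(\<integral>\<^sup>+(y::'a). ennreal (norm y powr p) * indicator S y \<partial>lborel) < \<infinity>"
proof -
  let ?A = "\<lambda>n::nat. {y::'a. 2 powr (s * n) < norm y \<and> norm y \<le> 2 * 2 powr (s * n)}"
  define K where "K = (\<integral>\<^sup>+(y::'a). ennreal (norm y powr p) * indicator {y. 1 < norm y \<and> norm y \<le> 2} y \<partial>lborel)"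
  define q where "q = 2 powr (s * (real DIM('a) + p))"
  have term_le: "f n \<le> suminf f" for f :: "nat \<Rightarrow> ennreal" and n
    using sum_le_suminf[of f "{n}"] by simp
  have q: "0 < q" "q < 1" using s by (auto simp: q_def powr_less_one)
  have "(\<integral>\<^sup>+(y::'a). ennreal (norm y powr p) * indicator S y \<partial>lborel)
     \<le> (\<integral>\<^sup>+(y::'a). (\<Sum>n. ennreal (norm y powr p) * indicator (?A n) y) \<partial>lborel)"
  proof (intro nn_integral_mono)
    fix y :: 'a
    show "ennreal (norm y powr p) * indicator S y \<le> (\<Sum>n. ennreal (norm y powr p) * indicator (?A n) y)"
    proof (cases "y \<in> S")
      case True
      then obtain n where "y \<in> ?A n" using S by blast
      then have "ennreal (norm y powr p) * indicator S y = ennreal (norm y powr p) * indicator (?A n) y"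
        using True by simp
      also have "\<dots> \<le> (\<Sum>n. ennreal (norm y powr p) * indicator (?A n) y)"
        by (rule term_le)
      finally show ?thesis .
    qed simp
  qed
  also have "\<dots> = (\<Sum>n. (\<integral>\<^sup>+(y::'a). ennreal (norm y powr p) * indicator (?A n) y \<partial>lborel))"
    by (rule nn_integral_suminf) measurable
  also have "\<dots> = (\<Sum>n. ennreal (q ^ n) * K)"
  proof (intro suminf_cong)
    fix n :: nat
    have "(2 powr (s * n)) powr (real DIM('a) + p) = q ^ n"
      by (simp add: q_def powr_powr powr_realpow[symmetric] mult_ac)
    then show "(\<integral>\<^sup>+(y::'a). ennreal (norm y powr p) * indicator (?A n) y \<partial>lborel) = ennreal (q ^ n) * K"
      using nn_integral_annulus[of "2 powr (s * n)" p, where ?'a = 'a] by (simp add: K_def)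
  qed
  also have "\<dots> = (\<Sum>n. ennreal (q ^ n)) * K"
    by simp
  also have "\<dots> < \<infinity>"
  proof -
    have "(\<Sum>n. ennreal (q ^ n)) = ennreal (\<Sum>n. q ^ n)"
      using q by (intro suminf_ennreal2) auto
    then show ?thesis using nn_integral_unit_annulus[of p, where ?'a = 'a]
      by (simp add: K_def ennreal_mult_less_top)
  qed
  finally show ?thesis .
qed

lemma nn_integral_norm_powr_ball:
  assumes "p > - real DIM('a::euclidean_space)"
  shows "(\<integral>\<^sup>+(y::'a). ennreal (norm y powr p) * indicator (cball 0 1) y \<partial>lborel) < \<infinity>"
proof -
  have "(\<integral>\<^sup>+(y::'a). ennreal (norm y powr p) * indicator (cball 0 1 - {0}) y \<partial>lborel) < \<infinity>"
  proof (rule nn_integral_dyadic[where s = "-1"])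
    show "cball 0 1 - {0} \<subseteq> (\<Union>n::nat. {y::'a. 2 powr (- 1 * real n) < norm y \<and> norm y \<le> 2 * 2 powr (- 1 * real n)})"
    proof (rule subsetI)
      fix y :: 'a assume "y \<in> cball 0 1 - {0}"
      then have y: "y \<in> cball 0 1" "y \<noteq> 0" by auto
      \<comment> \<open>The annulus of \<open>y\<close> is the one with \<open>n \<le> 1 - log\<^sub>2 |y| < n + 1\<close>.\<close>
      define l where "l = - log 2 (norm y)"
      have l: "l \<ge> 0" using y by (simp add: l_def)
      have n: "norm y = 2 powr (- l)" using y by (simp add: l_def)
      define n where "n = nat \<lfloor>l\<rfloor> + 1"
      have "real n = of_int \<lfloor>l\<rfloor> + 1" using l by (simp add: n_def)
      then have "l < real n" "real n \<le> l + 1" by linarith+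
      then have "2 powr (- real n) < norm y" "norm y \<le> 2 powr (1 + - real n)"
        unfolding n by auto
      moreover have "2 powr (1 + - real n) = 2 * 2 powr (- real n)"
        by (subst powr_add) simp
      ultimately have "y \<in> {y::'a. 2 powr (- 1 * real n) < norm y \<and> norm y \<le> 2 * 2 powr (- 1 * real n)}"
        by simp
      then show "y \<in> (\<Union>n::nat. {y::'a. 2 powr (- 1 * real n) < norm y \<and> norm y \<le> 2 * 2 powr (- 1 * real n)})"
        by (rule UN_I[OF UNIV_I])
    qed
  qed (use assms in auto)
  also have "(\<integral>\<^sup>+(y::'a). ennreal (norm y powr p) * indicator (cball 0 1 - {0}) y \<partial>lborel)
     = (\<integral>\<^sup>+(y::'a). ennreal (norm y powr p) * indicator (cball 0 1) y \<partial>lborel)"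
    by (intro nn_integral_cong) (auto simp: indicator_def)
  finally show ?thesis .
qed

lemma nn_integral_norm_powr_outside:
  assumes "p < - real DIM('a::euclidean_space)"
  shows "(\<integral>\<^sup>+(y::'a). ennreal (norm y powr p) * indicator {y. norm y > 1} y \<partial>lborel) < \<infinity>"
proof (rule nn_integral_dyadic[where s = 1])
  show "{y. norm y > 1} \<subseteq> (\<Union>n::nat. {y::'a. 2 powr (1 * real n) < norm y \<and> norm y \<le> 2 * 2 powr (1 * real n)})"
  proof safe
    fix y :: 'a assume y: "1 < norm y"
    define l where "l = log 2 (norm y)"
    have "norm y > 0" using y by linarith
    then have l: "l > 0" unfolding l_def using y by (subst zero_less_log_cancel_iff) auto
    have n: "norm y = 2 powr l" unfolding l_def using \<open>norm y > 0\<close> by (subst powr_log_cancel) auto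
    define n where "n = nat (\<lceil>l\<rceil> - 1)"
    have "real n = of_int \<lceil>l\<rceil> - 1" using l by (simp add: n_def)
    then have "real n < l" "l \<le> real n + 1" by linarith+
    then have "2 powr (real n) < norm y" "norm y \<le> 2 powr (1 + real n)"
      unfolding n by auto
    then have "y \<in> {y::'a. 2 powr (1 * real n) < norm y \<and> norm y \<le> 2 * 2 powr (1 * real n)}"
      by (simp add: powr_add)
    then show "y \<in> (\<Union>n::nat. {y::'a. 2 powr (1 * real n) < norm y \<and> norm y \<le> 2 * 2 powr (1 * real n)})"
      by (rule UN_I[OF UNIV_I])
  qed
qed (use assms in auto)

lemma integrable_weight:
  "integrable lborel (\<lambda>y::'a::euclidean_space. 1 / (1 + norm y) ^ (DIM('a) + 1))"
proof (rule integrableI_bounded)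
  let ?p = "- real (DIM('a) + 1)"
  have "(\<integral>\<^sup>+(y::'a). ennreal (norm (1 / (1 + norm y) ^ (DIM('a) + 1))) \<partial>lborel)
    \<le> (\<integral>\<^sup>+(y::'a). indicator (cball 0 1) y + ennreal (norm y powr ?p) * indicator {y. norm y > 1} y \<partial>lborel)"
  proof (intro nn_integral_mono)
    fix y :: 'a
    show "ennreal (norm (1 / (1 + norm y) ^ (DIM('a) + 1)))
       \<le> indicator (cball 0 1) y + ennreal (norm y powr ?p) * indicator {y. norm y > 1} y"
    proof (cases "norm y > 1")
      case True
      have "norm y powr ?p = 1 / norm y ^ (DIM('a) + 1)"
        unfolding powr_minus_divide by (subst powr_realpow) (use True in auto)
      moreover have "1 / (1 + norm y) ^ (DIM('a) + 1) \<le> 1 / norm y ^ (DIM('a) + 1)"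
        using True by (intro frac_le power_mono zero_less_power) auto
      ultimately show ?thesis using True by (auto simp: indicator_def intro!: ennreal_leI)
    next
      case False
      have "1 \<le> (1 + norm y) ^ (DIM('a) + 1)" by (rule one_le_power) simp
      then have "ennreal (norm (1 / (1 + norm y) ^ (DIM('a) + 1))) \<le> 1"
        by (simp add: divide_le_eq)
      then show ?thesis using False by (auto simp: indicator_def)
    qed
  qed
  also have "\<dots> = emeasure lborel (cball (0::'a) 1) + (\<integral>\<^sup>+(y::'a). ennreal (norm y powr ?p) * indicator {y. norm y > 1} y \<partial>lborel)"
    by (subst nn_integral_add) (auto intro!: borel_measurable_indicator)
  also have "\<dots> < \<infinity>"
    using nn_integral_norm_powr_outside[of ?p, where ?'a = 'a] emeasure_lborel_cball_finite[of "0::'a" 1] by simp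
  finally show "(\<integral>\<^sup>+(y::'a). ennreal (norm (1 / (1 + norm y) ^ (DIM('a) + 1))) \<partial>lborel) < \<infinity>" .
qed simp

lemma integrable_decay:
  fixes f :: "'a::euclidean_space \<Rightarrow> 'b::{banach, second_countable_topology}"
  assumes [measurable]: "f \<in> borel_measurable borel"
    and C: "\<And>x. (1 + norm x) ^ (DIM('a) + 1) * norm (f x) \<le> C"
  shows "integrable lborel f"
proof (rule Bochner_Integration.integrable_bound)
  show "integrable lborel (\<lambda>y::'a. C * (1 / (1 + norm y) ^ (DIM('a) + 1)))"
    by (intro integrable_mult_right integrable_weight)
  show "AE x in lborel. norm (f x) \<le> norm (C * (1 / (1 + norm x) ^ (DIM('a) + 1)))"
  proof (intro AE_I2)
    fix x :: 'a
    have p: "(1 + norm x) ^ (DIM('a) + 1) > 0" by (intro zero_less_power add_pos_nonneg) auto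
    then have "norm (f x) \<le> C / (1 + norm x) ^ (DIM('a) + 1)"
      using C[of x] by (simp add: pos_le_divide_eq mult.commute)
    moreover have "C \<ge> 0" using C[of 0] order_trans[OF norm_ge_zero, of "f 0" C] by simp
    ultimately show "norm (f x) \<le> norm (C * (1 / (1 + norm x) ^ (DIM('a) + 1)))" by simp
  qed
qed simp

text \<open>Difference quotients along any sequence are dominated by \<open>g\<close> through the mean value inequality, so that
  dominated convergence applies.\<close>

lemma has_derivative_integral_dominated:
  fixes F :: "'a::euclidean_space \<Rightarrow> 'm \<Rightarrow> 'b::{banach, second_countable_topology}"
  assumes r: "r > 0"
    and d: "\<And>x y. x \<in> ball x0 r \<Longrightarrow> ((\<lambda>x. F x y) has_derivative D x y) (at x)"
    and bnd: "\<And>x y h. x \<in> ball x0 r \<Longrightarrow> norm (D x y h) \<le> g y * norm h"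
    and F: "\<And>x. x \<in> ball x0 r \<Longrightarrow> integrable M (F x)" and g: "integrable M g"
    and D: "\<And>h. (\<lambda>y. D x0 y h) \<in> borel_measurable M"
  shows "((\<lambda>x. \<integral>y. F x y \<partial>M) has_derivative (\<lambda>h. \<integral>y. D x0 y h \<partial>M)) (at x0)"
proof -
  have x0: "x0 \<in> ball x0 r" using r by simp
  have gpos: "g y \<ge> 0" for y
  proof -
    obtain b :: 'a where "b \<in> Basis" using nonempty_Basis by blast
    then show ?thesis using bnd[OF x0, of y b] norm_ge_zero[of "D x0 y b"] by (simp del: norm_ge_zero)
  qed
  have gi: "integrable M (\<lambda>y. g y * norm h)" for h :: 'a using g by simp
  have Dint: "integrable M (\<lambda>y. D x0 y h)" for h
    by (rule Bochner_Integration.integrable_bound[OF gi[of h] D])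
       (use bnd[OF x0] gpos in auto)
  have lin: "linear (D x0 y)" for y using d[OF x0] has_derivative_linear by blast
  have bl: "bounded_linear (\<lambda>h. \<integral>y. D x0 y h \<partial>M)"
  proof (rule bounded_linear_intro)
    show "(\<integral>y. D x0 y (h + k) \<partial>M) = (\<integral>y. D x0 y h \<partial>M) + (\<integral>y. D x0 y k \<partial>M)" for h k
      by (simp add: linear_add[OF lin] Dint)
    show "(\<integral>y. D x0 y (c *\<^sub>R h) \<partial>M) = c *\<^sub>R (\<integral>y. D x0 y h \<partial>M)" for c h
      by (simp add: linear_scale[OF lin] Dint)
    show "norm (\<integral>y. D x0 y h \<partial>M) \<le> norm h * (\<integral>y. g y \<partial>M)" for h
    proof -
      have "norm (\<integral>y. D x0 y h \<partial>M) \<le> (\<integral>y. g y * norm h \<partial>M)"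
        using bnd[OF x0] by (intro order_trans[OF integral_norm_bound integral_mono] integrable_norm Dint gi) auto
      then show ?thesis using g by (simp add: mult.commute)
    qed
  qed
  show ?thesis
    unfolding has_derivative_at
  proof (intro conjI bl)
    show "(\<lambda>h. norm ((\<integral>y. F (x0 + h) y \<partial>M) - (\<integral>y. F x0 y \<partial>M) - (\<integral>y. D x0 y h \<partial>M)) / norm h) \<midarrow>0\<rightarrow> 0"
      unfolding tendsto_at_iff_sequentially comp_def
    proof safe
      fix h :: "nat \<Rightarrow> 'a" assume h: "\<forall>i. h i \<in> UNIV - {0}" "h \<longlonglongrightarrow> 0"
      let ?Q = "\<lambda>n y. (1 / norm (h n)) *\<^sub>R (F (x0 + h n) y - F x0 y - D x0 y (h n))"
      let ?Q' = "\<lambda>n. if norm (h n) < r then ?Q n else (\<lambda>y. 0)"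
      have "(\<lambda>n. \<integral>y. ?Q' n y \<partial>M) \<longlonglongrightarrow> (\<integral>y. 0 \<partial>M)"
      proof (rule integral_dominated_convergence[where w = "\<lambda>y. 2 * g y"])
        show "?Q' n \<in> borel_measurable M" for n
          using F[OF x0] F[of "x0 + h n"] D by (auto simp: dist_norm)
        show "integrable M (\<lambda>y. 2 * g y)" using g by simp
        have ev: "\<forall>\<^sub>F n in sequentially. norm (h n) < r"
          using h(2) r by (metis LIMSEQ_iff diff_zero eventually_at_top_linorderI)
        show "AE y in M. (\<lambda>n. ?Q' n y) \<longlonglongrightarrow> 0"
        proof (intro AE_I2)
          fix y
          have "(\<lambda>h. norm (F (x0 + h) y - F x0 y - D x0 y h) / norm h) \<midarrow>0\<rightarrow> 0"
            using d[OF x0, of y] by (simp add: has_derivative_at)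
          then have "(\<lambda>n. norm (F (x0 + h n) y - F x0 y - D x0 y (h n)) / norm (h n)) \<longlonglongrightarrow> 0"
            using h unfolding tendsto_at_iff_sequentially comp_def by blast
          then have "(\<lambda>n. ?Q n y) \<longlonglongrightarrow> 0"
            by (intro tendsto_norm_zero_cancel[of "\<lambda>n. ?Q n y"]) simp
          then show "(\<lambda>n. ?Q' n y) \<longlonglongrightarrow> 0"
            by (rule Lim_transform_eventually) (use ev in \<open>auto elim: eventually_mono\<close>)
        qed
        show "AE y in M. norm (?Q' n y) \<le> 2 * g y" for n
        proof (intro AE_I2)
          fix y
          show "norm (?Q' n y) \<le> 2 * g y"
          proof (cases "norm (h n) < r")
            case True
            have hn: "norm (h n) > 0" using h(1) by simp
            have "norm (F (x0 + h n) y - F x0 y) \<le> g y * norm (x0 + h n - x0)"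
            proof (rule differentiable_bound[OF convex_ball])
              show "((\<lambda>x. F x y) has_derivative D x y) (at x within ball x0 r)" if "x \<in> ball x0 r" for x
                using d[OF that] by (rule has_derivative_at_withinI)
              show "onorm (D x y) \<le> g y" if "x \<in> ball x0 r" for x
                using bnd[OF that] gpos by (intro onorm_bound) auto
            qed (use True r in \<open>auto simp: dist_norm\<close>)
            then have "norm (F (x0 + h n) y - F x0 y - D x0 y (h n)) \<le> 2 * g y * norm (h n)"
              using bnd[OF x0, of y "h n"] norm_triangle_ineq4[of "F (x0 + h n) y - F x0 y" "D x0 y (h n)"] by simp
            then show ?thesis using True hn by (simp add: divide_le_eq)
          qed (use gpos in auto)
        qed
      qed auto
      then have "(\<lambda>n. norm (\<integral>y. ?Q' n y \<partial>M)) \<longlonglongrightarrow> 0"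
        using tendsto_norm_zero by fastforce
      then show "(\<lambda>n. norm ((\<integral>y. F (x0 + h n) y \<partial>M) - (\<integral>y. F x0 y \<partial>M) - (\<integral>y. D x0 y (h n) \<partial>M)) / norm (h n)) \<longlonglongrightarrow> 0"
      proof (rule Lim_transform_eventually)
        have "\<forall>\<^sub>F n in sequentially. norm (h n) < r"
          using h(2) r by (metis LIMSEQ_iff diff_zero eventually_at_top_linorderI)
        then show "\<forall>\<^sub>F n in sequentially. norm (\<integral>y. ?Q' n y \<partial>M) =
           norm ((\<integral>y. F (x0 + h n) y \<partial>M) - (\<integral>y. F x0 y \<partial>M) - (\<integral>y. D x0 y (h n) \<partial>M)) / norm (h n)"
        proof (rule eventually_mono)
          fix n assume n: "norm (h n) < r"
          then have "integrable M (F (x0 + h n))" by (intro F) (simp add: dist_norm)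
          then have "(\<integral>y. ?Q n y \<partial>M) = (1 / norm (h n)) *\<^sub>R ((\<integral>y. F (x0 + h n) y \<partial>M) - (\<integral>y. F x0 y \<partial>M) - (\<integral>y. D x0 y (h n) \<partial>M))"
            using F[OF x0] Dint by simp
          then show "norm (\<integral>y. ?Q' n y \<partial>M) =
           norm ((\<integral>y. F (x0 + h n) y \<partial>M) - (\<integral>y. F x0 y \<partial>M) - (\<integral>y. D x0 y (h n) \<partial>M)) / norm (h n)"
            by (simp only: n if_True norm_scaleR) simp
        qed
      qed
    qed
  qed
qed

text \<open>This is what makes convolution preserve polynomial decay.\<close>

lemma weight_shift:
  fixes x y :: "'a::real_normed_vector"
  shows "(1 + norm x) \<le> (1 + norm (x - y)) * (1 + norm y)"
proof -
  have "norm x \<le> norm (x - y) + norm y" by (metis diff_add_cancel norm_triangle_ineq)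
  moreover have "0 \<le> norm (x - y) * norm y" by simp
  ultimately show ?thesis unfolding distrib_left distrib_right by linarith
qed

text \<open>Translating in the direction \<open>b\<close> does not change the integral; differentiating the
  translation parameter under the integral sign gives the integral of the partial derivative.\<close>

lemma integral_dderiv_zero:
  fixes h :: "'a::euclidean_space \<Rightarrow> 'b::{banach, second_countable_topology}"
  assumes d: "\<And>x. h differentiable (at x)" and hi: "integrable lborel h"
    and m: "dderiv b h \<in> borel_measurable borel"
    and C: "\<And>x. (1 + norm x) ^ (DIM('a) + 1) * norm (dderiv b h x) \<le> C"
  shows "(LINT x|lborel. dderiv b h x) = 0"
proof -
  let ?N = "DIM('a) + 1"
  define g where "g = (\<lambda>y::'a. (C * (1 + norm b) ^ ?N) * (1 / (1 + norm y) ^ ?N))"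
  have g: "integrable lborel g" unfolding g_def by (intro integrable_mult_right integrable_weight)
  have "((\<lambda>s. LINT y|lborel. h (y + s *\<^sub>R b)) has_derivative (\<lambda>v. LINT y|lborel. v *\<^sub>R dderiv b h (y + 0 *\<^sub>R b))) (at (0::real))"
  proof (rule has_derivative_integral_dominated[where r = 1 and g = g and D = "\<lambda>s y v. v *\<^sub>R dderiv b h (y + s *\<^sub>R b)"])
    fix s :: real and y :: 'a
    have "((\<lambda>s. y + s *\<^sub>R b) has_derivative (\<lambda>v. v *\<^sub>R b)) (at s)"
      by (auto intro!: derivative_eq_intros)
    from has_derivative_compose[OF this has_derivative_dderiv[OF d]]
    have "((\<lambda>s. h (y + s *\<^sub>R b)) has_derivative (\<lambda>v. dderiv (v *\<^sub>R b) h (y + s *\<^sub>R b))) (at s)" .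
    then show "((\<lambda>s. h (y + s *\<^sub>R b)) has_derivative (\<lambda>v. v *\<^sub>R dderiv b h (y + s *\<^sub>R b))) (at s)"
      by (simp add: linear_scale[OF dderiv_linear[OF d]])
  next
    fix s v :: real and y :: 'a assume s: "s \<in> ball 0 1"
    have p: "(1 + norm y) ^ ?N > 0" by (intro zero_less_power add_pos_nonneg) auto
    let ?z = "y + s *\<^sub>R b"
    have "norm (y - ?z) \<le> norm b" using s by (simp add: mult_left_le_one_le)
    then have "(1 + norm (y - ?z)) * (1 + norm ?z) \<le> (1 + norm b) * (1 + norm ?z)"
      by (intro mult_right_mono) auto
    with weight_shift[of y ?z] have "1 + norm y \<le> (1 + norm b) * (1 + norm ?z)"
      by (rule order_trans)
    then have "(1 + norm y) ^ ?N \<le> ((1 + norm b) * (1 + norm ?z)) ^ ?N"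
      by (rule power_mono) auto
    then have "(1 + norm y) ^ ?N * norm (dderiv b h ?z) \<le> (1 + norm b) ^ ?N * ((1 + norm ?z) ^ ?N * norm (dderiv b h ?z))"
      using mult_right_mono[OF _ norm_ge_zero[of "dderiv b h ?z"]] by (fastforce simp: power_mult_distrib mult_ac)
    also have "\<dots> \<le> (1 + norm b) ^ ?N * C"
      using C[of ?z] by (intro mult_left_mono) auto
    finally have "norm (dderiv b h ?z) \<le> g y"
      using p by (simp add: g_def field_simps)
    then show "norm (v *\<^sub>R dderiv b h (y + s *\<^sub>R b)) \<le> g y * norm v"
      using mult_left_mono[of "norm (dderiv b h (y + s *\<^sub>R b))" "g y" "\<bar>v\<bar>"] by (simp add: mult.commute)
  qed (use hi g m in \<open>auto intro: integrable_translate\<close>)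
  moreover have "(\<lambda>s. LINT y|lborel. h (y + s *\<^sub>R b)) = (\<lambda>s. LINT y|lborel. h y)"
    using hi by (intro ext integral_translate) auto
  ultimately have "((\<lambda>s::real. LINT y|lborel. h y) has_derivative (\<lambda>v. LINT y|lborel. v *\<^sub>R dderiv b h (y + 0 *\<^sub>R b))) (at 0)"
    by simp
  from has_derivative_unique[OF this has_derivative_const]
  have "(LINT y|lborel. 1 *\<^sub>R dderiv b h (y + 0 *\<^sub>R b)) = 0"
    by (rule fun_cong)
  then show ?thesis by simp
qed

section \<open>Schwartz functions and convolution with rapidly decaying kernels\<close>

lemma schwartz_smooth: "schwartz \<psi> \<Longrightarrow> smooth \<psi>"
  by (simp add: schwartz_def)

lemma schwartz_iter_bound:
  assumes "schwartz \<psi>" "set bs \<subseteq> Basis"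
  obtains C where "C \<ge> 0" "\<And>x. (1 + norm x) ^ k * norm (iter_dderiv bs \<psi> x) \<le> C"
proof -
  have "bounded (range (\<lambda>x. (1 + norm x) ^ k *\<^sub>R iter_dderiv bs \<psi> x))"
    using assms by (simp add: schwartz_def)
  then obtain B where B: "\<And>x. norm ((1 + norm x) ^ k *\<^sub>R iter_dderiv bs \<psi> x) \<le> B"
    unfolding bounded_iff by auto
  have *: "(1 + norm x) ^ k * norm (iter_dderiv bs \<psi> x) \<le> B" for x
    using B[of x] by simp
  moreover have "B \<ge> 0" using order_trans[OF norm_ge_zero B] .
  ultimately show ?thesis using that by blast
qed

lemma schwartz_bound:
  assumes "schwartz \<psi>"
  obtains C where "C \<ge> 0" "\<And>x. (1 + norm x) ^ k * norm (\<psi> x) \<le> C"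
  using schwartz_iter_bound[OF assms, of "[]" k] by auto

lemma schwartzI:
  assumes "smooth \<psi>"
    and "\<And>bs k. set bs \<subseteq> Basis \<Longrightarrow> \<exists>C. \<forall>x. (1 + norm x) ^ k * norm (iter_dderiv bs \<psi> x) \<le> C"
  shows "schwartz \<psi>"
  unfolding schwartz_def bounded_iff using assms by (auto simp: abs_mult)

lemma schwartz_dderiv: "schwartz \<psi> \<Longrightarrow> b \<in> Basis \<Longrightarrow> schwartz (dderiv b \<psi>)"
proof (rule schwartzI)
  assume \<psi>: "schwartz \<psi>" and b: "b \<in> Basis"
  show "smooth (dderiv b \<psi>)" using \<psi> b by (intro smooth_dderiv schwartz_smooth)
  fix bs :: "'a list" and k assume "set bs \<subseteq> Basis"
  then have "set (bs @ [b]) \<subseteq> Basis" using b by simp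
  from schwartz_iter_bound[OF \<psi> this, of k]
  show "\<exists>C. \<forall>x. (1 + norm x) ^ k * norm (iter_dderiv bs (dderiv b \<psi>) x) \<le> C"
    by (auto simp: iter_dderiv_append)
qed

lemma schwartz_iter_dderiv: "schwartz \<psi> \<Longrightarrow> set bs \<subseteq> Basis \<Longrightarrow> schwartz (iter_dderiv bs \<psi>)"
  by (induction bs) (auto intro: schwartz_dderiv)

lemma schwartz_measurable: "schwartz \<psi> \<Longrightarrow> \<psi> \<in> borel_measurable borel"
  by (intro borel_measurable_continuous_onI smooth_continuous schwartz_smooth)

lemma schwartz_integrable: 
  assumes "schwartz \<psi>"
  shows "integrable lborel \<psi>"
proof -
  obtain C where "\<And>x. (1 + norm x) ^ (DIM('a) + 1) * norm (\<psi> x) \<le> C"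
    using schwartz_bound[OF assms, of "DIM('a) + 1"] by blast
  then show ?thesis using integrable_decay schwartz_measurable[OF assms] by blast
qed

lemma dderiv_lincomb:
  fixes \<psi> \<eta> :: "'a::euclidean_space \<Rightarrow> complex"
  assumes "smooth \<psi>" "smooth \<eta>"
  shows "dderiv v (\<lambda>x. a * \<psi> x + b * \<eta> x) x = a * dderiv v \<psi> x + b * dderiv v \<eta> x"
proof (rule dderiv_eqI)
  have "(\<psi> has_derivative (\<lambda>v. dderiv v \<psi> x)) (at x)" "(\<eta> has_derivative (\<lambda>v. dderiv v \<eta> x)) (at x)"
    using assms by (auto intro: has_derivative_dderiv smooth_differentiable)
  then show "((\<lambda>x. a * \<psi> x + b * \<eta> x) has_derivative (\<lambda>v. a * dderiv v \<psi> x + b * dderiv v \<eta> x)) (at x)"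
    by (intro has_derivative_add has_derivative_mult_right)
qed

lemma iter_dderiv_lincomb:
  fixes \<psi> \<eta> :: "'a::euclidean_space \<Rightarrow> complex"
  assumes "smooth \<psi>" "smooth \<eta>" "set bs \<subseteq> Basis"
  shows "iter_dderiv bs (\<lambda>x. a * \<psi> x + b * \<eta> x) = (\<lambda>x. a * iter_dderiv bs \<psi> x + b * iter_dderiv bs \<eta> x)"
  using assms(3)
proof (induction bs)
  case (Cons c bs)
  then show ?case
    using assms by (auto simp: dderiv_lincomb smooth_iter_dderiv intro!: ext)
qed auto

lemma schwartz_lincomb:
  assumes \<psi>: "schwartz \<psi>" and \<eta>: "schwartz \<eta>"
  shows "schwartz (\<lambda>x. a * \<psi> x + b * \<eta> x)"
proof (rule schwartzI)
  show "smooth (\<lambda>x. a * \<psi> x + b * \<eta> x)"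
    using assms[THEN schwartz_smooth] by (intro smooth_add smooth_mult smooth_const)
  fix bs :: "'a list" and k assume bs: "set bs \<subseteq> Basis"
  obtain C where C: "\<And>x. (1 + norm x) ^ k * norm (iter_dderiv bs \<psi> x) \<le> C"
    using schwartz_iter_bound[OF \<psi> bs, of k] by blast
  obtain D where D: "\<And>x. (1 + norm x) ^ k * norm (iter_dderiv bs \<eta> x) \<le> D"
    using schwartz_iter_bound[OF \<eta> bs, of k] by blast
  have "(1 + norm x) ^ k * norm (iter_dderiv bs (\<lambda>x. a * \<psi> x + b * \<eta> x) x) \<le> norm a * C + norm b * D" for x
  proof -
    have "norm (iter_dderiv bs (\<lambda>x. a * \<psi> x + b * \<eta> x) x) \<le> norm a * norm (iter_dderiv bs \<psi> x) + norm b * norm (iter_dderiv bs \<eta> x)"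
      using assms[THEN schwartz_smooth] bs by (simp add: iter_dderiv_lincomb) (metis norm_mult norm_triangle_ineq)
    then have "(1 + norm x) ^ k * norm (iter_dderiv bs (\<lambda>x. a * \<psi> x + b * \<eta> x) x)
      \<le> (1 + norm x) ^ k * (norm a * norm (iter_dderiv bs \<psi> x) + norm b * norm (iter_dderiv bs \<eta> x))"
      by (intro mult_left_mono) auto
    also have "\<dots> = norm a * ((1 + norm x) ^ k * norm (iter_dderiv bs \<psi> x)) + norm b * ((1 + norm x) ^ k * norm (iter_dderiv bs \<eta> x))"
      by (simp add: algebra_simps)
    also have "\<dots> \<le> norm a * C + norm b * D"
      using C[of x] D[of x] by (intro add_mono mult_left_mono) auto
    finally show ?thesis .
  qed
  then show "\<exists>C. \<forall>x. (1 + norm x) ^ k * norm (iter_dderiv bs (\<lambda>x. a * \<psi> x + b * \<eta> x) x) \<le> C" by blast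
qed

lemma schwartz_cmult: "schwartz \<psi> \<Longrightarrow> schwartz (\<lambda>x. a * \<psi> x)"
  using schwartz_lincomb[of \<psi> \<psi> a 0] by simp

lemma schwartz_add: "schwartz \<psi> \<Longrightarrow> schwartz \<eta> \<Longrightarrow> schwartz (\<lambda>x. \<psi> x + \<eta> x)"
  using schwartz_lincomb[of \<psi> \<eta> 1 1] by simp

lemma schwartz_diff: "schwartz \<psi> \<Longrightarrow> schwartz \<eta> \<Longrightarrow> schwartz (\<lambda>x. \<psi> x - \<eta> x)"
  using schwartz_lincomb[of \<psi> \<eta> 1 "-1"] by simp

lemma dderiv_zero_off_support:
  assumes "closed K" "\<And>x. x \<notin> K \<Longrightarrow> f x = 0" "x \<notin> K"
  shows "dderiv b f x = 0"
proof (rule dderiv_eqI)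
  show "(f has_derivative (\<lambda>_. 0)) (at x)"
  proof (rule has_derivative_transform_within_open)
    show "((\<lambda>x. 0) has_derivative (\<lambda>_. 0)) (at x)" by simp
    show "open (- K)" using assms by auto
  qed (use assms in auto)
qed

lemma iter_dderiv_zero_off_support:
  assumes "closed K" "\<And>x. x \<notin> K \<Longrightarrow> f x = 0" "x \<notin> K"
  shows "iter_dderiv bs f x = 0"
  using assms(3)
proof (induction bs arbitrary: x)
  case (Cons b bs)
  then show ?case using dderiv_zero_off_support[OF assms(1), of "iter_dderiv bs f"] by simp
qed (use assms in auto)

lemma schwartz_compact_support:
  fixes \<psi> :: "'a::euclidean_space \<Rightarrow> complex"
  assumes \<psi>: "smooth \<psi>" and K: "\<And>x. norm x > R \<Longrightarrow> \<psi> x = 0"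
  shows "schwartz \<psi>"
proof (rule schwartzI[OF \<psi>])
  fix bs :: "'a list" and k assume bs: "set bs \<subseteq> Basis"
  have z: "iter_dderiv bs \<psi> x = 0" if "x \<notin> cball 0 R" for x
    by (rule iter_dderiv_zero_off_support[of "cball 0 R"]) (use K that in auto)
  have "continuous_on (cball 0 R) (\<lambda>x. (1 + norm x) ^ k * norm (iter_dderiv bs \<psi> x))"
    using \<psi> bs by (intro continuous_intros smooth_continuous smooth_iter_dderiv)
  then have "bounded ((\<lambda>x. (1 + norm x) ^ k * norm (iter_dderiv bs \<psi> x)) ` cball 0 R)"
    by (intro compact_imp_bounded compact_continuous_image) auto
  then obtain C where "\<forall>y\<in>(\<lambda>x. (1 + norm x) ^ k * norm (iter_dderiv bs \<psi> x)) ` cball 0 R. norm y \<le> C"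
    unfolding bounded_iff by blast
  then have C: "\<And>x. x \<in> cball 0 R \<Longrightarrow> (1 + norm x) ^ k * norm (iter_dderiv bs \<psi> x) \<le> C"
    by (simp add: abs_mult)
  have "(1 + norm x) ^ k * norm (iter_dderiv bs \<psi> x) \<le> max C 0" for x
    using C[of x] z[of x] by (cases "x \<in> cball 0 R") auto
  then show "\<exists>C. \<forall>x. (1 + norm x) ^ k * norm (iter_dderiv bs \<psi> x) \<le> C" by blast
qed

text \<open>The decay of Schwartz functions without their smoothness: the property of convolution kernels that is used.\<close>

definition rapid :: "('a::euclidean_space \<Rightarrow> complex) \<Rightarrow> bool" where
  "rapid k \<longleftrightarrow> k \<in> borel_measurable borel \<and> (\<forall>N. \<exists>C. \<forall>x. (1 + norm x) ^ N * norm (k x) \<le> C)"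

lemma rapid_measurable: "rapid k \<Longrightarrow> k \<in> borel_measurable borel"
  by (simp add: rapid_def)

lemma schwartz_rapid: "schwartz \<psi> \<Longrightarrow> rapid \<psi>"
  unfolding rapid_def using schwartz_measurable by (metis schwartz_bound)

lemma rapid_weight_integrable:
  assumes "rapid k"
  shows "integrable lborel (\<lambda>x. (1 + norm x) ^ N * norm (k x))"
proof -
  obtain C where C: "\<And>x. (1 + norm x) ^ (DIM('a) + 1 + N) * norm (k x) \<le> C"
    using assms unfolding rapid_def by metis
  have [measurable]: "k \<in> borel_measurable borel" using assms by (simp add: rapid_def)
  show ?thesis
  proof (rule integrable_decay)
    show "(1 + norm x) ^ (DIM('a) + 1) * norm ((1 + norm x) ^ N * norm (k x)) \<le> C" for x
      using C[of x] by (simp add: power_add mult_ac abs_mult)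
  qed measurable
qed

lemma rapid_integrable: "rapid k \<Longrightarrow> integrable lborel k"
  using rapid_weight_integrable[of k 0] rapid_measurable[of k] 
  by (simp add: integrable_norm_iff)

lemma rapid_bound:
  assumes "rapid k" obtains C where "C \<ge> 0" "\<And>x. norm (k x) \<le> C"
proof -
  obtain C where C: "\<And>x. (1 + norm x) ^ 0 * norm (k x) \<le> C"
    using assms unfolding rapid_def by metis
  then have "norm (k x) \<le> C" for x by simp
  with that show ?thesis by (meson norm_ge_zero order_trans)
qed

definition conv :: "('a::euclidean_space \<Rightarrow> complex) \<Rightarrow> ('a \<Rightarrow> complex) \<Rightarrow> 'a \<Rightarrow> complex" where
  "conv k \<psi> x = (LINT y|lborel. k y * \<psi> (x - y))"

lemma conv_integrable:
  assumes k: "rapid k" and \<psi>: "\<psi> \<in> borel_measurable borel" "\<And>x. norm (\<psi> x) \<le> C"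
  shows "integrable lborel (\<lambda>y. k y * \<psi> (x - y))"
proof (rule Bochner_Integration.integrable_bound)
  show "integrable lborel (\<lambda>y. C * norm (k y))" using rapid_integrable[OF k] by simp
  show "(\<lambda>y. k y * \<psi> (x - y)) \<in> borel_measurable lborel"
    using \<psi> rapid_measurable[OF k] by simp
  have C0: "C \<ge> 0" using order_trans[OF norm_ge_zero \<psi>(2)] .
  show "AE y in lborel. norm (k y * \<psi> (x - y)) \<le> norm (C * norm (k y))"
  proof (intro AE_I2)
    fix y show "norm (k y * \<psi> (x - y)) \<le> norm (C * norm (k y))"
      using C0 mult_right_mono[OF \<psi>(2)[of "x - y"] norm_ge_zero[of "k y"]]
      by (simp add: norm_mult mult.commute)
  qed
qed

lemma conv_weight_bound:
  assumes k: "rapid k" and \<psi>: "\<psi> \<in> borel_measurable borel" "\<And>x. (1 + norm x) ^ N * norm (\<psi> x) \<le> C"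
  shows "(1 + norm x) ^ N * norm (conv k \<psi> x) \<le> C * (LINT y|lborel. (1 + norm y) ^ N * norm (k y))"
proof -
  have C0: "C \<ge> 0" using order_trans[OF _ \<psi>(2)[of 0]] by simp
  have pt: "(1 + norm x) ^ N * norm (k y * \<psi> (x - y)) \<le> C * ((1 + norm y) ^ N * norm (k y))" for y
  proof -
    have "(1 + norm x) ^ N \<le> ((1 + norm (x - y)) * (1 + norm y)) ^ N"
      using weight_shift[of x y] by (intro power_mono) auto
    then have "(1 + norm x) ^ N * norm (\<psi> (x - y)) \<le> ((1 + norm (x - y)) ^ N * (1 + norm y) ^ N) * norm (\<psi> (x - y))"
      by (intro mult_right_mono) (auto simp: power_mult_distrib)
    also have "\<dots> = (1 + norm y) ^ N * ((1 + norm (x - y)) ^ N * norm (\<psi> (x - y)))" by (simp add: mult_ac)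
    also have "\<dots> \<le> (1 + norm y) ^ N * C" using \<psi>(2) by (intro mult_left_mono) auto
    finally have "(1 + norm x) ^ N * norm (\<psi> (x - y)) * norm (k y) \<le> (1 + norm y) ^ N * C * norm (k y)"
      by (rule mult_right_mono) auto
    then show ?thesis by (simp add: norm_mult mult_ac)
  qed
  have "(1 + norm x) ^ N * norm (conv k \<psi> x) \<le> (1 + norm x) ^ N * (LINT y|lborel. norm (k y * \<psi> (x - y)))"
    unfolding conv_def by (intro mult_left_mono integral_norm_bound) auto
  also have "\<dots> = (LINT y|lborel. (1 + norm x) ^ N * norm (k y * \<psi> (x - y)))" by simp
  also have "\<dots> \<le> (LINT y|lborel. C * ((1 + norm y) ^ N * norm (k y)))"
  proof (rule integral_mono_AE')
    show "integrable lborel (\<lambda>y. C * ((1 + norm y) ^ N * norm (k y)))"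
      using rapid_weight_integrable[OF k] by (intro integrable_mult_right)
  qed (use pt C0 in \<open>auto intro!: AE_I2 mult_nonneg_nonneg\<close>)
  finally show ?thesis by simp
qed

text \<open>The derivatives of \<open>\<psi>\<close> are bounded, so a multiple of \<open>norm (k y)\<close> dominates them under the integral.\<close>

lemma conv_has_derivative:
  assumes k: "rapid k" and \<psi>: "schwartz \<psi>"
  shows "(conv k \<psi> has_derivative (\<lambda>v. conv k (dderiv v \<psi>) x)) (at x)"
proof -
  have "\<exists>C. \<forall>x. norm (dderiv b \<psi> x) \<le> C" if "b \<in> Basis" for b
    using schwartz_bound[OF schwartz_dderiv[OF \<psi> that], of 0] by auto
  then obtain C where C: "\<And>b x. b \<in> Basis \<Longrightarrow> norm (dderiv b \<psi> x) \<le> C b" by metis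
  define B where "B = (\<Sum>b\<in>Basis. \<bar>C b\<bar>)"
  have diff: "\<psi> differentiable (at x)" for x using \<psi> by (intro smooth_differentiable schwartz_smooth)
  have bd: "norm (dderiv v \<psi> x) \<le> norm v * B" for v x
  proof -
    have "norm (dderiv v \<psi> x) \<le> (\<Sum>b\<in>Basis. norm ((v \<bullet> b) *\<^sub>R dderiv b \<psi> x))"
      by (subst dderiv_Basis_sum[OF diff]) (rule norm_sum)
    also have "\<dots> \<le> (\<Sum>b\<in>Basis. norm v * \<bar>C b\<bar>)"
    proof (rule sum_mono)
      fix b :: 'a assume b: "b \<in> Basis"
      have "\<bar>v \<bullet> b\<bar> \<le> norm v" by (rule Basis_le_norm[OF b])
      moreover have "norm (dderiv b \<psi> x) \<le> \<bar>C b\<bar>" using C[OF b, of x] by linarith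
      ultimately show "norm ((v \<bullet> b) *\<^sub>R dderiv b \<psi> x) \<le> norm v * \<bar>C b\<bar>"
        by (simp add: mult_mono)
    qed
    finally show ?thesis by (simp add: B_def sum_distrib_left)
  qed
  have m: "dderiv v \<psi> \<in> borel_measurable borel" for v
  proof -
    have "dderiv v \<psi> = (\<lambda>x. \<Sum>b\<in>Basis. (v \<bullet> b) *\<^sub>R dderiv b \<psi> x)"
      by (rule ext, rule dderiv_Basis_sum[OF diff])
    also have "\<dots> \<in> borel_measurable borel"
      using schwartz_measurable[OF schwartz_dderiv[OF \<psi>]] by (intro borel_measurable_sum borel_measurable_scaleR) auto
    finally show ?thesis .
  qed
  obtain C0 where C0: "\<And>x. norm (\<psi> x) \<le> C0" using schwartz_bound[OF \<psi>, of 0] by auto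
  show ?thesis unfolding conv_def[abs_def]
  proof (rule has_derivative_integral_dominated[where r = 1 and g = "\<lambda>y. B * norm (k y)"])
    fix x y
    show "((\<lambda>x. k y * \<psi> (x - y)) has_derivative (\<lambda>v. k y * dderiv v \<psi> (x - y))) (at x)"
    proof (rule has_derivative_mult_right)
      have "((\<lambda>x. x - y) has_derivative (\<lambda>v. v)) (at x)" by (auto intro!: derivative_eq_intros)
      from has_derivative_compose[OF this has_derivative_dderiv[OF diff]]
      show "((\<lambda>x. \<psi> (x - y)) has_derivative (\<lambda>v. dderiv v \<psi> (x - y))) (at x)" .
    qed
    show "norm (k y * dderiv h \<psi> (x - y)) \<le> B * norm (k y) * norm h" for h
      using mult_left_mono[OF bd[of h "x - y"], of "norm (k y)"] by (simp add: norm_mult mult_ac)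
  next
    show "integrable lborel (\<lambda>y. k y * \<psi> (x - y))" for x
      by (rule conv_integrable[OF k schwartz_measurable[OF \<psi>] C0])
    show "(\<lambda>y. k y * dderiv h \<psi> (x - y)) \<in> borel_measurable lborel" for h
      using rapid_measurable[OF k] m by simp
  qed (use rapid_integrable[OF k] in auto)
qed

lemma dderiv_conv: "rapid k \<Longrightarrow> schwartz \<psi> \<Longrightarrow> dderiv b (conv k \<psi>) = conv k (dderiv b \<psi>)"
  by (rule ext, rule dderiv_eqI, rule conv_has_derivative)

lemma iter_dderiv_conv:
  assumes k: "rapid k" and \<psi>: "schwartz \<psi>"
  shows "set bs \<subseteq> Basis \<Longrightarrow> iter_dderiv bs (conv k \<psi>) = conv k (iter_dderiv bs \<psi>)"
  by (induction bs) (auto simp: dderiv_conv[OF k schwartz_iter_dderiv[OF \<psi>]])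

text \<open>All derivatives fall on \<open>\<psi>\<close>, so the kernel needs no smoothness, only decay.\<close>

lemma schwartz_conv:
  assumes k: "rapid k" and \<psi>: "schwartz \<psi>"
  shows "schwartz (conv k \<psi>)"
proof (rule schwartzI)
  show "smooth (conv k \<psi>)"
    unfolding smooth_def
    using conv_has_derivative[OF k schwartz_iter_dderiv[OF \<psi>]]
    by (auto simp: iter_dderiv_conv[OF k \<psi>] differentiable_def)
  fix bs :: "'a list" and N assume bs: "set bs \<subseteq> Basis"
  obtain C where C: "\<And>x. (1 + norm x) ^ N * norm (iter_dderiv bs \<psi> x) \<le> C"
    using schwartz_iter_bound[OF \<psi> bs, of N] by blast
  show "\<exists>C. \<forall>x. (1 + norm x) ^ N * norm (iter_dderiv bs (conv k \<psi>) x) \<le> C"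
    using conv_weight_bound[OF k schwartz_measurable[OF schwartz_iter_dderiv[OF \<psi> bs]] C]
    by (auto simp: iter_dderiv_conv[OF k \<psi> bs])
qed

lemma nn_integral_conv_kernel:
  fixes a b c :: "'a::euclidean_space \<Rightarrow> ennreal"
  assumes [measurable]: "a \<in> borel_measurable borel" "b \<in> borel_measurable borel" "c \<in> borel_measurable borel"
  shows "(\<integral>\<^sup>+x. (\<integral>\<^sup>+y. a x * b y * c (x - y) \<partial>lborel) \<partial>lborel) = (\<integral>\<^sup>+y. b y * (\<integral>\<^sup>+x. a x * c (x - y) \<partial>lborel) \<partial>lborel)"
proof -
  have "(\<integral>\<^sup>+x. (\<integral>\<^sup>+y. a x * b y * c (x - y) \<partial>lborel) \<partial>lborel) = (\<integral>\<^sup>+y. (\<integral>\<^sup>+x. a x * b y * c (x - y) \<partial>lborel) \<partial>lborel)"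
    by (subst lborel_pair.Fubini') simp_all
  also have "\<dots> = (\<integral>\<^sup>+y. (\<integral>\<^sup>+x. b y * (a x * c (x - y)) \<partial>lborel) \<partial>lborel)"
    by (simp add: mult_ac)
  also have "\<dots> = (\<integral>\<^sup>+y. b y * (\<integral>\<^sup>+x. a x * c (x - y) \<partial>lborel) \<partial>lborel)"
    by (intro nn_integral_cong nn_integral_cmult) measurable
  finally show ?thesis .
qed

text \<open>Young's inequality for \<open>L\<^sup>1\<close>, by Fubini and translation invariance.\<close>

lemma nn_integral_conv_le:
  assumes [measurable]: "k \<in> borel_measurable borel" "\<psi> \<in> borel_measurable borel"
  shows "(\<integral>\<^sup>+x. ennreal (norm (conv k \<psi> x)) \<partial>lborel)
     \<le> (\<integral>\<^sup>+y. ennreal (norm (k y)) \<partial>lborel) * (\<integral>\<^sup>+y. ennreal (norm (\<psi> y)) \<partial>lborel)"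
proof -
  have "(\<integral>\<^sup>+x. ennreal (norm (conv k \<psi> x)) \<partial>lborel)
    \<le> (\<integral>\<^sup>+x. (\<integral>\<^sup>+y. 1 * ennreal (norm (k y)) * ennreal (norm (\<psi> (x - y))) \<partial>lborel) \<partial>lborel)"
  proof (intro nn_integral_mono)
    fix x
    have "ennreal (norm (conv k \<psi> x)) \<le> (\<integral>\<^sup>+y. ennreal (norm (k y * \<psi> (x - y))) \<partial>lborel)"
      unfolding conv_def by (cases "integrable lborel (\<lambda>y. k y * \<psi> (x - y))")
        (auto simp: integral_norm_bound_ennreal not_integrable_integral_eq)
    then show "ennreal (norm (conv k \<psi> x)) \<le> (\<integral>\<^sup>+y. 1 * ennreal (norm (k y)) * ennreal (norm (\<psi> (x - y))) \<partial>lborel)"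
      by (simp add: norm_mult ennreal_mult')
  qed
  also have "\<dots> = (\<integral>\<^sup>+y. ennreal (norm (k y)) * (\<integral>\<^sup>+x. 1 * ennreal (norm (\<psi> (x - y))) \<partial>lborel) \<partial>lborel)"
    by (subst nn_integral_conv_kernel) auto
  also have "\<dots> = (\<integral>\<^sup>+y. ennreal (norm (k y)) * (\<integral>\<^sup>+x. ennreal (norm (\<psi> x)) \<partial>lborel) \<partial>lborel)"
    using nn_integral_translate(2)[of "\<lambda>x. ennreal (norm (\<psi> x))"] by simp
  also have "\<dots> = (\<integral>\<^sup>+y. ennreal (norm (k y)) \<partial>lborel) * (\<integral>\<^sup>+y. ennreal (norm (\<psi> y)) \<partial>lborel)"
    by (rule nn_integral_multc) measurable
  finally show ?thesis .
qed

section \<open>The Fourier transform\<close>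

lemma cis_measurable [measurable]: "cis \<in> borel_measurable borel"
  by (intro borel_measurable_continuous_onI) (simp add: cis_conv_exp continuous_intros)

lemma isCont_cis: "isCont cis t"
  by (simp add: cis_conv_exp[abs_def])

lemma has_derivative_cis_linear:
  "((\<lambda>x. cis (- (x \<bullet> \<xi>))) has_derivative (\<lambda>v. - (v \<bullet> \<xi>) *\<^sub>R (\<i> * cis (- (x \<bullet> \<xi>))))) (at (x::'a::euclidean_space))"
  by (auto intro!: derivative_eq_intros)

lemma integrable_pair_mult:
  fixes f g :: "'a::euclidean_space \<Rightarrow> 'b::{real_normed_field, banach, second_countable_topology}"
  assumes f: "integrable lborel f" and g: "integrable lborel g"
    and K: "case_prod K \<in> borel_measurable (lborel \<Otimes>\<^sub>M lborel)" "\<And>x y. norm (K x y) \<le> B"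
  shows "integrable (lborel \<Otimes>\<^sub>M lborel) (\<lambda>(x, y). f x * g y * K x y)"
proof (rule integrableI_bounded)
  have [measurable]: "f \<in> borel_measurable borel" "g \<in> borel_measurable borel" "case_prod K \<in> borel_measurable (borel \<Otimes>\<^sub>M borel)"
    using f g K by auto
  show "(\<lambda>(x, y). f x * g y * K x y) \<in> borel_measurable (lborel \<Otimes>\<^sub>M lborel)"
    by measurable
  have "(\<integral>\<^sup>+z. ennreal (norm (case z of (x, y) \<Rightarrow> f x * g y * K x y)) \<partial>(lborel \<Otimes>\<^sub>M lborel))
     \<le> (\<integral>\<^sup>+z. (case z of (x, y) \<Rightarrow> ennreal (norm (f x)) * ennreal (norm (g y)) * ennreal B) \<partial>(lborel \<Otimes>\<^sub>M lborel))"
  proof (intro nn_integral_mono, clarify)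
    fix x y
    have "norm (f x * g y * K x y) \<le> norm (f x) * norm (g y) * B"
      using K(2)[of x y] by (simp add: norm_mult mult_left_mono)
    then show "ennreal (norm (f x * g y * K x y)) \<le> ennreal (norm (f x)) * ennreal (norm (g y)) * ennreal B"
      by (simp add: ennreal_mult'[symmetric] ennreal_leI)
  qed
  also have "\<dots> = (\<integral>\<^sup>+x. \<integral>\<^sup>+y. ennreal (norm (f x)) * ennreal (norm (g y)) * ennreal B \<partial>lborel \<partial>lborel)"
    by (subst lborel.nn_integral_fst[symmetric]) auto
  also have "\<dots> = (\<integral>\<^sup>+x. ennreal (norm (f x)) \<partial>lborel) * (\<integral>\<^sup>+y. ennreal (norm (g y)) \<partial>lborel) * ennreal B"
    by (simp add: nn_integral_cmult nn_integral_multc)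
  also have "\<dots> < \<infinity>"
    using f g by (simp add: integrable_iff_bounded ennreal_mult_less_top)
  finally show "(\<integral>\<^sup>+z. ennreal (norm (case z of (x, y) \<Rightarrow> f x * g y * K x y)) \<partial>(lborel \<Otimes>\<^sub>M lborel)) < \<infinity>" .
qed

lemma integral_swap_mult:
  fixes f g :: "'a::euclidean_space \<Rightarrow> 'b::{real_normed_field, banach, second_countable_topology}"
  assumes f: "integrable lborel f" and g: "integrable lborel g"
    and K: "case_prod K \<in> borel_measurable (lborel \<Otimes>\<^sub>M lborel)" "\<And>x y. norm (K x y) \<le> B"
  shows "(LINT x|lborel. f x * (LINT y|lborel. g y * K x y)) = (LINT y|lborel. g y * (LINT x|lborel. f x * K x y))"
proof -
  have "(LINT x|lborel. f x * (LINT y|lborel. g y * K x y)) = (LINT x|lborel. (LINT y|lborel. f x * g y * K x y))"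
    by (simp add: mult.assoc)
  also have "\<dots> = (LINT y|lborel. (LINT x|lborel. f x * g y * K x y))"
    using lborel_pair.Fubini_integral[of "\<lambda>x y. f x * g y * K x y"] integrable_pair_mult[OF assms] by simp
  also have "\<dots> = (LINT y|lborel. (LINT x|lborel. g y * (f x * K x y)))"
    by (simp add: mult_ac)
  also have "\<dots> = (LINT y|lborel. g y * (LINT x|lborel. f x * K x y))" by simp
  finally show ?thesis .
qed

lemma integrable_cis_mult:
  assumes "integrable lborel f" and [measurable]: "g \<in> borel_measurable borel"
  shows "integrable lborel (\<lambda>x::'a::euclidean_space. cis (g x) * f x)"
proof (rule Bochner_Integration.integrable_bound[OF assms(1)])
  have [measurable]: "f \<in> borel_measurable borel" using assms by auto
  show "(\<lambda>x. cis (g x) * f x) \<in> borel_measurable lborel" by measurable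
qed (auto simp: norm_mult)

lemma fourier_continuous:
  assumes "integrable lborel f"
  shows "isCont (fourier f) \<xi>"
  unfolding continuous_at_sequentially comp_def
proof safe
  fix X assume X: "X \<longlonglongrightarrow> \<xi>"
  have [measurable]: "f \<in> borel_measurable borel" using assms by auto
  show "(\<lambda>n. fourier f (X n)) \<longlonglongrightarrow> fourier f \<xi>"
    unfolding fourier_def
  proof (rule integral_dominated_convergence[where w = "\<lambda>x. norm (f x)"])
    show "AE x in lborel. (\<lambda>n. cis (- (x \<bullet> X n)) * f x) \<longlonglongrightarrow> cis (- (x \<bullet> \<xi>)) * f x"
      by (intro AE_I2 tendsto_intros isCont_tendsto_compose[OF isCont_cis] X)
  qed (use assms in \<open>auto simp: norm_mult\<close>)
qed

lemma fourier_continuous_on: "integrable lborel f \<Longrightarrow> continuous_on UNIV (fourier f)"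
  by (simp add: continuous_at_imp_continuous_on fourier_continuous)

lemma norm_fourier_le: "norm (fourier f \<xi>) \<le> (LINT x|lborel. norm (f x))"
proof -
  have "norm (fourier f \<xi>) \<le> (LINT x|lborel. norm (cis (- (x \<bullet> \<xi>)) * f x))"
    unfolding fourier_def by (rule integral_norm_bound)
  then show ?thesis by (simp add: norm_mult)
qed

lemma inv_fourier_eq: "inv_fourier f x = fourier f (- x) / complex_of_real ((2 * pi) ^ CARD('n))"
  for f :: "real^'n::finite \<Rightarrow> complex"
  unfolding inv_fourier_def fourier_def by (simp add: inner_commute)

text \<open>Integration by parts: the derivative of \<open>cis (- (x \<bullet> \<xi>)) * \<psi> x\<close> in the direction \<open>b\<close> has integral zero.\<close>

lemma fourier_dderiv:
  fixes \<psi> :: "real^'n::finite \<Rightarrow> complex"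
  assumes \<psi>: "schwartz \<psi>" and b: "b \<in> Basis"
  shows "fourier (dderiv b \<psi>) \<xi> = \<i> * complex_of_real (\<xi> \<bullet> b) * fourier \<psi> \<xi>"
proof -
  let ?h = "\<lambda>x. cis (- (x \<bullet> \<xi>)) * \<psi> x"
  have \<psi>d: "(\<psi> has_derivative (\<lambda>v. dderiv v \<psi> x)) (at x)" for x
    using \<psi> by (intro has_derivative_dderiv smooth_differentiable schwartz_smooth)
  have hd: "(?h has_derivative (\<lambda>v. cis (- (x \<bullet> \<xi>)) * dderiv v \<psi> x + (- (v \<bullet> \<xi>) *\<^sub>R (\<i> * cis (- (x \<bullet> \<xi>)))) * \<psi> x)) (at x)" for x
    by (rule has_derivative_mult[OF has_derivative_cis_linear \<psi>d])
  have dh: "dderiv b ?h = (\<lambda>x. cis (- (x \<bullet> \<xi>)) * dderiv b \<psi> x - \<i> * complex_of_real (\<xi> \<bullet> b) * (cis (- (x \<bullet> \<xi>)) * \<psi> x))"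
    by (rule ext, subst dderiv_eqI[OF hd]) (simp add: scaleR_conv_of_real inner_commute algebra_simps)
  have [measurable]: "\<psi> \<in> borel_measurable borel" "dderiv b \<psi> \<in> borel_measurable borel"
    using \<psi> b by (auto intro: schwartz_measurable schwartz_dderiv)
  have i1: "integrable lborel (\<lambda>x. cis (- (x \<bullet> \<xi>)) * dderiv b \<psi> x)" "integrable lborel ?h"
    using \<psi> b by (intro integrable_cis_mult schwartz_integrable[OF schwartz_dderiv] schwartz_integrable[OF \<psi>]; simp)+
  let ?N = "DIM(real^'n) + 1"
  obtain C1 where C1: "\<And>x. (1 + norm x) ^ ?N * norm (\<psi> x) \<le> C1"
    using schwartz_bound[OF \<psi>] by blast
  obtain C2 where C2: "\<And>x. (1 + norm x) ^ ?N * norm (dderiv b \<psi> x) \<le> C2"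
    using schwartz_bound[OF schwartz_dderiv[OF \<psi> b]] by blast
  have "(LINT x|lborel. dderiv b ?h x) = 0"
  proof (rule integral_dderiv_zero[where C = "C2 + \<bar>\<xi> \<bullet> b\<bar> * C1"])
    show "?h differentiable (at x)" for x using hd by (auto simp: differentiable_def)
    show "dderiv b ?h \<in> borel_measurable borel" unfolding dh by measurable
    fix x
    have "norm (dderiv b ?h x) \<le> norm (dderiv b \<psi> x) + \<bar>\<xi> \<bullet> b\<bar> * norm (\<psi> x)"
      unfolding dh by (rule order_trans[OF norm_triangle_ineq4]) (simp add: norm_mult)
    then have "(1 + norm x) ^ ?N * norm (dderiv b ?h x) \<le> (1 + norm x) ^ ?N * (norm (dderiv b \<psi> x) + \<bar>\<xi> \<bullet> b\<bar> * norm (\<psi> x))"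
      by (intro mult_left_mono) auto
    also have "\<dots> = (1 + norm x) ^ ?N * norm (dderiv b \<psi> x) + \<bar>\<xi> \<bullet> b\<bar> * ((1 + norm x) ^ ?N * norm (\<psi> x))"
      by (simp only: distrib_left mult.left_commute)
    also have "\<dots> \<le> C2 + \<bar>\<xi> \<bullet> b\<bar> * C1"
      using C1[of x] C2[of x] by (intro add_mono mult_left_mono) auto
    finally show "(1 + norm x) ^ ?N * norm (dderiv b ?h x) \<le> C2 + \<bar>\<xi> \<bullet> b\<bar> * C1" .
  qed (use i1 in auto)
  then show ?thesis
    unfolding dh using i1 by (simp add: fourier_def)
qed

lemma inv_fourier_dderiv:
  fixes \<psi> :: "real^'n::finite \<Rightarrow> complex"
  assumes "schwartz \<psi>" "b \<in> Basis"
  shows "inv_fourier (dderiv b \<psi>) \<xi> = - \<i> * complex_of_real (\<xi> \<bullet> b) * inv_fourier \<psi> \<xi>"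
  using fourier_dderiv[OF assms, of "- \<xi>"] by (simp add: inv_fourier_eq)

text \<open>Each factor \<open>1 + |\<xi>|\<close> is traded for a derivative of \<open>\<psi>\<close>.\<close>

lemma rapid_fourier:
  fixes \<psi> :: "real^'n::finite \<Rightarrow> complex"
  assumes \<psi>: "schwartz \<psi>"
  shows "rapid (fourier \<psi>)"
proof -
  have "schwartz \<psi> \<Longrightarrow> \<exists>C. \<forall>\<xi>. (1 + norm \<xi>) ^ N * norm (fourier \<psi> \<xi>) \<le> C" for N and \<psi> :: "real^'n \<Rightarrow> complex"
  proof (induction N arbitrary: \<psi>)
    case 0
    then show ?case using norm_fourier_le by auto
  next
    case (Suc N)
    obtain C where C: "\<And>\<xi>. (1 + norm \<xi>) ^ N * norm (fourier \<psi> \<xi>) \<le> C"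
      using Suc.IH[OF Suc.prems] by blast
    have "\<exists>C. \<forall>\<xi>. (1 + norm \<xi>) ^ N * norm (fourier (dderiv b \<psi>) \<xi>) \<le> C" if "b \<in> Basis" for b
      using Suc.IH[OF schwartz_dderiv[OF Suc.prems that]] .
    then obtain Cb where Cb: "\<And>b \<xi>. b \<in> Basis \<Longrightarrow> (1 + norm \<xi>) ^ N * norm (fourier (dderiv b \<psi>) \<xi>) \<le> Cb b"
      by metis
    have "(1 + norm \<xi>) ^ Suc N * norm (fourier \<psi> \<xi>) \<le> C + (\<Sum>b\<in>Basis. Cb b)" for \<xi>
    proof -
      have "norm \<xi> * norm (fourier \<psi> \<xi>) \<le> (\<Sum>b\<in>Basis. \<bar>\<xi> \<bullet> b\<bar>) * norm (fourier \<psi> \<xi>)"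
        by (intro mult_right_mono norm_le_l1) auto
      also have "\<dots> = (\<Sum>b\<in>Basis. norm (fourier (dderiv b \<psi>) \<xi>))"
        by (simp add: sum_distrib_right fourier_dderiv[OF Suc.prems] norm_mult)
      finally have "(1 + norm \<xi>) ^ N * ((1 + norm \<xi>) * norm (fourier \<psi> \<xi>))
         \<le> (1 + norm \<xi>) ^ N * (norm (fourier \<psi> \<xi>) + (\<Sum>b\<in>Basis. norm (fourier (dderiv b \<psi>) \<xi>)))"
        by (intro mult_left_mono) (auto simp: algebra_simps)
      also have "\<dots> = (1 + norm \<xi>) ^ N * norm (fourier \<psi> \<xi>) + (\<Sum>b\<in>Basis. (1 + norm \<xi>) ^ N * norm (fourier (dderiv b \<psi>) \<xi>))"
        by (simp only: distrib_left sum_distrib_left)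
      also have "\<dots> \<le> C + (\<Sum>b\<in>Basis. Cb b)"
        by (intro add_mono C sum_mono Cb)
      finally show ?thesis by (simp add: mult_ac)
    qed
    then show ?case by blast
  qed
  then show ?thesis
    unfolding rapid_def using \<psi> fourier_continuous_on[OF schwartz_integrable[OF \<psi>]]
    by (auto intro: borel_measurable_continuous_onI)
qed

lemma rapid_cmult: "rapid k \<Longrightarrow> rapid (\<lambda>x. c * k x)"
proof -
  assume k: "rapid k"
  have "\<exists>C. \<forall>x. (1 + norm x) ^ N * norm (c * k x) \<le> C" for N
  proof -
    obtain C where C: "\<And>x. (1 + norm x) ^ N * norm (k x) \<le> C" using k unfolding rapid_def by metis
    have "(1 + norm x) ^ N * norm (c * k x) \<le> norm c * C" for x
      using mult_left_mono[OF C[of x] norm_ge_zero[of c]] by (simp add: norm_mult mult_ac)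
    then show ?thesis by blast
  qed
  then show ?thesis using k by (auto simp: rapid_def)
qed

lemma rapid_reflect: "rapid k \<Longrightarrow> rapid (\<lambda>x. k (- x))"
  unfolding rapid_def
proof safe
  fix N assume "k \<in> borel_measurable borel" "\<forall>N. \<exists>C. \<forall>x. (1 + norm x) ^ N * norm (k x) \<le> C"
  then show "\<exists>C. \<forall>x. (1 + norm x) ^ N * norm (k (- x)) \<le> C" by (metis norm_minus_cancel)
next
  assume [measurable]: "k \<in> borel_measurable borel"
  show "(\<lambda>x. k (- x)) \<in> borel_measurable borel" by measurable
qed

lemma rapid_inv_fourier:
  assumes "schwartz \<psi>"
  shows "rapid (inv_fourier \<psi>)"
  using rapid_cmult[OF rapid_reflect[OF rapid_fourier[OF assms]], of "1 / complex_of_real ((2 * pi) ^ CARD('n))" for n]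
  by (simp add: inv_fourier_eq[abs_def] divide_inverse mult.commute rapid_cmult rapid_reflect rapid_fourier assms)

lemma inv_fourier_continuous_on:
  assumes "schwartz \<psi>"
  shows "continuous_on UNIV (inv_fourier \<psi>)"
proof -
  have "continuous_on UNIV (\<lambda>x. fourier \<psi> (- x))"
    by (rule continuous_on_compose2[OF fourier_continuous_on[OF schwartz_integrable[OF assms]]])
       (auto intro: continuous_intros)
  then show ?thesis unfolding inv_fourier_eq[abs_def] by (intro continuous_intros) auto
qed

subsection \<open>Inversion\<close>

text \<open>Lebesgue measure is a product measure along the basis, which reduces Gaussian integrals to dimension one.\<close>

lemma lborel_prod_Basis:
  fixes f :: "'a::euclidean_space \<Rightarrow> real \<Rightarrow> complex"
  assumes f: "\<And>b. b \<in> Basis \<Longrightarrow> integrable lborel (f b)"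
  shows "(LINT x|lborel. (\<Prod>b\<in>Basis. f b (x \<bullet> b))) = (\<Prod>b\<in>Basis. (LINT t|lborel. f b t))"
    and "integrable lborel (\<lambda>x::'a. (\<Prod>b\<in>Basis. f b (x \<bullet> b)))"
proof -
  have m: "f b \<in> borel_measurable borel" if "b \<in> Basis" for b using f[OF that] by auto
  interpret product_sigma_finite "\<lambda>_::'a. lborel :: real measure" ..
  have m2: "(\<lambda>x::'a. (\<Prod>b\<in>Basis. f b (x \<bullet> b))) \<in> borel_measurable borel"
    by (intro borel_measurable_prod measurable_compose[OF _ m]) auto
  have m3: "(\<lambda>y::'a \<Rightarrow> real. \<Sum>b\<in>Basis. y b *\<^sub>R b) \<in> (\<Pi>\<^sub>M b\<in>Basis. lborel) \<rightarrow>\<^sub>M borel"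
    by measurable
  have s: "(\<Prod>b\<in>Basis. f b ((\<Sum>b'\<in>Basis. y b' *\<^sub>R b') \<bullet> b)) = (\<Prod>b\<in>Basis. f b (y b))" for y :: "'a \<Rightarrow> real"
    by (intro prod.cong refl) (simp add: inner_sum_left_Basis)
  show "(LINT x|lborel. (\<Prod>b\<in>Basis. f b (x \<bullet> b))) = (\<Prod>b\<in>Basis. (LINT t|lborel. f b t))"
    by (subst lborel_eq, subst integral_distr[OF m3 m2])
       (simp only: s product_integral_prod[OF finite_Basis f])
  show "integrable lborel (\<lambda>x::'a. (\<Prod>b\<in>Basis. f b (x \<bullet> b)))"
    by (subst lborel_eq, subst integrable_distr_eq[OF m3 m2])
       (simp only: s product_integrable_prod[OF finite_Basis f])
qed

text \<open>The Gaussian is its own transform: this is the characteristic function of the normal distribution.\<close>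

lemma gaussian_1d:
  "integrable lborel (\<lambda>x::real. complex_of_real (exp (- x\<^sup>2 / 2)))"
  "(LINT x|lborel. cis (- (x * t)) * complex_of_real (exp (- x\<^sup>2 / 2))) = complex_of_real (sqrt (2 * pi) * exp (- t\<^sup>2 / 2))"
proof -
  have e: "exp (- x\<^sup>2 / 2) = sqrt (2 * pi) * std_normal_density x" for x :: real
    by (simp add: std_normal_density_def)
  show "integrable lborel (\<lambda>x::real. complex_of_real (exp (- x\<^sup>2 / 2)))"
    unfolding e using integrable_std_normal_moment[of 0] by simp
  have "char std_normal_distribution (- t) = complex_of_real (exp (- t\<^sup>2 / 2))"
    by (simp add: char_std_normal_distribution)
  moreover have "char std_normal_distribution (- t) = (LINT x|lborel. std_normal_density x *\<^sub>R cis (- (x * t)))"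
    unfolding char_def by (subst integral_density) (auto simp: cis_conv_exp mult_ac)
  ultimately have "(LINT x|lborel. std_normal_density x *\<^sub>R cis (- (x * t))) = complex_of_real (exp (- t\<^sup>2 / 2))" by simp
  moreover have "(LINT x|lborel. cis (- (x * t)) * complex_of_real (exp (- x\<^sup>2 / 2)))
     = (LINT x|lborel. complex_of_real (sqrt (2 * pi)) * (std_normal_density x *\<^sub>R cis (- (x * t))))"
    unfolding e by (intro Bochner_Integration.integral_cong refl) (simp add: scaleR_conv_of_real mult_ac)
  moreover have "\<dots> = complex_of_real (sqrt (2 * pi)) * (LINT x|lborel. (std_normal_density x *\<^sub>R cis (- (x * t))))"
    by (rule integral_mult_right_zero)
  ultimately show "(LINT x|lborel. cis (- (x * t)) * complex_of_real (exp (- x\<^sup>2 / 2))) = complex_of_real (sqrt (2 * pi) * exp (- t\<^sup>2 / 2))"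
    by simp
qed

definition gauss :: "'a::euclidean_space \<Rightarrow> complex" where
  "gauss x = (\<Prod>b\<in>Basis. complex_of_real (exp (- (x \<bullet> b)\<^sup>2 / 2)))"

lemma gauss_integrable: "integrable lborel gauss"
  unfolding gauss_def[abs_def] using lborel_prod_Basis(2)[of "\<lambda>b x. complex_of_real (exp (- x\<^sup>2 / 2))"] gaussian_1d(1) by simp

lemma gauss_continuous: "isCont gauss x"
  unfolding gauss_def by (intro continuous_intros) auto

lemma norm_gauss_le: "norm (gauss x) \<le> 1"
  unfolding gauss_def prod_norm[symmetric] by (intro prod_le_1) auto

lemma gauss_0: "gauss 0 = 1"
  by (simp add: gauss_def)

lemma cis_sum: "finite I \<Longrightarrow> cis (\<Sum>i\<in>I. f i) = (\<Prod>i\<in>I. cis (f i))"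
  by (induction I rule: finite_induct) (auto simp: cis_mult[symmetric])

lemma fourier_gauss:
  "fourier gauss \<xi> = complex_of_real (sqrt (2 * pi) ^ CARD('n)) * gauss (\<xi> :: real^'n::finite)"
proof -
  have i: "integrable lborel (\<lambda>t::real. cis (- (t * (\<xi> \<bullet> b))) * complex_of_real (exp (- t\<^sup>2 / 2)))" for b
    by (intro integrable_cis_mult gaussian_1d(1)) simp
  have "fourier gauss \<xi> = (LINT x|lborel. (\<Prod>b\<in>Basis. cis (- ((x \<bullet> b) * (\<xi> \<bullet> b))) * complex_of_real (exp (- (x \<bullet> b)\<^sup>2 / 2))))"
    unfolding fourier_def gauss_def
    by (intro Bochner_Integration.integral_cong refl)
       (simp add: prod.distrib cis_sum[symmetric] euclidean_inner[of _ \<xi>] sum_negf)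
  also have "\<dots> = (\<Prod>b\<in>Basis. complex_of_real (sqrt (2 * pi) * exp (- (\<xi> \<bullet> b)\<^sup>2 / 2)))"
    using lborel_prod_Basis(1)[of "\<lambda>b t. cis (- (t * (\<xi> \<bullet> b))) * complex_of_real (exp (- t\<^sup>2 / 2))", OF i]
    by (simp only: gaussian_1d(2))
  finally show ?thesis by (simp add: gauss_def prod.distrib)
qed

lemma gauss_mass: "(LINT x|lborel. gauss (x :: real^'n::finite)) = complex_of_real (sqrt (2 * pi) ^ CARD('n))"
  using fourier_gauss[of "0 :: real^'n"] by (simp add: fourier_def gauss_0)

text \<open>Multiplying the transform of \<open>h\<close> by the dilated Gaussian \<open>gauss (\<epsilon> y)\<close> turns the inversion
  integral into an average of \<open>h\<close> around \<open>x\<close> at scale \<open>\<epsilon>\<close>; both sides converge as \<open>\<epsilon>\<close> tends to 0.\<close>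

lemma inv_fourier_fourier:
  fixes h :: "real^'n::finite \<Rightarrow> complex"
  assumes h: "integrable lborel h" "\<And>x. isCont h x" "\<And>x. norm (h x) \<le> B"
    and hh: "integrable lborel (fourier h)"
  shows "inv_fourier (fourier h) x = h x"
proof -
  define c where "c = complex_of_real (sqrt (2 * pi) ^ CARD('n))"
  have [measurable]: "h \<in> borel_measurable borel" "fourier h \<in> borel_measurable borel" "(gauss :: real^'n \<Rightarrow> complex) \<in> borel_measurable borel"
    using h(1) hh gauss_integrable[where 'a = "real^'n"] by auto
  have key: "(LINT y|lborel. cis (x \<bullet> y) * fourier h y * gauss (\<epsilon> *\<^sub>R y)) = c * (LINT w|lborel. h (x + \<epsilon> *\<^sub>R w) * gauss w)"
    if \<epsilon>: "\<epsilon> > 0" for \<epsilon> :: real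
  proof -
    let ?g = "\<lambda>y::real^'n. gauss (\<epsilon> *\<^sub>R y)"
    have gi: "integrable lborel ?g" using integrable_affine[OF gauss_integrable, of \<epsilon> 0] \<epsilon> by simp
    have "(LINT y|lborel. cis (x \<bullet> y) * fourier h y * gauss (\<epsilon> *\<^sub>R y))
       = (LINT y|lborel. ?g y * (LINT z|lborel. h z * cis ((x - z) \<bullet> y)))"
    proof (intro Bochner_Integration.integral_cong refl)
      fix y
      have e: "cis ((x - z) \<bullet> y) = cis (x \<bullet> y) * cis (- (z \<bullet> y))" for z
        by (simp add: cis_mult inner_diff_left)
      have "cis (x \<bullet> y) * fourier h y = (LINT z|lborel. cis (x \<bullet> y) * (cis (- (z \<bullet> y)) * h z))"
        unfolding fourier_def by simp
      also have "\<dots> = (LINT z|lborel. h z * cis ((x - z) \<bullet> y))"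
        by (intro Bochner_Integration.integral_cong refl) (simp only: e mult_ac)
      finally show "cis (x \<bullet> y) * fourier h y * ?g y = ?g y * (LINT z|lborel. h z * cis ((x - z) \<bullet> y))"
        by (simp add: mult.commute)
    qed
    also have "\<dots> = (LINT z|lborel. h z * (LINT y|lborel. ?g y * cis ((x - z) \<bullet> y)))"
      using integral_swap_mult[OF gi h(1), of "\<lambda>y z. cis ((x - z) \<bullet> y)" 1] by simp
    also have "\<dots> = \<bar>\<epsilon>\<bar> ^ DIM(real^'n) *\<^sub>R (LINT w|lborel. h (x + \<epsilon> *\<^sub>R w) * (LINT y|lborel. ?g y * cis ((x - (x + \<epsilon> *\<^sub>R w)) \<bullet> y)))"
      by (rule integral_affine) (use \<epsilon> in auto)
    also have "(\<lambda>w. LINT y|lborel. ?g y * cis ((x - (x + \<epsilon> *\<^sub>R w)) \<bullet> y)) = (\<lambda>w. (1 / \<epsilon> ^ DIM(real^'n)) *\<^sub>R (c * gauss w))"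
    proof
      fix w
      have "(LINT y|lborel. ?g y * cis ((x - (x + \<epsilon> *\<^sub>R w)) \<bullet> y))
        = \<bar>1/\<epsilon>\<bar> ^ DIM(real^'n) *\<^sub>R (LINT y|lborel. ?g (0 + (1/\<epsilon>) *\<^sub>R y) * cis ((x - (x + \<epsilon> *\<^sub>R w)) \<bullet> (0 + (1/\<epsilon>) *\<^sub>R y)))"
        by (rule integral_affine) (use \<epsilon> in auto)
      also have "(\<lambda>y. ?g (0 + (1/\<epsilon>) *\<^sub>R y) * cis ((x - (x + \<epsilon> *\<^sub>R w)) \<bullet> (0 + (1/\<epsilon>) *\<^sub>R y))) = (\<lambda>y. cis (- (y \<bullet> w)) * gauss y)"
        using \<epsilon> by (intro ext) (simp add: inner_commute)
      also have "(LINT y|lborel. cis (- (y \<bullet> w)) * gauss y) = c * gauss w"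
        using fourier_gauss[of w] by (simp add: fourier_def c_def)
      finally show "(LINT y|lborel. ?g y * cis ((x - (x + \<epsilon> *\<^sub>R w)) \<bullet> y)) = (1 / \<epsilon> ^ DIM(real^'n)) *\<^sub>R (c * gauss w)"
        using \<epsilon> by (simp add: power_divide)
    qed
    also have "\<bar>\<epsilon>\<bar> ^ DIM(real^'n) *\<^sub>R (LINT w|lborel. h (x + \<epsilon> *\<^sub>R w) * ((1 / \<epsilon> ^ DIM(real^'n)) *\<^sub>R (c * gauss w)))
      = (LINT w|lborel. \<epsilon> ^ DIM(real^'n) *\<^sub>R (h (x + \<epsilon> *\<^sub>R w) * ((1 / \<epsilon> ^ DIM(real^'n)) *\<^sub>R (c * gauss w))))"
      using \<epsilon> by simp
    also have "\<dots> = (LINT w|lborel. c * (h (x + \<epsilon> *\<^sub>R w) * gauss w))"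
      using \<epsilon> by (intro Bochner_Integration.integral_cong refl) (simp add: mult_ac)
    finally show ?thesis by simp
  qed
  have e0: "(\<lambda>n. 1 / real (Suc n)) \<longlonglongrightarrow> 0" using LIMSEQ_inverse_real_of_nat by (simp add: inverse_eq_divide)
  have L: "(\<lambda>n. LINT y|lborel. cis (x \<bullet> y) * fourier h y * gauss ((1 / real (Suc n)) *\<^sub>R y)) \<longlonglongrightarrow> (LINT y|lborel. cis (x \<bullet> y) * fourier h y)"
  proof (rule integral_dominated_convergence[where w = "\<lambda>y. norm (fourier h y)"])
    show "AE y in lborel. (\<lambda>n. cis (x \<bullet> y) * fourier h y * gauss ((1 / real (Suc n)) *\<^sub>R y)) \<longlonglongrightarrow> cis (x \<bullet> y) * fourier h y"
    proof (intro AE_I2)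
      fix y :: "real^'n"
      have "(\<lambda>n. gauss ((1 / real (Suc n)) *\<^sub>R y)) \<longlonglongrightarrow> gauss (0 *\<^sub>R y)"
        by (intro isCont_tendsto_compose[OF gauss_continuous] tendsto_scaleR e0 tendsto_const)
      then show "(\<lambda>n. cis (x \<bullet> y) * fourier h y * gauss ((1 / real (Suc n)) *\<^sub>R y)) \<longlonglongrightarrow> cis (x \<bullet> y) * fourier h y"
        using tendsto_mult_left[of _ 1 sequentially "cis (x \<bullet> y) * fourier h y"] by (simp add: gauss_0)
    qed
    show "AE y in lborel. norm (cis (x \<bullet> y) * fourier h y * gauss ((1 / real (Suc n)) *\<^sub>R y)) \<le> norm (fourier h y)" for n
      by (intro AE_I2) (simp add: norm_mult mult_left_le norm_gauss_le)
  qed (use hh in auto)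
  have R: "(\<lambda>n. LINT w|lborel. h (x + (1 / real (Suc n)) *\<^sub>R w) * gauss w) \<longlonglongrightarrow> (LINT w|lborel. h x * gauss (w :: real^'n))"
  proof (rule integral_dominated_convergence[where w = "\<lambda>y::real^'n. B * norm (gauss y)"])
    show "AE w in lborel. (\<lambda>n. h (x + (1 / real (Suc n)) *\<^sub>R w) * gauss w) \<longlonglongrightarrow> h x * gauss w"
    proof (intro AE_I2 tendsto_mult tendsto_const)
      fix w :: "real^'n"
      have "(\<lambda>n. h (x + (1 / real (Suc n)) *\<^sub>R w)) \<longlonglongrightarrow> h (x + 0 *\<^sub>R w)"
        by (intro isCont_tendsto_compose[OF h(2)] tendsto_add tendsto_scaleR e0 tendsto_const)
      then show "(\<lambda>n. h (x + (1 / real (Suc n)) *\<^sub>R w)) \<longlonglongrightarrow> h x" by simp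
    qed
    show "AE w in lborel. norm (h (x + (1 / real (Suc n)) *\<^sub>R w) * gauss w) \<le> B * norm (gauss w)" for n
      using h(3) by (auto simp: norm_mult mult_right_mono)
    show "integrable lborel (\<lambda>y::real^'n. B * norm (gauss y))" using gauss_integrable[where 'a = "real^'n"] by simp
  qed auto
  have "(LINT y|lborel. cis (x \<bullet> y) * fourier h y) = c * (LINT w|lborel. h x * gauss (w :: real^'n))"
    by (rule LIMSEQ_unique[OF L]) (use tendsto_mult_left[OF R, of c] key in simp)
  also have "\<dots> = complex_of_real ((2 * pi) ^ CARD('n)) * h x"
  proof -
    have "sqrt (2 * pi) ^ CARD('n) * sqrt (2 * pi) ^ CARD('n) = (2 * pi) ^ CARD('n)"
      by (simp only: power_mult_distrib[symmetric] real_sqrt_mult_self) simp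
    then have "c * c = complex_of_real ((2 * pi) ^ CARD('n))"
      unfolding c_def of_real_mult[symmetric] by (rule arg_cong)
    moreover have "(LINT w|lborel. h x * gauss (w :: real^'n)) = h x * c"
      unfolding c_def gauss_mass[symmetric] by (rule integral_mult_right_zero)
    ultimately show ?thesis by (metis mult.assoc mult.commute)
  qed
  finally show ?thesis by (simp add: inv_fourier_def)
qed

section \<open>Fourier multipliers as convolutions\<close>

definition l1 :: "('a::euclidean_space \<Rightarrow> complex) \<Rightarrow> ennreal" where
  "l1 \<psi> = (\<integral>\<^sup>+x. ennreal (norm (\<psi> x)) \<partial>lborel)"

definition fmult :: "(real^'n::finite \<Rightarrow> real) \<Rightarrow> (real^'n \<Rightarrow> complex) \<Rightarrow> real^'n \<Rightarrow> complex" where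
  "fmult m \<psi> = fourier (\<lambda>\<xi>. complex_of_real (m \<xi>) * inv_fourier \<psi> \<xi>)"

text \<open>The inverse transform of the reflected symbol, so that \<open>fmult m\<close> is convolution with \<open>kern m\<close>.\<close>

definition kern :: "(real^'n::finite \<Rightarrow> real) \<Rightarrow> real^'n \<Rightarrow> complex" where
  "kern m x = fourier (\<lambda>\<xi>. complex_of_real (m \<xi>)) x / complex_of_real ((2 * pi) ^ CARD('n))"

text \<open>Such symbols are themselves Schwartz functions, so their kernels decay rapidly and their multipliers preserve
  Schwartz functions.\<close>

definition symb :: "('a::euclidean_space \<Rightarrow> real) \<Rightarrow> bool" where
  "symb m \<longleftrightarrow> smooth m \<and> (\<exists>R. \<forall>\<xi>. norm \<xi> > R \<longrightarrow> m \<xi> = 0)"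

lemma multiplier_eq: "multiplier m T \<psi> = T (fmult m \<psi>)"
  by (simp add: multiplier_def fmult_def)

lemma symb_smooth: "symb m \<Longrightarrow> smooth m"
  by (simp add: symb_def)

lemma symb_schwartz: "symb m \<Longrightarrow> schwartz (\<lambda>\<xi>. complex_of_real (m \<xi>))"
proof -
  assume m: "symb m"
  then obtain R where "\<And>\<xi>. norm \<xi> > R \<Longrightarrow> m \<xi> = 0" by (auto simp: symb_def)
  then show ?thesis
    using m by (intro schwartz_compact_support[where R = R] smooth_of_real) (auto simp: symb_def)
qed

lemma symb_times: "smooth g \<Longrightarrow> symb m \<Longrightarrow> symb (\<lambda>\<xi>. g \<xi> * m \<xi>)"
  unfolding symb_def by (auto intro: smooth_mult) 

lemma symb_diff: "symb m \<Longrightarrow> symb m' \<Longrightarrow> symb (\<lambda>\<xi>. m \<xi> - m' \<xi>)"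
proof -
  assume m: "symb m" "symb m'"
  then obtain R R' where "\<And>\<xi>. norm \<xi> > R \<Longrightarrow> m \<xi> = 0" "\<And>\<xi>. norm \<xi> > R' \<Longrightarrow> m' \<xi> = 0"
    by (auto simp: symb_def)
  then have "\<forall>\<xi>. norm \<xi> > max R R' \<longrightarrow> m \<xi> - m' \<xi> = 0" by simp
  then show ?thesis using m unfolding symb_def by (intro conjI exI[of _ "max R R'"] smooth_diff) auto
qed

lemma symb_dilate:
  fixes m :: "'a::euclidean_space \<Rightarrow> real"
  assumes "symb m" "s > 0" shows "symb (\<lambda>\<xi>. m (s *\<^sub>R \<xi>))"
proof -
  obtain R where R: "\<And>\<xi>. norm \<xi> > R \<Longrightarrow> m \<xi> = 0" using assms by (auto simp: symb_def)
  have "m (s *\<^sub>R \<xi>) = 0" if "norm \<xi> > R / s" for \<xi>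
    using that assms by (intro R) (simp add: field_simps)
  then show ?thesis using assms unfolding symb_def by (intro conjI smooth_dilate exI[of _ "R / s"]) auto
qed

lemma symb_cmult: "symb m \<Longrightarrow> symb (\<lambda>\<xi>. c * m \<xi>)"
  by (intro symb_times) auto

lemma symb_bounded:
  fixes m :: "'a::euclidean_space \<Rightarrow> real"
  assumes "symb m" obtains C where "\<And>\<xi>. \<bar>m \<xi>\<bar> \<le> C"
proof -
  obtain C where "\<And>x. (1 + norm x) ^ 0 * norm (complex_of_real (m x)) \<le> C"
    using schwartz_bound[OF symb_schwartz[OF assms]] by blast
  then show ?thesis using that[of C] by simp
qed

lemma rapid_kern:
  fixes m :: "real^'n::finite \<Rightarrow> real"
  assumes "symb m"
  shows "rapid (kern m)"
proof -
  have "kern m = (\<lambda>x. (1 / complex_of_real ((2 * pi) ^ CARD('n))) * fourier (\<lambda>\<xi>. complex_of_real (m \<xi>)) x)"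
    by (simp add: kern_def fun_eq_iff)
  then show ?thesis
    by (simp only: rapid_cmult[OF rapid_fourier[OF symb_schwartz[OF assms]]])
qed

lemma rapid_l1: "rapid k \<Longrightarrow> l1 k < \<infinity>"
  using rapid_integrable[of k] by (simp add: l1_def integrable_iff_bounded)

lemma schwartz_l1: "schwartz \<psi> \<Longrightarrow> l1 \<psi> < \<infinity>"
  by (intro rapid_l1 schwartz_rapid)

lemma integrable_symb_times:
  fixes h :: "real^'n::finite \<Rightarrow> complex"
  assumes m: "symb m" and h: "integrable lborel h"
  shows "integrable lborel (\<lambda>\<xi>. complex_of_real (m \<xi>) * h \<xi>)"
proof -
  obtain C where C: "\<And>\<xi>. \<bar>m \<xi>\<bar> \<le> C" using symb_bounded[OF m] by blast
  have [measurable]: "h \<in> borel_measurable borel" "(\<lambda>\<xi>. complex_of_real (m \<xi>)) \<in> borel_measurable borel"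
    using h schwartz_measurable[OF symb_schwartz[OF m]] by auto
  show ?thesis
  proof (rule Bochner_Integration.integrable_bound)
    show "integrable lborel (\<lambda>\<xi>. C * norm (h \<xi>))" using h by simp
    show "AE \<xi> in lborel. norm (complex_of_real (m \<xi>) * h \<xi>) \<le> norm (C * norm (h \<xi>))"
      using C by (intro AE_I2) (auto simp: norm_mult abs_mult intro!: mult_right_mono order_trans[OF C])
  qed measurable
qed

text \<open>Fubini, after writing out both transforms: the symbol is integrated first.\<close>

lemma fmult_eq_conv:
  fixes m :: "real^'n::finite \<Rightarrow> real"
  assumes m: "symb m" and \<psi>: "schwartz \<psi>"
  shows "fmult m \<psi> = conv (kern m) \<psi>"
proof
  fix x :: "real^'n"
  define c where "c = complex_of_real ((2 * pi) ^ CARD('n))"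
  let ?m = "\<lambda>\<xi>. complex_of_real (m \<xi>)"
  have mi: "integrable lborel ?m" and \<psi>i: "integrable lborel \<psi>"
    using m \<psi> by (auto intro: schwartz_integrable symb_schwartz)
  have [measurable]: "?m \<in> borel_measurable borel" "\<psi> \<in> borel_measurable borel" "kern m \<in> borel_measurable borel"
    using mi \<psi>i rapid_measurable[OF rapid_kern[OF m]] by auto
  have "fmult m \<psi> x = (LINT \<xi>|lborel. (1 / c) * (?m \<xi> * (LINT y|lborel. \<psi> y * cis (- (\<xi> \<bullet> (x - y))))))"
    unfolding fmult_def fourier_def
  proof (intro Bochner_Integration.integral_cong refl)
    fix \<xi>
    have e: "cis (- (\<xi> \<bullet> (x - y))) = cis (- (\<xi> \<bullet> x)) * cis (\<xi> \<bullet> y)" for y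
      by (simp add: cis_mult inner_diff_right)
    have "(LINT y|lborel. \<psi> y * cis (- (\<xi> \<bullet> (x - y)))) = (LINT y|lborel. cis (- (\<xi> \<bullet> x)) * (cis (\<xi> \<bullet> y) * \<psi> y))"
      by (intro Bochner_Integration.integral_cong refl) (simp only: e mult_ac)
    then show "cis (- (\<xi> \<bullet> x)) * (?m \<xi> * inv_fourier \<psi> \<xi>) = (1 / c) * (?m \<xi> * (LINT y|lborel. \<psi> y * cis (- (\<xi> \<bullet> (x - y)))))"
      by (simp add: inv_fourier_def c_def)
  qed
  also have "\<dots> = (1 / c) * (LINT y|lborel. \<psi> y * (LINT \<xi>|lborel. ?m \<xi> * cis (- (\<xi> \<bullet> (x - y)))))"
    using integral_swap_mult[OF mi \<psi>i, of "\<lambda>\<xi> y. cis (- (\<xi> \<bullet> (x - y)))" 1] by simp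
  also have "\<dots> = (LINT y|lborel. (1 / c) * (\<psi> y * (LINT \<xi>|lborel. ?m \<xi> * cis (- (\<xi> \<bullet> (x - y))))))" by simp
  also have "\<dots> = (LINT y|lborel. kern m (x - y) * \<psi> y)"
    by (intro Bochner_Integration.integral_cong refl) (simp add: kern_def fourier_def c_def mult_ac)
  also have "\<dots> = (LINT y|lborel. kern m (x - (x - y)) * \<psi> (x - y))"
    by (rule integral_translate(3)[symmetric]) measurable
  finally show "fmult m \<psi> x = conv (kern m) \<psi> x" by (simp add: conv_def)
qed

lemma schwartz_fmult: "symb m \<Longrightarrow> schwartz \<psi> \<Longrightarrow> schwartz (fmult m \<psi>)"
  by (simp add: fmult_eq_conv schwartz_conv rapid_kern)

lemma l1_fmult_le: "symb m \<Longrightarrow> schwartz \<psi> \<Longrightarrow> l1 (fmult m \<psi>) \<le> l1 (kern m) * l1 \<psi>"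
  unfolding l1_def fmult_eq_conv
  by (intro nn_integral_conv_le rapid_measurable rapid_kern schwartz_measurable)

text \<open>The inner multiplier is a Fourier transform, which the outer inverse transform undoes by Fourier inversion.\<close>

lemma fmult_fmult:
  assumes m: "symb m" "symb m'" and \<psi>: "schwartz \<psi>"
  shows "fmult m (fmult m' \<psi>) = fmult (\<lambda>\<xi>. m \<xi> * m' \<xi>) \<psi>"
proof -
  let ?h = "\<lambda>\<xi>. complex_of_real (m' \<xi>) * inv_fourier \<psi> \<xi>"
  obtain C where C: "\<And>\<xi>. \<bar>m' \<xi>\<bar> \<le> C" using symb_bounded[OF m(2)] by blast
  obtain B where B: "\<And>\<xi>. norm (inv_fourier \<psi> \<xi>) \<le> B" using rapid_bound[OF rapid_inv_fourier[OF \<psi>]] by blast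
  have "inv_fourier (fourier ?h) \<xi> = ?h \<xi>" for \<xi>
  proof (rule inv_fourier_fourier)
    show "integrable lborel ?h"
      by (intro integrable_symb_times m rapid_integrable rapid_inv_fourier \<psi>)
    have "continuous_on UNIV (\<lambda>\<xi>. complex_of_real (m' \<xi>))"
      by (rule smooth_continuous[OF schwartz_smooth[OF symb_schwartz[OF m(2)]]])
    then have "continuous_on UNIV ?h"
      using inv_fourier_continuous_on[OF \<psi>] by (intro continuous_on_mult)
    then show "isCont ?h x" for x by (simp add: continuous_on_eq_continuous_at)
    show "norm (?h x) \<le> C * B" for x
      unfolding norm_mult using C[of x] B[of x] by (intro mult_mono) auto
    show "integrable lborel (fourier ?h)"
      using schwartz_integrable[OF schwartz_fmult[OF m(2) \<psi>]] by (simp add: fmult_def)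
  qed
  then show ?thesis by (simp add: fmult_def fun_eq_iff mult.assoc)
qed

lemma kern_mass:
  fixes m :: "real^'n::finite \<Rightarrow> real"
  assumes m: "symb m"
  shows "(LINT x|lborel. kern m x) = complex_of_real (m 0)"
proof -
  let ?m = "\<lambda>\<xi>. complex_of_real (m \<xi>)"
  obtain C where C: "\<And>\<xi>. \<bar>m \<xi>\<bar> \<le> C" using symb_bounded[OF m] by blast
  have "inv_fourier (fourier ?m) 0 = ?m 0"
  proof (rule inv_fourier_fourier)
    show "isCont ?m x" for x
      using smooth_continuous[OF schwartz_smooth[OF symb_schwartz[OF m]], of UNIV]
      by (simp add: continuous_on_eq_continuous_at)
    show "norm (?m x) \<le> C" for x using C by simp
  qed (use m in \<open>auto intro: schwartz_integrable symb_schwartz rapid_integrable rapid_fourier\<close>)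
  then show ?thesis by (simp add: inv_fourier_def kern_def)
qed

lemma kern_cmult: "kern (\<lambda>\<xi>. c * m \<xi>) = (\<lambda>x. complex_of_real c * kern m x)"
  unfolding kern_def fourier_def by (auto simp: fun_eq_iff mult.left_commute)

lemma l1_cmult: "\<psi> \<in> borel_measurable borel \<Longrightarrow> l1 (\<lambda>x. c * \<psi> x) = ennreal (norm c) * l1 \<psi>"
  by (simp add: l1_def norm_mult ennreal_mult' nn_integral_cmult)

lemma kern_dilate:
  fixes m :: "real^'n::finite \<Rightarrow> real"
  assumes m: "symb m" and s: "s > 0"
  shows "kern (\<lambda>\<xi>. m (s *\<^sub>R \<xi>)) y = complex_of_real ((1 / s) ^ CARD('n)) * kern m ((1 / s) *\<^sub>R y)"
proof -
  have [measurable]: "m \<in> borel_measurable borel"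
    using m by (intro borel_measurable_continuous_onI smooth_continuous symb_smooth)
  have "fourier (\<lambda>\<xi>. complex_of_real (m (s *\<^sub>R \<xi>))) y
    = \<bar>1 / s\<bar> ^ DIM(real^'n) *\<^sub>R (LINT \<xi>|lborel. cis (- ((0 + (1 / s) *\<^sub>R \<xi>) \<bullet> y)) * complex_of_real (m (s *\<^sub>R (0 + (1 / s) *\<^sub>R \<xi>))))"
    unfolding fourier_def by (rule integral_affine) (use s in auto)
  also have "(\<lambda>\<xi>. cis (- ((0 + (1 / s) *\<^sub>R \<xi>) \<bullet> y)) * complex_of_real (m (s *\<^sub>R (0 + (1 / s) *\<^sub>R \<xi>))))
    = (\<lambda>\<xi>. cis (- (\<xi> \<bullet> ((1 / s) *\<^sub>R y))) * complex_of_real (m \<xi>))"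
    using s by (intro ext) simp
  also have "\<bar>1 / s\<bar> ^ DIM(real^'n) *\<^sub>R (LINT \<xi>|lborel. cis (- (\<xi> \<bullet> ((1 / s) *\<^sub>R y))) * complex_of_real (m \<xi>))
    = complex_of_real ((1 / s) ^ CARD('n)) * fourier (\<lambda>\<xi>. complex_of_real (m \<xi>)) ((1 / s) *\<^sub>R y)"
    unfolding fourier_def scaleR_conv_of_real using s by simp
  finally show ?thesis by (simp add: kern_def)
qed

text \<open>Dilating the symbol dilates the kernel with its mass preserved; this is why estimates on dyadic blocks hold
  uniformly in the frequency.\<close>

lemma l1_kern_dilate:
  fixes m :: "real^'n::finite \<Rightarrow> real"
  assumes m: "symb m" and s: "s > 0"
  shows "l1 (kern (\<lambda>\<xi>. m (s *\<^sub>R \<xi>))) = l1 (kern m)"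
proof -
  have [measurable]: "kern m \<in> borel_measurable borel" using m by (intro rapid_measurable rapid_kern)
  have "l1 (kern m) = ennreal (\<bar>1 / s\<bar> ^ DIM(real^'n)) * (\<integral>\<^sup>+x. ennreal (norm (kern m (0 + (1 / s) *\<^sub>R x))) \<partial>lborel)"
    unfolding l1_def by (rule nn_integral_affine) (use s in auto)
  also have "\<dots> = (\<integral>\<^sup>+x. ennreal (\<bar>1 / s\<bar> ^ DIM(real^'n)) * ennreal (norm (kern m (0 + (1 / s) *\<^sub>R x))) \<partial>lborel)"
    by (rule nn_integral_cmult[symmetric]) measurable
  also have "\<dots> = l1 (kern (\<lambda>\<xi>. m (s *\<^sub>R \<xi>)))"
  proof -
    have "norm (complex_of_real ((1 / s) ^ CARD('n))) = \<bar>1 / s\<bar> ^ DIM(real^'n)"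
      unfolding norm_of_real by (simp add: power_abs)
    then show ?thesis
      unfolding l1_def kern_dilate[OF m s] norm_mult by (simp only: ennreal_mult' zero_le_power abs_ge_zero add_0)
  qed
  finally show ?thesis by simp
qed

lemma norm_kern_dilate_le:
  fixes m :: "real^'n::finite \<Rightarrow> real"
  assumes m: "symb m" and s: "s > 0" and K: "\<And>x. norm (kern m x) \<le> K"
  shows "norm (kern (\<lambda>\<xi>. m (s *\<^sub>R \<xi>)) y) \<le> (1 / s) ^ CARD('n) * K"
proof -
  have "norm (complex_of_real ((1 / s) ^ CARD('n))) = (1 / s) ^ CARD('n)"
    unfolding norm_of_real using s by simp
  then show ?thesis
    unfolding kern_dilate[OF m s] norm_mult using K[of "(1 / s) *\<^sub>R y"] s
    by (metis mult_left_mono norm_ge_zero)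
qed

text \<open>Multiplication by a coordinate is a derivative up to the factor \<open>\<i>\<close>, and derivatives commute with multipliers.\<close>

lemma fmult_coord:
  assumes m: "symb m" and \<psi>: "schwartz \<psi>" and b: "b \<in> Basis"
  shows "fmult (\<lambda>\<xi>. (\<xi> \<bullet> b) * m \<xi>) \<psi> = (\<lambda>x. \<i> * fmult m (dderiv b \<psi>) x)"
    and "fmult (\<lambda>\<xi>. (\<xi> \<bullet> b) * m \<xi>) \<psi> = (\<lambda>x. \<i> * dderiv b (fmult m \<psi>) x)"
proof -
  have e: "complex_of_real ((\<xi> \<bullet> b) * m \<xi>) * inv_fourier \<psi> \<xi> = \<i> * (complex_of_real (m \<xi>) * inv_fourier (dderiv b \<psi>) \<xi>)" for \<xi>
    unfolding inv_fourier_dderiv[OF \<psi> b] by (simp add: mult_ac)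
  show *: "fmult (\<lambda>\<xi>. (\<xi> \<bullet> b) * m \<xi>) \<psi> = (\<lambda>x. \<i> * fmult m (dderiv b \<psi>) x)"
    unfolding fmult_def e by (simp add: fourier_def fun_eq_iff mult.left_commute)
  have "dderiv b (fmult m \<psi>) = fmult m (dderiv b \<psi>)"
    using m \<psi> b by (simp add: fmult_eq_conv schwartz_dderiv dderiv_conv rapid_kern)
  then show "fmult (\<lambda>\<xi>. (\<xi> \<bullet> b) * m \<xi>) \<psi> = (\<lambda>x. \<i> * dderiv b (fmult m \<psi>) x)" using * by simp
qed

lemma fmult_sum:
  fixes m :: "'i \<Rightarrow> real^'n::finite \<Rightarrow> real"
  assumes I: "finite I" and m: "\<And>i. i \<in> I \<Longrightarrow> symb (m i)" and \<psi>: "schwartz \<psi>"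
  shows "fmult (\<lambda>\<xi>. \<Sum>i\<in>I. m i \<xi>) \<psi> = (\<lambda>x. \<Sum>i\<in>I. fmult (m i) \<psi> x)"
proof
  fix x
  have "fmult (\<lambda>\<xi>. \<Sum>i\<in>I. m i \<xi>) \<psi> x = (LINT \<xi>|lborel. (\<Sum>i\<in>I. cis (- (\<xi> \<bullet> x)) * (complex_of_real (m i \<xi>) * inv_fourier \<psi> \<xi>)))"
    unfolding fmult_def fourier_def by (simp add: sum_distrib_left sum_distrib_right)
  also have "\<dots> = (\<Sum>i\<in>I. fmult (m i) \<psi> x)"
    unfolding fmult_def fourier_def
    by (intro Bochner_Integration.integral_sum integrable_cis_mult integrable_symb_times m rapid_integrable rapid_inv_fourier \<psi>) auto
  finally show "fmult (\<lambda>\<xi>. \<Sum>i\<in>I. m i \<xi>) \<psi> x = (\<Sum>i\<in>I. fmult (m i) \<psi> x)" .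
qed

lemma fmult_diff:
  fixes m m' :: "real^'n::finite \<Rightarrow> real"
  assumes m: "symb m" "symb m'" and \<psi>: "schwartz \<psi>"
  shows "fmult (\<lambda>\<xi>. m \<xi> - m' \<xi>) \<psi> = (\<lambda>x. fmult m \<psi> x - fmult m' \<psi> x)"
  unfolding fmult_def fourier_def using m \<psi>
  by (simp add: fun_eq_iff left_diff_distrib right_diff_distrib integrable_cis_mult integrable_symb_times rapid_integrable rapid_inv_fourier)

section \<open>The dual norm of a distribution\<close>

text \<open>For a distribution given by a function this is the \<open>L\<^sup>\<infinity>\<close> norm.  Being a supremum over test
  functions, it satisfies the triangle inequality and behaves well under multipliers without any
  reference to a representing function.\<close>

definition dnorm :: "'a::euclidean_space functional \<Rightarrow> ennreal" where
  "dnorm T = (SUP \<psi>\<in>{\<psi>. schwartz \<psi> \<and> l1 \<psi> \<le> 1}. ennreal (norm (T \<psi>)))"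

text \<open>Linearity on Schwartz functions, the part of temperedness that duality arguments use.\<close>

definition lin :: "'a::euclidean_space functional \<Rightarrow> bool" where
  "lin T \<longleftrightarrow> (\<forall>\<psi> \<eta> a b. schwartz \<psi> \<longrightarrow> schwartz \<eta> \<longrightarrow> T (\<lambda>x. a * \<psi> x + b * \<eta> x) = a * T \<psi> + b * T \<eta>)"

lemma tempered_lin: "tempered T \<Longrightarrow> lin T"
  by (simp add: tempered_def lin_def)

lemma lin_cmult: "lin T \<Longrightarrow> schwartz \<psi> \<Longrightarrow> T (\<lambda>x. a * \<psi> x) = a * T \<psi>"
  unfolding lin_def by (metis (no_types, lifting) add.right_neutral mult_zero_left ext)

lemma lin_add: "lin T \<Longrightarrow> schwartz \<psi> \<Longrightarrow> schwartz \<eta> \<Longrightarrow> T (\<lambda>x. \<psi> x + \<eta> x) = T \<psi> + T \<eta>"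
  unfolding lin_def using mult_1 by (metis (no_types, lifting) ext)

lemma lin_diff: "lin T \<Longrightarrow> schwartz \<psi> \<Longrightarrow> schwartz \<eta> \<Longrightarrow> T (\<lambda>x. \<psi> x - \<eta> x) = T \<psi> - T \<eta>"
proof -
  assume "lin T" "schwartz \<psi>" "schwartz \<eta>"
  then have "T (\<lambda>x. 1 * \<psi> x + (-1) * \<eta> x) = 1 * T \<psi> + (-1) * T \<eta>"
    unfolding lin_def by blast
  then show ?thesis by simp
qed

lemma schwartz_sum: "(\<And>i. i \<in> I \<Longrightarrow> schwartz (\<psi> i)) \<Longrightarrow> schwartz (\<lambda>x. \<Sum>i\<in>I. \<psi> i x)"
proof (induction I rule: infinite_finite_induct)
  case (insert i I)
  then show ?case by (simp add: schwartz_add)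
qed (auto intro!: schwartz_compact_support[where R = 0])

lemma lin_sum:
  assumes "lin T" "finite I" "\<And>i. i \<in> I \<Longrightarrow> schwartz (\<psi> i)"
  shows "T (\<lambda>x. \<Sum>i\<in>I. \<psi> i x) = (\<Sum>i\<in>I. T (\<psi> i))"
  using assms(2,3)
proof (induction I rule: finite_induct)
  case empty
  have "schwartz (\<lambda>x::'a. 0)" by (intro schwartz_compact_support[where R = 0]) auto
  from lin_cmult[OF assms(1) this, of 0] show ?case by simp
next
  case (insert i I)
  then show ?case using lin_add[OF assms(1), of "\<psi> i" "\<lambda>x. \<Sum>i\<in>I. \<psi> i x"] by (simp add: schwartz_sum)
qed

lemma dnorm_leI:
  assumes "\<And>\<psi>. schwartz \<psi> \<Longrightarrow> l1 \<psi> \<le> 1 \<Longrightarrow> ennreal (norm (T \<psi>)) \<le> C"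
  shows "dnorm T \<le> C"
  unfolding dnorm_def using assms by (intro SUP_least) auto

lemma dnorm_bound:
  assumes T: "lin T" and \<psi>: "schwartz \<psi>" and r: "r > 0" "l1 \<psi> \<le> ennreal r"
  shows "ennreal (norm (T \<psi>)) \<le> ennreal r * dnorm T"
proof -
  let ?\<eta> = "\<lambda>x. complex_of_real (1 / r) * \<psi> x"
  have "l1 ?\<eta> = ennreal (1 / r) * l1 \<psi>"
    using r by (subst l1_cmult) (auto intro: schwartz_measurable \<psi> simp: norm_divide)
  also have "\<dots> \<le> ennreal (1 / r) * ennreal r" using r by (intro mult_left_mono) auto
  also have "\<dots> = 1" using r by (simp add: ennreal_mult'[symmetric])
  finally have "l1 ?\<eta> \<le> 1" .
  then have "ennreal (norm (T ?\<eta>)) \<le> dnorm T"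
    unfolding dnorm_def by (intro SUP_upper CollectI conjI schwartz_cmult[OF \<psi>])
  then have "ennreal r * ennreal (norm (T ?\<eta>)) \<le> ennreal r * dnorm T" by (rule mult_left_mono) simp
  moreover have "norm (T ?\<eta>) = norm (T \<psi>) / r"
    using lin_cmult[OF T \<psi>, of "complex_of_real (1 / r)"] r by (simp add: norm_mult norm_divide)
  ultimately show ?thesis using r by (simp add: ennreal_mult'[symmetric])
qed

lemma dnorm_le_diff:
  assumes "\<And>\<psi>. schwartz \<psi> \<Longrightarrow> R \<psi> = T \<psi> - S \<psi>"
  shows "dnorm T \<le> dnorm S + dnorm R"
proof (rule dnorm_leI)
  fix \<psi> :: "'a \<Rightarrow> complex" assume \<psi>: "schwartz \<psi>" "l1 \<psi> \<le> 1"
  have "norm (T \<psi>) \<le> norm (S \<psi>) + norm (R \<psi>)"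
    using assms[OF \<psi>(1)] norm_triangle_ineq[of "S \<psi>" "R \<psi>"] by simp
  then have "ennreal (norm (T \<psi>)) \<le> ennreal (norm (S \<psi>)) + ennreal (norm (R \<psi>))"
    by (simp add: ennreal_plus[symmetric] ennreal_leI del: ennreal_plus)
  also have "\<dots> \<le> dnorm S + dnorm R"
    unfolding dnorm_def using \<psi> by (intro add_mono SUP_upper) auto
  finally show "ennreal (norm (T \<psi>)) \<le> dnorm S + dnorm R" .
qed

section \<open>Littlewood--Paley theory\<close>

lemma conv_lincomb:
  assumes k: "rapid k" and \<psi>: "schwartz \<psi>" "schwartz \<eta>"
  shows "conv k (\<lambda>x. a * \<psi> x + b * \<eta> x) = (\<lambda>x. a * conv k \<psi> x + b * conv k \<eta> x)"
proof
  fix x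
  obtain C D where CD: "\<And>x. norm (\<psi> x) \<le> C" "\<And>x. norm (\<eta> x) \<le> D"
    using rapid_bound[OF schwartz_rapid] \<psi> by metis
  have "integrable lborel (\<lambda>y. k y * \<psi> (x - y))" "integrable lborel (\<lambda>y. k y * \<eta> (x - y))"
    using conv_integrable[OF k] schwartz_measurable \<psi> CD by blast+
  then have "(LINT y|lborel. a * (k y * \<psi> (x - y)) + b * (k y * \<eta> (x - y))) = a * conv k \<psi> x + b * conv k \<eta> x"
    by (simp add: conv_def)
  then show "conv k (\<lambda>x. a * \<psi> x + b * \<eta> x) x = a * conv k \<psi> x + b * conv k \<eta> x"
    by (simp add: conv_def algebra_simps)
qed

lemma fmult_lincomb:
  "symb m \<Longrightarrow> schwartz \<psi> \<Longrightarrow> schwartz \<eta> \<Longrightarrow>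
     fmult m (\<lambda>x. a * \<psi> x + b * \<eta> x) = (\<lambda>x. a * fmult m \<psi> x + b * fmult m \<eta> x)"
  by (simp add: fmult_eq_conv schwartz_lincomb conv_lincomb rapid_kern)

lemma lin_multiplier: "lin T \<Longrightarrow> symb m \<Longrightarrow> lin (multiplier m T)"
  unfolding lin_def[of "multiplier m T"] multiplier_eq
  by (auto simp: fmult_lincomb lin_def schwartz_fmult)

lemma axis_Basis: "axis k 1 \<in> (Basis :: (real^'n::finite) set)"
  by (simp add: axis_in_Basis_iff)

lemma lin_dist_deriv: "lin T \<Longrightarrow> lin (dist_deriv k T)"
  unfolding lin_def[of "dist_deriv k T"]
  unfolding dist_deriv_def
proof (intro allI impI)
  fix \<psi> \<eta> :: "real^'a \<Rightarrow> complex" and a b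
  assume T: "lin T" and s: "schwartz \<psi>" "schwartz \<eta>"
  have "dderiv (axis k 1) (\<lambda>x. a * \<psi> x + b * \<eta> x) = (\<lambda>x. a * dderiv (axis k 1) \<psi> x + b * dderiv (axis k 1) \<eta> x)"
    using s by (intro ext dderiv_lincomb schwartz_smooth)
  then show "- T (dderiv (axis k 1) (\<lambda>x. a * \<psi> x + b * \<eta> x)) = a * - T (dderiv (axis k 1) \<psi>) + b * - T (dderiv (axis k 1) \<eta>)"
    using T s by (simp add: lin_def schwartz_dderiv axis_Basis)
qed

lemma kern_l1_bound:
  fixes m :: "real^'n::finite \<Rightarrow> real"
  assumes "symb m"
  obtains K where "K > 0" "l1 (kern m) \<le> ennreal K"
proof -
  have "l1 (kern m) < \<infinity>" by (intro rapid_l1 rapid_kern assms)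
  then obtain r where "r \<ge> 0" "l1 (kern m) = ennreal r" by (cases "l1 (kern m)") auto
  then show ?thesis using that[of "r + 1"] by (auto intro: ennreal_leI)
qed

text \<open>The symbol moved to the frequency scale \<open>2\<^sup>j\<close>.\<close>

definition dil :: "int \<Rightarrow> (real^'n::finite \<Rightarrow> real) \<Rightarrow> real^'n \<Rightarrow> real" where
  "dil j m \<xi> = m ((2 powr (- real_of_int j)) *\<^sub>R \<xi>)"

lemma symb_dil: "symb m \<Longrightarrow> symb (dil j m)"
  unfolding dil_def[abs_def] by (rule symb_dilate) auto

lemma l1_fmult_dil:
  fixes m :: "real^'n::finite \<Rightarrow> real"
  assumes m: "symb m" and K: "l1 (kern m) \<le> ennreal K" "K \<ge> 0" and \<psi>: "schwartz \<psi>" "l1 \<psi> \<le> ennreal r" "r \<ge> 0"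
  shows "l1 (fmult (\<lambda>\<xi>. c * dil j m \<xi>) \<psi>) \<le> ennreal (\<bar>c\<bar> * K * r)"
proof -
  have s: "symb (\<lambda>\<xi>. c * dil j m \<xi>)" using m by (intro symb_cmult symb_dil)
  have "l1 (kern (\<lambda>\<xi>. c * dil j m \<xi>)) = ennreal \<bar>c\<bar> * l1 (kern (dil j m))"
    unfolding kern_cmult by (subst l1_cmult) (auto intro!: rapid_measurable rapid_kern symb_dil m)
  also have "l1 (kern (dil j m)) = l1 (kern m)"
    unfolding dil_def[abs_def] by (rule l1_kern_dilate[OF m]) simp
  finally have "l1 (kern (\<lambda>\<xi>. c * dil j m \<xi>)) \<le> ennreal (\<bar>c\<bar> * K)"
    using K by (simp add: ennreal_mult' mult_left_mono)
  then have "l1 (fmult (\<lambda>\<xi>. c * dil j m \<xi>) \<psi>) \<le> ennreal (\<bar>c\<bar> * K) * ennreal r"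
    using \<psi>(2) by (intro order_trans[OF l1_fmult_le[OF s \<psi>(1)] mult_mono]) auto
  then show ?thesis using K \<psi> by (simp add: ennreal_mult'[symmetric])
qed

locale littlewood_paley =
  fixes chi :: "real^'n::finite \<Rightarrow> real"
  assumes cut: "cutoff chi"
begin

lemma chi_smooth: "smooth chi"
  using cut by (simp add: cutoff_def)

lemma chi_out: "norm \<xi> > 4/3 \<Longrightarrow> chi \<xi> = 0"
proof (rule ccontr)
  assume "norm \<xi> > 4/3" "chi \<xi> \<noteq> 0"
  then have "\<xi> \<in> closure {\<xi>. chi \<xi> \<noteq> 0}" using subsetD[OF closure_subset[of "{\<xi>. chi \<xi> \<noteq> 0}"]] by simp
  then show False using cut \<open>norm \<xi> > 4/3\<close> by (auto simp: cutoff_def)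
qed

lemma chi_in: "norm \<xi> < 3/4 \<Longrightarrow> chi \<xi> = 1"
  using cut by (auto simp: cutoff_def)

lemma chi_0: "chi 0 = 1"
  by (rule chi_in) simp

lemma chi_symb: "symb chi"
  unfolding symb_def using chi_smooth chi_out by blast

abbreviation phi where "phi \<equiv> LP_phi chi"

lemma phi_symb: "symb phi"
  unfolding LP_phi_def[abs_def] by (intro symb_diff chi_symb symb_dilate[of chi "inverse 2"]) auto

text \<open>Wide enough to equal 1 on the support of \<open>phi\<close>, so that any symbol may be multiplied by it on a dyadic
  block.\<close>

definition fat :: "real^'n \<Rightarrow> real" where
  "fat \<xi> = chi ((1/4) *\<^sub>R \<xi>) - chi (4 *\<^sub>R \<xi>)"

lemma fat_symb: "symb fat"
  unfolding fat_def[abs_def] by (intro symb_diff symb_dilate chi_symb) auto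

lemma phi_support: "phi \<xi> \<noteq> 0 \<Longrightarrow> 3/4 \<le> norm \<xi> \<and> norm \<xi> \<le> 8/3"
  using chi_out[of "\<xi> /\<^sub>R 2"] chi_out[of \<xi>] chi_in[of "\<xi> /\<^sub>R 2"] chi_in[of \<xi>]
  by (auto simp: LP_phi_def not_less[symmetric])

lemma phi_fat: "phi \<xi> * fat \<xi> = phi \<xi>"
proof (cases "phi \<xi> = 0")
  case False
  from phi_support[OF this] have "chi ((1/4) *\<^sub>R \<xi>) = 1" "chi (4 *\<^sub>R \<xi>) = 0"
    by (auto intro!: chi_in chi_out)
  then show ?thesis by (simp add: fat_def)
qed simp

lemma fat_support: "fat \<xi> \<noteq> 0 \<Longrightarrow> norm \<xi> \<ge> 3/16"
  using chi_in[of "(1/4) *\<^sub>R \<xi>"] chi_in[of "4 *\<^sub>R \<xi>"]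
  by (rule_tac ccontr) (auto simp: fat_def)

text \<open>A smooth positive function that coincides with the squared norm where \<open>fat\<close> is nonzero; its
  powers make homogeneous symbols smooth at the origin without changing them on the annulus.\<close>

definition sqnorm :: "real^'n \<Rightarrow> real" where
  "sqnorm \<xi> = \<xi> \<bullet> \<xi> + chi (16 *\<^sub>R \<xi>) * chi (16 *\<^sub>R \<xi>)"

lemma sqnorm_pos: "sqnorm \<xi> > 0"
  by (cases "\<xi> = 0") (auto simp: sqnorm_def chi_0 add_pos_nonneg)

lemma smooth_sqnorm: "smooth sqnorm"
proof -
  have "(\<lambda>\<xi>::real^'n. \<xi> \<bullet> \<xi>) = (\<lambda>\<xi>. \<Sum>b\<in>Basis. (\<xi> \<bullet> b) * (\<xi> \<bullet> b))"
    by (rule ext, rule euclidean_inner)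
  moreover have "smooth (\<lambda>\<xi>::real^'n. \<Sum>b\<in>Basis. (\<xi> \<bullet> b) * (\<xi> \<bullet> b))"
    by (intro smooth_sum smooth_mult smooth_inner_const)
  ultimately show ?thesis
    unfolding sqnorm_def[abs_def] by (intro smooth_add smooth_mult smooth_dilate chi_smooth) simp
qed

lemma sqnorm_eq: "fat \<xi> \<noteq> 0 \<Longrightarrow> sqnorm \<xi> = (norm \<xi>)\<^sup>2"
  using fat_support[of \<xi>] chi_out[of "16 *\<^sub>R \<xi>"] by (simp add: sqnorm_def power2_norm_eq_inner)

lemma powr_fat: "fat \<xi> * sqnorm \<xi> powr (s / 2) = fat \<xi> * norm \<xi> powr s"
proof (cases "fat \<xi> = 0")
  case False
  have "norm \<xi> > 0" using fat_support[OF False] by linarith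
  then show ?thesis by (simp add: sqnorm_eq[OF False] powr_powr flip: powr_numeral)
qed simp

text \<open>The symbol \<open>|\<xi>|\<^sup>s\<close> on the unit annulus, smooth also for \<open>s < 0\<close> and for \<open>s\<close> that are not even integers.\<close>

definition powsymb :: "real \<Rightarrow> real^'n \<Rightarrow> real" where
  "powsymb s \<xi> = sqnorm \<xi> powr (s / 2) * fat \<xi>"

lemma symb_powsymb: "symb (powsymb s)"
  unfolding powsymb_def[abs_def]
  by (intro symb_times smooth_powr smooth_sqnorm sqnorm_pos fat_symb)

lemma dil_powsymb:
  "dil j phi \<xi> * (2 powr (real_of_int j * s) * dil j (powsymb s) \<xi>) = norm \<xi> powr s * dil j phi \<xi>"
proof -
  define z where "z = (2 powr (- real_of_int j)) *\<^sub>R \<xi>"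
  have "powsymb s z = fat z * norm z powr s" using powr_fat[of z s] by (simp add: powsymb_def mult.commute)
  then have "phi z * powsymb s z = phi z * norm z powr s" using phi_fat[of z] by (metis mult.assoc)
  moreover have "2 powr (real_of_int j * s) * norm z powr s = norm \<xi> powr s"
    by (simp add: z_def powr_mult powr_powr mult.assoc[symmetric] powr_add[symmetric])
  ultimately show ?thesis unfolding dil_def z_def[symmetric] by (metis mult.assoc mult.commute)
qed

lemma LP_block_eq: "LP_block chi j T \<psi> = T (fmult (dil j phi) \<psi>)"
  by (simp add: LP_block_def multiplier_eq dil_def[abs_def])

lemma LP_low_eq: "LP_low chi j T \<psi> = T (fmult (dil j chi) \<psi>)"
  by (simp add: LP_low_def multiplier_eq dil_def[abs_def])

lemma lin_LP_block: "lin T \<Longrightarrow> lin (LP_block chi j T)"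
  using lin_multiplier[OF _ symb_dil[OF phi_symb]] by (simp add: LP_block_def dil_def[abs_def])

lemma symb_dil_phi: "symb (dil j phi)" and symb_dil_chi: "symb (dil j chi)"
  by (intro symb_dil phi_symb chi_symb)+

lemma LP_block_fmult:
  assumes "symb m" "schwartz \<psi>"
  shows "T (fmult (\<lambda>\<xi>. dil j phi \<xi> * m \<xi>) \<psi>) = LP_block chi j T (fmult m \<psi>)"
  using assms by (simp add: LP_block_eq fmult_fmult symb_dil_phi)

lemma dderiv_fmult:
  "symb m \<Longrightarrow> schwartz \<psi> \<Longrightarrow> dderiv (axis k 1) (fmult m \<psi>) = (\<lambda>x. - \<i> * fmult (\<lambda>\<xi>. (\<xi> $ k) * m \<xi>) \<psi> x)"
  using fmult_coord(2)[OF _ _ axis_Basis, of m \<psi> k] by (simp add: inner_axis fun_eq_iff)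

lemma symb_coord: "symb m \<Longrightarrow> symb (\<lambda>\<xi>. (\<xi> $ k) * m \<xi>)"
  using symb_times[OF smooth_inner_const[of "axis k 1"], of m] by (simp add: inner_axis)

text \<open>On a dyadic block a derivative costs a factor \<open>2\<^sup>j\<close>.\<close>

lemma dnorm_block_deriv:
  obtains C where "C > 0"
    "\<And>T j. lin T \<Longrightarrow> dnorm (LP_block chi j (dist_deriv k T)) \<le> ennreal (C * 2 powr real_of_int j) * dnorm (LP_block chi j T)"
proof -
  define m where "m = (\<lambda>\<xi>::real^'n. (\<xi> $ k) * fat \<xi>)"
  have m: "symb m" unfolding m_def by (intro symb_coord fat_symb)
  obtain K where K: "K > 0" "l1 (kern m) \<le> ennreal K" using kern_l1_bound[OF m] by blast
  have "dnorm (LP_block chi j (dist_deriv k T)) \<le> ennreal (K * 2 powr real_of_int j) * dnorm (LP_block chi j T)"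
    if T: "lin T" for T j
  proof (rule dnorm_leI)
    fix \<psi> :: "real^'n \<Rightarrow> complex" assume \<psi>: "schwartz \<psi>" "l1 \<psi> \<le> 1"
    let ?n = "\<lambda>\<xi>. 2 powr real_of_int j * dil j m \<xi>"
    have n: "symb ?n" by (intro symb_cmult symb_dil m)
    have pn: "(\<xi> $ k) * dil j phi \<xi> = dil j phi \<xi> * ?n \<xi>" for \<xi>
      unfolding dil_def m_def using phi_fat[of "(2 powr (- real_of_int j)) *\<^sub>R \<xi>"]
      by (simp add: powr_minus field_simps)
    have "LP_block chi j (dist_deriv k T) \<psi> = - T (\<lambda>x. - \<i> * fmult (\<lambda>\<xi>. (\<xi> $ k) * dil j phi \<xi>) \<psi> x)"
      by (simp add: LP_block_eq dist_deriv_def dderiv_fmult symb_dil_phi \<psi>)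
    also have "\<dots> = \<i> * T (fmult (\<lambda>\<xi>. (\<xi> $ k) * dil j phi \<xi>) \<psi>)"
      by (subst lin_cmult[OF T]) (auto intro!: schwartz_fmult symb_coord symb_dil_phi \<psi>)
    also have "\<dots> = \<i> * LP_block chi j T (fmult ?n \<psi>)"
      unfolding pn using LP_block_fmult[OF n \<psi>(1)] by simp
    finally have "ennreal (norm (LP_block chi j (dist_deriv k T) \<psi>)) = ennreal (norm (LP_block chi j T (fmult ?n \<psi>)))"
      by (simp add: norm_mult)
    also have "\<dots> \<le> ennreal (K * 2 powr real_of_int j) * dnorm (LP_block chi j T)"
    proof (rule dnorm_bound[OF lin_LP_block[OF T] schwartz_fmult[OF n \<psi>(1)]])
      show "l1 (fmult ?n \<psi>) \<le> ennreal (K * 2 powr real_of_int j)"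
        using l1_fmult_dil[OF m K(2) _ \<psi>(1), of 1 "2 powr real_of_int j" j] K(1) \<psi>(2) by (simp add: mult.commute)
    qed (use K in simp)
    finally show "ennreal (norm (LP_block chi j (dist_deriv k T) \<psi>)) \<le> ennreal (K * 2 powr real_of_int j) * dnorm (LP_block chi j T)" .
  qed
  then show ?thesis using that K by blast
qed

text \<open>Conversely, since \<open>1 = \<Sum>\<^sub>k \<xi>\<^sub>k (\<xi>\<^sub>k / |\<xi>|\<^sup>2)\<close> on the annulus, a block is controlled by its first
  derivatives.\<close>

lemma dnorm_block_reverse:
  obtains C where "C > 0"
    "\<And>T j. lin T \<Longrightarrow> dnorm (LP_block chi j T) \<le>
        ennreal (C * 2 powr (- real_of_int j)) * (\<Sum>k\<in>UNIV. dnorm (LP_block chi j (dist_deriv k T)))"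
proof -
  define m where "m = (\<lambda>k (\<xi>::real^'n). (\<xi> $ k) * powsymb (-2) \<xi>)"
  have m: "symb (m k)" for k unfolding m_def by (intro symb_coord symb_powsymb)
  have "\<exists>K>0. l1 (kern (m k)) \<le> ennreal K" for k using kern_l1_bound[OF m] by blast
  then obtain Kk where Kk: "\<And>k. Kk k > 0" "\<And>k. l1 (kern (m k)) \<le> ennreal (Kk k)" by metis
  define K where "K = (\<Sum>k\<in>UNIV. Kk k)"
  have K: "l1 (kern (m k)) \<le> ennreal K" "K > 0" for k
  proof -
    have "Kk k \<le> K" unfolding K_def using Kk(1) by (intro member_le_sum) (auto intro: less_imp_le)
    then show "l1 (kern (m k)) \<le> ennreal K" using Kk(2)[of k] by (meson ennreal_leI order_trans)
    show "K > 0" using Kk(1)[of k] \<open>Kk k \<le> K\<close> by linarith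
  qed
  have "dnorm (LP_block chi j T) \<le>
        ennreal (K * 2 powr (- real_of_int j)) * (\<Sum>k\<in>UNIV. dnorm (LP_block chi j (dist_deriv k T)))"
    if T: "lin T" for T j
  proof (rule dnorm_leI)
    fix \<psi> :: "real^'n \<Rightarrow> complex" assume \<psi>: "schwartz \<psi>" "l1 \<psi> \<le> 1"
    let ?n = "\<lambda>k \<xi>. 2 powr (- real_of_int j) * dil j (m k) \<xi>"
    have n: "symb (?n k)" for k by (intro symb_cmult symb_dil m)
    have pn: "dil j phi \<xi> = (\<Sum>k\<in>UNIV. (\<xi> $ k) * (dil j phi \<xi> * ?n k \<xi>))" for \<xi>
    proof -
      define z where "z = (2 powr (- real_of_int j)) *\<^sub>R \<xi>"
      have z: "2 powr (- real_of_int j) * (\<xi> $ k) = z $ k" for k by (simp add: z_def)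
      have "(\<Sum>k\<in>UNIV. (\<xi> $ k) * (dil j phi \<xi> * ?n k \<xi>)) = phi z * (\<Sum>k\<in>UNIV. (z $ k) * m k z)"
        unfolding dil_def z_def[symmetric] z[symmetric] by (simp add: sum_distrib_left mult_ac)
      also have "(\<Sum>k\<in>UNIV. (z $ k) * m k z) = (norm z)\<^sup>2 * powsymb (-2) z"
        unfolding m_def power2_norm_eq_inner inner_vec_def by (simp add: sum_distrib_left sum_distrib_right mult_ac)
      also have "phi z * ((norm z)\<^sup>2 * powsymb (-2) z) = phi z"
      proof (cases "phi z = 0")
        case False
        then have "norm z > 0" using phi_support[of z] by linarith
        then have "(norm z)\<^sup>2 * (fat z * norm z powr (-2)) = fat z" by (simp add: powr_minus_divide)
        then have "(norm z)\<^sup>2 * powsymb (-2) z = fat z"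
          by (simp only: powsymb_def mult.commute[of _ "fat z"] powr_fat)
        then show ?thesis using phi_fat by simp
      qed simp
      finally show ?thesis by (simp add: dil_def z_def)
    qed
    have s: "symb (\<lambda>\<xi>. dil j phi \<xi> * ?n k \<xi>)" for k
      by (intro symb_times symb_smooth[OF symb_dil_phi] n)
    have each: "T (fmult (\<lambda>\<xi>. (\<xi> $ k) * (dil j phi \<xi> * ?n k \<xi>)) \<psi>) = - \<i> * LP_block chi j (dist_deriv k T) (fmult (?n k) \<psi>)" for k
    proof -
      have "LP_block chi j (dist_deriv k T) (fmult (?n k) \<psi>) = dist_deriv k T (fmult (\<lambda>\<xi>. dil j phi \<xi> * ?n k \<xi>) \<psi>)"
        by (rule LP_block_fmult[OF n \<psi>(1), symmetric])
      also have "\<dots> = - T (\<lambda>x. - \<i> * fmult (\<lambda>\<xi>. (\<xi> $ k) * (dil j phi \<xi> * ?n k \<xi>)) \<psi> x)"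
        by (simp only: dist_deriv_def dderiv_fmult[OF s \<psi>(1)])
      also have "\<dots> = \<i> * T (fmult (\<lambda>\<xi>. (\<xi> $ k) * (dil j phi \<xi> * ?n k \<xi>)) \<psi>)"
        by (subst lin_cmult[OF T]) (auto intro!: schwartz_fmult symb_coord s \<psi>)
      finally show ?thesis by simp
    qed
    have "LP_block chi j T \<psi> = T (\<lambda>x. \<Sum>k\<in>UNIV. fmult (\<lambda>\<xi>. (\<xi> $ k) * (dil j phi \<xi> * ?n k \<xi>)) \<psi> x)"
      unfolding LP_block_eq by (subst pn[abs_def], subst fmult_sum) (auto intro!: symb_coord s \<psi>)
    also have "\<dots> = (\<Sum>k\<in>UNIV. - \<i> * LP_block chi j (dist_deriv k T) (fmult (?n k) \<psi>))"
      by (subst lin_sum[OF T]) (auto intro!: schwartz_fmult symb_coord s \<psi> simp: each)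
    finally have "norm (LP_block chi j T \<psi>) \<le> (\<Sum>k\<in>UNIV. norm (LP_block chi j (dist_deriv k T) (fmult (?n k) \<psi>)))"
      by (auto intro!: order_trans[OF norm_sum] simp: norm_mult)
    then have "ennreal (norm (LP_block chi j T \<psi>)) \<le> (\<Sum>k\<in>UNIV. ennreal (norm (LP_block chi j (dist_deriv k T) (fmult (?n k) \<psi>))))"
      by (simp add: ennreal_leI)
    also have "\<dots> \<le> (\<Sum>k\<in>UNIV. ennreal (K * 2 powr (- real_of_int j)) * dnorm (LP_block chi j (dist_deriv k T)))"
    proof (intro sum_mono dnorm_bound lin_LP_block lin_dist_deriv T schwartz_fmult n \<psi>(1))
      show "l1 (fmult (?n k) \<psi>) \<le> ennreal (K * 2 powr (- real_of_int j))" for k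
        using l1_fmult_dil[OF m[of k] K(1)[of k] _ \<psi>(1), of 1 "2 powr (- real_of_int j)" j] K(2) \<psi>(2) by (simp add: mult.commute)
    qed (use K(2) in simp)
    finally show "ennreal (norm (LP_block chi j T \<psi>)) \<le> ennreal (K * 2 powr (- real_of_int j)) * (\<Sum>k\<in>UNIV. dnorm (LP_block chi j (dist_deriv k T)))"
      by (simp add: sum_distrib_left)
  qed
  then show ?thesis using that K by blast
qed

end

lemma Lp_norm_le_imp:
  assumes d: "d > 0" and r: "r > 0" and le: "Lp_norm (of_nat d) f \<le> ennreal r"
  shows "(\<integral>\<^sup>+x. ennreal (norm (f x) powr real d) \<partial>lborel) \<le> ennreal (r ^ d)"
proof -
  define I where "I = (\<integral>\<^sup>+x. ennreal (norm (f x) powr real d) \<partial>lborel)"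
  have "Lp_norm (of_nat d) f = (if I = \<infinity> then \<infinity> else ennreal (enn2real I powr (1 / real d)))"
    unfolding Lp_norm_def I_def Let_def by (simp add: of_nat_less_top less_imp_neq)
  then have I: "I \<noteq> \<infinity>" "enn2real I powr (1 / real d) \<le> r"
    using le r by (auto split: if_splits simp: top_unique)
  have "(enn2real I powr (1 / real d)) powr real d \<le> r powr real d"
    using I(2) by (intro powr_mono2) auto
  then have "enn2real I \<le> r ^ d"
    using d r by (cases "enn2real I = 0") (auto simp: powr_powr powr_realpow)
  then have "ennreal (enn2real I) \<le> ennreal (r ^ d)" by (rule ennreal_leI)
  then show ?thesis using I(1) by (simp add: I_def less_top)
qed

text \<open>Splitting at the height \<open>c\<close> replaces Hoelder's inequality: below \<open>c\<close> the function is bounded,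
  above it \<open>t \<le> t\<^sup>d c\<^sup>1\<^sup>-\<^sup>d\<close>.\<close>

lemma height_split:
  assumes "t \<ge> 0" "c > 0" "d \<ge> (1::nat)"
  shows "t \<le> c + t powr real d * c powr (1 - real d)"
proof (cases "t \<le> c")
  case False
  then have t: "t > c" "t > 0" using assms by auto
  have "1 \<le> (t / c) powr (real d - 1)" using t assms by (intro ge_one_powr_ge_zero) auto
  then have "t * 1 \<le> t * (t / c) powr (real d - 1)" using t by (intro mult_left_mono) auto
  also have "\<dots> = t powr real d * c powr (1 - real d)"
    using t assms by (simp add: powr_divide powr_diff field_simps)
  finally show ?thesis using assms by simp
qed (simp add: add_increasing2)

lemma nn_integral_Lp_kernel:
  fixes f k :: "'a::euclidean_space \<Rightarrow> complex"
  assumes [measurable]: "f \<in> borel_measurable borel" "k \<in> borel_measurable borel"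
    and d: "d \<ge> (1::nat)" and c: "c > 0"
    and F: "(\<integral>\<^sup>+x. ennreal (norm (f x) powr real d) \<partial>lborel) \<le> ennreal F" "F \<ge> 0"
    and K1: "l1 k \<le> ennreal K1" "K1 \<ge> 0" and K2: "\<And>x. norm (k x) \<le> K2"
  shows "(\<integral>\<^sup>+x. ennreal (norm (f x)) * ennreal (norm (k (x - y))) \<partial>lborel) \<le> ennreal (c * K1 + c powr (1 - real d) * K2 * F)"
proof -
  have K20: "K2 \<ge> 0" using order_trans[OF norm_ge_zero K2] .
  have "(\<integral>\<^sup>+x. ennreal (norm (f x)) * ennreal (norm (k (x - y))) \<partial>lborel)
    \<le> (\<integral>\<^sup>+x. ennreal c * ennreal (norm (k (x - y))) + ennreal (c powr (1 - real d) * K2) * ennreal (norm (f x) powr real d) \<partial>lborel)"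
  proof (intro nn_integral_mono)
    fix x
    have "norm (f x) * norm (k (x - y)) \<le> (c + norm (f x) powr real d * c powr (1 - real d)) * norm (k (x - y))"
      using height_split[OF norm_ge_zero c d] by (intro mult_right_mono) auto
    also have "\<dots> = c * norm (k (x - y)) + (norm (f x) powr real d * c powr (1 - real d)) * norm (k (x - y))"
      by (rule distrib_right)
    also have "\<dots> \<le> c * norm (k (x - y)) + (norm (f x) powr real d * c powr (1 - real d)) * K2"
      using K2 by (intro add_left_mono mult_left_mono) auto
    finally have "ennreal (norm (f x) * norm (k (x - y))) \<le> ennreal (c * norm (k (x - y)) + (c powr (1 - real d) * K2) * norm (f x) powr real d)"
      by (intro ennreal_leI) (simp add: mult_ac)
    also have "\<dots> = ennreal c * ennreal (norm (k (x - y))) + ennreal (c powr (1 - real d) * K2) * ennreal (norm (f x) powr real d)"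
      using c K20 by (simp add: ennreal_mult')
    finally show "ennreal (norm (f x)) * ennreal (norm (k (x - y))) \<le> ennreal c * ennreal (norm (k (x - y))) + ennreal (c powr (1 - real d) * K2) * ennreal (norm (f x) powr real d)"
      by (simp add: ennreal_mult')
  qed
  also have "\<dots> = ennreal c * (\<integral>\<^sup>+x. ennreal (norm (k (x - y))) \<partial>lborel) + ennreal (c powr (1 - real d) * K2) * (\<integral>\<^sup>+x. ennreal (norm (f x) powr real d) \<partial>lborel)"
    by (subst nn_integral_add) (auto simp: nn_integral_cmult)
  also have "(\<integral>\<^sup>+x. ennreal (norm (k (x - y))) \<partial>lborel) = l1 k"
    unfolding l1_def by (rule nn_integral_translate(2)) measurable
  also have "ennreal c * l1 k + ennreal (c powr (1 - real d) * K2) * (\<integral>\<^sup>+x. ennreal (norm (f x) powr real d) \<partial>lborel)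
    \<le> ennreal c * ennreal K1 + ennreal (c powr (1 - real d) * K2) * ennreal F"
    by (intro add_mono mult_left_mono K1 F) auto
  also have "\<dots> = ennreal (c * K1 + c powr (1 - real d) * K2 * F)"
    using c K1 K20 F by (simp add: ennreal_mult'[symmetric] ennreal_plus[symmetric] del: ennreal_plus)
  finally show ?thesis .
qed

text \<open>Hoelder's inequality for \<open>L\<^sup>\<infinity>\<close> and \<open>L\<^sup>1\<close>.\<close>

lemma dnorm_le_dist_Linf:
  fixes S :: "'a::euclidean_space functional"
  shows "dnorm S \<le> dist_Lp_norm \<infinity> S"
  unfolding dist_Lp_norm_def
proof (rule INF_greatest, rule dnorm_leI)
  fix f \<psi> :: "'a \<Rightarrow> complex" assume f: "f \<in> {f. represents f S}" and \<psi>: "schwartz \<psi>" "l1 \<psi> \<le> 1"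
  define e where "e = esssup lborel (\<lambda>x. ennreal (norm (f x)))"
  have [measurable]: "\<psi> \<in> borel_measurable borel" using \<psi> by (intro schwartz_measurable)
  have int: "integrable lborel (\<lambda>x. f x * \<psi> x)" and S: "S \<psi> = (LINT x|lborel. f x * \<psi> x)"
    using f \<psi> by (auto simp: represents_def pairable_def pairing_def)
  have "ennreal (norm (S \<psi>)) \<le> (\<integral>\<^sup>+x. ennreal (norm (f x * \<psi> x)) \<partial>lborel)"
    unfolding S by (rule integral_norm_bound_ennreal[OF int])
  also have "\<dots> \<le> (\<integral>\<^sup>+x. e * ennreal (norm (\<psi> x)) \<partial>lborel)"
  proof (intro nn_integral_mono_AE)
    have "AE x in lborel. ennreal (norm (f x)) \<le> e" unfolding e_def by (rule esssup_AE)
    then show "AE x in lborel. ennreal (norm (f x * \<psi> x)) \<le> e * ennreal (norm (\<psi> x))"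
      by eventually_elim (simp add: norm_mult ennreal_mult' mult_right_mono)
  qed
  also have "\<dots> = e * l1 \<psi>" unfolding l1_def by (rule nn_integral_cmult) measurable
  also have "\<dots> \<le> e * 1" using \<psi> by (intro mult_left_mono) auto
  finally show "ennreal (norm (S \<psi>)) \<le> Lp_norm \<infinity> f" by (simp add: Lp_norm_def e_def)
qed

lemma sum_int_Suc:
  "(\<Sum>j\<in>{- int (Suc n)..int (Suc n)}. f j) = (\<Sum>j\<in>{- int n..int n}. f j) + f (int (Suc n)) + (f (- int (Suc n)) :: 'a::comm_monoid_add)"
proof -
  have "{- int (Suc n)..int (Suc n)} = insert (- int (Suc n)) (insert (int (Suc n)) {- int n..int n})" by auto
  then show ?thesis by (simp add: ac_simps)
qed

context littlewood_paley
begin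

text \<open>Multiplying by dilated cutoffs, which are Schwartz functions, gives integrable functions that converge
  pointwise to \<open>f\<close>.\<close>

lemma pairable_measurable:
  fixes f :: "real^'n \<Rightarrow> complex"
  assumes f: "pairable f"
  shows "f \<in> borel_measurable borel"
proof (rule borel_measurable_LIMSEQ_metric)
  show "(\<lambda>x. f x * complex_of_real (chi ((1 / real (Suc n)) *\<^sub>R x))) \<in> borel_measurable borel" for n
  proof -
    have "schwartz (\<lambda>x. complex_of_real (chi ((1 / real (Suc n)) *\<^sub>R x)))"
      by (intro symb_schwartz symb_dilate chi_symb) simp
    then have "integrable lborel (\<lambda>x. f x * complex_of_real (chi ((1 / real (Suc n)) *\<^sub>R x)))"
      using f by (auto simp: pairable_def)
    then show ?thesis by auto
  qed
  fix x :: "real^'n"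
  obtain N :: nat where N: "norm x < real N * (3/4)" using reals_Archimedean2[of "norm x / (3/4)"] by (auto simp: field_simps)
  have "\<forall>\<^sub>F n in sequentially. f x * complex_of_real (chi ((1 / real (Suc n)) *\<^sub>R x)) = f x"
    using eventually_ge_at_top[of N]
  proof eventually_elim
    fix n assume "N \<le> n"
    then have "real N * (3/4) \<le> real (Suc n) * (3/4)" by simp
    then have "norm x < real (Suc n) * (3/4)" using N by linarith
    then have "norm ((1 / real (Suc n)) *\<^sub>R x) < 3/4" by (simp add: field_simps)
    then show "f x * complex_of_real (chi ((1 / real (Suc n)) *\<^sub>R x)) = f x" using chi_in by simp
  qed
  then show "(\<lambda>n. f x * complex_of_real (chi ((1 / real (Suc n)) *\<^sub>R x))) \<longlonglongrightarrow> f x"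
    by (rule tendsto_eventually)
qed

text \<open>Bernstein's inequality: a block of frequency \<open>2\<^sup>j\<close> is reproduced by a kernel whose \<open>L\<^sup>1\<close> norm
  does not depend on \<open>j\<close> and whose maximum is of size \<open>2\<^sup>j\<^sup>d\<close>, so passing from \<open>L\<^sup>d\<close> to \<open>L\<^sup>\<infinity>\<close> costs \<open>2\<^sup>j\<close>.\<close>

lemma bernstein:
  obtains C where "C > 0"
    "\<And>T j. lin T \<Longrightarrow> dnorm (LP_block chi j T) \<le> ennreal (C * 2 powr real_of_int j) * dist_Lp_norm (of_nat CARD('n)) (LP_block chi j T)"
proof -
  let ?d = "CARD('n)"
  obtain K1 where K1: "K1 > 0" "l1 (kern fat) \<le> ennreal K1" using kern_l1_bound[OF fat_symb] by blast
  obtain K2 where K2: "K2 \<ge> 0" "\<And>x. norm (kern fat x) \<le> K2" using rapid_bound[OF rapid_kern[OF fat_symb]] by blast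
  define C where "C = K1 + K2"
  have C: "C > 0" using K1 K2 by (simp add: C_def)
  have main: "dnorm (LP_block chi j T) \<le> ennreal (C * 2 powr real_of_int j * r)"
    if T: "lin T" and f: "represents f (LP_block chi j T)" and r: "r > 0" "Lp_norm (of_nat ?d) f \<le> ennreal r" for T j f r
  proof (rule dnorm_leI)
    fix \<psi> :: "real^'n \<Rightarrow> complex" assume \<psi>: "schwartz \<psi>" "l1 \<psi> \<le> 1"
    define k where "k = kern (dil j fat)"
    define q where "q = 2 powr real_of_int j"
    have q: "q > 0" by (simp add: q_def)
    have fs: "symb (dil j fat)" by (intro symb_dil fat_symb)
    have [measurable]: "f \<in> borel_measurable borel" using f pairable_measurable by (simp add: represents_def)
    have [measurable]: "k \<in> borel_measurable borel" unfolding k_def using fs by (intro rapid_measurable rapid_kern)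
    have [measurable]: "\<psi> \<in> borel_measurable borel" using \<psi> by (intro schwartz_measurable)
    have k1: "l1 k \<le> ennreal K1"
      unfolding k_def dil_def[abs_def] using l1_kern_dilate[OF fat_symb] K1 by simp
    have k2: "norm (k x) \<le> q ^ ?d * K2" for x
    proof -
      have "1 / 2 powr (- real_of_int j) = q" by (simp add: q_def powr_minus_divide)
      then show ?thesis
        unfolding k_def dil_def[abs_def]
        using norm_kern_dilate_le[OF fat_symb _ K2(2), of "2 powr (- real_of_int j)" x] by simp
    qed
    have F: "(\<integral>\<^sup>+x. ennreal (norm (f x) powr real ?d) \<partial>lborel) \<le> ennreal (r ^ ?d)"
      by (rule Lp_norm_le_imp[OF _ r]) simp
    \<comment> \<open>The height \<open>q * r\<close> makes both terms of the splitting multiples of \<open>q * r\<close>.\<close>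
    have inner: "(\<integral>\<^sup>+x. ennreal (norm (f x)) * ennreal (norm (k (x - y))) \<partial>lborel) \<le> ennreal (C * q * r)" for y
    proof -
      have "(\<integral>\<^sup>+x. ennreal (norm (f x)) * ennreal (norm (k (x - y))) \<partial>lborel)
        \<le> ennreal ((q * r) * K1 + (q * r) powr (1 - real ?d) * (q ^ ?d * K2) * r ^ ?d)"
        using r q K1 by (intro nn_integral_Lp_kernel F k1 k2) auto
      also have "(q * r) powr (1 - real ?d) * (q ^ ?d * K2) * r ^ ?d = q * r * K2"
      proof -
        have "(q * r) powr (1 - real ?d) * (q * r) ^ ?d = q * r"
          using q r by (simp add: powr_diff powr_realpow)
        then show ?thesis by (simp add: power_mult_distrib mult_ac)
      qed
      finally show ?thesis by (simp add: C_def algebra_simps)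
    qed
    have "LP_block chi j T \<psi> = T (fmult (\<lambda>\<xi>. dil j phi \<xi> * dil j fat \<xi>) \<psi>)"
    proof -
      have "(\<lambda>\<xi>. dil j phi \<xi> * dil j fat \<xi>) = dil j phi" by (simp add: dil_def phi_fat fun_eq_iff)
      then show ?thesis by (simp only: LP_block_eq)
    qed
    also have "\<dots> = LP_block chi j T (fmult (dil j fat) \<psi>)" by (rule LP_block_fmult[OF fs \<psi>(1)])
    also have "\<dots> = (LINT x|lborel. f x * conv k \<psi> x)"
      using f schwartz_fmult[OF fs \<psi>(1)] by (simp add: represents_def pairing_def fmult_eq_conv[OF fs \<psi>(1)] k_def)
    finally have e: "LP_block chi j T \<psi> = (LINT x|lborel. f x * conv k \<psi> x)" .
    have int: "integrable lborel (\<lambda>x. f x * conv k \<psi> x)"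
      using f schwartz_fmult[OF fs \<psi>(1)] by (simp add: represents_def pairable_def fmult_eq_conv[OF fs \<psi>(1)] k_def)
    have "ennreal (norm (LP_block chi j T \<psi>)) \<le> (\<integral>\<^sup>+x. ennreal (norm (f x * conv k \<psi> x)) \<partial>lborel)"
      unfolding e by (rule integral_norm_bound_ennreal[OF int])
    also have "\<dots> \<le> (\<integral>\<^sup>+x. (\<integral>\<^sup>+y. ennreal (norm (f x)) * ennreal (norm (\<psi> y)) * ennreal (norm (k (x - y))) \<partial>lborel) \<partial>lborel)"
    proof (intro nn_integral_mono)
      fix x
      have "ennreal (norm (conv k \<psi> x)) \<le> (\<integral>\<^sup>+y. ennreal (norm (k y * \<psi> (x - y))) \<partial>lborel)"
        unfolding conv_def by (cases "integrable lborel (\<lambda>y. k y * \<psi> (x - y))")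
          (auto simp: integral_norm_bound_ennreal not_integrable_integral_eq)
      also have "\<dots> = (\<integral>\<^sup>+y. ennreal (norm (k (x - y) * \<psi> (x - (x - y)))) \<partial>lborel)"
        by (rule nn_integral_translate(3)[symmetric]) measurable
      finally have "ennreal (norm (f x)) * ennreal (norm (conv k \<psi> x)) \<le> ennreal (norm (f x)) * (\<integral>\<^sup>+y. ennreal (norm (k (x - y) * \<psi> (x - (x - y)))) \<partial>lborel)"
        by (rule mult_left_mono) simp
      also have "\<dots> = (\<integral>\<^sup>+y. ennreal (norm (f x)) * ennreal (norm (k (x - y) * \<psi> (x - (x - y)))) \<partial>lborel)"
        by (rule nn_integral_cmult[symmetric]) measurable
      finally show "ennreal (norm (f x * conv k \<psi> x)) \<le> (\<integral>\<^sup>+y. ennreal (norm (f x)) * ennreal (norm (\<psi> y)) * ennreal (norm (k (x - y))) \<partial>lborel)"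
        by (simp add: norm_mult ennreal_mult' mult_ac)
    qed
    also have "\<dots> = (\<integral>\<^sup>+y. ennreal (norm (\<psi> y)) * (\<integral>\<^sup>+x. ennreal (norm (f x)) * ennreal (norm (k (x - y))) \<partial>lborel) \<partial>lborel)"
      by (rule nn_integral_conv_kernel) measurable
    also have "\<dots> \<le> (\<integral>\<^sup>+y. ennreal (norm (\<psi> y)) * ennreal (C * q * r) \<partial>lborel)"
      by (intro nn_integral_mono mult_left_mono inner) auto
    also have "\<dots> = l1 \<psi> * ennreal (C * q * r)" unfolding l1_def by (rule nn_integral_multc) measurable
    also have "\<dots> \<le> 1 * ennreal (C * q * r)" using \<psi> by (intro mult_right_mono) auto
    finally show "ennreal (norm (LP_block chi j T \<psi>)) \<le> ennreal (C * 2 powr real_of_int j * r)" by (simp add: q_def)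
  qed
  have "dnorm (LP_block chi j T) \<le> ennreal (C * 2 powr real_of_int j) * dist_Lp_norm (of_nat ?d) (LP_block chi j T)"
    if T: "lin T" for T j
  proof -
    define a where "a = C * 2 powr real_of_int j"
    have a: "a > 0" using C by (simp add: a_def)
    have "ennreal (1 / a) * dnorm (LP_block chi j T) \<le> dist_Lp_norm (of_nat ?d) (LP_block chi j T)"
      unfolding dist_Lp_norm_def
    proof (rule INF_greatest)
      fix f assume f: "f \<in> {f. represents f (LP_block chi j T)}"
      show "ennreal (1 / a) * dnorm (LP_block chi j T) \<le> Lp_norm (of_nat ?d) f"
      proof (rule ennreal_le_epsilon)
        fix e :: real assume top: "Lp_norm (of_nat ?d) f < top" and e: "0 < e"
        then obtain L where L: "Lp_norm (of_nat ?d) f = ennreal L" "L \<ge> 0" by (cases "Lp_norm (of_nat ?d) f") auto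
        have "dnorm (LP_block chi j T) \<le> ennreal (a * (L + e))"
          using main[OF T _ _, of f j "L + e"] f L e by (auto simp: a_def intro: ennreal_leI)
        then have "ennreal (1 / a) * dnorm (LP_block chi j T) \<le> ennreal (1 / a) * ennreal (a * (L + e))"
          by (rule mult_left_mono) simp
        also have "\<dots> = ennreal (L + e)" using a L e by (simp add: ennreal_mult'[symmetric])
        finally show "ennreal (1 / a) * dnorm (LP_block chi j T) \<le> Lp_norm (of_nat ?d) f + ennreal e"
          using L e by simp
      qed
    qed
    then have "ennreal a * (ennreal (1 / a) * dnorm (LP_block chi j T)) \<le> ennreal a * dist_Lp_norm (of_nat ?d) (LP_block chi j T)"
      by (rule mult_left_mono) simp
    moreover have "ennreal a * (ennreal (1 / a) * dnorm (LP_block chi j T)) = dnorm (LP_block chi j T)"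
      using a by (simp add: mult.assoc[symmetric] ennreal_mult'[symmetric])
    ultimately show ?thesis by (simp add: a_def)
  qed
  then show ?thesis using that C by blast
qed

subsection \<open>Reconstruction from dyadic blocks\<close>

text \<open>Since \<open>phi\<close> is the difference of two consecutive dilates of \<open>chi\<close>.\<close>

lemma dil_phi_telescope: "(\<Sum>j\<in>{- int n..int n}. dil j phi \<xi>) = dil (int n + 1) chi \<xi> - dil (- int n) chi \<xi>"
proof -
  have d: "dil j phi \<xi> = dil (j + 1) chi \<xi> - dil j chi \<xi>" for j
  proof -
    have "2 powr (- real_of_int (j + 1)) = inverse 2 * 2 powr (- real_of_int j)"
      by (simp add: powr_diff powr_minus)
    then show ?thesis by (simp only: dil_def LP_phi_def scaleR_scaleR)
  qed
  show ?thesis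
  proof (induction n)
    case (Suc n)
    show ?case
      unfolding sum_int_Suc Suc.IH unfolding d by (simp add: algebra_simps)
  qed (simp add: d)
qed

text \<open>The kernel has mass \<open>chi 0 = 1\<close> and lives at scale \<open>s\<close>, so the error is an average of increments of \<open>g\<close>
  over distance \<open>s * norm y\<close>; the mean value inequality gives the factor \<open>s\<close>, and the rapid decay of the kernel
  absorbs the weights.\<close>

lemma conv_approx_bound:
  assumes g: "schwartz g"
  obtains C where "\<And>s x. 0 < s \<Longrightarrow> s \<le> 1 \<Longrightarrow>
     (1 + norm x) ^ N * norm (conv (kern (\<lambda>\<xi>. chi (s *\<^sub>R \<xi>))) g x - g x) \<le> C * s"
proof -
  have "\<exists>C. \<forall>x. (1 + norm x) ^ N * norm (dderiv b g x) \<le> C" if "b \<in> Basis" for b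
    using schwartz_bound[OF schwartz_dderiv[OF g that], of N] by blast
  then obtain Cb where Cb: "\<And>b x. b \<in> Basis \<Longrightarrow> (1 + norm x) ^ N * norm (dderiv b g x) \<le> Cb b" by metis
  define B where "B = (\<Sum>b\<in>Basis. \<bar>Cb b\<bar>)"
  have diff: "g differentiable (at x)" for x using g by (intro smooth_differentiable schwartz_smooth)
  have w0: "(1 + norm z) ^ N > 0" for z :: "real^'n" by (intro zero_less_power add_pos_nonneg) auto
  have Dg: "norm (dderiv h g z) \<le> B / (1 + norm z) ^ N * norm h" for h z
  proof -
    have "norm (dderiv h g z) \<le> (\<Sum>b\<in>Basis. norm ((h \<bullet> b) *\<^sub>R dderiv b g z))"
      by (subst dderiv_Basis_sum[OF diff]) (rule norm_sum)
    also have "\<dots> \<le> (\<Sum>b\<in>Basis. norm h * (\<bar>Cb b\<bar> / (1 + norm z) ^ N))"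
    proof (rule sum_mono)
      fix b :: "real^'n" assume b: "b \<in> Basis"
      have "norm (dderiv b g z) \<le> \<bar>Cb b\<bar> / (1 + norm z) ^ N"
        using Cb[OF b, of z] w0[of z] by (simp add: field_simps)
      then show "norm ((h \<bullet> b) *\<^sub>R dderiv b g z) \<le> norm h * (\<bar>Cb b\<bar> / (1 + norm z) ^ N)"
        using Basis_le_norm[OF b, of h] unfolding norm_scaleR real_norm_def by (intro mult_mono) auto
    qed
    finally show ?thesis by (simp add: B_def sum_distrib_left sum_divide_distrib mult.commute)
  qed
  have incr: "(1 + norm x) ^ N * norm (g (x - y) - g x) \<le> B * (norm y * (1 + norm y) ^ N)" for x y
  proof -
    let ?Q = "B * (1 + norm y) ^ N / (1 + norm x) ^ N"
    have B0: "B \<ge> 0" unfolding B_def by (intro sum_nonneg) auto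
    have "norm (g (x - y) - g x) \<le> ?Q * norm (x - y - x)"
    proof (rule differentiable_bound[where S = "closed_segment x (x - y)"])
      fix z assume "z \<in> closed_segment x (x - y)"
      then have "norm (x - z) \<le> norm (x - (x - y))"
        using segment_bound(1)[of z x "x - y"] by (simp add: norm_minus_commute)
      then have zy: "norm (x - z) \<le> norm y" by simp
      show "(g has_derivative (\<lambda>h. dderiv h g z)) (at z within closed_segment x (x - y))"
        using has_derivative_dderiv[OF diff] by (rule has_derivative_at_withinI)
      have "1 + norm x \<le> (1 + norm y) * (1 + norm z)"
        using weight_shift[of x z] mult_right_mono[of "1 + norm (x - z)" "1 + norm y" "1 + norm z"] zy by auto
      then have "(1 + norm x) ^ N \<le> (1 + norm y) ^ N * (1 + norm z) ^ N"
        unfolding power_mult_distrib[symmetric] by (intro power_mono) auto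
      then have "B * (1 + norm x) ^ N \<le> B * ((1 + norm y) ^ N * (1 + norm z) ^ N)"
        using B0 by (rule mult_left_mono)
      then have "B / (1 + norm z) ^ N \<le> ?Q"
        using w0[of x] w0[of z] by (simp add: divide_le_eq le_divide_eq mult_ac)
      then have "norm (dderiv h g z) \<le> ?Q * norm h" for h
        using Dg[of h z] mult_right_mono[of "B / (1 + norm z) ^ N" ?Q "norm h"] by auto
      then show "onorm (\<lambda>h. dderiv h g z) \<le> ?Q"
        using B0 w0[of x] w0[of y] by (intro onorm_bound) (auto intro: less_imp_le)
    qed auto
    then show ?thesis using w0[of x] by (simp add: field_simps)
  qed
  define k where "k = kern chi"
  have k: "rapid k" unfolding k_def by (intro rapid_kern chi_symb)
  define W where "W = (LINT y|lborel. norm y * (1 + norm y) ^ N * norm (k y))"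
  have Wi: "integrable lborel (\<lambda>y. norm y * (1 + norm y) ^ N * norm (k y))"
  proof (rule Bochner_Integration.integrable_bound[OF rapid_weight_integrable[OF k, of "Suc N"]])
    show "(\<lambda>y. norm y * (1 + norm y) ^ N * norm (k y)) \<in> borel_measurable lborel"
      using rapid_measurable[OF k] by simp
    show "AE y in lborel. norm (norm y * (1 + norm y) ^ N * norm (k y)) \<le> norm ((1 + norm y) ^ Suc N * norm (k y))"
      by (intro AE_I2) (simp add: abs_mult mult_right_mono)
  qed
  have "(1 + norm x) ^ N * norm (conv (kern (\<lambda>\<xi>. chi (s *\<^sub>R \<xi>))) g x - g x) \<le> B * W * s" if s: "0 < s" "s \<le> 1" for s x
  proof -
    define ks where "ks = kern (\<lambda>\<xi>. chi (s *\<^sub>R \<xi>))"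
    have sy: "symb (\<lambda>\<xi>. chi (s *\<^sub>R \<xi>))" using s by (intro symb_dilate chi_symb)
    have ks: "rapid ks" unfolding ks_def by (rule rapid_kern[OF sy])
    have [measurable]: "k \<in> borel_measurable borel" "ks \<in> borel_measurable borel" "g \<in> borel_measurable borel"
      using k ks g by (auto intro: rapid_measurable schwartz_measurable)
    have ksk: "ks (s *\<^sub>R y) = complex_of_real ((1 / s) ^ CARD('n)) * k y" for y
      unfolding ks_def k_def using kern_dilate[OF chi_symb s(1), of "s *\<^sub>R y"] s by simp
    have "s ^ CARD('n) * (1 / s) ^ CARD('n) = 1"
      by (subst power_mult_distrib[symmetric]) (use s in simp)
    moreover have "s ^ CARD('n) *\<^sub>R ks (s *\<^sub>R y) = complex_of_real (s ^ CARD('n) * (1 / s) ^ CARD('n)) * k y" for y :: "real^'n"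
      by (simp only: ksk) (simp only: scaleR_conv_of_real of_real_mult mult.assoc)
    ultimately have sk: "s ^ CARD('n) *\<^sub>R ks (s *\<^sub>R y) = k y" for y :: "real^'n" by simp
    obtain Cg where Cg: "\<And>x. norm (g x) \<le> Cg" using rapid_bound[OF schwartz_rapid[OF g]] by blast
    have i1: "integrable lborel (\<lambda>y. ks y * g (x - y))"
      by (rule conv_integrable[OF ks _ Cg]) measurable
    have i2: "integrable lborel (\<lambda>y. ks y * g x)" using rapid_integrable[OF ks] by simp
    have "(LINT y|lborel. ks y) = 1" unfolding ks_def using kern_mass[OF sy] chi_0 by simp
    then have "g x = (LINT y|lborel. ks y * g x)" by simp
    then have "conv ks g x - g x = (LINT y|lborel. ks y * g (x - y)) - (LINT y|lborel. ks y * g x)"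
      by (simp add: conv_def)
    also have "\<dots> = (LINT y|lborel. ks y * g (x - y) - ks y * g x)"
      by (rule Bochner_Integration.integral_diff[OF i1 i2, symmetric])
    also have "\<dots> = (LINT y|lborel. ks y * (g (x - y) - g x))"
      by (simp add: right_diff_distrib)
    also have "\<dots> = \<bar>s\<bar> ^ DIM(real^'n) *\<^sub>R (LINT y|lborel. ks (0 + s *\<^sub>R y) * (g (x - (0 + s *\<^sub>R y)) - g x))"
      by (rule integral_affine) (use s in auto)
    also have "\<dots> = (LINT y|lborel. s ^ CARD('n) *\<^sub>R (ks (s *\<^sub>R y) * (g (x - s *\<^sub>R y) - g x)))"
      using s by simp
    also have "\<dots> = (LINT y|lborel. k y * (g (x - s *\<^sub>R y) - g x))"
      by (simp only: mult_scaleR_left[symmetric] sk)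
    finally have e: "conv ks g x - g x = (LINT y|lborel. k y * (g (x - s *\<^sub>R y) - g x))" .
    have "(1 + norm x) ^ N * norm (conv ks g x - g x) \<le> (1 + norm x) ^ N * (LINT y|lborel. norm (k y * (g (x - s *\<^sub>R y) - g x)))"
      unfolding e using w0[of x] by (intro mult_left_mono integral_norm_bound) auto
    also have "\<dots> = (LINT y|lborel. (1 + norm x) ^ N * norm (k y * (g (x - s *\<^sub>R y) - g x)))" by simp
    also have "\<dots> \<le> (LINT y|lborel. (B * s) * (norm y * (1 + norm y) ^ N * norm (k y)))"
    proof (rule integral_mono_AE')
      show "integrable lborel (\<lambda>y. (B * s) * (norm y * (1 + norm y) ^ N * norm (k y)))"
        using Wi by (intro integrable_mult_right)
      have B0: "B \<ge> 0" unfolding B_def by (intro sum_nonneg) auto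
      show "AE y in lborel. (1 + norm x) ^ N * norm (k y * (g (x - s *\<^sub>R y) - g x)) \<le> (B * s) * (norm y * (1 + norm y) ^ N * norm (k y))"
      proof (intro AE_I2)
        fix y :: "real^'n"
        have "s * norm y \<le> norm y" using s by (simp add: mult_left_le_one_le)
        then have "(1 + s * norm y) ^ N \<le> (1 + norm y) ^ N" using s by (intro power_mono) auto
        then have "B * (s * norm y * (1 + s * norm y) ^ N) \<le> B * (s * norm y * (1 + norm y) ^ N)"
          using s B0 by (intro mult_left_mono) auto
        then have "(1 + norm x) ^ N * norm (g (x - s *\<^sub>R y) - g x) \<le> B * (s * norm y * (1 + norm y) ^ N)"
          using incr[of x "s *\<^sub>R y"] s by simp
        from mult_right_mono[OF this norm_ge_zero[of "k y"]]
        show "(1 + norm x) ^ N * norm (k y * (g (x - s *\<^sub>R y) - g x)) \<le> (B * s) * (norm y * (1 + norm y) ^ N * norm (k y))"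
          by (simp add: norm_mult mult_ac)
      qed
      show "AE y in lborel. 0 \<le> (B * s) * (norm y * (1 + norm y) ^ N * norm (k y))"
        using B0 s by (intro AE_I2 mult_nonneg_nonneg) auto
    qed
    also have "\<dots> = B * W * s" by (simp add: W_def)
    finally show ?thesis by (simp add: ks_def)
  qed
  then show ?thesis using that by blast
qed

lemma finite_lists_Basis: "finite {bs. set bs \<subseteq> (Basis::(real^'n) set) \<and> length bs \<le> N}"
  by (rule finite_lists_length_le) simp

lemma schwartz_norm_nonneg:
  fixes \<psi> :: "real^'n \<Rightarrow> complex"
  assumes \<psi>: "schwartz \<psi>"
  shows "schwartz_norm N \<psi> \<ge> 0"
proof -
  let ?L = "{bs. set bs \<subseteq> (Basis::(real^'n) set) \<and> length bs \<le> N}"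
  let ?f = "\<lambda>(bs, x). (1 + norm x) ^ N * norm (iter_dderiv bs \<psi> x)"
  have "\<forall>bs\<in>?L. \<exists>B. \<forall>x. (1 + norm x) ^ N * norm (iter_dderiv bs \<psi> x) \<le> B"
    by (intro ballI) (use schwartz_iter_bound[OF \<psi>, of _ N] in blast)
  from bchoice[OF this] obtain B where B: "\<forall>bs\<in>?L. \<forall>x. (1 + norm x) ^ N * norm (iter_dderiv bs \<psi> x) \<le> B bs"
    by (elim exE)
  have bdd: "bdd_above (?f ` (?L \<times> UNIV))"
  proof (rule bdd_aboveI2)
    fix z assume "z \<in> ?L \<times> (UNIV::(real^'n) set)"
    then obtain bs x where z: "z = (bs, x)" "bs \<in> ?L" by auto
    have "?f z \<le> \<bar>B bs\<bar>" using B[rule_format, OF z(2), of x] z(1) by simp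
    also have "\<dots> \<le> (\<Sum>bs\<in>?L. \<bar>B bs\<bar>)"
      using z(2) finite_lists_Basis by (intro member_le_sum) auto
    finally show "?f z \<le> (\<Sum>bs\<in>?L. \<bar>B bs\<bar>)" .
  qed
  have "0 \<le> ?f ([], 0)" by simp
  also have "\<dots> \<le> schwartz_norm N \<psi>"
    unfolding schwartz_norm_def by (rule cSUP_upper[OF _ bdd]) simp
  finally show ?thesis .
qed

text \<open>The low-pass filters are an approximate identity on Schwartz functions, in every Schwartz
  seminorm; hence tempered distributions are the limits of their low-frequency parts.\<close>

lemma low_pass_tendsto:
  assumes T: "tempered T" and \<psi>: "schwartz \<psi>"
  shows "(\<lambda>n. T (fmult (dil (int n + 1) chi) \<psi>)) \<longlonglongrightarrow> T \<psi>"
proof -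
  obtain C N where CN: "\<And>\<psi>. schwartz \<psi> \<Longrightarrow> norm (T \<psi>) \<le> C * schwartz_norm N \<psi>"
    using T by (auto simp: tempered_def)
  have lT: "lin T" using T by (rule tempered_lin)
  let ?L = "{bs. set bs \<subseteq> (Basis::(real^'n) set) \<and> length bs \<le> N}"
  have "\<forall>bs\<in>?L. \<exists>C. \<forall>s x. 0 < s \<longrightarrow> s \<le> 1 \<longrightarrow>
     (1 + norm x) ^ N * norm (conv (kern (\<lambda>\<xi>. chi (s *\<^sub>R \<xi>))) (iter_dderiv bs \<psi>) x - iter_dderiv bs \<psi> x) \<le> C * s"
  proof
    fix bs assume "bs \<in> ?L"
    then have "set bs \<subseteq> Basis" by simp
    from conv_approx_bound[OF schwartz_iter_dderiv[OF \<psi> this], of N]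
    show "\<exists>C. \<forall>s x. 0 < s \<longrightarrow> s \<le> 1 \<longrightarrow>
     (1 + norm x) ^ N * norm (conv (kern (\<lambda>\<xi>. chi (s *\<^sub>R \<xi>))) (iter_dderiv bs \<psi>) x - iter_dderiv bs \<psi> x) \<le> C * s"
      by blast
  qed
  from bchoice[OF this] obtain D where D: "\<forall>bs\<in>?L. \<forall>s x. 0 < s \<longrightarrow> s \<le> 1 \<longrightarrow>
     (1 + norm x) ^ N * norm (conv (kern (\<lambda>\<xi>. chi (s *\<^sub>R \<xi>))) (iter_dderiv bs \<psi>) x - iter_dderiv bs \<psi> x) \<le> D bs * s"
    by (elim exE)
  define E where "E = (\<Sum>bs\<in>?L. \<bar>D bs\<bar>)"
  have sn: "schwartz_norm N (\<lambda>x. fmult (\<lambda>\<xi>. chi (s *\<^sub>R \<xi>)) \<psi> x - \<psi> x) \<le> E * s" if s: "0 < s" "s \<le> 1" for s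
    unfolding schwartz_norm_def
  proof (rule cSUP_least)
    show "?L \<times> (UNIV::(real^'n) set) \<noteq> {}" by (auto intro!: exI[of _ "[]"])
    fix z assume "z \<in> ?L \<times> (UNIV::(real^'n) set)"
    then obtain bs x where z: "z = (bs, x)" "bs \<in> ?L" by auto
    then have bs: "set bs \<subseteq> Basis" by simp
    have sy: "symb (\<lambda>\<xi>. chi (s *\<^sub>R \<xi>))" using s by (intro symb_dilate chi_symb)
    have "iter_dderiv bs (\<lambda>x. fmult (\<lambda>\<xi>. chi (s *\<^sub>R \<xi>)) \<psi> x - \<psi> x) = iter_dderiv bs (\<lambda>x. 1 * conv (kern (\<lambda>\<xi>. chi (s *\<^sub>R \<xi>))) \<psi> x + (-1) * \<psi> x)"
      by (simp add: fmult_eq_conv[OF sy \<psi>])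
    also have "\<dots> = (\<lambda>x. 1 * conv (kern (\<lambda>\<xi>. chi (s *\<^sub>R \<xi>))) (iter_dderiv bs \<psi>) x + (-1) * iter_dderiv bs \<psi> x)"
      by (subst iter_dderiv_lincomb[OF _ _ bs])
         (auto intro!: schwartz_smooth schwartz_conv rapid_kern sy \<psi> simp: iter_dderiv_conv[OF rapid_kern[OF sy] \<psi> bs])
    finally have "(case z of (bs, x) \<Rightarrow> (1 + norm x) ^ N * norm (iter_dderiv bs (\<lambda>x. fmult (\<lambda>\<xi>. chi (s *\<^sub>R \<xi>)) \<psi> x - \<psi> x) x))
      \<le> D bs * s" using D[rule_format, OF z(2) s, of x] z by simp
    also have "D bs \<le> E"
    proof -
      have "\<bar>D bs\<bar> \<le> E" unfolding E_def using z(2) finite_lists_Basis by (intro member_le_sum) auto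
      then show ?thesis by simp
    qed
    then have "D bs * s \<le> E * s" using s by (intro mult_right_mono) auto
    finally show "(case z of (bs, x) \<Rightarrow> (1 + norm x) ^ N * norm (iter_dderiv bs (\<lambda>x. fmult (\<lambda>\<xi>. chi (s *\<^sub>R \<xi>)) \<psi> x - \<psi> x) x)) \<le> E * s" .
  qed
  have "(\<lambda>n. T (fmult (dil (int n + 1) chi) \<psi>) - T \<psi>) \<longlonglongrightarrow> 0"
  proof (rule Lim_null_comparison)
    show "\<forall>\<^sub>F n in sequentially. norm (T (fmult (dil (int n + 1) chi) \<psi>) - T \<psi>) \<le> \<bar>C\<bar> * E * (1/2) ^ Suc n"
    proof (intro always_eventually allI)
      fix n
      define s where "s = 2 powr (- real_of_int (int n + 1))"
      have s: "0 < s" "s \<le> 1" and s2: "s = (1/2) ^ Suc n"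
      proof -
        have "real_of_int (int n + 1) = real (Suc n)" by simp
        then have "s = 2 powr (- real (Suc n))" by (simp only: s_def)
        also have "\<dots> = 1 / 2 powr real (Suc n)" by (rule powr_minus_divide)
        also have "2 powr real (Suc n) = (2::real) ^ Suc n" by (rule powr_realpow) simp
        finally show s2: "s = (1/2) ^ Suc n" by (simp only: power_one_over)
        show "0 < s" by (simp add: s_def)
        show "s \<le> 1" unfolding s2 by (rule power_le_one) auto
      qed
      have sy: "symb (\<lambda>\<xi>. chi (s *\<^sub>R \<xi>))" using s by (intro symb_dilate chi_symb)
      have de: "dil (int n + 1) chi = (\<lambda>\<xi>. chi (s *\<^sub>R \<xi>))" by (simp add: dil_def fun_eq_iff s_def)
      have sc: "schwartz (fmult (\<lambda>\<xi>. chi (s *\<^sub>R \<xi>)) \<psi>)" by (rule schwartz_fmult[OF sy \<psi>])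
      have "norm (T (fmult (\<lambda>\<xi>. chi (s *\<^sub>R \<xi>)) \<psi>) - T \<psi>) = norm (T (\<lambda>x. fmult (\<lambda>\<xi>. chi (s *\<^sub>R \<xi>)) \<psi> x - \<psi> x))"
        using lin_diff[OF lT sc \<psi>] by simp
      also have "\<dots> \<le> C * schwartz_norm N (\<lambda>x. fmult (\<lambda>\<xi>. chi (s *\<^sub>R \<xi>)) \<psi> x - \<psi> x)"
        by (rule CN[OF schwartz_diff[OF sc \<psi>]])
      also have "\<dots> \<le> \<bar>C\<bar> * (E * s)"
      proof -
        let ?S = "schwartz_norm N (\<lambda>x. fmult (\<lambda>\<xi>. chi (s *\<^sub>R \<xi>)) \<psi> x - \<psi> x)"
        have "C * ?S \<le> \<bar>C\<bar> * \<bar>?S\<bar>" by (metis abs_ge_self abs_mult)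
        moreover have "?S \<ge> 0"
          by (rule schwartz_norm_nonneg[OF schwartz_diff[OF sc \<psi>]])
        ultimately show ?thesis using mult_left_mono[OF sn[OF s], of "\<bar>C\<bar>"] by simp
      qed
      finally show "norm (T (fmult (dil (int n + 1) chi) \<psi>) - T \<psi>) \<le> \<bar>C\<bar> * E * (1/2) ^ Suc n"
        unfolding de by (simp add: s2 mult.assoc)
    qed
    have "(\<lambda>n. (1/2 :: real) ^ Suc n) \<longlonglongrightarrow> 0" by (rule LIMSEQ_Suc, rule LIMSEQ_realpow_zero) auto
    from tendsto_mult_left[OF this, of "\<bar>C\<bar> * E"]
    show "(\<lambda>n. \<bar>C\<bar> * E * (1/2) ^ Suc n) \<longlonglongrightarrow> 0" by simp
  qed
  then show ?thesis by (rule LIM_zero_cancel)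
qed

lemma fmult_telescope:
  assumes \<psi>: "schwartz \<psi>" and T: "lin T"
  shows "T (fmult (dil (int n + 1) chi) \<psi>) = LP_low chi (- int n) T \<psi> + (\<Sum>j\<in>{- int n..int n}. LP_block chi j T \<psi>)"
proof -
  have "(\<Sum>j\<in>{- int n..int n}. LP_block chi j T \<psi>) = T (\<lambda>x. \<Sum>j\<in>{- int n..int n}. fmult (dil j phi) \<psi> x)"
    unfolding LP_block_eq by (rule lin_sum[OF T, symmetric]) (auto intro!: schwartz_fmult symb_dil_phi \<psi>)
  also have "(\<lambda>x. \<Sum>j\<in>{- int n..int n}. fmult (dil j phi) \<psi> x) = fmult (\<lambda>\<xi>. \<Sum>j\<in>{- int n..int n}. dil j phi \<xi>) \<psi>"
    by (rule fmult_sum[symmetric]) (auto intro!: symb_dil_phi \<psi>)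
  also have "\<dots> = (\<lambda>x. fmult (dil (int n + 1) chi) \<psi> x - fmult (dil (- int n) chi) \<psi> x)"
    unfolding dil_phi_telescope by (rule fmult_diff[OF symb_dil_chi symb_dil_chi \<psi>])
  also have "T \<dots> = T (fmult (dil (int n + 1) chi) \<psi>) - LP_low chi (- int n) T \<psi>"
    unfolding LP_low_eq by (rule lin_diff[OF T]) (auto intro!: schwartz_fmult symb_dil_chi \<psi>)
  finally show ?thesis by simp
qed

text \<open>The part of membership in a Besov space that reconstruction from dyadic blocks uses, in a form that is
  stable under differences.\<close>

definition approximable :: "(real^'n) functional \<Rightarrow> bool" where
  "approximable T \<longleftrightarrow> lin T \<and>
     (\<forall>\<psi>. schwartz \<psi> \<longrightarrow> (\<lambda>n. T (fmult (dil (int n + 1) chi) \<psi>)) \<longlonglongrightarrow> T \<psi>) \<and>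
     ((\<lambda>j. dnorm (LP_low chi j T)) \<longlongrightarrow> 0) at_bot"

lemma approximable_besov:
  assumes "T \<in> besov chi s p"
  shows "approximable T"
proof -
  have T: "tempered T" and low: "((\<lambda>j. dist_Lp_norm \<infinity> (LP_low chi j T)) \<longlongrightarrow> 0) at_bot"
    using assms by (auto simp: besov_def)
  have "((\<lambda>j. dnorm (LP_low chi j T)) \<longlongrightarrow> 0) at_bot"
    by (rule tendsto_sandwich[OF _ _ tendsto_const low]) (auto intro!: always_eventually dnorm_le_dist_Linf simp del: infinity_ennreal_def)
  then show ?thesis using T by (auto simp: approximable_def intro: tempered_lin low_pass_tendsto)
qed

lemma approximable_diff:
  assumes "approximable T" "approximable S"
  shows "approximable (\<lambda>\<psi>. T \<psi> - S \<psi>)"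
  unfolding approximable_def
proof (intro conjI allI impI)
  show "lin (\<lambda>\<psi>. T \<psi> - S \<psi>)" using assms by (auto simp: approximable_def lin_def algebra_simps)
  show "(\<lambda>n. T (fmult (dil (int n + 1) chi) \<psi>) - S (fmult (dil (int n + 1) chi) \<psi>)) \<longlonglongrightarrow> T \<psi> - S \<psi>" if "schwartz \<psi>" for \<psi>
    using assms that by (intro tendsto_diff) (auto simp: approximable_def)
  have lim: "((\<lambda>j. dnorm (LP_low chi j S) + dnorm (LP_low chi j T)) \<longlongrightarrow> 0 + 0) at_bot"
    using assms by (intro tendsto_add) (auto simp: approximable_def)
  have le: "dnorm (LP_low chi j (\<lambda>\<psi>. T \<psi> - S \<psi>)) \<le> dnorm (LP_low chi j S) + dnorm (LP_low chi j T)" for j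
  proof -
    have "dnorm (LP_low chi j (\<lambda>\<psi>. T \<psi> - S \<psi>)) \<le> dnorm (\<lambda>\<psi>. - LP_low chi j S \<psi>) + dnorm (LP_low chi j T)"
      by (rule dnorm_le_diff) (simp add: LP_low_eq)
    also have "dnorm (\<lambda>\<psi>. - LP_low chi j S \<psi>) = dnorm (LP_low chi j S)" by (simp add: dnorm_def)
    finally show ?thesis .
  qed
  show "((\<lambda>j. dnorm (LP_low chi j (\<lambda>\<psi>. T \<psi> - S \<psi>))) \<longlongrightarrow> 0) at_bot"
    by (rule tendsto_sandwich[OF _ _ tendsto_const lim[unfolded add_0]]) (use le in \<open>auto intro: always_eventually\<close>)
qed

text \<open>A low-pass filtered test function splits into finitely many blocks and a low-frequency remainder, which
  tends to 0 by assumption; the blocks are bounded by their dual norms.\<close>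

lemma dnorm_reconstruct:
  assumes T: "approximable T"
  shows "dnorm T \<le> (SUP n::nat. \<Sum>j\<in>{- int n..int n}. dnorm (LP_block chi j T))" (is "_ \<le> ?S")
proof (rule dnorm_leI)
  fix \<psi> :: "real^'n \<Rightarrow> complex" assume \<psi>: "schwartz \<psi>" "l1 \<psi> \<le> 1"
  have lT: "lin T" and low: "((\<lambda>j. dnorm (LP_low chi j T)) \<longlongrightarrow> 0) at_bot"
    and conv: "(\<lambda>n. T (fmult (dil (int n + 1) chi) \<psi>)) \<longlonglongrightarrow> T \<psi>"
    using T \<psi> by (auto simp: approximable_def)
  have up: "ennreal (norm (S \<psi>)) \<le> dnorm S" for S
    unfolding dnorm_def using \<psi> by (intro SUP_upper) auto
  have le: "ennreal (norm (T (fmult (dil (int n + 1) chi) \<psi>))) \<le> dnorm (LP_low chi (- int n) T) + ?S" for n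
  proof -
    have "norm (T (fmult (dil (int n + 1) chi) \<psi>)) \<le> norm (LP_low chi (- int n) T \<psi>) + (\<Sum>j\<in>{- int n..int n}. norm (LP_block chi j T \<psi>))"
      unfolding fmult_telescope[OF \<psi>(1) lT] by (intro order_trans[OF norm_triangle_ineq] add_mono norm_sum order_refl)
    then have "ennreal (norm (T (fmult (dil (int n + 1) chi) \<psi>))) \<le> ennreal (norm (LP_low chi (- int n) T \<psi>)) + (\<Sum>j\<in>{- int n..int n}. ennreal (norm (LP_block chi j T \<psi>)))"
      by (subst sum_ennreal) (auto simp: ennreal_plus[symmetric] sum_nonneg intro!: ennreal_leI simp del: ennreal_plus)
    also have "\<dots> \<le> dnorm (LP_low chi (- int n) T) + (\<Sum>j\<in>{- int n..int n}. dnorm (LP_block chi j T))"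
      by (intro add_mono sum_mono up)
    also have "\<dots> \<le> dnorm (LP_low chi (- int n) T) + ?S"
      by (intro add_left_mono SUP_upper) simp
    finally show ?thesis .
  qed
  have "filterlim (\<lambda>n. - int n) at_bot sequentially"
    unfolding filterlim_at_bot
  proof
    fix Z :: int
    show "\<forall>\<^sub>F n in sequentially. - int n \<le> Z"
      using eventually_ge_at_top[of "nat (- Z)"] by eventually_elim linarith
  qed
  then have "(\<lambda>n. dnorm (LP_low chi (- int n) T)) \<longlonglongrightarrow> 0"
    by (rule filterlim_compose[OF low])
  then have A: "(\<lambda>n. dnorm (LP_low chi (- int n) T) + ?S) \<longlonglongrightarrow> 0 + ?S"
    by (intro tendsto_add tendsto_const)
  have B: "(\<lambda>n. ennreal (norm (T (fmult (dil (int n + 1) chi) \<psi>)))) \<longlonglongrightarrow> ennreal (norm (T \<psi>))"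
    by (intro tendsto_ennrealI tendsto_norm conv)
  have "ennreal (norm (T \<psi>)) \<le> 0 + ?S"
    by (rule LIMSEQ_le[OF B A]) (use le in auto)
  then show "ennreal (norm (T \<psi>)) \<le> ?S" by simp
qed

end

lemma l1_sum_le:
  assumes "finite I" "\<And>i. i \<in> I \<Longrightarrow> f i \<in> borel_measurable borel"
  shows "l1 (\<lambda>x. \<Sum>i\<in>I. f i x) \<le> (\<Sum>i\<in>I. l1 (f i))"
proof -
  have "l1 (\<lambda>x. \<Sum>i\<in>I. f i x) \<le> (\<integral>\<^sup>+x. (\<Sum>i\<in>I. ennreal (norm (f i x))) \<partial>lborel)"
    unfolding l1_def by (intro nn_integral_mono) (simp add: ennreal_leI norm_sum)
  also have "\<dots> = (\<Sum>i\<in>I. l1 (f i))"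
    unfolding l1_def using assms by (intro nn_integral_sum) auto
  finally show ?thesis .
qed

lemma sum_geometric_two_sided:
  fixes q :: real
  assumes "0 < q" "q < 1"
  shows "(\<Sum>j\<in>{- int n..int n}. q ^ nat \<bar>j\<bar>) \<le> 2 / (1 - q)"
proof -
  have "(\<Sum>j\<in>{- int n..int n}. q ^ nat \<bar>j\<bar>) \<le> 2 * (\<Sum>i\<le>n. q ^ i)"
  proof (induction n)
    case (Suc n)
    have "nat \<bar>int (Suc n)\<bar> = Suc n" "nat \<bar>- int (Suc n)\<bar> = Suc n" by auto
    then show ?case unfolding sum_int_Suc using Suc.IH by (simp only:) simp
  qed simp
  also have "(\<Sum>i\<le>n. q ^ i) \<le> (\<Sum>i. q ^ i)"
    using assms by (intro sum_le_suminf summable_geometric) auto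
  also have "\<dots> = 1 / (1 - q)" using assms by (intro suminf_geometric) auto
  finally show ?thesis by simp
qed

context littlewood_paley
begin

text \<open>The part of the symbol of \<open>(-\<Delta>)\<^sup>s\<^sup>/\<^sup>2\<close> in one dyadic block.\<close>

definition riesz :: "real \<Rightarrow> int \<Rightarrow> real^'n \<Rightarrow> real" where
  "riesz s j \<xi> = norm \<xi> powr s * dil j phi \<xi>"

lemma riesz_eq: "riesz s j = (\<lambda>\<xi>. dil j phi \<xi> * (2 powr (real_of_int j * s) * dil j (powsymb s) \<xi>))"
  by (rule ext) (simp only: riesz_def dil_powsymb)

lemma symb_riesz: "symb (riesz s j)"
  unfolding riesz_eq by (intro symb_times symb_smooth[OF symb_dil_phi] symb_cmult symb_dil symb_powsymb)

text \<open>The symbol is \<open>2\<^sup>j\<^sup>s\<close> times a dilate of a fixed symbol.\<close>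

lemma l1_fmult_riesz:
  obtains K where "K > 0"
    "\<And>\<psi> r j. schwartz \<psi> \<Longrightarrow> l1 \<psi> \<le> ennreal r \<Longrightarrow> r \<ge> 0 \<Longrightarrow> l1 (fmult (riesz s j) \<psi>) \<le> ennreal (K * 2 powr (real_of_int j * s) * r)"
proof -
  obtain K1 where K1: "K1 > 0" "l1 (kern phi) \<le> ennreal K1" using kern_l1_bound[OF phi_symb] by blast
  obtain K2 where K2: "K2 > 0" "l1 (kern (powsymb s)) \<le> ennreal K2" using kern_l1_bound[OF symb_powsymb] by blast
  have "l1 (fmult (riesz s j) \<psi>) \<le> ennreal (K1 * K2 * 2 powr (real_of_int j * s) * r)"
    if \<psi>: "schwartz \<psi>" "l1 \<psi> \<le> ennreal r" "r \<ge> 0" for \<psi> r j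
  proof -
    let ?n = "\<lambda>\<xi>. 2 powr (real_of_int j * s) * dil j (powsymb s) \<xi>"
    have n: "symb ?n" by (intro symb_cmult symb_dil symb_powsymb)
    have e: "fmult (riesz s j) \<psi> = fmult (\<lambda>\<xi>. 1 * dil j phi \<xi>) (fmult ?n \<psi>)"
      unfolding riesz_eq by (simp add: fmult_fmult symb_dil_phi n \<psi>(1))
    have "l1 (fmult ?n \<psi>) \<le> ennreal (\<bar>2 powr (real_of_int j * s)\<bar> * K2 * r)"
      by (rule l1_fmult_dil[OF symb_powsymb K2(2) _ \<psi>]) (use K2 in simp)
    then have "l1 (fmult (riesz s j) \<psi>) \<le> ennreal (\<bar>1\<bar> * K1 * (\<bar>2 powr (real_of_int j * s)\<bar> * K2 * r))"
      unfolding e using K1 K2 \<psi> n by (intro l1_fmult_dil[OF phi_symb K1(2)] schwartz_fmult) auto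
    then show ?thesis by (simp add: mult_ac)
  qed
  then show ?thesis using that[of "K1 * K2"] K1 K2 by simp
qed

text \<open>This is \<open>|\<xi>|\<^sup>s = |\<xi>|\<^sup>2 |\<xi>|\<^sup>s\<^sup>-\<^sup>2\<close> with \<open>|\<xi>|\<^sup>2 = - (\<i>\<xi>) \<bullet> (\<i>\<xi>)\<close>: the two extra powers become derivatives of \<open>\<psi>\<close>.\<close>

lemma fmult_riesz_square:
  assumes \<psi>: "schwartz \<psi>"
  shows "fmult (riesz s j) \<psi> = (\<lambda>x. \<Sum>k\<in>UNIV. - fmult (riesz (s - 2) j) (dderiv (axis k 1) (dderiv (axis k 1) \<psi>)) x)"
proof -
  have "riesz s j \<xi> = (\<Sum>k\<in>UNIV. (\<xi> $ k) * ((\<xi> $ k) * riesz (s - 2) j \<xi>))" for \<xi>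
  proof -
    have "(\<Sum>k\<in>UNIV. (\<xi> $ k) * ((\<xi> $ k) * riesz (s - 2) j \<xi>)) = (norm \<xi>)\<^sup>2 * riesz (s - 2) j \<xi>"
      unfolding power2_norm_eq_inner inner_vec_def by (simp add: sum_distrib_left sum_distrib_right mult_ac)
    also have "\<dots> = riesz s j \<xi>"
      by (cases "\<xi> = 0") (auto simp: riesz_def powr_diff)
    finally show ?thesis by simp
  qed
  then have "riesz s j = (\<lambda>\<xi>. \<Sum>k\<in>UNIV. (\<xi> $ k) * ((\<xi> $ k) * riesz (s - 2) j \<xi>))" by (rule ext)
  then have "fmult (riesz s j) \<psi> = (\<lambda>x. \<Sum>k\<in>UNIV. fmult (\<lambda>\<xi>. (\<xi> $ k) * ((\<xi> $ k) * riesz (s - 2) j \<xi>)) \<psi> x)"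
    by (simp only:) (rule fmult_sum, auto intro!: symb_coord symb_riesz \<psi>)
  moreover have "fmult (\<lambda>\<xi>. (\<xi> $ k) * ((\<xi> $ k) * riesz (s - 2) j \<xi>)) \<psi> x
      = - fmult (riesz (s - 2) j) (dderiv (axis k 1) (dderiv (axis k 1) \<psi>)) x" for k x
  proof -
    have c: "fmult (\<lambda>\<xi>. (\<xi> $ k) * m \<xi>) \<eta> = (\<lambda>x. \<i> * fmult m (dderiv (axis k 1) \<eta>) x)"
      if "symb m" "schwartz \<eta>" for m \<eta>
      using fmult_coord(1)[OF that axis_Basis, of k] by (simp add: inner_axis)
    show ?thesis
      by (simp add: c symb_coord symb_riesz \<psi> schwartz_dderiv axis_Basis)
  qed
  ultimately show ?thesis by simp
qed

text \<open>At low frequencies the symbol \<open>|\<xi>|\<^sup>\<alpha>\<close> is small; at high frequencies two derivatives are moved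
  to the test function, which leaves the decaying factor \<open>2\<^sup>j\<^sup>(\<^sup>\<alpha>\<^sup>-\<^sup>2\<^sup>)\<close>.\<close>

lemma l1_fmult_riesz_summable:
  assumes \<alpha>: "0 < \<alpha>" "\<alpha> < 2" and \<psi>: "schwartz \<psi>"
  obtains B q where "0 < q" "q < 1" "B \<ge> 0" "\<And>j. l1 (fmult (riesz \<alpha> j) \<psi>) \<le> ennreal (B * q ^ nat \<bar>j\<bar>)"
proof -
  obtain K1 where K1: "K1 > 0"
    "\<And>\<psi> r j. schwartz \<psi> \<Longrightarrow> l1 \<psi> \<le> ennreal r \<Longrightarrow> r \<ge> 0 \<Longrightarrow> l1 (fmult (riesz \<alpha> j) \<psi>) \<le> ennreal (K1 * 2 powr (real_of_int j * \<alpha>) * r)"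
    using l1_fmult_riesz[of \<alpha>] by blast
  obtain K2 where K2: "K2 > 0"
    "\<And>\<psi> r j. schwartz \<psi> \<Longrightarrow> l1 \<psi> \<le> ennreal r \<Longrightarrow> r \<ge> 0 \<Longrightarrow> l1 (fmult (riesz (\<alpha> - 2) j) \<psi>) \<le> ennreal (K2 * 2 powr (real_of_int j * (\<alpha> - 2)) * r)"
    using l1_fmult_riesz[of "\<alpha> - 2"] by blast
  define d2 where "d2 = (\<lambda>k. dderiv (axis k 1) (dderiv (axis k 1) \<psi>))"
  have d2: "schwartz (d2 k)" for k unfolding d2_def by (intro schwartz_dderiv axis_Basis \<psi>)
  have fin: "\<exists>r\<ge>0. l1 \<eta> \<le> ennreal r" if "schwartz \<eta>" for \<eta> :: "real^'n \<Rightarrow> complex"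
    using schwartz_l1[OF that] by (cases "l1 \<eta>") auto
  obtain r where r: "r \<ge> 0" "l1 \<psi> \<le> ennreal r" using fin[OF \<psi>] by blast
  obtain rk where rk: "\<And>k. rk k \<ge> 0" "\<And>k. l1 (d2 k) \<le> ennreal (rk k)" using fin[OF d2] by metis
  define R where "R = (\<Sum>k\<in>UNIV. rk k)"
  have R: "R \<ge> 0" unfolding R_def using rk by (intro sum_nonneg) auto
  define q where "q = max (2 powr (- \<alpha>)) (2 powr (\<alpha> - 2))"
  have q: "0 < q" "q < 1" using \<alpha> unfolding q_def by (auto simp: powr_less_one less_max_iff_disj)
  have "l1 (fmult (riesz \<alpha> j) \<psi>) \<le> ennreal ((K1 * r + K2 * R) * q ^ nat \<bar>j\<bar>)" for j
  proof (cases "j \<le> 0")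
    case True
    have "2 powr (real_of_int j * \<alpha>) = (2 powr (- \<alpha>)) powr real (nat \<bar>j\<bar>)"
      using True by (simp add: powr_powr mult.commute)
    also have "\<dots> = (2 powr (- \<alpha>)) ^ nat \<bar>j\<bar>" by (rule powr_realpow) simp
    also have "\<dots> \<le> q ^ nat \<bar>j\<bar>" unfolding q_def by (rule power_mono) auto
    finally have "K1 * r * 2 powr (real_of_int j * \<alpha>) \<le> (K1 * r + K2 * R) * q ^ nat \<bar>j\<bar>"
      using K1 K2 r R q by (intro mult_mono) auto
    then have "ennreal (K1 * 2 powr (real_of_int j * \<alpha>) * r) \<le> ennreal ((K1 * r + K2 * R) * q ^ nat \<bar>j\<bar>)"
      by (intro ennreal_leI) (simp add: mult_ac)
    then show ?thesis using K1(2)[OF \<psi> r(2,1), of j] by (rule order_trans[rotated])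
  next
    case False
    have "2 powr (real_of_int j * (\<alpha> - 2)) = (2 powr (\<alpha> - 2)) powr real (nat \<bar>j\<bar>)"
      using False by (simp add: powr_powr mult.commute)
    also have "\<dots> = (2 powr (\<alpha> - 2)) ^ nat \<bar>j\<bar>" by (rule powr_realpow) simp
    also have "\<dots> \<le> q ^ nat \<bar>j\<bar>" unfolding q_def by (rule power_mono) auto
    finally have le: "K2 * R * 2 powr (real_of_int j * (\<alpha> - 2)) \<le> (K1 * r + K2 * R) * q ^ nat \<bar>j\<bar>"
      using K1 K2 r R q by (intro mult_mono) auto
    have "l1 (fmult (riesz \<alpha> j) \<psi>) \<le> (\<Sum>k\<in>UNIV. l1 (\<lambda>x. - fmult (riesz (\<alpha> - 2) j) (d2 k) x))"
      unfolding fmult_riesz_square[OF \<psi>] d2_def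
      by (rule l1_sum_le) (auto intro!: borel_measurable_uminus schwartz_measurable schwartz_fmult symb_riesz d2[unfolded d2_def])
    also have "\<dots> = (\<Sum>k\<in>UNIV. l1 (fmult (riesz (\<alpha> - 2) j) (d2 k)))" by (simp add: l1_def)
    also have "\<dots> \<le> (\<Sum>k\<in>UNIV. ennreal (K2 * 2 powr (real_of_int j * (\<alpha> - 2)) * rk k))"
      by (intro sum_mono K2(2) d2 rk)
    also have "\<dots> = ennreal (K2 * R * 2 powr (real_of_int j * (\<alpha> - 2)))"
      using K2 rk by (subst sum_ennreal) (auto simp: R_def sum_distrib_left sum_distrib_right mult_ac)
    also have "\<dots> \<le> ennreal ((K1 * r + K2 * R) * q ^ nat \<bar>j\<bar>)" using le by (rule ennreal_leI)
    finally show ?thesis .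
  qed
  then show ?thesis using that[OF q, of "K1 * r + K2 * R"] K1(1) K2(1) r(1) R by simp
qed

lemma riesz_sum: "(\<Sum>j\<in>{- int n..int n}. riesz s j \<xi>) = norm \<xi> powr s * (dil (int n + 1) chi \<xi> - dil (- int n) chi \<xi>)"
  unfolding riesz_def sum_distrib_left[symmetric] dil_phi_telescope ..

lemma riesz_sum_tendsto: "(\<lambda>n. norm \<xi> powr s * (dil (int n + 1) chi \<xi> - dil (- int n) chi \<xi>)) \<longlonglongrightarrow> norm \<xi> powr s"
proof (cases "\<xi> = 0")
  case False
  then have pos: "norm \<xi> > 0" by simp
  obtain N1 :: nat where N1: "norm \<xi> / (3/4) < 2 ^ N1" using real_arch_pow[of 2 "norm \<xi> / (3/4)"] by auto
  obtain N2 :: nat where N2: "(4/3) / norm \<xi> < 2 ^ N2" using real_arch_pow[of 2 "(4/3) / norm \<xi>"] by auto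
  have "\<forall>\<^sub>F n in sequentially. norm \<xi> powr s * (dil (int n + 1) chi \<xi> - dil (- int n) chi \<xi>) = norm \<xi> powr s"
    using eventually_ge_at_top[of "max N1 N2"]
  proof eventually_elim
    fix n assume n: "max N1 N2 \<le> n"
    have p: "(2::real) ^ N1 \<le> 2 ^ Suc n" "(2::real) ^ N2 \<le> 2 ^ n" using n by (intro power_increasing; simp)+
    have "norm \<xi> / (3/4) < 2 ^ Suc n" using N1 p by linarith
    moreover have "(4/3) / norm \<xi> < 2 ^ n" using N2 p by linarith
    moreover have e1: "2 powr (- real_of_int (int n + 1)) = 1 / 2 ^ Suc n"
    proof -
      have "real_of_int (int n + 1) = real (Suc n)" by simp
      then show ?thesis by (simp only: powr_minus_divide powr_realpow[of 2] zero_less_numeral)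
    qed
    moreover have e2: "2 powr (- real_of_int (- int n)) = 2 ^ n"
      by (simp add: powr_realpow)
    ultimately have "norm ((2 powr (- real_of_int (int n + 1))) *\<^sub>R \<xi>) < 3/4" "norm ((2 powr (- real_of_int (- int n))) *\<^sub>R \<xi>) > 4/3"
      unfolding e1 e2 using pos by (simp_all add: field_simps)
    then have "dil (int n + 1) chi \<xi> = 1" "dil (- int n) chi \<xi> = 0"
      unfolding dil_def by (auto intro: chi_in chi_out)
    then show "norm \<xi> powr s * (dil (int n + 1) chi \<xi> - dil (- int n) chi \<xi>) = norm \<xi> powr s" by simp
  qed
  then show ?thesis by (rule tendsto_eventually)
qed simp

text \<open>The partial sums of the symbols are bounded by a multiple of \<open>(1 + |\<xi>|)\<^sup>2\<close>, and the inverse transform of \<open>\<psi>\<close>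
  decays faster than any power.\<close>

lemma fmult_riesz_sum_tendsto:
  assumes \<alpha>: "0 < \<alpha>" "\<alpha> < 2" and \<psi>: "schwartz \<psi>"
  shows "(\<lambda>n. \<Sum>j\<in>{- int n..int n}. fmult (riesz \<alpha> j) \<psi> x) \<longlonglongrightarrow> fmult (\<lambda>\<xi>. norm \<xi> powr \<alpha>) \<psi> x"
proof -
  obtain C where C: "\<And>\<xi>. \<bar>chi \<xi>\<bar> \<le> C" using symb_bounded[OF chi_symb] by blast
  have [measurable]: "inv_fourier \<psi> \<in> borel_measurable borel" by (rule rapid_measurable[OF rapid_inv_fourier[OF \<psi>]])
  have [measurable]: "dil j chi \<in> borel_measurable borel" for j
    by (intro borel_measurable_continuous_onI smooth_continuous symb_smooth symb_dil_chi)
  have "(\<lambda>n. fmult (\<lambda>\<xi>. norm \<xi> powr \<alpha> * (dil (int n + 1) chi \<xi> - dil (- int n) chi \<xi>)) \<psi> x) \<longlonglongrightarrow> fmult (\<lambda>\<xi>. norm \<xi> powr \<alpha>) \<psi> x"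
    unfolding fmult_def fourier_def
  proof (rule integral_dominated_convergence[where w = "\<lambda>\<xi>. (2 * C) * ((1 + norm \<xi>) ^ 2 * norm (inv_fourier \<psi> \<xi>))"])
    show "integrable lborel (\<lambda>\<xi>. (2 * C) * ((1 + norm \<xi>) ^ 2 * norm (inv_fourier \<psi> \<xi>)))"
      by (intro integrable_mult_right rapid_weight_integrable rapid_inv_fourier \<psi>)
    show "AE \<xi> in lborel. (\<lambda>n. cis (- (\<xi> \<bullet> x)) * (complex_of_real (norm \<xi> powr \<alpha> * (dil (int n + 1) chi \<xi> - dil (- int n) chi \<xi>)) * inv_fourier \<psi> \<xi>))
      \<longlonglongrightarrow> cis (- (\<xi> \<bullet> x)) * (complex_of_real (norm \<xi> powr \<alpha>) * inv_fourier \<psi> \<xi>)"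
      by (intro AE_I2 tendsto_intros riesz_sum_tendsto)
    show "AE \<xi> in lborel. norm (cis (- (\<xi> \<bullet> x)) * (complex_of_real (norm \<xi> powr \<alpha> * (dil (int n + 1) chi \<xi> - dil (- int n) chi \<xi>)) * inv_fourier \<psi> \<xi>))
      \<le> (2 * C) * ((1 + norm \<xi>) ^ 2 * norm (inv_fourier \<psi> \<xi>))" for n
    proof (intro AE_I2)
      fix \<xi> :: "real^'n"
      have "norm \<xi> powr \<alpha> \<le> (1 + norm \<xi>) powr \<alpha>" using \<alpha> by (intro powr_mono2) auto
      also have "\<dots> \<le> (1 + norm \<xi>) powr 2" using \<alpha> by (intro powr_mono) auto
      also have "\<dots> = (1 + norm \<xi>) ^ 2" by (simp add: powr_numeral add_nonneg_eq_0_iff)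
      finally have a: "norm \<xi> powr \<alpha> \<le> (1 + norm \<xi>) ^ 2" .
      have b: "\<bar>dil (int n + 1) chi \<xi> - dil (- int n) chi \<xi>\<bar> \<le> 2 * C"
        unfolding dil_def using C[of "2 powr - real_of_int (int n + 1) *\<^sub>R \<xi>"] C[of "2 powr - real_of_int (- int n) *\<^sub>R \<xi>"] by linarith
      have "norm \<xi> powr \<alpha> * \<bar>dil (int n + 1) chi \<xi> - dil (- int n) chi \<xi>\<bar> \<le> (1 + norm \<xi>) ^ 2 * (2 * C)"
        by (intro mult_mono a b) auto
      then show "norm (cis (- (\<xi> \<bullet> x)) * (complex_of_real (norm \<xi> powr \<alpha> * (dil (int n + 1) chi \<xi> - dil (- int n) chi \<xi>)) * inv_fourier \<psi> \<xi>))
      \<le> (2 * C) * ((1 + norm \<xi>) ^ 2 * norm (inv_fourier \<psi> \<xi>))"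
        using mult_right_mono[of _ _ "norm (inv_fourier \<psi> \<xi>)"] unfolding norm_mult norm_cis norm_of_real abs_mult
        by (fastforce simp: mult_ac)
    qed
  qed measurable
  moreover have "fmult (\<lambda>\<xi>. norm \<xi> powr \<alpha> * (dil (int n + 1) chi \<xi> - dil (- int n) chi \<xi>)) \<psi> x = (\<Sum>j\<in>{- int n..int n}. fmult (riesz \<alpha> j) \<psi> x)" for n
    unfolding riesz_sum[symmetric] by (subst fmult_sum) (auto intro!: symb_riesz \<psi>)
  ultimately show ?thesis by simp
qed

text \<open>The operator is transposed onto the test function, where it produces a function that is not Schwartz.  Its
  dyadic pieces have summable \<open>L\<^sup>1\<close> norms, so that for bounded \<open>u\<close> the sum may be taken out of the pairing;
  each piece is then a dyadic block of \<open>u\<close> tested with a function of norm at most a multiple of \<open>2\<^sup>j\<^sup>\<alpha>\<close>.\<close>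

lemma dnorm_frac_lap:
  assumes \<alpha>: "0 < \<alpha>" "\<alpha> < 2"
  obtains C where "C > 0"
    "\<And>u M. pairable u \<Longrightarrow> lin (pairing u) \<Longrightarrow> AE x in lborel. norm (u x) \<le> M \<Longrightarrow>
       dnorm (frac_lap \<alpha> (pairing u)) \<le> ennreal C *
         (SUP n::nat. \<Sum>j\<in>{- int n..int n}. ennreal (2 powr (real_of_int j * \<alpha>)) * dnorm (LP_block chi j (pairing u)))"
proof -
  obtain K where K: "K > 0" "l1 (kern (powsymb \<alpha>)) \<le> ennreal K" using kern_l1_bound[OF symb_powsymb] by blast
  have "dnorm (frac_lap \<alpha> (pairing u)) \<le> ennreal K *
         (SUP n::nat. \<Sum>j\<in>{- int n..int n}. ennreal (2 powr (real_of_int j * \<alpha>)) * dnorm (LP_block chi j (pairing u)))"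
    (is "_ \<le> ennreal K * ?S")
    if u: "pairable u" "lin (pairing u)" and M: "AE x in lborel. norm (u x) \<le> M" for u M
  proof (rule dnorm_leI)
    fix \<psi> :: "real^'n \<Rightarrow> complex" assume \<psi>: "schwartz \<psi>" "l1 \<psi> \<le> 1"
    define e where "e = (\<lambda>j. fmult (riesz \<alpha> j) \<psi>)"
    have es: "schwartz (e j)" for j unfolding e_def by (intro schwartz_fmult symb_riesz \<psi>)
    have [measurable]: "e j \<in> borel_measurable borel" for j by (rule schwartz_measurable[OF es])
    have [measurable]: "u \<in> borel_measurable borel" by (rule pairable_measurable[OF u(1)])
    obtain B q where q: "0 < q" "q < 1" "B \<ge> 0" "\<And>j. l1 (e j) \<le> ennreal (B * q ^ nat \<bar>j\<bar>)"
      unfolding e_def using l1_fmult_riesz_summable[OF \<alpha> \<psi>(1)] by blast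
    define D where "D = (\<lambda>x. SUP n::nat. \<Sum>j\<in>{- int n..int n}. ennreal (norm (e j x)))"
    have [measurable]: "D \<in> borel_measurable borel" unfolding D_def by measurable
    have inc: "incseq (\<lambda>n::nat. \<Sum>j\<in>{- int n..int n}. ennreal (norm (e j x)))" for x
      by (intro incseq_SucI sum_mono2) auto
    have "(\<integral>\<^sup>+x. D x \<partial>lborel) = (SUP n::nat. (\<integral>\<^sup>+x. (\<Sum>j\<in>{- int n..int n}. ennreal (norm (e j x))) \<partial>lborel))"
      unfolding D_def by (rule nn_integral_monotone_convergence_SUP) (use inc in \<open>auto simp: incseq_def le_fun_def\<close>)
    also have "\<dots> = (SUP n::nat. \<Sum>j\<in>{- int n..int n}. l1 (e j))"
      unfolding l1_def by (subst nn_integral_sum) auto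
    also have "\<dots> \<le> ennreal (B * (2 / (1 - q)))"
    proof (rule SUP_least)
      fix n :: nat
      have "(\<Sum>j\<in>{- int n..int n}. l1 (e j)) \<le> (\<Sum>j\<in>{- int n..int n}. ennreal (B * q ^ nat \<bar>j\<bar>))"
        by (intro sum_mono q)
      also have "\<dots> = ennreal (B * (\<Sum>j\<in>{- int n..int n}. q ^ nat \<bar>j\<bar>))"
        using q by (subst sum_ennreal) (auto simp: sum_distrib_left)
      also have "\<dots> \<le> ennreal (B * (2 / (1 - q)))"
        using q by (intro ennreal_leI mult_left_mono sum_geometric_two_sided) auto
      finally show "(\<Sum>j\<in>{- int n..int n}. l1 (e j)) \<le> ennreal (B * (2 / (1 - q)))" .
    qed
    also have "\<dots> < \<infinity>" by simp
    finally have Dfin: "(\<integral>\<^sup>+x. D x \<partial>lborel) < \<infinity>" .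
    then have Dae: "AE x in lborel. D x < \<infinity>"
      using nn_integral_PInf_AE[of D lborel] by (auto simp: less_top)
    have Dint: "integrable lborel (\<lambda>x. \<bar>M\<bar> * enn2real (D x))"
    proof (intro integrable_mult_right integrableI_bounded)
      have "(\<integral>\<^sup>+x. ennreal (norm (enn2real (D x))) \<partial>lborel) \<le> (\<integral>\<^sup>+x. D x \<partial>lborel)"
        by (intro nn_integral_mono) (simp add: ennreal_enn2real_if)
      then show "(\<integral>\<^sup>+x. ennreal (norm (enn2real (D x))) \<partial>lborel) < \<infinity>" using Dfin by simp
    qed measurable
    let ?G = "fmult (\<lambda>\<xi>. norm \<xi> powr \<alpha>) \<psi>"
    have Gm: "?G \<in> borel_measurable borel"
    proof (rule borel_measurable_LIMSEQ_metric)
      show "(\<lambda>x. \<Sum>j\<in>{- int n..int n}. e j x) \<in> borel_measurable borel" for n by measurable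
      show "(\<lambda>n. \<Sum>j\<in>{- int n..int n}. e j x) \<longlonglongrightarrow> ?G x" for x
        unfolding e_def by (rule fmult_riesz_sum_tendsto[OF \<alpha> \<psi>(1)])
    qed
    have lim: "(\<lambda>n. LINT x|lborel. u x * (\<Sum>j\<in>{- int n..int n}. e j x)) \<longlonglongrightarrow> (LINT x|lborel. u x * ?G x)"
    proof (rule integral_dominated_convergence[where w = "\<lambda>x. \<bar>M\<bar> * enn2real (D x)", OF _ _ Dint])
      show "AE x in lborel. (\<lambda>n. u x * (\<Sum>j\<in>{- int n..int n}. e j x)) \<longlonglongrightarrow> u x * ?G x"
        unfolding e_def by (intro AE_I2 tendsto_intros fmult_riesz_sum_tendsto[OF \<alpha> \<psi>(1)])
      show "AE x in lborel. norm (u x * (\<Sum>j\<in>{- int n..int n}. e j x)) \<le> \<bar>M\<bar> * enn2real (D x)" for n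
        using M Dae
      proof eventually_elim
        fix x assume x: "norm (u x) \<le> M" "D x < \<infinity>"
        have "ennreal (\<Sum>j\<in>{- int n..int n}. norm (e j x)) \<le> D x"
          unfolding D_def by (subst sum_ennreal[symmetric]) (auto intro!: SUP_upper)
        then have "(\<Sum>j\<in>{- int n..int n}. norm (e j x)) \<le> enn2real (D x)"
          using x(2) by (cases "D x") (auto simp: sum_nonneg)
        then have "norm (\<Sum>j\<in>{- int n..int n}. e j x) \<le> enn2real (D x)"
          by (rule order_trans[OF norm_sum])
        then show "norm (u x * (\<Sum>j\<in>{- int n..int n}. e j x)) \<le> \<bar>M\<bar> * enn2real (D x)"
          unfolding norm_mult using x(1) by (intro mult_mono) auto
      qed
      show "(\<lambda>x. u x * ?G x) \<in> borel_measurable lborel" using Gm by simp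
      show "(\<lambda>x. u x * (\<Sum>j\<in>{- int n..int n}. e j x)) \<in> borel_measurable lborel" for n by measurable
    qed
    have bnd: "ennreal (norm (LINT x|lborel. u x * (\<Sum>j\<in>{- int n..int n}. e j x))) \<le> ennreal K * ?S" for n
    proof -
      have "(LINT x|lborel. u x * (\<Sum>j\<in>{- int n..int n}. e j x)) = (\<Sum>j\<in>{- int n..int n}. pairing u (e j))"
        unfolding pairing_def sum_distrib_left
        by (intro Bochner_Integration.integral_sum) (use u(1) es in \<open>auto simp: pairable_def\<close>)
      then have "ennreal (norm (LINT x|lborel. u x * (\<Sum>j\<in>{- int n..int n}. e j x))) \<le> ennreal (\<Sum>j\<in>{- int n..int n}. norm (pairing u (e j)))"
        by (simp add: ennreal_leI norm_sum)
      also have "\<dots> = (\<Sum>j\<in>{- int n..int n}. ennreal (norm (pairing u (e j))))" by (simp add: sum_ennreal)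
      also have "\<dots> \<le> (\<Sum>j\<in>{- int n..int n}. ennreal K * (ennreal (2 powr (real_of_int j * \<alpha>)) * dnorm (LP_block chi j (pairing u))))"
      proof (rule sum_mono)
        fix j
        let ?n = "\<lambda>\<xi>. 2 powr (real_of_int j * \<alpha>) * dil j (powsymb \<alpha>) \<xi>"
        have n: "symb ?n" by (intro symb_cmult symb_dil symb_powsymb)
        have "pairing u (e j) = LP_block chi j (pairing u) (fmult ?n \<psi>)"
          unfolding e_def riesz_eq by (rule LP_block_fmult[OF n \<psi>(1)])
        then have "ennreal (norm (pairing u (e j))) \<le> ennreal (K * 2 powr (real_of_int j * \<alpha>)) * dnorm (LP_block chi j (pairing u))"
          using dnorm_bound[OF lin_LP_block[OF u(2)] schwartz_fmult[OF n \<psi>(1)], of "K * 2 powr (real_of_int j * \<alpha>)" j]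
            l1_fmult_dil[OF symb_powsymb K(2) _ \<psi>(1), of 1 "2 powr (real_of_int j * \<alpha>)" j] K(1) \<psi>(2)
          by (simp add: mult.commute)
        then show "ennreal (norm (pairing u (e j))) \<le> ennreal K * (ennreal (2 powr (real_of_int j * \<alpha>)) * dnorm (LP_block chi j (pairing u)))"
          using K by (simp add: ennreal_mult' mult.assoc)
      qed
      also have "\<dots> = ennreal K * (\<Sum>j\<in>{- int n..int n}. ennreal (2 powr (real_of_int j * \<alpha>)) * dnorm (LP_block chi j (pairing u)))"
        by (rule sum_distrib_left[symmetric])
      also have "\<dots> \<le> ennreal K * ?S" by (intro mult_left_mono SUP_upper) auto
      finally show ?thesis .
    qed
    have "(\<lambda>n. ennreal (norm (LINT x|lborel. u x * (\<Sum>j\<in>{- int n..int n}. e j x)))) \<longlonglongrightarrow> ennreal (norm (LINT x|lborel. u x * ?G x))"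
      by (intro tendsto_ennrealI tendsto_norm lim)
    then have "ennreal (norm (LINT x|lborel. u x * ?G x)) \<le> ennreal K * ?S"
      by (rule LIMSEQ_le_const2) (use bnd in auto)
    then show "ennreal (norm (frac_lap \<alpha> (pairing u) \<psi>)) \<le> ennreal K * ?S"
      by (simp add: frac_lap_def multiplier_eq pairing_def)
  qed
  then show ?thesis using that K by blast
qed

end

section \<open>From weak bounds to pointwise bounds\<close>

definition loc_integrable :: "('a::euclidean_space \<Rightarrow> real) \<Rightarrow> bool" where
  "loc_integrable f \<longleftrightarrow> (\<forall>R. integrable lborel (\<lambda>x. indicator (cball 0 R) x * f x))"

lemma loc_integrable_measurable:
  fixes f :: "'a::euclidean_space \<Rightarrow> real"
  assumes "loc_integrable f" shows "f \<in> borel_measurable borel"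
proof (rule borel_measurable_LIMSEQ_metric)
  show "(\<lambda>x. indicator (cball 0 (real n)) x * f x) \<in> borel_measurable borel" for n
    using borel_measurable_integrable[OF assms[unfolded loc_integrable_def, rule_format, of "real n"]] by simp
  fix x :: 'a
  obtain N :: nat where N: "norm x \<le> real N" using real_arch_simple by blast
  have "\<forall>\<^sub>F n in sequentially. indicator (cball 0 (real n)) x * f x = f x"
    using eventually_ge_at_top[of N] by eventually_elim (use N in \<open>auto simp: indicator_def\<close>)
  then show "(\<lambda>n. indicator (cball 0 (real n)) x * f x) \<longlonglongrightarrow> f x" by (rule tendsto_eventually)
qed

lemma loc_integrable_times:
  fixes f g :: "'a::euclidean_space \<Rightarrow> real"
  assumes f: "loc_integrable f" and g: "g \<in> borel_measurable borel" "\<And>x. \<bar>g x\<bar> \<le> B" "\<And>x. norm x > R \<Longrightarrow> g x = 0"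
  shows "integrable lborel (\<lambda>x. f x * g x)"
proof (rule Bochner_Integration.integrable_bound)
  show "integrable lborel (\<lambda>x. B * norm (indicator (cball 0 R) x * f x))"
    using f by (auto simp: loc_integrable_def)
  show "(\<lambda>x. f x * g x) \<in> borel_measurable lborel"
    using loc_integrable_measurable[OF f] g(1) by simp
  show "AE x in lborel. norm (f x * g x) \<le> norm (B * norm (indicator (cball 0 R) x * f x))"
  proof (intro AE_I2)
    fix x
    show "norm (f x * g x) \<le> norm (B * norm (indicator (cball 0 R) x * f x))"
      using mult_right_mono[OF order_trans[OF g(2)[of x] abs_ge_self] abs_ge_zero[of "f x"]] g(3)[of x]
      by (cases "norm x \<le> R") (auto simp: abs_mult mult.commute)
  qed
qed

lemma loc_integrable_translate:
  fixes f :: "'a::euclidean_space \<Rightarrow> real"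
  assumes f: "loc_integrable f"
  shows "loc_integrable (\<lambda>x. f (x + y))"
  unfolding loc_integrable_def
proof
  fix R
  have [measurable]: "f \<in> borel_measurable borel" by (rule loc_integrable_measurable[OF f])
  have "integrable lborel (\<lambda>x. indicator (cball 0 (R + norm y)) (x + y) * f (x + y))"
    using f by (intro integrable_translate(1)) (auto simp: loc_integrable_def)
  then show "integrable lborel (\<lambda>x. indicator (cball 0 R) x * f (x + y))"
  proof (rule Bochner_Integration.integrable_bound)
    show "AE x in lborel. norm (indicator (cball 0 R) x * f (x + y)) \<le> norm (indicator (cball 0 (R + norm y)) (x + y) * f (x + y))"
    proof (intro AE_I2)
      fix x
      have "norm (x + y) \<le> norm x + norm y" by (rule norm_triangle_ineq)
      then show "norm (indicator (cball 0 R) x * f (x + y)) \<le> norm (indicator (cball 0 (R + norm y)) (x + y) * f (x + y))"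
        by (auto simp: indicator_def)
    qed
    have "(\<lambda>x. f (x + y)) \<in> borel_measurable borel" by measurable
    then show "(\<lambda>x. indicator (cball 0 R) x * f (x + y)) \<in> borel_measurable lborel"
      by (intro borel_measurable_times borel_measurable_indicator) auto
  qed
qed

lemma loc_integrable_diff:
  "loc_integrable f \<Longrightarrow> loc_integrable g \<Longrightarrow> loc_integrable (\<lambda>x. f x - g x)"
  by (simp add: loc_integrable_def right_diff_distrib)

lemma loc_integrable_minus: "loc_integrable f \<Longrightarrow> loc_integrable (\<lambda>x. - f x)"
  by (simp add: loc_integrable_def)

text \<open>Regularity of Lebesgue measure: a bound on the averages over compact sets is a bound almost
  everywhere.\<close>

lemma ae_le_of_compact_averages:
  fixes f :: "'a::euclidean_space \<Rightarrow> real"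
  assumes f: "loc_integrable f"
    and K: "\<And>K. compact K \<Longrightarrow> (LINT x|lborel. indicator K x * f x) \<le> C * measure lborel K"
  shows "AE x in lborel. f x \<le> C"
proof -
  have [measurable]: "f \<in> borel_measurable borel" by (rule loc_integrable_measurable[OF f])
  have "AE x in lborel. \<not> (norm x \<le> real n \<and> f x > C)" for n
  proof (rule ccontr)
    assume not: "\<not> (AE x in lborel. \<not> (norm x \<le> real n \<and> f x > C))"
    define E where "E = {x. norm x \<le> real n \<and> f x > C}"
    have Em: "E \<in> sets borel" unfolding E_def by measurable
    have E0: "emeasure lborel E > 0"
    proof (rule ccontr)
      assume "\<not> emeasure lborel E > 0"
      then have "E \<in> null_sets lborel" using Em by (auto simp: null_sets_def)
      then have "AE x in lborel. x \<notin> E" by (rule AE_not_in)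
      then show False using not by (simp add: E_def)
    qed
    obtain e where e: "e > 0" "ennreal e \<le> emeasure lborel E"
    proof -
      have "E \<subseteq> cball 0 (real n)" by (auto simp: E_def)
      then have "emeasure lborel E < \<infinity>"
        using emeasure_mono[of E "cball 0 (real n)" lborel] emeasure_lborel_cball_finite[of "0::'a" "real n"] by auto
      then show ?thesis using E0 that[of "enn2real (emeasure lborel E)"] by (auto simp: enn2real_positive_iff)
    qed
    obtain T where T: "closed T" "T \<subseteq> E" "emeasure lebesgue (E - T) < ennreal e"
    proof (rule sets_lebesgue_inner_closed)
      show "E \<in> sets lebesgue" using Em by simp
      show "e > 0" by (rule e)
    qed (rule that)
    have "bounded T" using T(2) by (auto simp: E_def bounded_iff)
    then have cT: "compact T" using T(1) by (simp add: compact_eq_bounded_closed)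
    have Tm: "T \<in> sets borel" using T(1) by auto
    have T0: "emeasure lborel T \<noteq> 0"
    proof
      assume "emeasure lborel T = 0"
      then have "emeasure lborel (E - T) = emeasure lborel E"
        using Em Tm by (intro emeasure_Diff_null_set) (auto simp: null_sets_def)
      then show False using T(3) e Em Tm by (simp add: emeasure_completion)
    qed
    have int: "integrable lborel (\<lambda>x. indicator T x * f x)"
    proof -
      have "integrable lborel (\<lambda>x. f x * indicator T x)"
        using T(2) Tm by (intro loc_integrable_times[OF f, where B = 1 and R = "real n"]) (auto simp: E_def indicator_def)
      then show ?thesis by (simp add: mult.commute)
    qed
    have fin: "emeasure lborel T < \<infinity>" using cT by (rule emeasure_compact_finite)
    have iC: "integrable lborel (\<lambda>x. C * indicator T x)"
      using Tm fin by (intro integrable_mult_right) (simp add: integrable_indicator_iff)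
    let ?g = "\<lambda>x. indicator T x * f x - C * indicator T x"
    have ig: "integrable lborel ?g" using int iC by simp
    have "integral\<^sup>L lborel ?g = (LINT x|lborel. indicator T x * f x) - C * measure lborel T"
      using int iC Tm fin by simp
    then have "integral\<^sup>L lborel ?g \<le> 0" using K[OF cT] by simp
    moreover have nn: "AE x in lborel. 0 \<le> ?g x" using T(2) by (intro AE_I2) (auto simp: E_def indicator_def)
    ultimately have "integral\<^sup>L lborel ?g = 0" using integral_nonneg_AE[OF nn] by simp
    then have "AE x in lborel. ?g x = 0" using integral_nonneg_eq_0_iff_AE[OF ig nn] by simp
    then have "AE x in lborel. x \<notin> T"
      by eventually_elim (use T(2) in \<open>auto simp: E_def indicator_def\<close>)
    then have "T \<in> null_sets lborel" using Tm by (simp add: AE_iff_null_sets)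
    then show False using T0 by auto
  qed
  then have "AE x in lborel. \<forall>n::nat. \<not> (norm x \<le> real n \<and> f x > C)" by (intro AE_all_countable[THEN iffD2] allI)
  then show ?thesis
  proof eventually_elim
    fix x assume H: "\<forall>n::nat. \<not> (norm x \<le> real n \<and> f x > C)"
    obtain N :: nat where "norm x \<le> real N" using real_arch_simple by blast
    then show "f x \<le> C" using H[rule_format, of N] by linarith
  qed
qed

text \<open>Fubini for null sets: the Lipschitz bounds hold for every shift outside a null set that depends on the shift,
  while the principal value needs them for almost every shift at a fixed point.\<close>

lemma AE_AE_commute:
  fixes P :: "'a::euclidean_space \<Rightarrow> 'b::euclidean_space \<Rightarrow> bool"
  assumes m: "Measurable.pred (borel \<Otimes>\<^sub>M borel) (\<lambda>z. P (fst z) (snd z))" and ae: "\<And>y. AE x in lborel. P x y"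
  shows "AE x in lborel. AE y in lborel. P x y"
proof -
  have s: "{z \<in> space (lborel \<Otimes>\<^sub>M lborel). P (fst z) (snd z)} \<in> sets (lborel \<Otimes>\<^sub>M lborel)"
    using m[unfolded pred_def] by (simp add: space_pair_measure sets_pair_measure_cong[OF sets_lborel sets_lborel])
  show ?thesis
    unfolding lborel_pair.AE_commute[OF s] using ae by simp
qed

context littlewood_paley
begin

text \<open>The square makes the mollifier nonnegative, a sign that \<open>chi\<close> itself need not have.\<close>

definition bump :: "real^'n \<Rightarrow> real" where
  "bump x = chi x * chi x / (LINT y|lborel. chi y * chi y)"

definition moll :: "real \<Rightarrow> real^'n \<Rightarrow> real^'n \<Rightarrow> real" where
  "moll \<epsilon> a x = (1 / \<epsilon>) ^ CARD('n) * bump ((1 / \<epsilon>) *\<^sub>R (x - a))"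

lemma chi_sq_integrable: "integrable lborel (\<lambda>x. chi x * chi x)"
proof -
  have "integrable lborel (\<lambda>x. complex_of_real (chi x * chi x))"
    by (intro schwartz_integrable symb_schwartz symb_times chi_smooth chi_symb)
  then show ?thesis by (simp only: complex_of_real_integrable_eq)
qed

lemma chi_sq_mass: "(LINT x|lborel. chi x * chi x) > 0"
proof -
  have "0 < measure lborel (ball (0::real^'n) (3/4))" by (rule content_ball_pos) simp
  also have "\<dots> = (LINT x|lborel. indicator (ball (0::real^'n) (3/4)) x)" by simp
  also have "\<dots> \<le> (LINT x|lborel. chi x * chi x)"
    using emeasure_lborel_ball_finite[of "0::real^'n" "3/4"]
    by (intro integral_mono chi_sq_integrable integrable_real_indicator) (auto simp: indicator_def chi_in)
  finally show ?thesis .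
qed

lemma bump_nonneg: "bump x \<ge> 0"
  unfolding bump_def using chi_sq_mass by simp

lemma bump_mass: "(LINT x|lborel. bump x) = 1"
  unfolding bump_def using chi_sq_mass by simp

lemma bump_symb: "symb bump"
proof -
  have "symb (\<lambda>x. (1 / (LINT y|lborel. chi y * chi y)) * (chi x * chi x))"
    by (intro symb_cmult symb_times chi_smooth chi_symb)
  then show ?thesis by (simp add: bump_def[abs_def])
qed

lemma bump_out: "norm x > 4/3 \<Longrightarrow> bump x = 0"
  by (simp add: bump_def chi_out)

lemma bump_bounded: obtains B where "B \<ge> 0" "\<And>x. bump x \<le> B"
  using symb_bounded[OF bump_symb] by (metis abs_ge_self abs_ge_zero order_trans)

lemma bump_measurable [measurable]: "bump \<in> borel_measurable borel"
  by (intro borel_measurable_continuous_onI smooth_continuous symb_smooth bump_symb)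

lemma bump_integrable: "integrable lborel bump"
proof -
  have "integrable lborel (\<lambda>x. complex_of_real (bump x))"
    by (intro schwartz_integrable symb_schwartz bump_symb)
  then show ?thesis by (simp only: complex_of_real_integrable_eq)
qed

lemma moll_nonneg: "\<epsilon> > 0 \<Longrightarrow> moll \<epsilon> a x \<ge> 0"
  unfolding moll_def using bump_nonneg by simp

lemma moll_measurable [measurable]: "moll \<epsilon> a \<in> borel_measurable borel"
  unfolding moll_def by measurable

lemma moll_out: "\<epsilon> > 0 \<Longrightarrow> norm (x - a) > 4/3 * \<epsilon> \<Longrightarrow> moll \<epsilon> a x = 0"
proof -
  assume "\<epsilon> > 0" "norm (x - a) > 4/3 * \<epsilon>"
  moreover have "norm ((1 / \<epsilon>) *\<^sub>R (x - a)) = norm (x - a) / \<epsilon>"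
    unfolding norm_scaleR using \<open>\<epsilon> > 0\<close> by simp
  ultimately have "norm ((1 / \<epsilon>) *\<^sub>R (x - a)) > 4/3" by (simp only: pos_less_divide_eq)
  then show ?thesis unfolding moll_def by (subst bump_out) auto
qed

lemma moll_le: "\<epsilon> > 0 \<Longrightarrow> (\<And>x. bump x \<le> B) \<Longrightarrow> moll \<epsilon> a x \<le> (1 / \<epsilon>) ^ CARD('n) * B"
  unfolding moll_def by (intro mult_left_mono) auto

lemma smooth_moll: "smooth (moll \<epsilon> a)"
  unfolding moll_def[abs_def]
  by (intro smooth_mult smooth_const smooth_translate[of "\<lambda>x. bump ((1 / \<epsilon>) *\<^sub>R x)"] smooth_dilate symb_smooth bump_symb)

lemma symb_moll:
  assumes "\<epsilon> > 0" shows "symb (moll \<epsilon> a)"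
  unfolding symb_def
proof (intro conjI smooth_moll exI[of _ "norm a + 4/3 * \<epsilon>"] allI impI)
  fix x :: "real^'n" assume "norm a + 4/3 * \<epsilon> < norm x"
  then have "norm (x - a) > 4/3 * \<epsilon>" using norm_triangle_ineq2[of x a] by linarith
  then show "moll \<epsilon> a x = 0" by (rule moll_out[OF assms])
qed

lemma schwartz_moll: "\<epsilon> > 0 \<Longrightarrow> schwartz (\<lambda>x. complex_of_real (moll \<epsilon> a x))"
  by (intro symb_schwartz symb_moll)

lemma moll_mass: 
  assumes \<epsilon>: "\<epsilon> > 0" shows "(LINT x|lborel. moll \<epsilon> a x) = 1"
proof -
  have "1 = (LINT x|lborel. bump x)" by (simp add: bump_mass)
  also have "\<dots> = \<bar>1/\<epsilon>\<bar> ^ DIM(real^'n) *\<^sub>R (LINT x|lborel. bump (- ((1/\<epsilon>) *\<^sub>R a) + (1/\<epsilon>) *\<^sub>R x))"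
    by (rule integral_affine) (use \<epsilon> in auto)
  also have "\<dots> = (LINT x|lborel. moll \<epsilon> a x)"
    using \<epsilon> by (simp add: moll_def scaleR_diff_right)
  finally show ?thesis by simp
qed

lemma moll_integrable: "\<epsilon> > 0 \<Longrightarrow> integrable lborel (moll \<epsilon> a)"
  using schwartz_integrable[OF schwartz_moll] by (simp only: complex_of_real_integrable_eq)

lemma l1_moll: 
  assumes \<epsilon>: "\<epsilon> > 0" shows "l1 (\<lambda>x. complex_of_real (moll \<epsilon> a x)) = 1"
proof -
  have "l1 (\<lambda>x. complex_of_real (moll \<epsilon> a x)) = (\<integral>\<^sup>+x. ennreal (moll \<epsilon> a x) \<partial>lborel)"
    unfolding l1_def using moll_nonneg[OF \<epsilon>] by simp
  also have "\<dots> = ennreal (LINT x|lborel. moll \<epsilon> a x)"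
    by (intro nn_integral_eq_integral moll_integrable \<epsilon>) (simp add: moll_nonneg \<epsilon>)
  finally show ?thesis by (simp add: moll_mass \<epsilon>)
qed

lemma loc_integrable_moll:
  assumes f: "loc_integrable f" and \<epsilon>: "\<epsilon> > 0"
  shows "integrable lborel (\<lambda>x. f x * moll \<epsilon> a x)"
proof -
  obtain B where B: "B \<ge> 0" "\<And>x. bump x \<le> B" using bump_bounded by blast
  show ?thesis
  proof (rule loc_integrable_times[OF f, where R = "norm a + 4/3 * \<epsilon>" and B = "(1 / \<epsilon>) ^ CARD('n) * B"])
    show "\<bar>moll \<epsilon> a x\<bar> \<le> (1 / \<epsilon>) ^ CARD('n) * B" for x
      using moll_le[OF \<epsilon> B(2)] moll_nonneg[OF \<epsilon>] by simp
    fix x :: "real^'n" assume "norm x > norm a + 4/3 * \<epsilon>"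
    then have "norm (x - a) > 4/3 * \<epsilon>" using norm_triangle_ineq2[of x a] by linarith
    then show "moll \<epsilon> a x = 0" by (rule moll_out[OF \<epsilon>])
  qed measurable
qed

text \<open>A dilated cutoff is a Schwartz function that equals 1 on a given ball.\<close>

lemma rpairable_loc_integrable:
  assumes f: "rpairable (f :: real^'n \<Rightarrow> real)"
  shows "loc_integrable f"
  unfolding loc_integrable_def
proof
  fix R :: real
  define r where "r = \<bar>R\<bar> + 1"
  have r: "r > 0" by (simp add: r_def)
  have "schwartz (\<lambda>x. complex_of_real (chi ((1 / (2 * r)) *\<^sub>R x)))"
    using r by (intro symb_schwartz symb_dilate chi_symb) auto
  then have "integrable lborel (\<lambda>x. complex_of_real (f x) * complex_of_real (chi ((1 / (2 * r)) *\<^sub>R x)))"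
    using f by (auto simp: pairable_def)
  then have i: "integrable lborel (\<lambda>x. f x * chi ((1 / (2 * r)) *\<^sub>R x))"
    by (simp only: of_real_mult[symmetric] complex_of_real_integrable_eq)
  have "(\<lambda>x. indicator (cball 0 R) x * (f x * chi ((1 / (2 * r)) *\<^sub>R x))) = (\<lambda>x. indicator (cball 0 R) x * f x)"
  proof
    fix x :: "real^'n"
    have "chi ((1 / (2 * r)) *\<^sub>R x) = 1" if "norm x \<le> R"
    proof (rule chi_in)
      have "norm x < 2 * r * (3/4)" using that r by (simp add: r_def)
      then show "norm ((1 / (2 * r)) *\<^sub>R x) < 3/4" using r by (simp add: field_simps)
    qed
    then show "indicator (cball 0 R) x * (f x * chi ((1 / (2 * r)) *\<^sub>R x)) = indicator (cball 0 R) x * f x"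
      by (auto simp: indicator_def)
  qed
  moreover have "integrable lborel (\<lambda>x. indicator (cball 0 R) x *\<^sub>R (f x * chi ((1 / (2 * r)) *\<^sub>R x)))"
    by (rule integrable_mult_indicator[OF _ i]) simp
  ultimately show "integrable lborel (\<lambda>x. indicator (cball 0 R) x * f x)" by simp
qed

text \<open>Integrating the bound on the mollifications against a continuous \<open>g \<ge> 0\<close> and letting the scale
  tend to 0 tests \<open>f\<close> against \<open>g\<close> itself.\<close>

lemma continuous_test_of_moll:
  fixes f g :: "real^'n \<Rightarrow> real"
  assumes f: "loc_integrable f"
    and C: "\<And>\<epsilon> a. 0 < \<epsilon> \<Longrightarrow> \<epsilon> \<le> 1 \<Longrightarrow> (LINT x|lborel. f x * moll \<epsilon> a x) \<le> C"
    and C0: "C \<ge> 0"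
    and g: "\<And>x. isCont g x" "\<And>x. 0 \<le> g x" "\<And>x. g x \<le> M" "\<And>x. norm x > R \<Longrightarrow> g x = 0"
  shows "(LINT x|lborel. f x * g x) \<le> C * (LINT x|lborel. g x)"
proof -
  obtain B where B: "B \<ge> 0" "\<And>x. bump x \<le> B" using bump_bounded by blast
  have M0: "M \<ge> 0" using g(2,3)[of 0] by linarith
  have [measurable]: "f \<in> borel_measurable borel" by (rule loc_integrable_measurable[OF f])
  have [measurable]: "g \<in> borel_measurable borel"
    using g(1) by (intro borel_measurable_continuous_onI) (simp add: continuous_at_imp_continuous_on)
  have gi: "integrable lborel g"
  proof -
    have "loc_integrable (\<lambda>x::real^'n. 1)"
      unfolding loc_integrable_def using emeasure_lborel_cball_finite[of "0::real^'n"] by (auto simp: integrable_indicator_iff)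
    from loc_integrable_times[OF this, of g M R] show ?thesis using g by auto
  qed
  define gm where "gm = (\<lambda>\<epsilon> x. LINT z|lborel. bump z * g (x - \<epsilon> *\<^sub>R z))"
  have gm_eq: "gm \<epsilon> x = (LINT a|lborel. g a * moll \<epsilon> a x)" if \<epsilon>: "\<epsilon> > 0" for \<epsilon> x
  proof -
    have "(LINT a|lborel. g a * moll \<epsilon> a x) = \<bar>- \<epsilon>\<bar> ^ DIM(real^'n) *\<^sub>R (LINT z|lborel. g (x + (- \<epsilon>) *\<^sub>R z) * moll \<epsilon> (x + (- \<epsilon>) *\<^sub>R z) x)"
      by (rule integral_affine) (use \<epsilon> in \<open>auto simp: moll_def\<close>)
    also have "\<dots> = (LINT z|lborel. \<epsilon> ^ CARD('n) * (g (x - \<epsilon> *\<^sub>R z) * ((1 / \<epsilon>) ^ CARD('n) * bump z)))"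
      using \<epsilon> by (simp add: moll_def)
    also have "\<dots> = gm \<epsilon> x"
      unfolding gm_def using \<epsilon> by (intro Bochner_Integration.integral_cong refl) (simp add: power_divide)
    finally show ?thesis by simp
  qed
  have gm_bound: "\<bar>gm \<epsilon> x\<bar> \<le> M" for \<epsilon> x
  proof -
    have "norm (gm \<epsilon> x) \<le> (LINT z|lborel. norm (bump z * g (x - \<epsilon> *\<^sub>R z)))"
      unfolding gm_def by (rule integral_norm_bound)
    also have "\<dots> \<le> (LINT z|lborel. bump z * M)"
      using bump_nonneg g by (intro integral_mono_AE' AE_I2 integrable_mult_left bump_integrable) (auto simp: abs_mult intro!: mult_left_mono mult_nonneg_nonneg M0)
    also have "\<dots> = M" using bump_mass by simp
    finally show ?thesis by simp
  qed
  have gm_out: "gm \<epsilon> x = 0" if "norm x > R + 4/3" "0 < \<epsilon>" "\<epsilon> \<le> 1" for \<epsilon> x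
  proof -
    have "bump z * g (x - \<epsilon> *\<^sub>R z) = 0" for z
    proof (cases "norm z > 4/3")
      case False
      have "\<epsilon> * norm z \<le> 1 * (4/3)" using that False by (intro mult_mono) auto
      then have "norm (x - \<epsilon> *\<^sub>R z) > R" using that norm_triangle_ineq2[of x "\<epsilon> *\<^sub>R z"] by simp
      then show ?thesis using g(4) by simp
    qed (simp add: bump_out)
    then show ?thesis unfolding gm_def by (simp only:) simp
  qed
  have main: "(LINT x|lborel. f x * gm \<epsilon> x) \<le> C * (LINT x|lborel. g x)" if \<epsilon>: "0 < \<epsilon>" "\<epsilon> \<le> 1" for \<epsilon>
  proof -
    let ?f = "\<lambda>x. indicator (cball 0 (R + 4/3)) x * f x"
    have fi: "integrable lborel ?f" using f by (auto simp: loc_integrable_def)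
    have km: "(\<lambda>(a, x). moll \<epsilon> a x) \<in> borel_measurable (lborel \<Otimes>\<^sub>M lborel)"
      unfolding moll_def by measurable
    have kb: "norm (moll \<epsilon> a x) \<le> (1 / \<epsilon>) ^ CARD('n) * B" for a x
      using moll_le[OF \<epsilon>(1) B(2)] moll_nonneg[OF \<epsilon>(1)] by simp
    have cut1: "g a * (f x * moll \<epsilon> a x) = g a * (?f x * moll \<epsilon> a x)" for a x
    proof (cases "norm x \<le> R + 4/3")
      case False
      have "g a = 0 \<or> moll \<epsilon> a x = 0"
      proof (cases "norm a > R")
        case False2: False
        have "norm (x - a) > 4/3" using False False2 norm_triangle_ineq2[of x a] by linarith
        then have "norm (x - a) > 4/3 * \<epsilon>" using \<epsilon> by linarith
        then show ?thesis using moll_out[OF \<epsilon>(1)] by simp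
      qed (use g(4) in auto)
      then show ?thesis by auto
    qed (simp add: indicator_def)
    have "(LINT x|lborel. f x * gm \<epsilon> x) = (LINT x|lborel. ?f x * gm \<epsilon> x)"
      using gm_out[OF _ \<epsilon>] by (intro Bochner_Integration.integral_cong refl) (auto simp: indicator_def not_le)
    also have "\<dots> = (LINT x|lborel. ?f x * (LINT a|lborel. g a * moll \<epsilon> a x))"
      by (simp add: gm_eq[OF \<epsilon>(1)])
    also have "\<dots> = (LINT a|lborel. g a * (LINT x|lborel. ?f x * moll \<epsilon> a x))"
      by (rule integral_swap_mult[OF gi fi km kb, symmetric])
    also have "\<dots> = (LINT a|lborel. g a * (LINT x|lborel. f x * moll \<epsilon> a x))"
      unfolding integral_mult_right_zero[symmetric] cut1 ..
    also have "\<dots> \<le> (LINT a|lborel. C * g a)"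
    proof (rule integral_mono')
      show "integrable lborel (\<lambda>a. C * g a)" using gi by simp
      show "g a * (LINT x|lborel. f x * moll \<epsilon> a x) \<le> C * g a" for a
        using mult_left_mono[OF C[OF \<epsilon>, of a] g(2)[of a]] by (simp add: mult.commute)
      show "0 \<le> C * g a" for a using C0 g(2) by simp
    qed
    finally show ?thesis by simp
  qed
  have e0: "(\<lambda>n. 1 / real (Suc n)) \<longlonglongrightarrow> 0" using LIMSEQ_inverse_real_of_nat by (simp add: inverse_eq_divide)
  have lim1: "(\<lambda>n. gm (1 / real (Suc n)) x) \<longlonglongrightarrow> g x" for x
  proof -
    have "(\<lambda>n. LINT z|lborel. bump z * g (x - (1 / real (Suc n)) *\<^sub>R z)) \<longlonglongrightarrow> (LINT z|lborel. bump z * g x)"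
    proof (rule integral_dominated_convergence[where w = "\<lambda>z. bump z * M"])
      show "AE z in lborel. (\<lambda>n. bump z * g (x - (1 / real (Suc n)) *\<^sub>R z)) \<longlonglongrightarrow> bump z * g x"
      proof (intro AE_I2 tendsto_mult tendsto_const)
        fix z :: "real^'n"
        have "(\<lambda>n. g (x - (1 / real (Suc n)) *\<^sub>R z)) \<longlonglongrightarrow> g (x - 0 *\<^sub>R z)"
          by (intro isCont_tendsto_compose[OF g(1)] tendsto_diff tendsto_scaleR e0 tendsto_const)
        then show "(\<lambda>n. g (x - (1 / real (Suc n)) *\<^sub>R z)) \<longlonglongrightarrow> g x" by simp
      qed
      show "AE z in lborel. norm (bump z * g (x - (1 / real (Suc n)) *\<^sub>R z)) \<le> bump z * M" for n
        using bump_nonneg g by (intro AE_I2) (auto simp: abs_mult intro!: mult_left_mono)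
    qed (use bump_integrable in auto)
    then show ?thesis by (simp add: gm_def bump_mass)
  qed
  have [measurable]: "gm \<epsilon> \<in> borel_measurable borel" for \<epsilon> unfolding gm_def by measurable
  have "(\<lambda>n. LINT x|lborel. f x * gm (1 / real (Suc n)) x) \<longlonglongrightarrow> (LINT x|lborel. f x * g x)"
  proof (rule integral_dominated_convergence[where w = "\<lambda>x. norm (indicator (cball 0 (R + 4/3)) x * f x) * M"])
    show "integrable lborel (\<lambda>x. norm (indicator (cball 0 (R + 4/3)) x * f x) * M)"
      using f by (intro integrable_mult_left integrable_norm) (auto simp: loc_integrable_def)
    show "AE x in lborel. (\<lambda>n. f x * gm (1 / real (Suc n)) x) \<longlonglongrightarrow> f x * g x"
      by (intro AE_I2 tendsto_mult tendsto_const lim1)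
    show "AE x in lborel. norm (f x * gm (1 / real (Suc n)) x) \<le> norm (indicator (cball 0 (R + 4/3)) x * f x) * M" for n
    proof (intro AE_I2)
      fix x
      show "norm (f x * gm (1 / real (Suc n)) x) \<le> norm (indicator (cball 0 (R + 4/3)) x * f x) * M"
        using gm_bound[of "1 / real (Suc n)" x] gm_out[of x "1 / real (Suc n)"]
        by (cases "norm x \<le> R + 4/3") (auto simp: abs_mult intro!: mult_left_mono)
    qed
  qed measurable
  then show ?thesis
    by (rule LIMSEQ_le_const2) (intro exI[of _ 0] allI impI main, auto)
qed

text \<open>The indicator of a compact set is a decreasing limit of continuous functions with compact support.\<close>

lemma ae_le_of_moll:
  fixes f :: "real^'n \<Rightarrow> real"
  assumes f: "loc_integrable f"
    and C: "\<And>\<epsilon> a. 0 < \<epsilon> \<Longrightarrow> \<epsilon> \<le> 1 \<Longrightarrow> (LINT x|lborel. f x * moll \<epsilon> a x) \<le> C"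
    and C0: "C \<ge> 0"
  shows "AE x in lborel. f x \<le> C"
proof (rule ae_le_of_compact_averages[OF f])
  fix K :: "(real^'n) set" assume K: "compact K"
  show "(LINT x|lborel. indicator K x * f x) \<le> C * measure lborel K"
  proof (cases "K = {}")
    case False
    have [measurable]: "f \<in> borel_measurable borel" by (rule loc_integrable_measurable[OF f])
    have cl: "closed K" using K by (rule compact_imp_closed)
    have [measurable]: "K \<in> sets borel" using cl by auto
    obtain R where R: "\<And>x. x \<in> K \<Longrightarrow> norm x \<le> R" using compact_imp_bounded[OF K] by (auto simp: bounded_iff)
    define g where "g = (\<lambda>n x. max 0 (1 - real (Suc n) * infdist x K))"
    have g1: "g n x = 1" if "x \<in> K" for n x using that by (simp add: g_def)
    have gout: "g n x = 0" if "norm x > R + 1" for n x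
    proof -
      have "infdist x K \<ge> 1"
        unfolding infdist_notempty[OF False]
      proof (rule cINF_greatest[OF False])
        fix y assume "y \<in> K"
        then show "1 \<le> dist x y" using that R[of y] norm_triangle_ineq2[of x y] by (simp add: dist_norm)
      qed
      then have "1 * 1 \<le> real (Suc n) * infdist x K" by (intro mult_mono) auto
      then show ?thesis by (simp add: g_def)
    qed
    have gb: "0 \<le> g n x" "g n x \<le> 1" for n x by (auto simp: g_def infdist_nonneg)
    have gc: "isCont (g n) x" for n x
      unfolding g_def by (intro continuous_intros continuous_infdist)
    have [measurable]: "g n \<in> borel_measurable borel" for n
      using gc by (intro borel_measurable_continuous_onI) (simp add: continuous_at_imp_continuous_on)
    have glim: "(\<lambda>n. g n x) \<longlonglongrightarrow> indicator K x" for x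
    proof (cases "x \<in> K")
      case True then show ?thesis by (simp add: g1)
    next
      case nK: False
      have pos: "infdist x K > 0" using nK in_closed_iff_infdist_zero[OF cl False, of x] infdist_nonneg[of x K] by linarith
      obtain N :: nat where N: "1 / infdist x K \<le> real N" using real_arch_simple by blast
      have "\<forall>\<^sub>F n in sequentially. g n x = 0"
        using eventually_ge_at_top[of N]
      proof eventually_elim
        fix n assume "N \<le> n"
        then have "1 / infdist x K \<le> real (Suc n)" using N by simp
        then have "1 \<le> real (Suc n) * infdist x K" using pos by (simp add: divide_le_eq)
        then show "g n x = 0" by (simp add: g_def)
      qed
      then show ?thesis using nK by (simp add: tendsto_eventually)
    qed
    have le: "(LINT x|lborel. f x * g n x) \<le> C * (LINT x|lborel. g n x)" for n
      by (rule continuous_test_of_moll[OF f C C0 gc gb gout])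
    have L1: "(\<lambda>n. LINT x|lborel. f x * g n x) \<longlonglongrightarrow> (LINT x|lborel. f x * indicator K x)"
    proof (rule integral_dominated_convergence[where w = "\<lambda>x. norm (indicator (cball 0 (R + 1)) x * f x)"])
      show "integrable lborel (\<lambda>x. norm (indicator (cball 0 (R + 1)) x * f x))"
        using f by (intro integrable_norm) (auto simp: loc_integrable_def)
      show "AE x in lborel. (\<lambda>n. f x * g n x) \<longlonglongrightarrow> f x * indicator K x"
        by (intro AE_I2 tendsto_mult tendsto_const glim)
      show "AE x in lborel. norm (f x * g n x) \<le> norm (indicator (cball 0 (R + 1)) x * f x)" for n
      proof (intro AE_I2)
        fix x show "norm (f x * g n x) \<le> norm (indicator (cball 0 (R + 1)) x * f x)"
          using gb[of n x] gout[of x n] by (cases "norm x \<le> R + 1") (auto simp: abs_mult mult_left_le)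
      qed
    qed measurable
    have L2: "(\<lambda>n. LINT x|lborel. g n x) \<longlonglongrightarrow> (LINT x|lborel. indicator K x)"
    proof (rule integral_dominated_convergence[where w = "\<lambda>x. indicator (cball 0 (R + 1)) x"])
      show "integrable lborel (\<lambda>x. indicator (cball (0::real^'n) (R + 1)) x :: real)"
        using emeasure_lborel_cball_finite[of "0::real^'n" "R + 1"] by (simp add: integrable_indicator_iff)
      show "AE x in lborel. (\<lambda>n. g n x) \<longlonglongrightarrow> indicator K x" by (intro AE_I2 glim)
      show "AE x in lborel. norm (g n x) \<le> indicator (cball 0 (R + 1)) x" for n
      proof (intro AE_I2)
        fix x show "norm (g n x) \<le> indicator (cball 0 (R + 1)) x"
          using gb[of n x] gout[of x n] by (cases "norm x \<le> R + 1") auto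
      qed
    qed measurable
    have "(LINT x|lborel. f x * indicator K x) \<le> C * (LINT x|lborel. indicator K x)"
      by (rule LIMSEQ_le[OF L1 tendsto_mult_left[OF L2]]) (use le in auto)
    then show ?thesis by (simp add: mult.commute)
  qed simp
qed

lemma ae_abs_le_of_moll:
  fixes f :: "real^'n \<Rightarrow> real"
  assumes f: "loc_integrable f"
    and C: "\<And>\<epsilon> a. 0 < \<epsilon> \<Longrightarrow> \<epsilon> \<le> 1 \<Longrightarrow> \<bar>LINT x|lborel. f x * moll \<epsilon> a x\<bar> \<le> C"
  shows "AE x in lborel. \<bar>f x\<bar> \<le> C"
proof -
  have C0: "C \<ge> 0" using order_trans[OF abs_ge_zero C[of 1 0]] by simp
  have "AE x in lborel. f x \<le> C" by (rule ae_le_of_moll[OF f _ C0]) (use C in \<open>auto intro: order_trans[OF abs_ge_self]\<close>)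
  moreover have "AE x in lborel. - f x \<le> C"
    by (rule ae_le_of_moll[OF loc_integrable_minus[OF f] _ C0]) (use C in \<open>auto intro: order_trans[OF abs_ge_minus_self]\<close>)
  ultimately show ?thesis by eventually_elim auto
qed

lemma rpairing_moll: "rpairing f (\<lambda>x. complex_of_real (moll \<epsilon> a x)) = complex_of_real (LINT x|lborel. f x * moll \<epsilon> a x)"
  unfolding pairing_def of_real_mult[symmetric] by (rule integral_complex_of_real)

text \<open>Mollifiers have \<open>L\<^sup>1\<close> norm 1, so they are admissible in the supremum defining \<open>dnorm\<close>.\<close>

lemma moll_le_dnorm: "\<epsilon> > 0 \<Longrightarrow> dnorm T \<le> ennreal C \<Longrightarrow> C \<ge> 0 \<Longrightarrow> norm (T (\<lambda>x. complex_of_real (moll \<epsilon> a x))) \<le> C"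
proof -
  assume \<epsilon>: "\<epsilon> > 0" and C: "dnorm T \<le> ennreal C" "C \<ge> 0"
  have "ennreal (norm (T (\<lambda>x. complex_of_real (moll \<epsilon> a x)))) \<le> dnorm T"
    unfolding dnorm_def using schwartz_moll[OF \<epsilon>] l1_moll[OF \<epsilon>] by (intro SUP_upper) auto
  then show ?thesis using C by (meson ennreal_le_iff order_trans)
qed

lemma ae_bound_of_dnorm:
  fixes f :: "real^'n \<Rightarrow> real"
  assumes f: "rpairable f" and C: "dnorm (rpairing f) \<le> ennreal C" "C \<ge> 0"
  shows "AE x in lborel. \<bar>f x\<bar> \<le> C"
proof (rule ae_abs_le_of_moll[OF rpairable_loc_integrable[OF f]])
  fix \<epsilon> :: real and a :: "real^'n" assume "0 < \<epsilon>"
  from moll_le_dnorm[OF this C, of a] show "\<bar>LINT x|lborel. f x * moll \<epsilon> a x\<bar> \<le> C"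
    by (simp add: rpairing_moll)
qed

text \<open>A function whose distributional gradient is bounded is Lipschitz: its mollifications are, with a
  constant independent of the scale.\<close>

lemma ae_lipschitz:
  fixes f :: "real^'n \<Rightarrow> real"
  assumes f: "rpairable f" and L: "\<And>k. dnorm (dist_deriv k (rpairing f)) \<le> ennreal L" "L \<ge> 0"
  shows "AE x in lborel. \<bar>f (x + y) - f x\<bar> \<le> real CARD('n) * L * norm y"
proof -
  have fl: "loc_integrable f" by (rule rpairable_loc_integrable[OF f])
  have [measurable]: "f \<in> borel_measurable borel" by (rule loc_integrable_measurable[OF fl])
  show ?thesis
  proof (rule ae_abs_le_of_moll[OF loc_integrable_diff[OF loc_integrable_translate[OF fl] fl]])
    fix \<epsilon> :: real and a :: "real^'n" assume \<epsilon>: "0 < \<epsilon>" "\<epsilon> \<le> 1"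
    define m where "m = moll \<epsilon> 0"
    have m: "smooth m" "symb m" unfolding m_def by (intro smooth_moll symb_moll \<epsilon>)+
    have mt: "moll \<epsilon> b x = m (x - b)" for b x by (simp add: m_def moll_def)
    have mo: "m z = 0" if "norm z > 4/3" for z
    proof -
      have "norm (z - 0) > 4/3 * \<epsilon>" using that \<epsilon> by simp
      then show ?thesis unfolding m_def by (rule moll_out[OF \<epsilon>(1)])
    qed
    have md: "m differentiable (at z)" for z by (rule smooth_differentiable[OF m(1)])
    have dzero: "dderiv v m z = 0" if "norm z > 4/3" for v z
      by (rule dderiv_zero_off_support[of "cball 0 (4/3)"]) (use mo that in auto)
    have dcont: "continuous_on UNIV (dderiv y m)"
    proof -
      have "dderiv y m = (\<lambda>z. \<Sum>b\<in>Basis. (y \<bullet> b) *\<^sub>R dderiv b m z)" by (rule ext, rule dderiv_Basis_sum[OF md])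
      then show ?thesis using smooth_continuous[OF smooth_dderiv[OF m(1)]] by (auto intro!: continuous_intros)
    qed
    then have [measurable]: "dderiv y m \<in> borel_measurable borel" by (rule borel_measurable_continuous_onI)
    have "bounded (dderiv y m ` cball 0 (4/3))"
      by (intro compact_imp_bounded compact_continuous_image continuous_on_subset[OF dcont]) auto
    then obtain B0 where "\<forall>w\<in>dderiv y m ` cball 0 (4/3). norm w \<le> B0" unfolding bounded_iff by blast
    then have "norm (dderiv y m z) \<le> B0" if "z \<in> cball 0 (4/3)" for z using that by blast
    then have B0: "norm (dderiv y m z) \<le> \<bar>B0\<bar>" for z
      using dzero[of z y] by (cases "norm z \<le> 4/3") (auto intro: order_trans[OF _ abs_ge_self])
    define \<Phi> where "\<Phi> = (\<lambda>s. LINT x|lborel. f x * m (x - (a + s *\<^sub>R y)))"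
    define R where "R = norm a + 2 * norm y + 4/3"
    have der: "(\<Phi> has_derivative (\<lambda>v. LINT x|lborel. f x * (- v * dderiv y m (x - (a + s *\<^sub>R y))))) (at s)" if s: "s \<in> {0..1}" for s
      unfolding \<Phi>_def
    proof (rule has_derivative_integral_dominated[where r = 1 and g = "\<lambda>x. \<bar>B0\<bar> * norm (indicator (cball 0 R) x * f x)"])
      fix t :: real and x :: "real^'n"
      have "((\<lambda>t. x - (a + t *\<^sub>R y)) has_derivative (\<lambda>v. - (v *\<^sub>R y))) (at t)"
        by (auto intro!: derivative_eq_intros)
      from has_derivative_compose[OF this has_derivative_dderiv[OF md]]
      have "((\<lambda>t. m (x - (a + t *\<^sub>R y))) has_derivative (\<lambda>v. dderiv (- (v *\<^sub>R y)) m (x - (a + t *\<^sub>R y)))) (at t)" .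
      moreover have "dderiv (- (v *\<^sub>R y)) m z = - v * dderiv y m z" for v z
        using linear_scale[OF dderiv_linear[OF md], of "- v" y z] by simp
      ultimately show "((\<lambda>t. f x * m (x - (a + t *\<^sub>R y))) has_derivative (\<lambda>v. f x * (- v * dderiv y m (x - (a + t *\<^sub>R y))))) (at t)"
        by (intro has_derivative_mult_right) simp
    next
      fix t v :: real and x :: "real^'n" assume "t \<in> ball s 1"
      then have t: "\<bar>t\<bar> \<le> 2" using s by (auto simp: dist_real_def)
      show "norm (f x * (- v * dderiv y m (x - (a + t *\<^sub>R y)))) \<le> \<bar>B0\<bar> * norm (indicator (cball 0 R) x * f x) * norm v"
      proof (cases "norm x \<le> R")
        case True
        have "\<bar>f x\<bar> * \<bar>v\<bar> * \<bar>dderiv y m (x - (a + t *\<^sub>R y))\<bar> \<le> \<bar>f x\<bar> * \<bar>v\<bar> * \<bar>B0\<bar>"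
          using B0 by (intro mult_left_mono) auto
        then show ?thesis using True by (simp add: abs_mult mult_ac)
      next
        case False
        have "\<bar>t\<bar> * norm y \<le> 2 * norm y" using t by (intro mult_right_mono) auto
        then have "norm (a + t *\<^sub>R y) \<le> norm a + 2 * norm y" using norm_triangle_ineq[of a "t *\<^sub>R y"] by simp
        then have "norm (x - (a + t *\<^sub>R y)) > 4/3" using False norm_triangle_ineq2[of x "a + t *\<^sub>R y"] by (simp add: R_def)
        then show ?thesis by (simp add: dzero)
      qed
    next
      show "integrable lborel (\<lambda>x. f x * m (x - (a + t *\<^sub>R y)))" for t
        using loc_integrable_moll[OF fl \<epsilon>(1), of "a + t *\<^sub>R y"] by (simp add: mt)
      show "integrable lborel (\<lambda>x. \<bar>B0\<bar> * norm (indicator (cball 0 R) x * f x))"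
        using fl by (intro integrable_mult_right integrable_norm) (auto simp: loc_integrable_def)
    qed auto
    have dk: "\<bar>LINT x|lborel. f x * dderiv (axis k 1) m (x - b)\<bar> \<le> L" for k b
    proof -
      have "dderiv (axis k 1) (\<lambda>x. complex_of_real (moll \<epsilon> b x)) x = complex_of_real (dderiv (axis k 1) m (x - b))" for x
      proof -
        have "((\<lambda>x. m (x - b)) has_derivative (\<lambda>v. dderiv v (\<lambda>x. m (x - b)) x)) (at x)"
          by (intro has_derivative_dderiv smooth_differentiable smooth_translate m)
        then have "((\<lambda>x. complex_of_real (m (x - b))) has_derivative (\<lambda>v. complex_of_real (dderiv v (\<lambda>x. m (x - b)) x))) (at x)"
          by (rule has_derivative_of_real)
        from dderiv_eqI[OF this, of "axis k 1"] show ?thesis by (simp add: mt dderiv_translate[OF m(1)])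
      qed
      then have "dist_deriv k (rpairing f) (\<lambda>x. complex_of_real (moll \<epsilon> b x)) = - complex_of_real (LINT x|lborel. f x * dderiv (axis k 1) m (x - b))"
        unfolding dist_deriv_def pairing_def by (simp flip: of_real_mult)
      then show ?thesis using moll_le_dnorm[OF \<epsilon>(1) L(1)[of k] L(2), of b] by simp
    qed
    have dint: "integrable lborel (\<lambda>x. f x * dderiv (axis k 1) m (x - b))" for k b
    proof -
      have "schwartz (\<lambda>x. complex_of_real (moll \<epsilon> b x))" by (rule schwartz_moll[OF \<epsilon>(1)])
      have sm: "smooth (dderiv (axis k 1) m)" by (intro smooth_dderiv m axis_Basis)
      have "bounded (dderiv (axis k 1) m ` cball 0 (4/3))"
        by (intro compact_imp_bounded compact_continuous_image smooth_continuous[OF sm]) auto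
      then obtain B1 where "\<forall>w\<in>dderiv (axis k 1) m ` cball 0 (4/3). norm w \<le> B1" unfolding bounded_iff by blast
      then have "norm (dderiv (axis k 1) m z) \<le> B1" if "z \<in> cball 0 (4/3)" for z using that by blast
      then have B1: "\<bar>dderiv (axis k 1) m z\<bar> \<le> \<bar>B1\<bar>" for z
        using dzero[of z "axis k 1"] by (cases "norm z \<le> 4/3") (auto intro: order_trans[OF _ abs_ge_self])
      show ?thesis
      proof (rule loc_integrable_times[OF fl, where R = "norm b + 4/3" and B = "\<bar>B1\<bar>"])
        show "(\<lambda>x. dderiv (axis k 1) m (x - b)) \<in> borel_measurable borel"
          by (intro borel_measurable_continuous_onI smooth_continuous smooth_translate sm)
        show "dderiv (axis k 1) m (x - b) = 0" if "norm x > norm b + 4/3" for x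
          using that norm_triangle_ineq2[of x b] by (intro dzero) linarith
      qed (use B1 in auto)
    qed
    have Dbound: "\<bar>LINT x|lborel. f x * dderiv y m (x - b)\<bar> \<le> real CARD('n) * L * norm y" for b
    proof -
      have Bs: "(\<Sum>b\<in>Basis. F b) = (\<Sum>k\<in>UNIV. F (axis k 1))" for F :: "real^'n \<Rightarrow> real"
      proof -
        have b: "(Basis :: (real^'n) set) = (\<lambda>k. axis k 1) ` UNIV" by (auto simp: Basis_vec_def)
        have i: "inj (\<lambda>k. axis k (1::real) :: real^'n)" by (auto simp: inj_on_def axis_eq_axis)
        show ?thesis by (simp only: b sum.reindex[OF i] o_def)
      qed
      have "dderiv y m z = (\<Sum>k\<in>UNIV. (y $ k) * dderiv (axis k 1) m z)" for z
        by (subst dderiv_Basis_sum[OF md], subst Bs) (simp add: inner_axis)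
      then have "(LINT x|lborel. f x * dderiv y m (x - b)) = (LINT x|lborel. (\<Sum>k\<in>UNIV. (y $ k) * (f x * dderiv (axis k 1) m (x - b))))"
        by (simp add: sum_distrib_left mult_ac)
      also have "\<dots> = (\<Sum>k\<in>UNIV. (y $ k) * (LINT x|lborel. f x * dderiv (axis k 1) m (x - b)))"
        by (subst Bochner_Integration.integral_sum) (auto intro: dint)
      finally have "\<bar>LINT x|lborel. f x * dderiv y m (x - b)\<bar> \<le> (\<Sum>k\<in>UNIV. \<bar>(y $ k) * (LINT x|lborel. f x * dderiv (axis k 1) m (x - b))\<bar>)"
        by (simp add: sum_abs)
      also have "\<dots> \<le> (\<Sum>k\<in>(UNIV::'n set). norm y * L)"
        unfolding abs_mult using dk L by (intro sum_mono mult_mono component_le_norm_cart) auto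
      finally show ?thesis by (simp add: mult_ac)
    qed
    have "norm (\<Phi> 1 - \<Phi> 0) \<le> (real CARD('n) * L * norm y) * norm (1 - 0 :: real)"
    proof (rule differentiable_bound[where S = "{0..1::real}"])
      fix s :: real assume s: "s \<in> {0..1}"
      show "(\<Phi> has_derivative (\<lambda>v. LINT x|lborel. f x * (- v * dderiv y m (x - (a + s *\<^sub>R y))))) (at s within {0..1})"
        using der[OF s] by (rule has_derivative_at_withinI)
      have "(LINT x|lborel. f x * (- v * dderiv y m (x - (a + s *\<^sub>R y)))) = - v * (LINT x|lborel. f x * dderiv y m (x - (a + s *\<^sub>R y)))" for v
        unfolding integral_mult_right_zero[symmetric] by (simp add: mult_ac)
      then show "onorm (\<lambda>v. LINT x|lborel. f x * (- v * dderiv y m (x - (a + s *\<^sub>R y)))) \<le> real CARD('n) * L * norm y"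
        using Dbound[of "a + s *\<^sub>R y"] L(2) by (intro onorm_bound) (auto simp: abs_mult mult.commute intro!: mult_left_mono)
    qed auto
    moreover have "(LINT x|lborel. (f (x + y) - f x) * moll \<epsilon> a x) = \<Phi> 1 - \<Phi> 0"
    proof -
      have i1: "integrable lborel (\<lambda>x. f (x + y) * moll \<epsilon> a x)" "integrable lborel (\<lambda>x. f x * moll \<epsilon> a x)"
        by (intro loc_integrable_moll loc_integrable_translate fl \<epsilon>)+
      have "(LINT x|lborel. f (x + y) * moll \<epsilon> a x) = (LINT x|lborel. f (x - y + y) * moll \<epsilon> a (x - y))"
        by (rule integral_translate(2)[symmetric]) measurable
      also have "\<dots> = \<Phi> 1" by (simp add: \<Phi>_def mt diff_diff_eq add.commute)
      finally show ?thesis using i1 by (simp add: left_diff_distrib \<Phi>_def mt)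
    qed
    ultimately show "\<bar>LINT x|lborel. (f (x + y) - f x) * moll \<epsilon> a x\<bar> \<le> real CARD('n) * L * norm y" by simp
  qed
qed

end

section \<open>The principal value integral\<close>

lemma AE_translate:
  fixes P :: "'a::euclidean_space \<Rightarrow> bool"
  assumes "AE z in lborel. P z"
  shows "AE y in lborel. P (x + y)"
proof -
  have "AE z in distr lborel borel ((+) x). P z" using assms by (simp only: lborel_distr_plus)
  then show ?thesis by (rule AE_distrD[rotated]) simp
qed

text \<open>Near the origin both increments are Lipschitz and \<open>|y|\<^sup>2\<^sup>-\<^sup>d\<^sup>-\<^sup>\<alpha>\<close> is integrable because \<open>\<alpha> < 2\<close>; away from
  it only one increment grows and \<open>|y|\<^sup>1\<^sup>-\<^sup>d\<^sup>-\<^sup>\<alpha>\<close> is integrable because \<open>\<alpha> > 1\<close>.\<close>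

lemma has_pv_bound:
  assumes \<alpha>: "1 < \<alpha>" "\<alpha> < 2"
  obtains W where "W \<ge> 0"
    "\<And>(s :: real^'n::finite \<Rightarrow> real) (v :: real^'n \<Rightarrow> real^'n) J M Ls Lv.
       s \<in> borel_measurable borel \<Longrightarrow> v \<in> borel_measurable borel \<Longrightarrow> M \<ge> 0 \<Longrightarrow> Ls \<ge> 0 \<Longrightarrow> Lv \<ge> 0 \<Longrightarrow>
       AE x in lborel. \<bar>s x\<bar> \<le> M \<Longrightarrow>
       (\<And>y. AE x in lborel. \<bar>s (x + y) - s x\<bar> \<le> Ls * norm y) \<Longrightarrow>
       (\<And>y. AE x in lborel. norm (v (x + y) - v x) \<le> Lv * norm y) \<Longrightarrow>
       AE x in lborel. has_pv (\<lambda>y. ((s (x + y) - s x) / norm y powr (real CARD('n) + \<alpha>)) *\<^sub>R (v (x + y) - v x)) (J x) \<Longrightarrow>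
       AE x in lborel. norm (J x) \<le> W * (Ls + 2 * M) * Lv"
proof -
  let ?d = "real CARD('n)"
  define W1 where "W1 = (\<integral>\<^sup>+(y::real^'n). ennreal (norm y powr (2 - ?d - \<alpha>)) * indicator (cball 0 1) y \<partial>lborel)"
  define W2 where "W2 = (\<integral>\<^sup>+(y::real^'n). ennreal (norm y powr (1 - ?d - \<alpha>)) * indicator {y. norm y > 1} y \<partial>lborel)"
  have "W1 < \<infinity>" unfolding W1_def by (rule nn_integral_norm_powr_ball) (use \<alpha> in simp)
  moreover have "W2 < \<infinity>" unfolding W2_def by (rule nn_integral_norm_powr_outside) (use \<alpha> in simp)
  ultimately have W12: "W1 + W2 < \<infinity>" by simp
  define W where "W = enn2real (W1 + W2)"
  have W: "W1 \<le> ennreal W" "W2 \<le> ennreal W" "W \<ge> 0"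
  proof -
    have "ennreal W = W1 + W2" unfolding W_def using W12 by (simp add: less_top)
    then show "W1 \<le> ennreal W" "W2 \<le> ennreal W" by simp_all
  qed (simp add: W_def)
  have "AE x in lborel. norm (J x) \<le> W * (Ls + 2 * M) * Lv"
    if m: "s \<in> borel_measurable borel" "v \<in> borel_measurable borel"
      and nn: "M \<ge> 0" "Ls \<ge> 0" "Lv \<ge> 0" and M: "AE x in lborel. \<bar>s x\<bar> \<le> M"
      and Ls: "\<And>y. AE x in lborel. \<bar>s (x + y) - s x\<bar> \<le> Ls * norm y"
      and Lv: "\<And>y. AE x in lborel. norm (v (x + y) - v x) \<le> Lv * norm y"
      and J: "AE x in lborel. has_pv (\<lambda>y. ((s (x + y) - s x) / norm y powr (?d + \<alpha>)) *\<^sub>R (v (x + y) - v x)) (J x)"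
    for s :: "real^'n \<Rightarrow> real" and v :: "real^'n \<Rightarrow> real^'n" and J M Ls Lv
  proof -
    note [measurable] = m
    have "AE x in lborel. AE y in lborel. \<bar>s (x + y) - s x\<bar> \<le> Ls * norm y"
      by (rule AE_AE_commute[OF _ Ls]) measurable
    moreover have "AE x in lborel. AE y in lborel. norm (v (x + y) - v x) \<le> Lv * norm y"
      by (rule AE_AE_commute[OF _ Lv]) measurable
    ultimately show ?thesis using M J
    proof eventually_elim
      fix x assume as: "AE y in lborel. \<bar>s (x + y) - s x\<bar> \<le> Ls * norm y" "\<bar>s x\<bar> \<le> M"
        and av: "AE y in lborel. norm (v (x + y) - v x) \<le> Lv * norm y"
        and pv: "has_pv (\<lambda>y. ((s (x + y) - s x) / norm y powr (?d + \<alpha>)) *\<^sub>R (v (x + y) - v x)) (J x)"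
      define G where "G = (\<lambda>y. ((s (x + y) - s x) / norm y powr (?d + \<alpha>)) *\<^sub>R (v (x + y) - v x))"
      have aM: "AE y in lborel. \<bar>s (x + y)\<bar> \<le> M" by (rule AE_translate[OF M])
      have pt: "AE y in lborel. ennreal (norm (G y))
        \<le> ennreal (Lv * Ls) * (ennreal (norm y powr (2 - ?d - \<alpha>)) * indicator (cball 0 1) y)
          + ennreal (Lv * (2 * M)) * (ennreal (norm y powr (1 - ?d - \<alpha>)) * indicator {y. norm y > 1} y)"
        using as(1) av aM
      proof eventually_elim
        fix y assume y: "\<bar>s (x + y) - s x\<bar> \<le> Ls * norm y" "norm (v (x + y) - v x) \<le> Lv * norm y" "\<bar>s (x + y)\<bar> \<le> M"
        show "ennreal (norm (G y))
        \<le> ennreal (Lv * Ls) * (ennreal (norm y powr (2 - ?d - \<alpha>)) * indicator (cball 0 1) y)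
          + ennreal (Lv * (2 * M)) * (ennreal (norm y powr (1 - ?d - \<alpha>)) * indicator {y. norm y > 1} y)"
        proof (cases "y = 0")
          case False
          then have y0: "norm y > 0" by simp
          have nG: "norm (G y) = \<bar>s (x + y) - s x\<bar> * norm (v (x + y) - v x) * norm y powr (- (?d + \<alpha>))"
            unfolding powr_minus G_def by (simp add: divide_inverse abs_mult mult_ac)
          show ?thesis
          proof (cases "norm y \<le> 1")
            case True
            have "norm (G y) \<le> (Ls * norm y) * (Lv * norm y) * norm y powr (- (?d + \<alpha>))"
              unfolding nG using y nn by (intro mult_mono) auto
            also have "\<dots> = (Lv * Ls) * (norm y powr 2 * norm y powr (- (?d + \<alpha>)))"
              using y0 by (simp add: powr_numeral power2_eq_square)
            also have "norm y powr 2 * norm y powr (- (?d + \<alpha>)) = norm y powr (2 - ?d - \<alpha>)"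
              by (subst powr_add[symmetric]) (simp add: algebra_simps)
            finally show ?thesis using True nn by (simp add: ennreal_mult'[symmetric] ennreal_leI)
          next
            case False2: False
            have "\<bar>s (x + y) - s x\<bar> \<le> 2 * M" using y(3) as(2) by linarith
            then have "norm (G y) \<le> (2 * M) * (Lv * norm y) * norm y powr (- (?d + \<alpha>))"
              unfolding nG using y nn by (intro mult_mono) auto
            also have "\<dots> = (Lv * (2 * M)) * (norm y powr 1 * norm y powr (- (?d + \<alpha>)))"
              using y0 by simp
            also have "norm y powr 1 * norm y powr (- (?d + \<alpha>)) = norm y powr (1 - ?d - \<alpha>)"
              by (subst powr_add[symmetric]) (simp add: algebra_simps)
            finally show ?thesis using False2 nn by (simp add: ennreal_mult'[symmetric] ennreal_leI)
          qed
        qed (simp add: G_def)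
      qed
      have tot: "(\<integral>\<^sup>+y. ennreal (norm (G y)) \<partial>lborel) \<le> ennreal (W * (Ls + 2 * M) * Lv)"
      proof -
        have "(\<integral>\<^sup>+y. ennreal (norm (G y)) \<partial>lborel) \<le> (\<integral>\<^sup>+(y::real^'n). ennreal (Lv * Ls) * (ennreal (norm y powr (2 - ?d - \<alpha>)) * indicator (cball 0 1) y)
          + ennreal (Lv * (2 * M)) * (ennreal (norm y powr (1 - ?d - \<alpha>)) * indicator {y. norm y > 1} y) \<partial>lborel)"
          by (rule nn_integral_mono_AE[OF pt])
        also have "\<dots> = ennreal (Lv * Ls) * W1 + ennreal (Lv * (2 * M)) * W2"
        proof -
          have m1: "(\<lambda>y::real^'n. ennreal (norm y powr (2 - ?d - \<alpha>)) * indicator (cball 0 1) y) \<in> borel_measurable lborel"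
            by (intro borel_measurable_times_ennreal borel_measurable_indicator) auto
          have m2: "(\<lambda>y::real^'n. ennreal (norm y powr (1 - ?d - \<alpha>)) * indicator {y. norm y > 1} y) \<in> borel_measurable lborel"
            by (intro borel_measurable_times_ennreal borel_measurable_indicator) auto
          show ?thesis
            unfolding W1_def W2_def nn_integral_cmult[OF m1, symmetric] nn_integral_cmult[OF m2, symmetric]
            by (intro nn_integral_add borel_measurable_times_ennreal m1 m2) auto
        qed
        also have "\<dots> \<le> ennreal (Lv * Ls) * ennreal W + ennreal (Lv * (2 * M)) * ennreal W"
          by (intro add_mono mult_left_mono W) auto
        also have "\<dots> = ennreal (W * (Ls + 2 * M) * Lv)"
          using nn W(3) by (simp add: ennreal_mult'[symmetric] ennreal_plus[symmetric] algebra_simps del: ennreal_plus)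
        finally show ?thesis .
      qed
      have each: "norm (LINT y:{y. norm y > \<delta>}|lborel. G y) \<le> W * (Ls + 2 * M) * Lv" if \<delta>: "\<delta> > 0" for \<delta>
      proof -
        have "integrable lborel (\<lambda>y. indicator {y. norm y > \<delta>} y *\<^sub>R G y)"
          using pv \<delta> by (simp add: has_pv_def set_integrable_def G_def)
        from integral_norm_bound_ennreal[OF this]
        have "ennreal (norm (LINT y:{y. norm y > \<delta>}|lborel. G y)) \<le> (\<integral>\<^sup>+y. ennreal (norm (indicator {y. norm y > \<delta>} y *\<^sub>R G y)) \<partial>lborel)"
          by (simp add: set_lebesgue_integral_def)
        also have "\<dots> \<le> (\<integral>\<^sup>+y. ennreal (norm (G y)) \<partial>lborel)"
          by (intro nn_integral_mono) (auto simp: indicator_def)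
        also note tot
        finally show ?thesis using nn W(3) by (subst (asm) ennreal_le_iff) auto
      qed
      have "((\<lambda>\<delta>. LINT y:{y. norm y > \<delta>}|lborel. G y) \<longlongrightarrow> J x) (at_right 0)"
        using pv by (simp add: has_pv_def G_def)
      then show "norm (J x) \<le> W * (Ls + 2 * M) * Lv"
      proof (rule Lim_norm_ubound[rotated])
        show "\<forall>\<^sub>F \<delta> in at_right 0. norm (LINT y:{y. norm y > \<delta>}|lborel. G y) \<le> W * (Ls + 2 * M) * Lv"
          using eventually_at_right_less[of "0::real"] by eventually_elim (rule each)
      qed simp
    qed
  qed
  then show ?thesis using that[OF W(3)] by blast
qed

section \<open>Besov norms with summability one over bounded functions\<close>

lemma sum_le_infsum_ennreal:
  fixes f :: "'a \<Rightarrow> ennreal"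
  assumes "finite F"
  shows "sum f F \<le> infsum f UNIV"
proof -
  have "infsum f F \<le> infsum f UNIV"
    by (rule infsum_mono_neutral) (auto intro: nonneg_summable_on_complete)
  then show ?thesis using assms by simp
qed

lemma dnorm_cong: "(\<And>\<psi>. schwartz \<psi> \<Longrightarrow> T \<psi> = S \<psi>) \<Longrightarrow> dnorm T = dnorm S"
  unfolding dnorm_def by (intro SUP_cong) auto

context littlewood_paley
begin

text \<open>The norm of \<open>B\<^sup>s\<close> based on \<open>L\<^sup>\<infinity>\<close> with summability one, with \<open>dnorm\<close> in place of the \<open>L\<^sup>\<infinity>\<close> norm.  Partial sums over
  symmetric ranges make it measurable in time as a countable supremum.\<close>

definition bsum :: "real \<Rightarrow> (real^'n) functional \<Rightarrow> ennreal" where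
  "bsum s T = (SUP n::nat. \<Sum>j\<in>{- int n..int n}. ennreal (2 powr (real_of_int j * s)) * dnorm (LP_block chi j T))"

lemma bsum_term_le: "ennreal (2 powr (real_of_int j * s)) * dnorm (LP_block chi j T) \<le> bsum s T"
proof -
  have "ennreal (2 powr (real_of_int j * s)) * dnorm (LP_block chi j T) = (\<Sum>j\<in>{j}. ennreal (2 powr (real_of_int j * s)) * dnorm (LP_block chi j T))" by simp
  also have "\<dots> \<le> (\<Sum>j\<in>{- int (nat \<bar>j\<bar>)..int (nat \<bar>j\<bar>)}. ennreal (2 powr (real_of_int j * s)) * dnorm (LP_block chi j T))"
    by (rule sum_mono2) auto
  also have "\<dots> \<le> bsum s T" unfolding bsum_def by (intro SUP_upper) simp
  finally show ?thesis .
qed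

text \<open>Comparisons between these norms are made block by block.\<close>

lemma bsum_leI:
  assumes I: "finite I" and c: "c \<ge> 0"
    and le: "\<And>j. ennreal (2 powr (real_of_int j * s)) * dnorm (LP_block chi j T)
       \<le> ennreal c * (\<Sum>i\<in>I. ennreal (2 powr (real_of_int j * s' i)) * dnorm (LP_block chi j (T' i)))"
  shows "bsum s T \<le> ennreal c * (\<Sum>i\<in>I. bsum (s' i) (T' i))"
  unfolding bsum_def[of s T]
proof (rule SUP_least)
  fix n :: nat
  have "(\<Sum>j\<in>{- int n..int n}. ennreal (2 powr (real_of_int j * s)) * dnorm (LP_block chi j T))
    \<le> (\<Sum>j\<in>{- int n..int n}. ennreal c * (\<Sum>i\<in>I. ennreal (2 powr (real_of_int j * s' i)) * dnorm (LP_block chi j (T' i))))"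
    by (intro sum_mono le)
  also have "\<dots> = ennreal c * (\<Sum>i\<in>I. \<Sum>j\<in>{- int n..int n}. ennreal (2 powr (real_of_int j * s' i)) * dnorm (LP_block chi j (T' i)))"
    by (subst sum.swap) (simp add: sum_distrib_left)
  also have "\<dots> \<le> ennreal c * (\<Sum>i\<in>I. bsum (s' i) (T' i))"
    unfolding bsum_def by (intro mult_left_mono sum_mono SUP_upper) auto
  finally show "(\<Sum>j\<in>{- int n..int n}. ennreal (2 powr (real_of_int j * s)) * dnorm (LP_block chi j T)) \<le> ennreal c * (\<Sum>i\<in>I. bsum (s' i) (T' i))" .
qed

lemma bsum_interpolate:
  assumes "a \<le> s" "s \<le> b"
  shows "bsum s T \<le> bsum a T + bsum b T"
proof -
  have "bsum s T \<le> ennreal 1 * (\<Sum>i\<in>{False, True}. bsum (if i then b else a) T)"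
  proof (rule bsum_leI)
    fix j :: int
    have "2 powr (real_of_int j * s) \<le> 2 powr (real_of_int j * a) + 2 powr (real_of_int j * b)"
    proof (cases "j \<ge> 0")
      case True
      then have "2 powr (real_of_int j * s) \<le> 2 powr (real_of_int j * b)" using assms by (intro powr_mono mult_left_mono) auto
      then show ?thesis by (simp add: add_increasing)
    next
      case False
      then have "2 powr (real_of_int j * s) \<le> 2 powr (real_of_int j * a)" using assms by (intro powr_mono mult_left_mono_neg) auto
      then show ?thesis by (simp add: add_increasing2)
    qed
    then have "ennreal (2 powr (real_of_int j * s)) \<le> ennreal (2 powr (real_of_int j * a)) + ennreal (2 powr (real_of_int j * b))"
      by (simp add: ennreal_plus[symmetric] ennreal_leI del: ennreal_plus)
    then have "ennreal (2 powr (real_of_int j * s)) * dnorm (LP_block chi j T) \<le> (ennreal (2 powr (real_of_int j * a)) + ennreal (2 powr (real_of_int j * b))) * dnorm (LP_block chi j T)"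
      by (rule mult_right_mono) simp
    then show "ennreal (2 powr (real_of_int j * s)) * dnorm (LP_block chi j T)
      \<le> ennreal 1 * (\<Sum>i\<in>{False, True}. ennreal (2 powr (real_of_int j * (if i then b else a))) * dnorm (LP_block chi j T))"
      by (simp add: distrib_right)
  qed auto
  then show ?thesis by simp
qed

lemma bsum_deriv:
  obtains C where "C > 0" "\<And>T s k. lin T \<Longrightarrow> bsum s (dist_deriv k T) \<le> ennreal C * bsum (s + 1) T"
proof -
  have "\<exists>C>0. \<forall>T j. lin T \<longrightarrow> dnorm (LP_block chi j (dist_deriv k T)) \<le> ennreal (C * 2 powr real_of_int j) * dnorm (LP_block chi j T)" for k
    using dnorm_block_deriv[of k] by metis
  then obtain Ck where Ck: "\<And>k. Ck k > 0" "\<And>k T j. lin T \<Longrightarrow> dnorm (LP_block chi j (dist_deriv k T)) \<le> ennreal (Ck k * 2 powr real_of_int j) * dnorm (LP_block chi j T)"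
    by metis
  define C where "C = (\<Sum>k\<in>UNIV. Ck k)"
  have le: "Ck k \<le> C" for k unfolding C_def using Ck(1) by (intro member_le_sum) (auto intro: less_imp_le)
  have C: "C > 0" using le[of undefined] Ck(1)[of undefined] by linarith
  have "bsum s (dist_deriv k T) \<le> ennreal C * bsum (s + 1) T" if T: "lin T" for T s k
  proof -
    have "bsum s (dist_deriv k T) \<le> ennreal C * (\<Sum>i\<in>{()}. bsum (s + 1) T)"
    proof (rule bsum_leI)
      fix j :: int
      have "ennreal (2 powr (real_of_int j * s)) * dnorm (LP_block chi j (dist_deriv k T))
        \<le> ennreal (2 powr (real_of_int j * s)) * (ennreal (C * 2 powr real_of_int j) * dnorm (LP_block chi j T))"
        by (intro mult_left_mono order_trans[OF Ck(2)[OF T, of j k]] mult_right_mono ennreal_leI le) auto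
      also have "\<dots> = ennreal C * (ennreal (2 powr (real_of_int j * (s + 1))) * dnorm (LP_block chi j T))"
        using C by (simp add: mult.assoc[symmetric] ennreal_mult'[symmetric]) (simp add: distrib_left powr_add mult_ac)
      finally show "ennreal (2 powr (real_of_int j * s)) * dnorm (LP_block chi j (dist_deriv k T))
        \<le> ennreal C * (\<Sum>i\<in>{()}. ennreal (2 powr (real_of_int j * (s + 1))) * dnorm (LP_block chi j T))" by simp
    qed (use C in auto)
    then show ?thesis by simp
  qed
  then show ?thesis using that C by blast
qed

lemma bsum_reverse:
  obtains C where "C > 0" "\<And>T s. lin T \<Longrightarrow> bsum (s + 1) T \<le> ennreal C * (\<Sum>k\<in>UNIV. bsum s (dist_deriv k T))"
proof -
  obtain C where C: "C > 0" "\<And>T j. lin T \<Longrightarrow> dnorm (LP_block chi j T) \<le>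
        ennreal (C * 2 powr (- real_of_int j)) * (\<Sum>k\<in>UNIV. dnorm (LP_block chi j (dist_deriv k T)))"
    using dnorm_block_reverse by blast
  have "bsum (s + 1) T \<le> ennreal C * (\<Sum>k\<in>UNIV. bsum s (dist_deriv k T))" if T: "lin T" for T s
  proof (rule bsum_leI)
    fix j :: int
    have "ennreal (2 powr (real_of_int j * (s + 1))) * dnorm (LP_block chi j T)
      \<le> ennreal (2 powr (real_of_int j * (s + 1))) * (ennreal (C * 2 powr (- real_of_int j)) * (\<Sum>k\<in>UNIV. dnorm (LP_block chi j (dist_deriv k T))))"
      by (intro mult_left_mono C(2) T) auto
    also have "\<dots> = ennreal (C * 2 powr (real_of_int j * s)) * (\<Sum>k\<in>UNIV. dnorm (LP_block chi j (dist_deriv k T)))"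
    proof -
      have e: "2 powr (real_of_int j * (s + 1)) * (C * 2 powr (- real_of_int j)) = C * 2 powr (real_of_int j * s)"
        by (simp add: distrib_left powr_add powr_minus)
      have "ennreal x * (ennreal y * z) = ennreal (x * y) * z" if "x \<ge> 0" for x y :: real and z
        using that by (simp add: ennreal_mult' mult.assoc)
      then show ?thesis by (simp only: e powr_ge_zero)
    qed
    also have "\<dots> = ennreal C * (\<Sum>k\<in>UNIV. ennreal (2 powr (real_of_int j * s)) * dnorm (LP_block chi j (dist_deriv k T)))"
      using C by (simp add: ennreal_mult' sum_distrib_left mult.assoc)
    finally show "ennreal (2 powr (real_of_int j * (s + 1))) * dnorm (LP_block chi j T)
      \<le> ennreal C * (\<Sum>k\<in>UNIV. ennreal (2 powr (real_of_int j * s)) * dnorm (LP_block chi j (dist_deriv k T)))" .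
  qed (use C in auto)
  then show ?thesis using that C by blast
qed

text \<open>Bernstein's inequality in every block: \<open>B\<^sup>s\<^sup>+\<^sup>1\<close> based on \<open>L\<^sup>d\<close> embeds in \<open>B\<^sup>s\<close> based on \<open>L\<^sup>\<infinity>\<close>.\<close>

lemma bsum_le_besov:
  obtains C where "C > 0" "\<And>T s. lin T \<Longrightarrow> bsum s T \<le> ennreal C * besov_norm chi (s + 1) (of_nat CARD('n)) T"
proof -
  obtain C where C: "C > 0" "\<And>T j. lin T \<Longrightarrow> dnorm (LP_block chi j T) \<le> ennreal (C * 2 powr real_of_int j) * dist_Lp_norm (of_nat CARD('n)) (LP_block chi j T)"
    using bernstein by blast
  have "bsum s T \<le> ennreal C * besov_norm chi (s + 1) (of_nat CARD('n)) T" if T: "lin T" for T s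
    unfolding bsum_def
  proof (rule SUP_least)
    fix n :: nat
    have "(\<Sum>j\<in>{- int n..int n}. ennreal (2 powr (real_of_int j * s)) * dnorm (LP_block chi j T))
      \<le> (\<Sum>j\<in>{- int n..int n}. ennreal C * (ennreal (2 powr (real_of_int j * (s + 1))) * dist_Lp_norm (of_nat CARD('n)) (LP_block chi j T)))"
    proof (rule sum_mono)
      fix j
      have "ennreal (2 powr (real_of_int j * s)) * dnorm (LP_block chi j T)
        \<le> ennreal (2 powr (real_of_int j * s)) * (ennreal (C * 2 powr real_of_int j) * dist_Lp_norm (of_nat CARD('n)) (LP_block chi j T))"
        by (intro mult_left_mono C(2) T) auto
      also have "\<dots> = ennreal C * (ennreal (2 powr (real_of_int j * (s + 1))) * dist_Lp_norm (of_nat CARD('n)) (LP_block chi j T))"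
        using C(1) by (simp add: mult.assoc[symmetric] ennreal_mult'[symmetric]) (simp add: distrib_left powr_add mult_ac)
      finally show "ennreal (2 powr (real_of_int j * s)) * dnorm (LP_block chi j T)
        \<le> ennreal C * (ennreal (2 powr (real_of_int j * (s + 1))) * dist_Lp_norm (of_nat CARD('n)) (LP_block chi j T))" .
    qed
    also have "\<dots> = ennreal C * (\<Sum>j\<in>{- int n..int n}. ennreal (2 powr (real_of_int j * (s + 1))) * dist_Lp_norm (of_nat CARD('n)) (LP_block chi j T))"
      by (rule sum_distrib_left[symmetric])
    also have "\<dots> \<le> ennreal C * besov_norm chi (s + 1) (of_nat CARD('n)) T"
      unfolding besov_norm_def by (intro mult_left_mono sum_le_infsum_ennreal) auto
    finally show "(\<Sum>j\<in>{- int n..int n}. ennreal (2 powr (real_of_int j * s)) * dnorm (LP_block chi j T)) \<le> ennreal C * besov_norm chi (s + 1) (of_nat CARD('n)) T" .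
  qed
  then show ?thesis using that C by blast
qed

lemma besov_lin: "T \<in> besov chi s p \<Longrightarrow> lin T"
  by (simp add: besov_def tempered_lin)

lemma dnorm_le_bsum: "approximable T \<Longrightarrow> dnorm T \<le> bsum 0 T"
  using dnorm_reconstruct[of T] by (simp add: bsum_def)

text \<open>A bound on the whole space that separates low and high frequencies: it makes \<open>dnorm T\<close> small when
  \<open>bsum b T\<close> is small, using only boundedness at the negative regularity \<open>- a\<close>.\<close>

lemma bsum_split:
  assumes a: "a > 0" and b: "b > 0" and l: "l > 0"
  shows "bsum 0 T \<le> ennreal (2 powr (- (a * l))) * bsum (- a) T + ennreal (2 powr (b * l)) * bsum b T"
proof -
  let ?c = "\<lambda>i. if i then 2 powr (b * l) else 2 powr (- (a * l)) :: real"
  have "(\<Sum>j\<in>{- int n..int n}. ennreal (2 powr (real_of_int j * 0)) * dnorm (LP_block chi j T))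
     \<le> ennreal (2 powr (- (a * l))) * bsum (- a) T + ennreal (2 powr (b * l)) * bsum b T" for n
  proof -
    have "(\<Sum>j\<in>{- int n..int n}. ennreal (2 powr (real_of_int j * 0)) * dnorm (LP_block chi j T))
      \<le> (\<Sum>j\<in>{- int n..int n}. ennreal (2 powr (- (a * l))) * (ennreal (2 powr (real_of_int j * (- a))) * dnorm (LP_block chi j T))
          + ennreal (2 powr (b * l)) * (ennreal (2 powr (real_of_int j * b)) * dnorm (LP_block chi j T)))"
    proof (rule sum_mono)
      fix j
      have "1 \<le> 2 powr (- (a * l)) * 2 powr (real_of_int j * (- a)) + 2 powr (b * l) * 2 powr (real_of_int j * b)"
      proof (cases "real_of_int j \<le> - l")
        case True
        then have "0 \<le> - (a * l) + real_of_int j * (- a)" using mult_left_mono[of "real_of_int j" "- l" a] a by (simp add: mult.commute)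
        then have "1 \<le> 2 powr (- (a * l) + real_of_int j * (- a))" by (intro ge_one_powr_ge_zero) auto
        moreover have "0 \<le> 2 powr (b * l) * 2 powr (real_of_int j * b)" by simp
        ultimately show ?thesis unfolding powr_add by linarith
      next
        case False
        then have "0 \<le> b * l + real_of_int j * b" using mult_left_mono[of "- l" "real_of_int j" b] b by (simp add: mult.commute)
        then have "1 \<le> 2 powr (b * l + real_of_int j * b)" by (intro ge_one_powr_ge_zero) auto
        moreover have "0 \<le> 2 powr (- (a * l)) * 2 powr (real_of_int j * (- a))" by simp
        ultimately show ?thesis unfolding powr_add by linarith
      qed
      then have "ennreal 1 \<le> ennreal (2 powr (- (a * l)) * 2 powr (real_of_int j * (- a)) + 2 powr (b * l) * 2 powr (real_of_int j * b))"
        by (rule ennreal_leI)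
      then have "1 * dnorm (LP_block chi j T) \<le> (ennreal (2 powr (- (a * l))) * ennreal (2 powr (real_of_int j * (- a))) + ennreal (2 powr (b * l)) * ennreal (2 powr (real_of_int j * b))) * dnorm (LP_block chi j T)"
        by (intro mult_right_mono) (auto simp: ennreal_mult')
      then show "ennreal (2 powr (real_of_int j * 0)) * dnorm (LP_block chi j T)
        \<le> ennreal (2 powr (- (a * l))) * (ennreal (2 powr (real_of_int j * (- a))) * dnorm (LP_block chi j T))
          + ennreal (2 powr (b * l)) * (ennreal (2 powr (real_of_int j * b)) * dnorm (LP_block chi j T))"
        by (simp add: distrib_right mult.assoc)
    qed
    also have "\<dots> = ennreal (2 powr (- (a * l))) * (\<Sum>j\<in>{- int n..int n}. ennreal (2 powr (real_of_int j * (- a))) * dnorm (LP_block chi j T))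
          + ennreal (2 powr (b * l)) * (\<Sum>j\<in>{- int n..int n}. ennreal (2 powr (real_of_int j * b)) * dnorm (LP_block chi j T))"
      by (simp only: sum.distrib sum_distrib_left)
    also have "\<dots> \<le> ennreal (2 powr (- (a * l))) * bsum (- a) T + ennreal (2 powr (b * l)) * bsum b T"
      unfolding bsum_def by (intro add_mono mult_left_mono SUP_upper) auto
    finally show ?thesis .
  qed
  then show ?thesis unfolding bsum_def[of 0] by (intro SUP_least) auto
qed

subsection \<open>Time-dependent distributions\<close>

lemma Cb_block_bound:
  obtains C where "C > 0" "\<And>T r t s j. lin (T r) \<Longrightarrow> lin (T t) \<Longrightarrow>
     dnorm (LP_block chi j (\<lambda>\<psi>. T r \<psi> - T t \<psi>)) \<le> ennreal (C * 2 powr (real_of_int j * (1 - s))) * besov_norm chi s (of_nat CARD('n)) (\<lambda>\<psi>. (T :: real \<Rightarrow> (real^'n) functional) r \<psi> - T t \<psi>)"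
proof -
  obtain C where C: "C > 0" "\<And>T s. lin T \<Longrightarrow> bsum s T \<le> ennreal C * besov_norm chi (s + 1) (of_nat CARD('n)) T"
    using bsum_le_besov by blast
  have "dnorm (LP_block chi j (\<lambda>\<psi>. T r \<psi> - T t \<psi>)) \<le> ennreal (C * 2 powr (real_of_int j * (1 - s))) * besov_norm chi s (of_nat CARD('n)) (\<lambda>\<psi>. T r \<psi> - T t \<psi>)"
    if T: "lin (T r)" "lin (T t)" for T :: "real \<Rightarrow> (real^'n) functional" and r t s j
  proof -
    let ?D = "\<lambda>\<psi>. T r \<psi> - T t \<psi>"
    have lD: "lin ?D" using T by (auto simp: lin_def algebra_simps)
    have "dnorm (LP_block chi j ?D) = ennreal (2 powr (real_of_int j * (1 - s))) * (ennreal (2 powr (real_of_int j * (s - 1))) * dnorm (LP_block chi j ?D))"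
    proof -
      have "2 powr (real_of_int j * (1 - s)) * 2 powr (real_of_int j * (s - 1)) = (1 :: real)"
        by (simp add: powr_add[symmetric] algebra_simps)
      then show ?thesis by (simp add: mult.assoc[symmetric] ennreal_mult'[symmetric])
    qed
    also have "\<dots> \<le> ennreal (2 powr (real_of_int j * (1 - s))) * bsum (s - 1) ?D"
      by (intro mult_left_mono bsum_term_le) simp
    also have "\<dots> \<le> ennreal (2 powr (real_of_int j * (1 - s))) * (ennreal C * besov_norm chi (s - 1 + 1) (of_nat CARD('n)) ?D)"
      by (intro mult_left_mono C lD) simp
    also have "\<dots> = ennreal (C * 2 powr (real_of_int j * (1 - s))) * besov_norm chi s (of_nat CARD('n)) ?D"
      using C(1) by (simp add: ennreal_mult' mult_ac)
    finally show ?thesis .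
  qed
  then show ?thesis using that C by blast
qed

text \<open>A single block is continuous in time.  This is how measurability of the norms is obtained from continuity with
  values in the Besov space.\<close>

lemma Cb_block_measurable:
  assumes T: "T \<in> Cb_besov chi s (of_nat CARD('n))"
  shows "(\<lambda>t. indicator {0..} t * dnorm (LP_block chi j (T t))) \<in> borel_measurable borel"
proof -
  obtain M where M: "\<And>t. t \<ge> 0 \<Longrightarrow> besov_norm chi s (of_nat CARD('n)) (T t) \<le> ennreal M"
    using T by (auto simp: Cb_besov_def)
  have lT: "lin (T t)" if "t \<ge> 0" for t using T that besov_lin by (auto simp: Cb_besov_def)
  obtain C where C: "C > 0" "\<And>T s. lin T \<Longrightarrow> bsum s T \<le> ennreal C * besov_norm chi (s + 1) (of_nat CARD('n)) T"
    using bsum_le_besov by blast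
  obtain C' where C': "C' > 0" "\<And>T r t s j. lin (T r) \<Longrightarrow> lin (T t) \<Longrightarrow>
     dnorm (LP_block chi j (\<lambda>\<psi>. T r \<psi> - T t \<psi>)) \<le> ennreal (C' * 2 powr (real_of_int j * (1 - s))) * besov_norm chi s (of_nat CARD('n)) (\<lambda>\<psi>. (T :: real \<Rightarrow> (real^'n) functional) r \<psi> - T t \<psi>)"
    using Cb_block_bound by blast
  define F where "F = (\<lambda>t. dnorm (LP_block chi j (T t)))"
  have Ffin: "F t < \<infinity>" if t: "t \<ge> 0" for t
  proof -
    have "ennreal (2 powr (real_of_int j * (s - 1))) * F t \<le> bsum (s - 1) (T t)"
      unfolding F_def by (rule bsum_term_le)
    also have "\<dots> \<le> ennreal C * besov_norm chi (s - 1 + 1) (of_nat CARD('n)) (T t)" by (rule C(2)[OF lT[OF t]])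
    also have "\<dots> \<le> ennreal C * ennreal M" using M[OF t] by (intro mult_left_mono) auto
    also have "\<dots> < \<infinity>" by (simp add: ennreal_mult_less_top)
    finally show ?thesis by (auto simp: ennreal_mult_less_top ennreal_eq_0_iff)
  qed
  have "continuous_on {0..} (\<lambda>t. enn2real (F t))"
    unfolding continuous_on_def
  proof
    fix t :: real assume t: "t \<in> {0..}"
    let ?c = "ennreal (C' * 2 powr (real_of_int j * (1 - s)))"
    have "((\<lambda>r. ?c * besov_norm chi s (of_nat CARD('n)) (\<lambda>\<psi>. T r \<psi> - T t \<psi>)) \<longlongrightarrow> ?c * 0) (at t within {0..})"
      using T t by (intro ennreal_tendsto_cmult) (auto simp: Cb_besov_def)
    then have lim: "((\<lambda>r. ?c * besov_norm chi s (of_nat CARD('n)) (\<lambda>\<psi>. T r \<psi> - T t \<psi>)) \<longlongrightarrow> ennreal 0) (at t within {0..})" by simp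
    have near: "\<bar>enn2real (F r) - enn2real (F t)\<bar> \<le> e" if r: "r \<ge> 0" and e: "?c * besov_norm chi s (of_nat CARD('n)) (\<lambda>\<psi>. T r \<psi> - T t \<psi>) \<le> ennreal e" "e \<ge> 0" for r e
    proof -
      have D: "dnorm (LP_block chi j (\<lambda>\<psi>. T r \<psi> - T t \<psi>)) \<le> ennreal e"
        using C'(2)[of T r t j s] lT r t e by (auto intro: order_trans)
      have D': "dnorm (LP_block chi j (\<lambda>\<psi>. T t \<psi> - T r \<psi>)) = dnorm (LP_block chi j (\<lambda>\<psi>. T r \<psi> - T t \<psi>))"
        unfolding dnorm_def LP_block_eq by (intro SUP_cong refl) (simp add: norm_minus_commute)
      have "F r \<le> F t + dnorm (LP_block chi j (\<lambda>\<psi>. T r \<psi> - T t \<psi>))"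
        unfolding F_def by (rule dnorm_le_diff) (simp add: LP_block_eq)
      also have "\<dots> \<le> F t + ennreal e" by (intro add_left_mono D)
      finally have 1: "F r \<le> F t + ennreal e" .
      have "F t \<le> F r + dnorm (LP_block chi j (\<lambda>\<psi>. T t \<psi> - T r \<psi>))"
        unfolding F_def by (rule dnorm_le_diff) (simp add: LP_block_eq)
      also have "\<dots> \<le> F r + ennreal e" unfolding D' by (intro add_left_mono D)
      finally have 2: "F t \<le> F r + ennreal e" .
      obtain p q where pq: "F r = ennreal p" "F t = ennreal q" "p \<ge> 0" "q \<ge> 0"
        using Ffin[OF r] Ffin[of t] t by (cases "F r"; cases "F t") auto
      show ?thesis using 1 2 pq e by (simp add: ennreal_plus[symmetric] del: ennreal_plus)
    qed
    show "((\<lambda>t. enn2real (F t)) \<longlongrightarrow> enn2real (F t)) (at t within {0..})"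
      unfolding tendsto_iff
    proof (intro allI impI)
      fix e :: real assume e: "e > 0"
      have "\<forall>\<^sub>F r in at t within {0..}. ?c * besov_norm chi s (of_nat CARD('n)) (\<lambda>\<psi>. T r \<psi> - T t \<psi>) < ennreal (e / 2)"
        by (rule order_tendstoD(2)[OF lim]) (use e in simp)
      moreover have "\<forall>\<^sub>F r in at t within {0..}. r \<in> {0..}" by (simp add: eventually_at_filter)
      ultimately show "\<forall>\<^sub>F r in at t within {0..}. dist (enn2real (F r)) (enn2real (F t)) < e"
      proof eventually_elim
        fix r assume "?c * besov_norm chi s (of_nat CARD('n)) (\<lambda>\<psi>. T r \<psi> - T t \<psi>) < ennreal (e / 2)" "r \<in> {0..}"
        then have "\<bar>enn2real (F r) - enn2real (F t)\<bar> \<le> e / 2" using e by (intro near) auto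
        then show "dist (enn2real (F r)) (enn2real (F t)) < e" using e by (simp add: dist_real_def)
      qed
    qed
  qed
  then have "(\<lambda>t. indicator {0..} t *\<^sub>R enn2real (F t)) \<in> borel_measurable borel"
    by (rule borel_measurable_continuous_on_indicator[rotated]) simp
  then have "(\<lambda>t. ennreal (indicator {0..} t *\<^sub>R enn2real (F t))) \<in> borel_measurable borel" by simp
  moreover have "(\<lambda>t. ennreal (indicator {0..} t *\<^sub>R enn2real (F t))) = (\<lambda>t. indicator {0..} t * F t)"
    using Ffin by (auto simp: fun_eq_iff indicator_def less_top)
  ultimately have "(\<lambda>t. indicator {0..} t * F t) \<in> borel_measurable borel" by (simp only:)
  then show ?thesis by (simp only: F_def)
qed

lemma bsum_measurable:
  assumes "T \<in> Cb_besov chi s (of_nat CARD('n))"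
  shows "(\<lambda>t. indicator {0..} t * bsum r (T t)) \<in> borel_measurable borel"
proof -
  have "(\<lambda>t. indicator {0..} t * bsum r (T t)) = (\<lambda>t. SUP n::nat. \<Sum>j\<in>{- int n..int n}. ennreal (2 powr (real_of_int j * r)) * (indicator {0..} t * dnorm (LP_block chi j (T t))))"
    by (auto simp: fun_eq_iff indicator_def bsum_def bot_ennreal)
  also have "\<dots> \<in> borel_measurable borel"
    using Cb_block_measurable[OF assms] by measurable
  finally show ?thesis .
qed

lemma bsum_integrable:
  assumes "T \<in> Cb_besov chi s (of_nat CARD('n))" and L: "T \<in> L1_besov chi 2 (of_nat CARD('n))"
  shows "(\<integral>\<^sup>+t. indicator {0..} t * bsum 1 (T t) \<partial>lborel) < \<infinity>"
proof -
  obtain C where C: "C > 0" "\<And>T s. lin T \<Longrightarrow> bsum s T \<le> ennreal C * besov_norm chi (s + 1) (of_nat CARD('n)) T"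
    using bsum_le_besov by blast
  have lT: "lin (T t)" if "t \<ge> 0" for t using assms(1) that besov_lin by (auto simp: Cb_besov_def)
  let ?f = "\<lambda>t. indicator {0..} t * bsum 1 (T t)"
  have [measurable]: "?f \<in> borel_measurable borel" by (rule bsum_measurable[OF assms(1)])
  have "(\<integral>\<^sup>+t. ennreal (1 / C) * ?f t \<partial>lebesgue) \<le> (\<integral>\<^sup>+t\<in>{0..}. besov_norm chi 2 (of_nat CARD('n)) (T t) \<partial>lebesgue)"
  proof (intro nn_integral_mono)
    fix t :: real
    show "ennreal (1 / C) * ?f t \<le> besov_norm chi 2 (of_nat CARD('n)) (T t) * indicator {0..} t"
    proof (cases "t \<ge> 0")
      case True
      have "ennreal (1 / C) * bsum 1 (T t) \<le> ennreal (1 / C) * (ennreal C * besov_norm chi (1 + 1) (of_nat CARD('n)) (T t))"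
        by (intro mult_left_mono C lT True) simp
      also have "\<dots> = besov_norm chi 2 (of_nat CARD('n)) (T t)"
        using C(1) by (simp add: mult.assoc[symmetric] ennreal_mult'[symmetric])
      finally show ?thesis using True by simp
    qed simp
  qed
  also have "\<dots> < \<infinity>" using L by (simp add: L1_besov_def)
  finally have "(\<integral>\<^sup>+t. ennreal (1 / C) * ?f t \<partial>lborel) < \<infinity>"
    by (simp add: nn_integral_completion)
  then have "ennreal (1 / C) * (\<integral>\<^sup>+t. ?f t \<partial>lborel) < \<infinity>"
    by (simp add: nn_integral_cmult)
  then show ?thesis using C(1) by (auto simp: ennreal_mult_less_top ennreal_eq_0_iff)
qed

section \<open>Bounds for solutions at a fixed time\<close>

lemma Cb_lin: "T \<in> Cb_besov chi s p \<Longrightarrow> t \<ge> 0 \<Longrightarrow> lin (T t)"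
  and Cb_approximable: "T \<in> Cb_besov chi s p \<Longrightarrow> t \<ge> 0 \<Longrightarrow> approximable (T t)"
  by (auto simp: Cb_besov_def intro: besov_lin approximable_besov)

lemma Cb_bsum_bound:
  assumes T: "T \<in> Cb_besov chi s (of_nat CARD('n))"
  shows "\<exists>M\<ge>0. \<forall>t\<ge>0. bsum (s - 1) (T t) \<le> ennreal M"
proof -
  obtain M where M: "\<And>t. t \<ge> 0 \<Longrightarrow> besov_norm chi s (of_nat CARD('n)) (T t) \<le> ennreal M"
    using T by (auto simp: Cb_besov_def)
  obtain C where C: "C > 0" "\<And>T s. lin T \<Longrightarrow> bsum s T \<le> ennreal C * besov_norm chi (s + 1) (of_nat CARD('n)) T"
    using bsum_le_besov by blast
  have "bsum (s - 1) (T t) \<le> ennreal (C * \<bar>M\<bar>)" if t: "t \<ge> 0" for t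
  proof -
    have "bsum (s - 1) (T t) \<le> ennreal C * besov_norm chi (s - 1 + 1) (of_nat CARD('n)) (T t)"
      by (rule C(2)[OF Cb_lin[OF T t]])
    also have "\<dots> \<le> ennreal C * ennreal \<bar>M\<bar>"
      using M[OF t] order_trans[OF _ ennreal_leI[OF abs_ge_self[of M]]] by (intro mult_left_mono) auto
    finally show ?thesis using C by (simp add: ennreal_mult')
  qed
  then show ?thesis using C by (intro exI[of _ "C * \<bar>M\<bar>"]) auto
qed

text \<open>Used to pass from bounds for each component to one bound for all components.\<close>

lemma finite_family_bound:
  fixes P :: "'i::finite \<Rightarrow> real \<Rightarrow> bool"
  assumes ex: "\<And>i. \<exists>M\<ge>0. P i M" and mono: "\<And>i M M'. P i M \<Longrightarrow> M \<le> M' \<Longrightarrow> P i M'"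
  shows "\<exists>M\<ge>0. \<forall>i. P i M"
proof -
  obtain Mi where Mi: "\<And>i. Mi i \<ge> 0" "\<And>i. P i (Mi i)" using ex by metis
  have "Mi i \<le> (\<Sum>i\<in>UNIV. Mi i)" for i using Mi(1) by (intro member_le_sum) auto
  then have "\<forall>i. P i (\<Sum>i\<in>UNIV. Mi i)" using Mi(2) mono by blast
  then show ?thesis using Mi(1) by (intro exI[of _ "\<Sum>i\<in>UNIV. Mi i"]) (auto intro: sum_nonneg)
qed

lemma Cb_bsum_bound_family:
  assumes T: "\<And>i::'i::finite. T i \<in> Cb_besov chi s (of_nat CARD('n))"
  shows "\<exists>M\<ge>0. \<forall>i. \<forall>t\<ge>0. bsum (s - 1) (T i t) \<le> ennreal M"
proof (rule finite_family_bound)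
  show "\<exists>M\<ge>0. \<forall>t\<ge>0. bsum (s - 1) (T i t) \<le> ennreal M" for i by (rule Cb_bsum_bound[OF T])
  show "\<forall>t\<ge>0. bsum (s - 1) (T i t) \<le> ennreal M'" if "\<forall>t\<ge>0. bsum (s - 1) (T i t) \<le> ennreal M" "M \<le> M'" for i M M'
    using that by (auto intro: order_trans[OF _ ennreal_leI])
qed

lemma rpairable_shift: "rpairable \<rho> \<Longrightarrow> rpairable (\<lambda>x. \<rho> x - 1)"
  by (simp add: pairable_def left_diff_distrib schwartz_integrable)

lemma represents_dnorm: "represents f T \<Longrightarrow> dnorm (pairing f) = dnorm T"
  by (rule dnorm_cong) (simp add: represents_def)

lemma norm_vec_le:
  fixes v :: "real^'n"
  assumes "\<And>i. \<bar>v $ i\<bar> \<le> c"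
  shows "norm v \<le> real CARD('n) * c"
proof -
  have "norm v \<le> (\<Sum>i\<in>UNIV. \<bar>v $ i\<bar>)" by (rule norm_le_l1_cart)
  also have "\<dots> \<le> (\<Sum>i\<in>(UNIV::'n set). c)" by (intro sum_mono assms)
  finally show ?thesis by simp
qed

lemma AE_all_finite:
  assumes "\<And>i::'i::finite. AE x in M. P i x"
  shows "AE x in M. \<forall>i. P i x"
proof -
  have "AE x in M. \<forall>i\<in>UNIV. P i x" by (subst AE_finite_all) (use assms in auto)
  then show ?thesis by simp
qed

lemma rpairable_vec_measurable:
  fixes v :: "real^'n \<Rightarrow> real^'n"
  assumes "\<And>i. rpairable (\<lambda>x. v x $ i)"
  shows "v \<in> borel_measurable borel"
proof (subst borel_measurable_euclidean_space, intro ballI)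
  fix b :: "real^'n" assume "b \<in> Basis"
  then obtain k where b: "b = axis k 1" by (auto simp: Basis_vec_def)
  show "(\<lambda>x. v x \<bullet> b) \<in> borel_measurable borel"
    unfolding b using loc_integrable_measurable[OF rpairable_loc_integrable[OF assms[of k]]] by (simp add: inner_axis)
qed

text \<open>In every term one factor is controlled by \<open>H\<close>, a bound on the norms that are integrable in time, and the
  others by \<open>M0\<close>, \<open>M1\<close> and \<open>L\<close>, which bound norms uniformly in time.  The constant is chosen before the functions,
  so that it serves for all times.\<close>

lemma rhs_bound:
  assumes \<alpha>: "1 < \<alpha>" "\<alpha> < 2" and nn: "M0 \<ge> 0" "M1 \<ge> 0" "L \<ge> 0"
  obtains C where "C \<ge> 0"
    "\<And>(r :: real^'n \<Rightarrow> real) (v :: real^'n \<Rightarrow> real^'n) A (G :: real^'n \<Rightarrow> real^'n^'n) J H \<mu>.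
      \<mu> = mu_const TYPE('n) \<alpha> \<Longrightarrow> H \<ge> 0 \<Longrightarrow> rpairable r \<Longrightarrow> (\<And>i. rpairable (\<lambda>x. v x $ i)) \<Longrightarrow>
      (\<And>i. lin (rpairing (\<lambda>x. v x $ i))) \<Longrightarrow>
      (\<And>i k. approximable (dist_deriv k (rpairing (\<lambda>x. v x $ i)))) \<Longrightarrow>
      (\<And>i. dnorm (rpairing (\<lambda>x. v x $ i)) \<le> ennreal M0) \<Longrightarrow>
      (\<And>i. bsum 1 (rpairing (\<lambda>x. v x $ i)) \<le> ennreal H) \<Longrightarrow>
      (\<And>i k. bsum 1 (dist_deriv k (rpairing (\<lambda>x. v x $ i))) \<le> ennreal H) \<Longrightarrow>
      dnorm (rpairing (\<lambda>x. r x - 1)) \<le> ennreal M1 \<Longrightarrow>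
      (\<And>k. dnorm (dist_deriv k (rpairing r)) \<le> ennreal L) \<Longrightarrow>
      (\<And>i. rrepresents (\<lambda>x. A x $ i) (frac_lap \<alpha> (rpairing (\<lambda>x. v x $ i)))) \<Longrightarrow>
      (\<And>i k. rrepresents (\<lambda>x. G x $ i $ k) (dist_deriv k (rpairing (\<lambda>x. v x $ i)))) \<Longrightarrow>
      AE x in lborel. has_pv (\<lambda>y. (((r (x + y) - 1) - (r x - 1)) / norm y powr (real CARD('n) + \<alpha>)) *\<^sub>R (v (x + y) - v x)) (J x) \<Longrightarrow>
      AE x in lborel. norm (- (\<mu> *\<^sub>R A x) + J x - (\<mu> * (r x - 1)) *\<^sub>R A x - G x *v v x) \<le> C * H"
proof -
  obtain Cd where Cd: "Cd > 0" "\<And>T s k. lin T \<Longrightarrow> bsum s (dist_deriv k T) \<le> ennreal Cd * bsum (s + 1) T"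
    using bsum_deriv by blast
  obtain Cr where Cr: "Cr > 0" "\<And>T s. lin T \<Longrightarrow> bsum (s + 1) T \<le> ennreal Cr * (\<Sum>k\<in>UNIV. bsum s (dist_deriv k T))"
    using bsum_reverse by blast
  obtain Cf where Cf: "Cf > 0"
    "\<And>u M. pairable u \<Longrightarrow> lin (pairing u) \<Longrightarrow> AE x in lborel. norm (u x) \<le> M \<Longrightarrow>
       dnorm (frac_lap \<alpha> (pairing u)) \<le> ennreal Cf *
         (SUP n::nat. \<Sum>j\<in>{- int n..int n}. ennreal (2 powr (real_of_int j * \<alpha>)) * dnorm (LP_block chi j (pairing u)))"
  proof -
    have "0 < \<alpha>" using \<alpha> by linarith
    from dnorm_frac_lap[OF this \<alpha>(2)] show ?thesis using that by blast
  qed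
  obtain W where W: "W \<ge> 0"
    "\<And>(s :: real^'n \<Rightarrow> real) (v :: real^'n \<Rightarrow> real^'n) J M Ls Lv.
       s \<in> borel_measurable borel \<Longrightarrow> v \<in> borel_measurable borel \<Longrightarrow> M \<ge> 0 \<Longrightarrow> Ls \<ge> 0 \<Longrightarrow> Lv \<ge> 0 \<Longrightarrow>
       AE x in lborel. \<bar>s x\<bar> \<le> M \<Longrightarrow>
       (\<And>y. AE x in lborel. \<bar>s (x + y) - s x\<bar> \<le> Ls * norm y) \<Longrightarrow>
       (\<And>y. AE x in lborel. norm (v (x + y) - v x) \<le> Lv * norm y) \<Longrightarrow>
       AE x in lborel. has_pv (\<lambda>y. ((s (x + y) - s x) / norm y powr (real CARD('n) + \<alpha>)) *\<^sub>R (v (x + y) - v x)) (J x) \<Longrightarrow>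
       AE x in lborel. norm (J x) \<le> W * (Ls + 2 * M) * Lv"
    using has_pv_bound[OF \<alpha>, where ?'n = 'n] by blast
  let ?d = "real CARD('n)"
  define CA where "CA = Cf * (1 + Cr * ?d)"
  define CJ where "CJ = W * (?d * L + 2 * M1) * (?d * (?d * Cd))"
  define \<mu>0 where "\<mu>0 = \<bar>mu_const TYPE('n) \<alpha>\<bar>"
  define C where "C = \<mu>0 * (?d * CA) + CJ + \<mu>0 * M1 * (?d * CA) + ?d * (?d * Cd * M0)"
  have CA: "CA \<ge> 0" unfolding CA_def using Cf Cr by simp
  have CJ: "CJ \<ge> 0" unfolding CJ_def using W nn Cd by simp
  have C: "C \<ge> 0" unfolding C_def \<mu>0_def using CA CJ nn Cd by simp
  have "AE x in lborel. norm (- (\<mu> *\<^sub>R A x) + J x - (\<mu> * (r x - 1)) *\<^sub>R A x - G x *v v x) \<le> C * H"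
    if mu: "\<mu> = mu_const TYPE('n) \<alpha>" and H: "H \<ge> 0" and r: "rpairable r" and v: "\<And>i. rpairable (\<lambda>x. v x $ i)"
      and lv: "\<And>i. lin (rpairing (\<lambda>x. v x $ i))"
      and adv: "\<And>i k. approximable (dist_deriv k (rpairing (\<lambda>x. v x $ i)))"
      and vM: "\<And>i. dnorm (rpairing (\<lambda>x. v x $ i)) \<le> ennreal M0"
      and vH: "\<And>i. bsum 1 (rpairing (\<lambda>x. v x $ i)) \<le> ennreal H"
      and dvH: "\<And>i k. bsum 1 (dist_deriv k (rpairing (\<lambda>x. v x $ i))) \<le> ennreal H"
      and rM: "dnorm (rpairing (\<lambda>x. r x - 1)) \<le> ennreal M1"
      and rL: "\<And>k. dnorm (dist_deriv k (rpairing r)) \<le> ennreal L"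
      and A: "\<And>i. rrepresents (\<lambda>x. A x $ i) (frac_lap \<alpha> (rpairing (\<lambda>x. v x $ i)))"
      and G: "\<And>i k. rrepresents (\<lambda>x. G x $ i $ k) (dist_deriv k (rpairing (\<lambda>x. v x $ i)))"
      and J: "AE x in lborel. has_pv (\<lambda>y. (((r (x + y) - 1) - (r x - 1)) / norm y powr (?d + \<alpha>)) *\<^sub>R (v (x + y) - v x)) (J x)"
    for r :: "real^'n \<Rightarrow> real" and v :: "real^'n \<Rightarrow> real^'n" and A and G :: "real^'n \<Rightarrow> real^'n^'n" and J H \<mu>
  proof -
    have aev: "AE x in lborel. \<forall>i. \<bar>v x $ i\<bar> \<le> M0"
      by (intro AE_all_finite ae_bound_of_dnorm v vM nn)
    have aer: "AE x in lborel. \<bar>r x - 1\<bar> \<le> M1"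
      by (intro ae_bound_of_dnorm rpairable_shift r rM nn)
    have grad: "dnorm (dist_deriv k (rpairing (\<lambda>x. v x $ i))) \<le> ennreal (Cd * H)" for i k
    proof -
      have "dnorm (dist_deriv k (rpairing (\<lambda>x. v x $ i))) \<le> bsum 0 (dist_deriv k (rpairing (\<lambda>x. v x $ i)))"
        by (rule dnorm_le_bsum[OF adv])
      also have "\<dots> \<le> ennreal Cd * bsum (0 + 1) (rpairing (\<lambda>x. v x $ i))" by (rule Cd(2)[OF lv])
      also have "\<dots> \<le> ennreal Cd * ennreal H" using vH[of i] by (intro mult_left_mono) auto
      finally show ?thesis using Cd by (simp add: ennreal_mult')
    qed
    have CdH: "Cd * H \<ge> 0" using Cd H by simp
    have aeG: "AE x in lborel. \<forall>i k. \<bar>G x $ i $ k\<bar> \<le> Cd * H"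
    proof (intro AE_all_finite ae_bound_of_dnorm CdH)
      fix i k
      show "rpairable (\<lambda>x. G x $ i $ k)" using G[of i k] by (simp add: represents_def)
      show "dnorm (rpairing (\<lambda>x. G x $ i $ k)) \<le> ennreal (Cd * H)"
        using represents_dnorm[OF G[of i k]] grad[of k i] by simp
    qed
    have aeA: "AE x in lborel. \<forall>i. \<bar>A x $ i\<bar> \<le> CA * H"
    proof (intro AE_all_finite ae_bound_of_dnorm)
      fix i
      show "rpairable (\<lambda>x. A x $ i)" using A[of i] by (simp add: represents_def)
      have "bsum \<alpha> (rpairing (\<lambda>x. v x $ i)) \<le> bsum 1 (rpairing (\<lambda>x. v x $ i)) + bsum (1 + 1) (rpairing (\<lambda>x. v x $ i))"
        using \<alpha> by (intro bsum_interpolate) auto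
      also have "\<dots> \<le> ennreal H + ennreal Cr * (\<Sum>k\<in>(UNIV::'n set). ennreal H)"
        by (intro add_mono vH order_trans[OF Cr(2)[OF lv]] mult_left_mono sum_mono dvH) auto
      also have "\<dots> = ennreal ((1 + Cr * ?d) * H)"
        using H Cr(1) by (simp add: ennreal_of_nat_eq_real_of_nat ennreal_mult'[symmetric] ennreal_plus[symmetric] algebra_simps del: ennreal_plus)
      finally have bs: "bsum \<alpha> (rpairing (\<lambda>x. v x $ i)) \<le> ennreal ((1 + Cr * ?d) * H)" .
      have "AE x in lborel. norm (complex_of_real (v x $ i)) \<le> M0" using aev by eventually_elim simp
      then have "dnorm (frac_lap \<alpha> (rpairing (\<lambda>x. v x $ i))) \<le> ennreal Cf * bsum \<alpha> (rpairing (\<lambda>x. v x $ i))"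
        unfolding bsum_def by (rule Cf(2)[OF v lv])
      also have "\<dots> \<le> ennreal Cf * ennreal ((1 + Cr * ?d) * H)" by (intro mult_left_mono bs) simp
      also have "\<dots> = ennreal (CA * H)" using Cf(1) by (simp add: CA_def ennreal_mult'[symmetric] mult.assoc)
      finally show "dnorm (rpairing (\<lambda>x. A x $ i)) \<le> ennreal (CA * H)" using represents_dnorm[OF A[of i]] by simp
    qed (use CA H in simp)
    have rl: "AE x in lborel. \<bar>r (x + y) - r x\<bar> \<le> ?d * L * norm y" for y
      by (rule ae_lipschitz[OF r rL nn(3)])
    have vl: "AE x in lborel. norm (v (x + y) - v x) \<le> ?d * (?d * (Cd * H)) * norm y" for y
    proof -
      have "AE x in lborel. \<forall>i. \<bar>v (x + y) $ i - v x $ i\<bar> \<le> ?d * (Cd * H) * norm y"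
        by (intro AE_all_finite ae_lipschitz[OF v grad CdH])
      then show ?thesis
      proof eventually_elim
        fix x assume "\<forall>i. \<bar>v (x + y) $ i - v x $ i\<bar> \<le> ?d * (Cd * H) * norm y"
        then show "norm (v (x + y) - v x) \<le> ?d * (?d * (Cd * H)) * norm y"
          using norm_vec_le[of "v (x + y) - v x" "?d * (Cd * H) * norm y"] by (simp add: mult_ac)
      qed
    qed
    have aeJ: "AE x in lborel. norm (J x) \<le> W * (?d * L + 2 * M1) * (?d * (?d * (Cd * H)))"
    proof (rule W(2)[where s = "\<lambda>x. r x - 1" and v = v])
      show "(\<lambda>x. r x - 1) \<in> borel_measurable borel"
        by (rule loc_integrable_measurable[OF rpairable_loc_integrable[OF rpairable_shift[OF r]]])
      show "v \<in> borel_measurable borel" by (rule rpairable_vec_measurable[OF v])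
      show "AE x in lborel. \<bar>r (x + y) - 1 - (r x - 1)\<bar> \<le> ?d * L * norm y" for y using rl[of y] by simp
    qed (use nn CdH aer vl J in auto)
    show ?thesis using aev aer aeG aeA aeJ
    proof eventually_elim
      fix x assume x: "\<forall>i. \<bar>v x $ i\<bar> \<le> M0" "\<bar>r x - 1\<bar> \<le> M1" "\<forall>i k. \<bar>G x $ i $ k\<bar> \<le> Cd * H"
        "\<forall>i. \<bar>A x $ i\<bar> \<le> CA * H" "norm (J x) \<le> W * (?d * L + 2 * M1) * (?d * (?d * (Cd * H)))"
      have nA: "norm (A x) \<le> ?d * (CA * H)" by (rule norm_vec_le) (use x in auto)
      have nJ: "norm (J x) \<le> CJ * H" using x(5) by (simp add: CJ_def mult_ac)
      have nG: "norm (G x *v v x) \<le> ?d * (?d * (Cd * H * M0))"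
      proof (rule norm_vec_le)
        fix i
        have "\<bar>(G x *v v x) $ i\<bar> \<le> (\<Sum>k\<in>UNIV. \<bar>G x $ i $ k * v x $ k\<bar>)"
          unfolding matrix_vector_mult_def by (simp add: sum_abs)
        also have "\<dots> \<le> (\<Sum>k\<in>(UNIV::'n set). Cd * H * M0)"
          unfolding abs_mult using x CdH by (intro sum_mono mult_mono) auto
        finally show "\<bar>(G x *v v x) $ i\<bar> \<le> ?d * (Cd * H * M0)" by simp
      qed
      have n1: "norm (\<mu> *\<^sub>R A x) \<le> \<mu>0 * (?d * (CA * H))"
        unfolding norm_scaleR mu \<mu>0_def using nA by (intro mult_left_mono) auto
      have n2: "norm ((\<mu> * (r x - 1)) *\<^sub>R A x) \<le> \<mu>0 * M1 * (?d * (CA * H))"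
        unfolding norm_scaleR mu \<mu>0_def abs_mult using nA x(2) nn by (intro mult_mono) auto
      have "norm (- (\<mu> *\<^sub>R A x) + J x - (\<mu> * (r x - 1)) *\<^sub>R A x - G x *v v x)
        \<le> norm (\<mu> *\<^sub>R A x) + norm (J x) + norm ((\<mu> * (r x - 1)) *\<^sub>R A x) + norm (G x *v v x)"
        by (smt (verit) norm_minus_cancel norm_triangle_ineq norm_triangle_ineq4)
      also have "\<dots> \<le> \<mu>0 * (?d * (CA * H)) + CJ * H + \<mu>0 * M1 * (?d * (CA * H)) + ?d * (?d * (Cd * H * M0))"
        by (intro add_mono n1 n2 nJ nG)
      also have "\<dots> = C * H" by (simp add: C_def algebra_simps)
      finally show "norm (- (\<mu> *\<^sub>R A x) + J x - (\<mu> * (r x - 1)) *\<^sub>R A x - G x *v v x) \<le> C * H" .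
    qed
  qed
  then show ?thesis using that[OF C] by blast
qed

lemma dnorm_diff_le:
  assumes "approximable T" "approximable S" "-1 < s" "s \<le> 0"
  shows "dnorm (\<lambda>\<psi>. T \<psi> - S \<psi>) \<le> bsum s (\<lambda>\<psi>. T \<psi> - S \<psi>) + bsum (s + 1) (\<lambda>\<psi>. T \<psi> - S \<psi>)"
  using order_trans[OF dnorm_le_bsum[OF approximable_diff[OF assms(1,2)]] bsum_interpolate[of s 0 "s + 1"]] assms by auto

text \<open>Continuity in time of the pairing with a fixed test function: high frequencies are controlled
  through the gradient, low ones directly.\<close>

lemma Cb_pairing_continuous:
  fixes T :: "real \<Rightarrow> (real^'n) functional"
  assumes T: "T \<in> Cb_besov chi s (of_nat CARD('n))" and dT: "\<And>k. (\<lambda>t. dist_deriv k (T t)) \<in> Cb_besov chi s (of_nat CARD('n))"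
    and s: "0 < s" "s \<le> 1" and \<psi>: "schwartz \<psi>" "l1 \<psi> \<le> 1"
  shows "continuous_on {0..} (\<lambda>t. T t \<psi>)"
  unfolding continuous_on_def
proof
  fix t :: real assume t: "t \<in> {0..}"
  obtain C where C: "C > 0" "\<And>T s. lin T \<Longrightarrow> bsum s T \<le> ennreal C * besov_norm chi (s + 1) (of_nat CARD('n)) T"
    using bsum_le_besov by blast
  obtain Cr where Cr: "Cr > 0" "\<And>T s. lin T \<Longrightarrow> bsum (s + 1) T \<le> ennreal Cr * (\<Sum>k\<in>UNIV. bsum s (dist_deriv k T))"
    using bsum_reverse by blast
  define N where "N = (\<lambda>r. besov_norm chi s (of_nat CARD('n)) (\<lambda>\<psi>. T r \<psi> - T t \<psi>))"
  define Nk where "Nk = (\<lambda>k r. besov_norm chi s (of_nat CARD('n)) (\<lambda>\<psi>. dist_deriv k (T r) \<psi> - dist_deriv k (T t) \<psi>))"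
  have "((\<lambda>r. ennreal C * N r + ennreal Cr * (\<Sum>k\<in>UNIV. ennreal C * Nk k r)) \<longlongrightarrow> ennreal C * 0 + ennreal Cr * (\<Sum>k\<in>(UNIV::'n set). ennreal C * 0)) (at t within {0..})"
    using T dT t unfolding N_def Nk_def Cb_besov_def by (intro tendsto_add ennreal_tendsto_cmult tendsto_sum) auto
  then have lim: "((\<lambda>r. ennreal C * N r + ennreal Cr * (\<Sum>k\<in>UNIV. ennreal C * Nk k r)) \<longlongrightarrow> ennreal 0) (at t within {0..})" by simp
  have le: "ennreal (norm (T r \<psi> - T t \<psi>)) \<le> ennreal C * N r + ennreal Cr * (\<Sum>k\<in>UNIV. ennreal C * Nk k r)" if r: "r \<in> {0..}" for r
  proof -
    let ?D = "\<lambda>\<psi>. T r \<psi> - T t \<psi>"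
    have ap: "approximable (T r)" "approximable (T t)" using Cb_approximable[OF T] r t by auto
    have lD: "lin ?D" using approximable_diff[OF ap] by (simp add: approximable_def)
    have dD: "dist_deriv k ?D = (\<lambda>\<psi>. dist_deriv k (T r) \<psi> - dist_deriv k (T t) \<psi>)" for k
      by (simp add: dist_deriv_def fun_eq_iff)
    have "ennreal (norm (?D \<psi>)) \<le> dnorm ?D"
      unfolding dnorm_def using \<psi> by (intro SUP_upper) auto
    also have "\<dots> \<le> bsum (s - 1) ?D + bsum (s - 1 + 1) ?D"
      using dnorm_diff_le[OF ap, of "s - 1"] s by auto
    also have "\<dots> \<le> ennreal C * besov_norm chi (s - 1 + 1) (of_nat CARD('n)) ?D
        + ennreal Cr * (\<Sum>k\<in>UNIV. ennreal C * besov_norm chi (s - 1 + 1) (of_nat CARD('n)) (dist_deriv k ?D))"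
      by (intro add_mono C(2) lD order_trans[OF Cr(2)[OF lD]] mult_left_mono sum_mono lin_dist_deriv) auto
    finally show ?thesis by (simp add: N_def Nk_def dD)
  qed
  show "((\<lambda>t. T t \<psi>) \<longlongrightarrow> T t \<psi>) (at t within {0..})"
    unfolding tendsto_iff
  proof (intro allI impI)
    fix e :: real assume e: "e > 0"
    have "\<forall>\<^sub>F r in at t within {0..}. ennreal C * N r + ennreal Cr * (\<Sum>k\<in>UNIV. ennreal C * Nk k r) < ennreal e"
      by (rule order_tendstoD(2)[OF lim]) (use e in simp)
    moreover have "\<forall>\<^sub>F r in at t within {0..}. r \<in> {0..}" by (simp add: eventually_at_filter)
    ultimately show "\<forall>\<^sub>F r in at t within {0..}. dist (T r \<psi>) (T t \<psi>) < e"
    proof eventually_elim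
      fix r assume r: "ennreal C * N r + ennreal Cr * (\<Sum>k\<in>UNIV. ennreal C * Nk k r) < ennreal e" "r \<in> {0..}"
      from le_less_trans[OF le[OF r(2)] r(1)] show "dist (T r \<psi>) (T t \<psi>) < e"
        by (simp add: dist_norm ennreal_less_iff)
    qed
  qed
qed

end

section \<open>Integration in time\<close>

text \<open>Continuity from above of the measure with density \<open>h\<close>.\<close>

lemma tail_integral_small:
  fixes h :: "real \<Rightarrow> ennreal"
  assumes [measurable]: "h \<in> borel_measurable borel" and fin: "(\<integral>\<^sup>+t. h t \<partial>lborel) < \<infinity>" and c: "c > 0"
  shows "\<exists>r\<ge>0. (\<integral>\<^sup>+t. h t * indicator {r..} t \<partial>lborel) < c"
proof -
  let ?\<nu> = "density lborel h"
  have em: "emeasure ?\<nu> {r..} = (\<integral>\<^sup>+t. h t * indicator {r..} t \<partial>lborel)" for r :: real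
    by (simp add: emeasure_density)
  have "(\<lambda>n. emeasure ?\<nu> {real n..}) \<longlonglongrightarrow> emeasure ?\<nu> (\<Inter>n. {real n..})"
  proof (rule Lim_emeasure_decseq)
    show "range (\<lambda>n. {real n..}) \<subseteq> sets ?\<nu>" by auto
    show "decseq (\<lambda>n. {real n..})" by (auto simp: decseq_def)
    show "emeasure ?\<nu> {real n..} \<noteq> \<infinity>" for n
    proof -
      have "emeasure ?\<nu> {real n..} \<le> (\<integral>\<^sup>+t. h t \<partial>lborel)"
        unfolding em by (intro nn_integral_mono) (auto simp: indicator_def)
      then show ?thesis using fin by (auto simp: top_unique)
    qed
  qed
  moreover have "(\<Inter>n. {real n..}) = {}"
  proof safe
    fix x assume "x \<in> (\<Inter>n. {real n..})"
    then have "\<And>n. real n \<le> x" by auto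
    moreover obtain N :: nat where "x < real N" using reals_Archimedean2 by blast
    ultimately show "x \<in> {}" using not_less by blast
  qed
  ultimately have "(\<lambda>n. emeasure ?\<nu> {real n..}) \<longlonglongrightarrow> 0" by simp
  then have "\<forall>\<^sub>F n in sequentially. emeasure ?\<nu> {real n..} < c"
    using c by (rule order_tendstoD(2))
  then obtain n where "emeasure ?\<nu> {real n..} < c" by (auto simp: eventually_sequentially)
  then show ?thesis unfolding em by (intro exI[of _ "real n"]) auto
qed

text \<open>Otherwise \<open>h\<close> would be bounded below on a half line.\<close>

lemma integrable_small_somewhere:
  fixes h :: "real \<Rightarrow> ennreal"
  assumes fin: "(\<integral>\<^sup>+t. h t \<partial>lborel) < \<infinity>" and c: "c > 0"
  shows "\<exists>s\<ge>r. h s \<le> ennreal c"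
proof (rule ccontr)
  assume "\<not> ?thesis"
  then have big: "\<And>s. s \<ge> r \<Longrightarrow> h s \<ge> ennreal c" by (meson linear)
  have "ennreal c * emeasure lborel {r..} = (\<integral>\<^sup>+t. ennreal c * indicator {r..} t \<partial>lborel)"
    by (simp add: nn_integral_cmult_indicator)
  also have "\<dots> \<le> (\<integral>\<^sup>+t. h t \<partial>lborel)"
    using big by (intro nn_integral_mono) (auto simp: indicator_def)
  finally have "ennreal c * emeasure lborel {r..} < \<infinity>" using fin by simp
  then have fe: "emeasure lborel {r..} < \<infinity>" using c by (auto simp: ennreal_mult_less_top ennreal_eq_0_iff)
  obtain m where m: "m \<ge> 0" "emeasure lborel {r..} = ennreal m" using fe by (cases "emeasure lborel {r..}") auto
  have "emeasure lborel {r..r + (m + 1)} \<le> emeasure lborel {r..}" by (intro emeasure_mono) auto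
  then show False using m by simp
qed

context littlewood_paley
begin

text \<open>A smooth step, as the antiderivative of a one-dimensional slice of the cutoff squared.\<close>

lemma smooth_step:
  obtains \<Theta> w :: "real \<Rightarrow> real" where
    "smooth \<Theta>" "continuous_on UNIV w" "\<And>t. (\<Theta> has_real_derivative w t) (at t)" "\<And>t. w t \<ge> 0" "\<And>t. \<bar>t\<bar> \<ge> 2 \<Longrightarrow> w t = 0"
    "\<And>t. t \<le> -2 \<Longrightarrow> \<Theta> t = 0" "\<And>t. t \<ge> 2 \<Longrightarrow> \<Theta> t = 1" "\<And>s t. s \<le> t \<Longrightarrow> \<Theta> s \<le> \<Theta> t"
    "integrable lborel w" "(LINT t|lborel. w t) = 1"
proof -
  define e :: "real^'n" where "e = axis undefined 1"
  have ne: "norm (t *\<^sub>R e) = \<bar>t\<bar>" for t by (simp add: e_def)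
  define w0 where "w0 = (\<lambda>t. chi (t *\<^sub>R e) * chi (t *\<^sub>R e))"
  have "smooth (\<lambda>t::real. chi (0 + t *\<^sub>R e))"
    by (rule smooth_compose_affine[OF chi_smooth bounded_linear_scaleR_left])
  then have sw: "smooth w0" unfolding w0_def by (intro smooth_mult) auto
  have w0: "w0 t \<ge> 0" for t by (simp add: w0_def)
  have w0out: "w0 t = 0" if "\<bar>t\<bar> \<ge> 2" for t
  proof -
    have "norm (t *\<^sub>R e) > 4/3" unfolding ne using that by linarith
    then show ?thesis by (simp add: w0_def chi_out)
  qed
  have w0in: "w0 t = 1" if "\<bar>t\<bar> < 3/4" for t
  proof -
    have "norm (t *\<^sub>R e) < 3/4" unfolding ne using that .
    then show ?thesis by (simp add: w0_def chi_in)
  qed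
  have cw: "continuous_on UNIV w0" by (rule smooth_continuous[OF sw])
  have "\<exists>F. \<forall>x::real. -\<infinity> < ereal x \<longrightarrow> ereal x < \<infinity> \<longrightarrow> (F has_vector_derivative w0 x) (at x)"
    using cw by (intro einterval_antiderivative) (auto simp: continuous_on_eq_continuous_at)
  then obtain F where F: "\<And>x. (F has_real_derivative w0 x) (at x)"
    by (auto simp: has_real_derivative_iff_has_vector_derivative)
  have Fmono: "F s \<le> F t" if "s \<le> t" for s t
    by (rule DERIV_nonneg_imp_nondecreasing[OF that]) (use F w0 in blast)
  have F1: "F t = F 2" if "t \<ge> 2" for t
  proof (cases "t = 2")
    case False
    then have "2 < t" using that by simp
    from MVT2[OF this F] obtain z where "2 < z" "F t - F 2 = (t - 2) * w0 z" by blast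
    then show ?thesis using w0out[of z] by simp
  qed simp
  have F2: "F t = F (-2)" if "t \<le> -2" for t
  proof (cases "t = -2")
    case False
    then have "t < -2" using that by simp
    from MVT2[OF this F] obtain z where "z < -2" "F (-2) - F t = (-2 - t) * w0 z" by blast
    then show ?thesis using w0out[of z] by simp
  qed simp
  obtain z where z: "-(1/2) < z" "z < 1/2" "F (1/2) - F (-(1/2)) = (1/2 - (-(1/2))) * w0 z"
    using MVT2[of "-(1/2)" "1/2" F w0, OF _ F] by auto
  then have "F (1/2) - F (-(1/2)) = 1" using w0in[of z] by simp
  then have N: "F 2 - F (-2) > 0" using Fmono[of "1/2" 2] Fmono[of "-2" "-(1/2)"] by simp
  define N where "N = F 2 - F (-2)"
  define w where "w = (\<lambda>t. w0 t / N)"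
  define \<Theta> where "\<Theta> = (\<lambda>t. (F t - F (-2)) / N)"
  have N0: "N > 0" using N by (simp add: N_def)
  have der: "(\<Theta> has_real_derivative w t) (at t)" for t
    unfolding \<Theta>_def w_def using F[of t] N0 by (auto intro!: derivative_eq_intros)
  have cw1: "continuous_on UNIV w" unfolding w_def using cw N0 by (intro continuous_intros) auto
  have wo: "w t = 0" if "\<bar>t\<bar> \<ge> 2" for t using w0out[OF that] by (simp add: w_def)
  have ind: "w t * indicator {-2..2} t = w t" for t using wo[of t] by (cases "\<bar>t\<bar> \<le> 2") (auto simp: indicator_def)
  have i: "has_bochner_integral lborel (\<lambda>t. w t * indicator {-2..2} t) (\<Theta> 2 - \<Theta> (-2))"
    by (rule has_bochner_integral_FTC_Icc_real) (use der cw1 in \<open>auto simp: continuous_on_eq_continuous_at\<close>)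
  have smT: "smooth \<Theta>"
  proof (rule smooth_antiderivative[OF der])
    have "smooth (\<lambda>t. (1 / N) * w0 t)" by (intro smooth_mult smooth_const sw)
    then show "smooth w" by (simp add: w_def)
  qed
  show ?thesis
  proof (rule that[of \<Theta> w])
    show "\<Theta> t = 0" if "t \<le> -2" for t using F2[OF that] by (simp add: \<Theta>_def)
    show T1: "\<Theta> t = 1" if "t \<ge> 2" for t using F1[OF that] N0 by (simp add: \<Theta>_def N_def)
    show "\<Theta> s \<le> \<Theta> t" if "s \<le> t" for s t using Fmono[OF that] N0 by (simp add: \<Theta>_def divide_right_mono)
    have "\<Theta> (-2) = 0" by (simp add: \<Theta>_def)
    then show "integrable lborel w" "(LINT t|lborel. w t) = 1"
      using i T1[of 2] unfolding ind by (auto simp: has_bochner_integral_iff)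
  qed (use smT cw1 der w0 N0 wo in \<open>auto simp: w_def\<close>)
qed

text \<open>The kernel is concentrated on \<open>|t - s| \<le> 2\<delta>\<close>, where \<open>a\<close> is close to \<open>a s\<close>.\<close>

lemma average_near:
  fixes a w :: "real \<Rightarrow> real"
  assumes w: "continuous_on UNIV w" "\<And>t. w t \<ge> 0" "\<And>t. \<bar>t\<bar> \<ge> 2 \<Longrightarrow> w t = 0" "integrable lborel w" "(LINT t|lborel. w t) = 1"
    and a: "continuous_on {0..} a" and \<delta>: "\<delta> > 0" "2 * \<delta> \<le> s" and e: "\<And>t. \<bar>t - s\<bar> \<le> 2 * \<delta> \<Longrightarrow> \<bar>a t - a s\<bar> \<le> e"
  shows "integrable lborel (\<lambda>t. w ((t - s) / \<delta>) / \<delta> * a t)" and "\<bar>(LINT t|lborel. w ((t - s) / \<delta>) / \<delta> * a t) - a s\<bar> \<le> e"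
proof -
  define K where "K = (\<lambda>t. w ((t - s) / \<delta>) / \<delta>)"
  have e0: "e \<ge> 0" using e[of s] \<delta> by simp
  have K0: "K t \<ge> 0" for t unfolding K_def using w(2) \<delta> by simp
  have Kout: "K t = 0" if "\<bar>t - s\<bar> > 2 * \<delta>" for t
  proof -
    have "2 \<le> \<bar>t - s\<bar> / \<delta>" using that \<delta> by (simp add: pos_le_divide_eq)
    then have "\<bar>(t - s) / \<delta>\<bar> \<ge> 2" using \<delta> by (simp add: abs_divide)
    then show ?thesis using w(3) by (simp add: K_def)
  qed
  have wm [measurable]: "w \<in> borel_measurable borel" using w(1) by (rule borel_measurable_continuous_onI)
  have [measurable]: "K \<in> borel_measurable borel" unfolding K_def by measurable
  have aff: "w (- (s / \<delta>) + (1 / \<delta>) *\<^sub>R t) = \<delta> * K t" for t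
    using \<delta> by (simp add: K_def diff_divide_distrib)
  have Ki: "integrable lborel K"
  proof -
    have "integrable lborel (\<lambda>t. w (- (s / \<delta>) + (1 / \<delta>) *\<^sub>R t))" by (rule integrable_affine[OF w(4)]) (use \<delta> in simp)
    then have "integrable lborel (\<lambda>t. (1 / \<delta>) * (\<delta> * K t))" unfolding aff by (rule integrable_mult_right)
    then show ?thesis using \<delta> by simp
  qed
  have "1 = \<bar>1 / \<delta>\<bar> ^ DIM(real) *\<^sub>R (LINT t|lborel. w (- (s / \<delta>) + (1 / \<delta>) *\<^sub>R t))"
    using integral_affine[of w "1 / \<delta>" "- (s / \<delta>)"] w(5) \<delta> by simp
  then have K1: "(LINT t|lborel. K t) = 1" unfolding aff using \<delta> by simp
  have am: "(\<lambda>t. indicator {0..} t *\<^sub>R a t) \<in> borel_measurable borel"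
    by (rule borel_measurable_continuous_on_indicator[OF _ a]) simp
  have Ka: "K t * a t = K t * (indicator {0..} t *\<^sub>R a t)" for t
    using Kout[of t] \<delta> by (cases "t \<ge> 0") auto
  have m: "(\<lambda>t. K t * a t) \<in> borel_measurable borel" unfolding Ka using am by measurable
  have near: "\<bar>K t * a t - K t * a s\<bar> \<le> K t * e" for t
  proof (cases "\<bar>t - s\<bar> \<le> 2 * \<delta>")
    case True
    have "\<bar>K t * a t - K t * a s\<bar> = K t * \<bar>a t - a s\<bar>"
      using K0[of t] by (simp add: abs_mult right_diff_distrib[symmetric])
    also have "\<dots> \<le> K t * e" using e[OF True] K0 by (intro mult_left_mono) auto
    finally show ?thesis .
  qed (simp add: Kout)
  have int: "integrable lborel (\<lambda>t. K t * a t)"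
  proof (rule Bochner_Integration.integrable_bound)
    show "integrable lborel (\<lambda>t. K t * (\<bar>a s\<bar> + e))" using Ki by simp
    show "AE t in lborel. norm (K t * a t) \<le> norm (K t * (\<bar>a s\<bar> + e))"
    proof (intro AE_I2)
      fix t
      have "\<bar>K t * a t\<bar> \<le> \<bar>K t * a s\<bar> + K t * e" using near[of t] by linarith
      then show "norm (K t * a t) \<le> norm (K t * (\<bar>a s\<bar> + e))" using K0[of t] e0 by (simp add: abs_mult distrib_left)
    qed
  qed (use m in simp)
  show "integrable lborel (\<lambda>t. w ((t - s) / \<delta>) / \<delta> * a t)" using int by (simp add: K_def)
  have "(LINT t|lborel. K t * a t) - a s = (LINT t|lborel. K t * a t - K t * a s)"
    using int Ki K1 by simp
  also have "\<bar>\<dots>\<bar> \<le> (LINT t|lborel. \<bar>K t * a t - K t * a s\<bar>)" by (rule integral_abs_bound)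
  also have "\<dots> \<le> (LINT t|lborel. K t * e)"
    using int Ki near by (intro integral_mono) auto
  also have "\<dots> = e" using Ki K1 by simp
  finally show "\<bar>(LINT t|lborel. w ((t - s) / \<delta>) / \<delta> * a t) - a s\<bar> \<le> e" by (simp add: K_def)
qed

text \<open>The weak form of \<open>u\<^sub>t = R\<close>, tested with a smoothed indicator of \<open>[s, t]\<close> times a mollifier, bounds the
  increment of the mollified velocity by the time integral of the bound on \<open>R\<close>.\<close>

lemma weak_increment_bound:
  fixes u R :: "real \<Rightarrow> real^'n \<Rightarrow> real^'n" and h :: "real \<Rightarrow> ennreal"
  assumes weak: "\<And>\<phi>. test_fun \<phi> \<Longrightarrow> spacetime_integral_zero (\<lambda>t x. dt \<phi> t x *\<^sub>R u t x + \<phi> (t, x) *\<^sub>R R t x)"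
    and u: "\<And>t i. t \<ge> 0 \<Longrightarrow> rpairable (\<lambda>x. u t x $ i)"
    and cont: "continuous_on {0..} (\<lambda>t. LINT x|lborel. u t x $ i * moll \<epsilon> b x)"
    and C: "C \<ge> 0" and R: "AE t in lborel. t > 0 \<longrightarrow> h t < \<infinity> \<and> (AE x in lborel. norm (R t x) \<le> C * enn2real (h t))"
    and hm: "h \<in> borel_measurable borel"
    and \<epsilon>: "0 < \<epsilon>" and st: "2 \<le> s" "s \<le> t"
  shows "ennreal \<bar>(LINT x|lborel. u t x $ i * moll \<epsilon> b x) - (LINT x|lborel. u s x $ i * moll \<epsilon> b x)\<bar>
    \<le> ennreal C * (\<integral>\<^sup>+\<tau>. h \<tau> * indicator {s - 1..} \<tau> \<partial>lborel)"
proof -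
  note [measurable] = hm
  define a where "a = (\<lambda>t. LINT x|lborel. u t x $ i * moll \<epsilon> b x)"
  have ca: "continuous_on {0..} a" using cont by (simp add: a_def)
  obtain \<Theta> w :: "real \<Rightarrow> real" where step:
    "smooth \<Theta>" "continuous_on UNIV w" "\<And>t. (\<Theta> has_real_derivative w t) (at t)" "\<And>t. w t \<ge> 0" "\<And>t. \<bar>t\<bar> \<ge> 2 \<Longrightarrow> w t = 0"
    "\<And>t. t \<le> -2 \<Longrightarrow> \<Theta> t = 0" "\<And>t. t \<ge> 2 \<Longrightarrow> \<Theta> t = 1" "\<And>s t. s \<le> t \<Longrightarrow> \<Theta> s \<le> \<Theta> t"
    "integrable lborel w" "(LINT t|lborel. w t) = 1"
    by (rule smooth_step) (rule that)
  let ?tail = "ennreal C * (\<integral>\<^sup>+\<tau>. h \<tau> * indicator {s - 1..} \<tau> \<partial>lborel)"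
  have main: "ennreal \<bar>a t - a s\<bar> \<le> ?tail + ennreal (2 * e)" if e: "e > 0" for e
  proof -
    have ex: "\<exists>d>0. \<forall>x\<in>{0..}. dist x r < d \<longrightarrow> dist (a x) (a r) < e" if "r \<in> {0..}" for r
      using ca that e by (auto simp: continuous_on_iff)
    obtain d1 where d1: "d1 > 0" "\<And>x. x \<ge> 0 \<Longrightarrow> dist x s < d1 \<Longrightarrow> dist (a x) (a s) < e"
      using ex[of s] st by auto
    obtain d2 where d2: "d2 > 0" "\<And>x. x \<ge> 0 \<Longrightarrow> dist x t < d2 \<Longrightarrow> dist (a x) (a t) < e"
      using ex[of t] st by auto
    note d = d1(1) d2(1) d1(2) d2(2)
    \<comment> \<open>With \<open>\<delta> \<le> 1/2\<close> the smoothed indicator vanishes outside \<open>[s - 1, t + 1]\<close>, in particular near time 0.\<close>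
    define \<delta> where "\<delta> = min (1/2) (min (d1 / 3) (d2 / 3))"
    have \<delta>: "\<delta> > 0" "\<delta> \<le> 1/2" "2 * \<delta> < d1" "2 * \<delta> < d2" using d by (auto simp: \<delta>_def min_def)
    have as: "\<bar>a x - a s\<bar> \<le> e" if "\<bar>x - s\<bar> \<le> 2 * \<delta>" for x
    proof -
      have "x \<ge> 0" "dist x s < d1" using that \<delta> st by (auto simp: dist_real_def)
      then show ?thesis using d(3)[of x] by (simp add: dist_real_def)
    qed
    have at: "\<bar>a x - a t\<bar> \<le> e" if "\<bar>x - t\<bar> \<le> 2 * \<delta>" for x
    proof -
      have "x \<ge> 0" "dist x t < d2" using that \<delta> st by (auto simp: dist_real_def)
      then show ?thesis using d(4)[of x] by (simp add: dist_real_def)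
    qed
    define \<theta> where "\<theta> = (\<lambda>\<tau>. \<Theta> ((\<tau> - s) / \<delta>) - \<Theta> ((\<tau> - t) / \<delta>))"
    define \<theta>' where "\<theta>' = (\<lambda>\<tau>. w ((\<tau> - s) / \<delta>) / \<delta> - w ((\<tau> - t) / \<delta>) / \<delta>)"
    have \<theta>der: "(\<theta> has_real_derivative \<theta>' \<tau>) (at \<tau>)" for \<tau>
    proof -
      have "((\<lambda>\<tau>. \<Theta> ((\<tau> - r) / \<delta>)) has_real_derivative w ((\<tau> - r) / \<delta>) * (1 / \<delta>)) (at \<tau>)" for r
        by (rule DERIV_chain2[OF step(3)]) (use \<delta> in \<open>auto intro!: derivative_eq_intros\<close>)
      then show ?thesis unfolding \<theta>_def \<theta>'_def by (auto intro!: derivative_eq_intros)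
    qed
    have \<theta>smooth: "smooth \<theta>"
    proof -
      have "smooth (\<lambda>\<tau>. \<Theta> (- (r / \<delta>) + (1 / \<delta>) *\<^sub>R \<tau>))" for r
        by (rule smooth_compose_affine[OF step(1) bounded_linear_scaleR_right])
      then have "smooth (\<lambda>\<tau>. \<Theta> ((\<tau> - r) / \<delta>))" for r by (simp add: diff_divide_distrib)
      then show ?thesis unfolding \<theta>_def by (intro smooth_diff)
    qed
    have \<theta>0: "0 \<le> \<theta> \<tau>" "\<theta> \<tau> \<le> 1" for \<tau>
    proof -
      have "(\<tau> - t) / \<delta> \<le> (\<tau> - s) / \<delta>" using st \<delta> by (intro divide_right_mono) auto
      then show "0 \<le> \<theta> \<tau>" using step(8) by (simp add: \<theta>_def)
      have "\<Theta> ((\<tau> - s) / \<delta>) \<le> 1" using step(8)[of "(\<tau> - s) / \<delta>" "max 2 ((\<tau> - s) / \<delta>)"] step(7)[of "max 2 ((\<tau> - s) / \<delta>)"] by simp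
      moreover have "0 \<le> \<Theta> ((\<tau> - t) / \<delta>)" using step(8)[of "min (-2) ((\<tau> - t) / \<delta>)" "(\<tau> - t) / \<delta>"] step(6)[of "min (-2) ((\<tau> - t) / \<delta>)"] by simp
      ultimately show "\<theta> \<tau> \<le> 1" by (simp add: \<theta>_def)
    qed
    have \<theta>out: "\<theta> \<tau> = 0" if "\<tau> < s - 1 \<or> \<tau> > t + 1" for \<tau>
    proof -
      have lo: "(\<tau> - r) / \<delta> \<le> -2" if "\<tau> < r - 1" for r
        using that \<delta> by (simp add: pos_divide_le_eq)
      have hi: "2 \<le> (\<tau> - r) / \<delta>" if "\<tau> > r + 1" for r
        using that \<delta> by (simp add: pos_le_divide_eq)
      show ?thesis
      proof (cases "\<tau> < s - 1")
        case True
        then show ?thesis using lo[of s] lo[of t] st step(6) by (simp add: \<theta>_def)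
      next
        case False
        then show ?thesis using hi[of s] hi[of t] st that step(7) by (simp add: \<theta>_def)
      qed
    qed
    define \<phi> where "\<phi> = (\<lambda>z::real \<times> (real^'n). \<theta> (fst z) * moll \<epsilon> b (snd z))"
    have \<phi>v: "\<phi> (\<tau>, x) = \<theta> \<tau> * moll \<epsilon> b x" for \<tau> x by (simp add: \<phi>_def)
    have tf: "test_fun \<phi>"
    proof -
      have "smooth (\<lambda>z::real \<times> (real^'n). \<theta> (0 + fst z))"
        by (rule smooth_compose_affine[OF \<theta>smooth bounded_linear_fst])
      moreover have "smooth (\<lambda>z::real \<times> (real^'n). moll \<epsilon> b (0 + snd z))"
        by (rule smooth_compose_affine[OF smooth_moll bounded_linear_snd])
      ultimately have sm: "smooth \<phi>" unfolding \<phi>_def by (intro smooth_mult) auto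
      let ?K = "{s - 1..t + 1} \<times> cball b (4/3 * \<epsilon>)"
      have K: "compact ?K" by (intro compact_Times) auto
      have "{z. \<phi> z \<noteq> 0} \<subseteq> ?K"
      proof safe
        fix \<tau> x assume nz: "\<phi> (\<tau>, x) \<noteq> 0"
        then show "\<tau> \<in> {s - 1..t + 1}" using \<theta>out[of \<tau>] by (force simp: \<phi>_def)
        show "x \<in> cball b (4/3 * \<epsilon>)"
          using nz moll_out[OF \<epsilon>, of x b] by (force simp: \<phi>_def dist_norm norm_minus_commute)
      qed
      then have cl: "closure {z. \<phi> z \<noteq> 0} \<subseteq> ?K" by (rule closure_minimal[OF _ compact_imp_closed[OF K]])
      moreover have "compact (closure {z. \<phi> z \<noteq> 0})"
        using compact_Int_closed[OF K closed_closure, of "{z. \<phi> z \<noteq> 0}"] cl by (simp add: Int_absorb1)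
      moreover have "?K \<subseteq> {0<..} \<times> UNIV" using st by auto
      ultimately show ?thesis using sm by (auto simp: test_fun_def)
    qed
    have dt\<phi>: "dt \<phi> \<tau> x = \<theta>' \<tau> * moll \<epsilon> b x" for \<tau> x
    proof -
      have d1: "((\<lambda>z::real \<times> (real^'n). \<theta> (fst z)) has_derivative (\<lambda>v. \<theta>' \<tau> * fst v)) (at (\<tau>, x))"
      proof -
        have "(\<theta> has_derivative (\<lambda>v. \<theta>' \<tau> * v)) (at (fst (\<tau>, x)))" using \<theta>der[of \<tau>] by (simp add: has_field_derivative_def)
        from has_derivative_compose[OF has_derivative_fst[OF has_derivative_ident] this] show ?thesis .
      qed
      have d2: "((\<lambda>z::real \<times> (real^'n). moll \<epsilon> b (snd z)) has_derivative (\<lambda>v. dderiv (snd v) (moll \<epsilon> b) x)) (at (\<tau>, x))"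
      proof -
        have "(moll \<epsilon> b has_derivative (\<lambda>v. dderiv v (moll \<epsilon> b) x)) (at (snd (\<tau>, x)))"
          using has_derivative_dderiv[OF smooth_differentiable[OF smooth_moll]] by simp
        from has_derivative_compose[OF has_derivative_snd[OF has_derivative_ident] this] show ?thesis .
      qed
      have "dderiv (0 :: real^'n) (moll \<epsilon> b) x = 0"
        using linear_0[OF dderiv_linear[OF smooth_differentiable[OF smooth_moll]]] .
      then show ?thesis
        unfolding dt_def \<phi>_def by (subst dderiv_eqI[OF has_derivative_mult[OF d1 d2]]) simp
    qed
    define P where "P = (\<lambda>\<tau>. LINT x|lborel. (dt \<phi> \<tau> x *\<^sub>R u \<tau> x + \<phi> (\<tau>, x) *\<^sub>R R \<tau> x))"
    have sz: "AE \<tau> in lborel. \<tau> > 0 \<longrightarrow> integrable lborel (\<lambda>x. dt \<phi> \<tau> x *\<^sub>R u \<tau> x + \<phi> (\<tau>, x) *\<^sub>R R \<tau> x)"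
      "integrable lborel (\<lambda>\<tau>. indicator {0<..} \<tau> *\<^sub>R P \<tau>)" "(LINT \<tau>|lborel. indicator {0<..} \<tau> *\<^sub>R P \<tau>) = 0"
      using weak[OF tf] unfolding spacetime_integral_zero_def P_def set_integrable_def set_lebesgue_integral_def by auto
    define p where "p = (\<lambda>\<tau>. indicator {0<..} \<tau> * (P \<tau> $ i))"
    have pe: "p \<tau> = (indicator {0<..} \<tau> *\<^sub>R P \<tau>) $ i" for \<tau> by (simp add: p_def)
    have pint: "integrable lborel p"
      unfolding pe[abs_def] by (rule integrable_bounded_linear[OF bounded_linear_vec_nth sz(2)])
    have p0: "(LINT \<tau>|lborel. p \<tau>) = 0"
      unfolding pe[abs_def] using integral_bounded_linear[OF bounded_linear_vec_nth[of i] sz(2)] sz(3) by simp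
    define k where "k = (\<lambda>\<tau>. w ((\<tau> - s) / \<delta>) / \<delta> * a \<tau> - w ((\<tau> - t) / \<delta>) / \<delta> * a \<tau>)"
    have k\<theta>: "k \<tau> = \<theta>' \<tau> * a \<tau>" for \<tau> by (simp add: k_def \<theta>'_def left_diff_distrib)
    have s2: "2 * \<delta> \<le> s" "2 * \<delta> \<le> t" using \<delta> st by auto
    note avs = average_near[OF step(2,4,5,9,10) ca \<delta>(1) s2(1) as]
    note avt = average_near[OF step(2,4,5,9,10) ca \<delta>(1) s2(2) at]
    have kint: "integrable lborel k" unfolding k_def using avs(1) avt(1) by simp
    have kval: "\<bar>(LINT \<tau>|lborel. k \<tau>) - (a s - a t)\<bar> \<le> 2 * e"
    proof -
      have "(LINT \<tau>|lborel. k \<tau>) = (LINT \<tau>|lborel. w ((\<tau> - s) / \<delta>) / \<delta> * a \<tau>) - (LINT \<tau>|lborel. w ((\<tau> - t) / \<delta>) / \<delta> * a \<tau>)"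
        unfolding k_def by (rule Bochner_Integration.integral_diff[OF avs(1) avt(1)])
      then show ?thesis using avs(2) avt(2) by linarith
    qed
    have kneg: "k \<tau> = 0" if "\<tau> \<le> 0" for \<tau>
    proof -
      have "\<bar>(\<tau> - r) / \<delta>\<bar> \<ge> 2" if "2 \<le> r" for r
      proof -
        have "2 * \<delta> \<le> r - \<tau>" using \<delta> that \<open>\<tau> \<le> 0\<close> by simp
        then have "2 \<le> (r - \<tau>) / \<delta>" using \<delta> by (simp add: pos_le_divide_eq)
        then show ?thesis by (simp add: minus_divide_left[symmetric] abs_if diff_divide_distrib)
      qed
      then show ?thesis using st step(5) by (simp add: k_def)
    qed
    have qb: "AE \<tau> in lborel. ennreal (norm (p \<tau> - k \<tau>)) \<le> ennreal C * (h \<tau> * indicator {s - 1..} \<tau>)"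
      using sz(1) R
    proof eventually_elim
      fix \<tau> assume as1: "\<tau> > 0 \<longrightarrow> integrable lborel (\<lambda>x. dt \<phi> \<tau> x *\<^sub>R u \<tau> x + \<phi> (\<tau>, x) *\<^sub>R R \<tau> x)"
        and as2: "\<tau> > 0 \<longrightarrow> h \<tau> < \<infinity> \<and> (AE x in lborel. norm (R \<tau> x) \<le> C * enn2real (h \<tau>))"
      show "ennreal (norm (p \<tau> - k \<tau>)) \<le> ennreal C * (h \<tau> * indicator {s - 1..} \<tau>)"
      proof (cases "\<tau> > 0")
        case True
        let ?H = "enn2real (h \<tau>)"
        have iF: "integrable lborel (\<lambda>x. (\<theta>' \<tau> * moll \<epsilon> b x) *\<^sub>R u \<tau> x + (\<theta> \<tau> * moll \<epsilon> b x) *\<^sub>R R \<tau> x)"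
          using as1 True by (simp add: dt\<phi> \<phi>v)
        have PF: "P \<tau> = (LINT x|lborel. (\<theta>' \<tau> * moll \<epsilon> b x) *\<^sub>R u \<tau> x + (\<theta> \<tau> * moll \<epsilon> b x) *\<^sub>R R \<tau> x)"
          by (simp add: P_def dt\<phi> \<phi>v)
        have iFi: "integrable lborel (\<lambda>x. \<theta>' \<tau> * (u \<tau> x $ i * moll \<epsilon> b x) + \<theta> \<tau> * moll \<epsilon> b x * R \<tau> x $ i)"
          using integrable_bounded_linear[OF bounded_linear_vec_nth[of i] iF] by (simp add: mult_ac)
        have PFi: "P \<tau> $ i = (LINT x|lborel. \<theta>' \<tau> * (u \<tau> x $ i * moll \<epsilon> b x) + \<theta> \<tau> * moll \<epsilon> b x * R \<tau> x $ i)"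
          unfolding PF using integral_bounded_linear[OF bounded_linear_vec_nth[of i] iF] by (simp add: mult_ac)
        have iu: "integrable lborel (\<lambda>x. \<theta>' \<tau> * (u \<tau> x $ i * moll \<epsilon> b x))"
          using True by (intro integrable_mult_right loc_integrable_moll rpairable_loc_integrable u \<epsilon>) auto
        have iR: "integrable lborel (\<lambda>x. \<theta> \<tau> * moll \<epsilon> b x * R \<tau> x $ i)"
          using Bochner_Integration.integrable_diff[OF iFi iu] by simp
        have "p \<tau> - k \<tau> = (LINT x|lborel. \<theta> \<tau> * moll \<epsilon> b x * R \<tau> x $ i)"
          unfolding p_def k\<theta> PFi a_def using True Bochner_Integration.integral_add[OF iu iR] by simp
        also have "norm \<dots> \<le> (LINT x|lborel. norm (\<theta> \<tau> * moll \<epsilon> b x * R \<tau> x $ i))" by (rule integral_norm_bound)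
        also have "\<dots> \<le> (LINT x|lborel. \<theta> \<tau> * (C * ?H) * moll \<epsilon> b x)"
        proof (rule integral_mono_AE)
          show "integrable lborel (\<lambda>x. norm (\<theta> \<tau> * moll \<epsilon> b x * R \<tau> x $ i))" using iR by (rule integrable_norm)
          show "integrable lborel (\<lambda>x. \<theta> \<tau> * (C * ?H) * moll \<epsilon> b x)" using moll_integrable[OF \<epsilon>] by (intro integrable_mult_right)
          have "AE x in lborel. norm (R \<tau> x) \<le> C * ?H" using as2 True by simp
          then show "AE x in lborel. norm (\<theta> \<tau> * moll \<epsilon> b x * R \<tau> x $ i) \<le> \<theta> \<tau> * (C * ?H) * moll \<epsilon> b x"
          proof eventually_elim
            fix x assume "norm (R \<tau> x) \<le> C * ?H"
            then have "\<bar>R \<tau> x $ i\<bar> \<le> C * ?H" using component_le_norm_cart[of "R \<tau> x" i] by linarith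
            then have "(\<theta> \<tau> * moll \<epsilon> b x) * \<bar>R \<tau> x $ i\<bar> \<le> (\<theta> \<tau> * moll \<epsilon> b x) * (C * ?H)"
              using \<theta>0 moll_nonneg[OF \<epsilon>] by (intro mult_left_mono) auto
            then show "norm (\<theta> \<tau> * moll \<epsilon> b x * R \<tau> x $ i) \<le> \<theta> \<tau> * (C * ?H) * moll \<epsilon> b x"
              using \<theta>0[of \<tau>] moll_nonneg[OF \<epsilon>, of b x] by (simp add: abs_mult mult_ac)
          qed
        qed
        also have "\<dots> = \<theta> \<tau> * (C * ?H)" by (simp add: moll_mass[OF \<epsilon>])
        finally have n: "norm (p \<tau> - k \<tau>) \<le> \<theta> \<tau> * (C * ?H)" .
        show ?thesis
        proof (cases "\<tau> \<ge> s - 1")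
          case True2: True
          have "norm (p \<tau> - k \<tau>) \<le> 1 * (C * ?H)"
            using n \<theta>0[of \<tau>] C mult_right_mono[of "\<theta> \<tau>" 1 "C * ?H"] by simp
          then have "ennreal (norm (p \<tau> - k \<tau>)) \<le> ennreal (C * ?H)" by (simp add: ennreal_leI)
          also have "\<dots> = ennreal C * h \<tau>" using C as2 True by (simp add: ennreal_mult' less_top)
          finally show ?thesis using True2 by simp
        next
          case False
          then show ?thesis using n \<theta>out[of \<tau>] by simp
        qed
      qed (simp add: p_def kneg)
    qed
    have "ennreal \<bar>LINT \<tau>|lborel. p \<tau> - k \<tau>\<bar> \<le> (\<integral>\<^sup>+\<tau>. ennreal (norm (p \<tau> - k \<tau>)) \<partial>lborel)"
      using integral_norm_bound_ennreal[of lborel "\<lambda>\<tau>. p \<tau> - k \<tau>"] pint kint by simp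
    also have "\<dots> \<le> (\<integral>\<^sup>+\<tau>. ennreal C * (h \<tau> * indicator {s - 1..} \<tau>) \<partial>lborel)"
      by (rule nn_integral_mono_AE[OF qb])
    also have "\<dots> = ?tail" by (rule nn_integral_cmult) measurable
    finally have "ennreal \<bar>LINT \<tau>|lborel. k \<tau>\<bar> \<le> ?tail" using pint kint p0 by simp
    then have "ennreal \<bar>LINT \<tau>|lborel. k \<tau>\<bar> + ennreal (2 * e) \<le> ?tail + ennreal (2 * e)" by (rule add_right_mono)
    moreover have "ennreal \<bar>a t - a s\<bar> \<le> ennreal \<bar>LINT \<tau>|lborel. k \<tau>\<bar> + ennreal (2 * e)"
    proof -
      have "\<bar>a t - a s\<bar> \<le> \<bar>LINT \<tau>|lborel. k \<tau>\<bar> + 2 * e" using kval by linarith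
      then have "ennreal \<bar>a t - a s\<bar> \<le> ennreal (\<bar>LINT \<tau>|lborel. k \<tau>\<bar> + 2 * e)" by (rule ennreal_leI)
      also have "\<dots> = ennreal \<bar>LINT \<tau>|lborel. k \<tau>\<bar> + ennreal (2 * e)" using e by (intro ennreal_plus) auto
      finally show ?thesis .
    qed
    ultimately show ?thesis by (rule order_trans[rotated])
  qed
  have "ennreal \<bar>a t - a s\<bar> \<le> ?tail"
  proof (rule ennreal_le_epsilon)
    fix e :: real assume "0 < e"
    then show "ennreal \<bar>a t - a s\<bar> \<le> ?tail + ennreal e" using main[of "e / 2"] by simp
  qed
  then show ?thesis by (simp add: a_def)
qed

end

section \<open>Decay of the velocity\<close>

context littlewood_paley
begin

text \<open>Boundedness in the solution class makes the low frequencies of \<open>u\<close> harmless, and integrability in time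
  of \<open>bsum 1\<close> makes the high frequencies small at arbitrarily late times \<open>s\<close>.  From such a time on, the
  integrated right-hand side, being the tail of a convergent integral, keeps \<open>u\<close> small.\<close>

theorem velocity_decay:
  fixes \<rho> :: "real \<Rightarrow> real^'n \<Rightarrow> real" and u :: "real \<Rightarrow> real^'n \<Rightarrow> real^'n"
  assumes \<alpha>: "1 < \<alpha>" "\<alpha> < 2" and sol: "global_solution chi \<alpha> \<rho>0 u0 \<rho> u"
  shows "((\<lambda>t. Lp_norm \<infinity> (u t)) \<longlongrightarrow> 0) at_top"
proof -
  define U where "U = (\<lambda>i t. rpairing (\<lambda>x. u t x $ i))"
  let ?D = "\<lambda>i k t. dist_deriv k (U i t)"
  have rp: "rpairable (\<rho> t)" "\<And>i. rpairable (\<lambda>x. u t x $ i)" if "t \<ge> 0" for t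
    using sol that by (auto simp: global_solution_def)
  have UC: "U i \<in> Cb_besov chi (2 - \<alpha>) (of_nat CARD('n))" "U i \<in> L1_besov chi 2 (of_nat CARD('n))" for i
    using sol by (auto simp: global_solution_def U_def)
  have DC: "?D i k \<in> Cb_besov chi (2 - \<alpha>) (of_nat CARD('n))" "?D i k \<in> L1_besov chi 2 (of_nat CARD('n))" for i k
    using sol by (auto simp: global_solution_def U_def)
  have SC: "(\<lambda>t. rpairing (\<lambda>x. \<rho> t x - 1)) \<in> Cb_besov chi 1 (of_nat CARD('n))"
    and RC: "(\<lambda>t. dist_deriv k (rpairing (\<rho> t))) \<in> Cb_besov chi 1 (of_nat CARD('n))" for k
    using sol by (auto simp: global_solution_def)
  have weak: "weak_momentum_eq \<alpha> (\<lambda>t x. \<rho> t x - 1) u" using sol by (simp add: global_solution_def)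
  obtain M where M: "M \<ge> 0" "\<And>i t. t \<ge> 0 \<Longrightarrow> bsum (1 - \<alpha>) (U i t) \<le> ennreal M"
    using Cb_bsum_bound_family[of U "2 - \<alpha>", OF UC(1)] by (auto simp: algebra_simps)
  obtain M' where M': "M' \<ge> 0" "\<And>i k t. t \<ge> 0 \<Longrightarrow> bsum (1 - \<alpha>) (?D i k t) \<le> ennreal M'"
  proof -
    have "\<exists>M\<ge>0. \<forall>z. \<forall>t\<ge>0. bsum ((2 - \<alpha>) - 1) (?D (fst z) (snd z) t) \<le> ennreal M"
      by (rule Cb_bsum_bound_family[OF DC(1)])
    then show ?thesis using that by (auto simp: algebra_simps)
  qed
  obtain Cr where Cr: "Cr > 0" "\<And>T s. lin T \<Longrightarrow> bsum (s + 1) T \<le> ennreal Cr * (\<Sum>k\<in>UNIV. bsum s (dist_deriv k T))"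
    using bsum_reverse by blast
  define M0 where "M0 = M + Cr * (real CARD('n) * M')"
  have M0: "M0 \<ge> 0" using M M' Cr by (simp add: M0_def)
  have dU: "dnorm (U i t) \<le> ennreal M0" if t: "t \<ge> 0" for i t
  proof -
    have "(\<Sum>k\<in>UNIV. bsum (1 - \<alpha>) (?D i k t)) \<le> (\<Sum>k\<in>(UNIV::'n set). ennreal M')" by (intro sum_mono M' t)
    also have "\<dots> = ennreal (real CARD('n) * M')" using M' by (simp add: ennreal_mult' ennreal_of_nat_eq_real_of_nat)
    finally have "bsum (1 - \<alpha> + 1) (U i t) \<le> ennreal Cr * ennreal (real CARD('n) * M')"
      using Cr(2)[OF Cb_lin[OF UC(1) t], of "1 - \<alpha>"] by (meson mult_left_mono order_trans zero_le)
    then have b: "bsum (1 - \<alpha> + 1) (U i t) \<le> ennreal (Cr * (real CARD('n) * M'))"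
      using Cr M' by (simp add: ennreal_mult')
    have "dnorm (U i t) \<le> bsum 0 (U i t)" by (rule dnorm_le_bsum[OF Cb_approximable[OF UC(1) t]])
    also have "\<dots> \<le> bsum (1 - \<alpha>) (U i t) + bsum (1 - \<alpha> + 1) (U i t)" using \<alpha> by (intro bsum_interpolate) auto
    also have "\<dots> \<le> ennreal M + ennreal (Cr * (real CARD('n) * M'))" by (intro add_mono M(2) t b)
    also have "\<dots> = ennreal M0" using M M' Cr by (simp add: M0_def ennreal_plus)
    finally show ?thesis .
  qed
  obtain M1 where M1: "M1 \<ge> 0" "\<And>t. t \<ge> 0 \<Longrightarrow> dnorm (rpairing (\<lambda>x. \<rho> t x - 1)) \<le> ennreal M1"
  proof -
    obtain M1 where M1: "M1 \<ge> 0" "\<forall>t\<ge>0. bsum (1 - 1) (rpairing (\<lambda>x. \<rho> t x - 1)) \<le> ennreal M1"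
      using Cb_bsum_bound[OF SC] by blast
    have "dnorm (rpairing (\<lambda>x. \<rho> t x - 1)) \<le> ennreal M1" if "t \<ge> 0" for t
      using dnorm_le_bsum[OF Cb_approximable[OF SC that]] M1(2) that by (auto intro: order_trans)
    then show ?thesis using that M1(1) by blast
  qed
  obtain L where L: "L \<ge> 0" "\<And>k t. t \<ge> 0 \<Longrightarrow> dnorm (dist_deriv k (rpairing (\<rho> t))) \<le> ennreal L"
  proof -
    have "\<exists>L\<ge>0. \<forall>k. \<forall>t\<ge>0. bsum (1 - 1) (dist_deriv k (rpairing (\<rho> t))) \<le> ennreal L"
      by (rule Cb_bsum_bound_family[OF RC])
    then obtain L where L: "L \<ge> 0" "\<forall>k. \<forall>t\<ge>0. bsum (1 - 1) (dist_deriv k (rpairing (\<rho> t))) \<le> ennreal L" by blast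
    have "dnorm (dist_deriv k (rpairing (\<rho> t))) \<le> ennreal L" if "t \<ge> 0" for k t
      using dnorm_le_bsum[OF Cb_approximable[OF RC that]] L(2) that by (auto intro: order_trans)
    then show ?thesis using that L(1) by blast
  qed
  \<comment> \<open>Outside \<open>t \<ge> 0\<close> nothing is known about \<open>u\<close>, hence the indicators.\<close>
  define h where "h = (\<lambda>t. (\<Sum>i\<in>UNIV. indicator {0..} t * bsum 1 (U i t))
     + (\<Sum>i\<in>UNIV. \<Sum>k\<in>UNIV. indicator {0..} t * bsum 1 (?D i k t)))"
  note [measurable] = bsum_measurable[OF UC(1), of 1] bsum_measurable[OF DC(1), of 1]
  have hm [measurable]: "h \<in> borel_measurable borel" unfolding h_def by measurable
  have hfin: "(\<integral>\<^sup>+t. h t \<partial>lborel) < \<infinity>"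
  proof -
    define a where "a = (\<lambda>i t. indicator {0..} t * bsum 1 (U i t))"
    define b where "b = (\<lambda>i k t. indicator {0..} t * bsum 1 (?D i k t))"
    have [measurable]: "a i \<in> borel_measurable borel" "b i k \<in> borel_measurable borel" for i k
      unfolding a_def b_def by measurable
    have "(\<integral>\<^sup>+t. h t \<partial>lborel) = (\<integral>\<^sup>+t. (\<Sum>i\<in>UNIV. a i t) + (\<Sum>i\<in>UNIV. \<Sum>k\<in>UNIV. b i k t) \<partial>lborel)"
      by (simp only: h_def a_def b_def)
    also have "\<dots> = (\<Sum>i\<in>UNIV. \<integral>\<^sup>+t. a i t \<partial>lborel) + (\<Sum>i\<in>UNIV. \<Sum>k\<in>UNIV. \<integral>\<^sup>+t. b i k t \<partial>lborel)"
      by (simp add: nn_integral_add nn_integral_sum)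
    also have "\<dots> < \<infinity>"
      using bsum_integrable[OF UC] bsum_integrable[OF DC] unfolding a_def b_def by (auto simp: less_top ennreal_add_eq_top)
    finally show ?thesis .
  qed
  have hU: "bsum 1 (U i t) \<le> h t" if "t \<ge> 0" for i t
  proof -
    have "indicator {0..} t * bsum 1 (U i t) \<le> (\<Sum>i\<in>UNIV. indicator {0..} t * bsum 1 (U i t))"
      by (rule member_le_sum) auto
    then show ?thesis using that unfolding h_def by (simp add: add_increasing2)
  qed
  have hD: "bsum 1 (?D i k t) \<le> h t" if "t \<ge> 0" for i k t
  proof -
    have "indicator {0..} t * bsum 1 (?D i k t) \<le> (\<Sum>k\<in>UNIV. indicator {0..} t * bsum 1 (?D i k t))"
      by (rule member_le_sum) auto
    also have "\<dots> \<le> (\<Sum>i\<in>UNIV. \<Sum>k\<in>UNIV. indicator {0..} t * bsum 1 (?D i k t))"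
      by (rule member_le_sum) auto
    finally show ?thesis using that unfolding h_def by (simp add: add_increasing)
  qed
  have hae: "AE t in lborel. h t < \<infinity>"
    using nn_integral_PInf_AE[of h lborel] hfin by (auto simp: less_top)
  obtain A G J where
    AGJ: "AE t in lborel. t > 0 \<longrightarrow>
           (\<forall>i. rrepresents (\<lambda>x. A t x $ i) (frac_lap \<alpha> (rpairing (\<lambda>x. u t x $ i)))) \<and>
           (\<forall>i k. rrepresents (\<lambda>x. G t x $ i $ k) (dist_deriv k (rpairing (\<lambda>x. u t x $ i)))) \<and>
           (AE x in lborel. has_pv
              (\<lambda>y. (((\<rho> t (x + y) - 1) - (\<rho> t x - 1)) / norm y powr (real CARD('n) + \<alpha>)) *\<^sub>R (u t (x + y) - u t x))
              (J t x))"
    and eqn: "\<And>\<phi>. test_fun \<phi> \<Longrightarrow> spacetime_integral_zero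
           (\<lambda>t x. dt \<phi> t x *\<^sub>R u t x
              + \<phi> (t, x) *\<^sub>R (- (mu_const TYPE('n) \<alpha> *\<^sub>R A t x) + J t x
                  - (mu_const TYPE('n) \<alpha> * (\<rho> t x - 1)) *\<^sub>R A t x - G t x *v u t x))"
    using weak unfolding weak_momentum_eq_def by blast
  define R where "R = (\<lambda>t x. - (mu_const TYPE('n) \<alpha> *\<^sub>R A t x) + J t x
                  - (mu_const TYPE('n) \<alpha> * (\<rho> t x - 1)) *\<^sub>R A t x - G t x *v u t x)"
  have eqnR: "spacetime_integral_zero (\<lambda>t x. dt \<phi> t x *\<^sub>R u t x + \<phi> (t, x) *\<^sub>R R t x)" if "test_fun \<phi>" for \<phi>
    using eqn[OF that] by (simp add: R_def)
  obtain C where C: "C \<ge> 0" and RB: "AE t in lborel. t > 0 \<longrightarrow> h t < \<infinity> \<and> (AE x in lborel. norm (R t x) \<le> C * enn2real (h t))"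
  proof (rule rhs_bound[OF \<alpha> M0 M1(1) L(1)], goal_cases)
    case (1 C)
    note bound = 1(3)
    have "AE t in lborel. t > 0 \<longrightarrow> h t < \<infinity> \<and> (AE x in lborel. norm (R t x) \<le> C * enn2real (h t))"
      using AGJ hae
    proof eventually_elim
      case (elim t)
      show ?case
      proof (intro impI conjI)
        assume "t > 0"
        then have t: "t \<ge> 0" by simp
        show "h t < \<infinity>" by (rule elim(2))
        then have hr: "ennreal (enn2real (h t)) = h t" by simp
        show "AE x in lborel. norm (R t x) \<le> C * enn2real (h t)"
          unfolding R_def
        proof (rule bound[OF refl enn2real_nonneg rp(1)[OF t] rp(2)[OF t]])
          show "lin (rpairing (\<lambda>x. u t x $ i))" for i using Cb_lin[OF UC(1) t] by (simp add: U_def)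
          show "approximable (dist_deriv k (rpairing (\<lambda>x. u t x $ i)))" for i k
            using Cb_approximable[OF DC(1) t] by (simp add: U_def)
          show "dnorm (rpairing (\<lambda>x. u t x $ i)) \<le> ennreal M0" for i using dU[OF t] by (simp add: U_def)
          show "bsum 1 (rpairing (\<lambda>x. u t x $ i)) \<le> ennreal (enn2real (h t))" for i
            unfolding hr using hU[OF t] by (simp add: U_def)
          show "bsum 1 (dist_deriv k (rpairing (\<lambda>x. u t x $ i))) \<le> ennreal (enn2real (h t))" for i k
            unfolding hr using hD[OF t] by (simp add: U_def)
          show "dnorm (rpairing (\<lambda>x. \<rho> t x - 1)) \<le> ennreal M1" by (rule M1(2)[OF t])
          show "dnorm (dist_deriv k (rpairing (\<rho> t))) \<le> ennreal L" for k by (rule L(2)[OF t])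
        qed (use elim(1) \<open>t > 0\<close> in blast)+
      qed
    qed
    then show ?case by (rule 1(1)[OF 1(2)])
  qed
  have cont: "continuous_on {0..} (\<lambda>t. LINT x|lborel. u t x $ i * moll \<epsilon> b x)" if \<epsilon>: "\<epsilon> > 0" for i \<epsilon> b
  proof -
    have "continuous_on {0..} (\<lambda>t. U i t (\<lambda>x. complex_of_real (moll \<epsilon> b x)))"
      by (rule Cb_pairing_continuous[OF UC(1) DC(1)]) (use \<alpha> \<epsilon> in \<open>auto simp: schwartz_moll l1_moll\<close>)
    then have "continuous_on {0..} (\<lambda>t. Re (U i t (\<lambda>x. complex_of_real (moll \<epsilon> b x))))" by (rule continuous_on_Re)
    then show ?thesis by (simp add: U_def rpairing_moll)
  qed
  have small: "\<forall>\<^sub>F t in at_top. Lp_norm \<infinity> (u t) \<le> ennreal (real CARD('n) * e)" if e: "e > 0" for e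
  proof -
    obtain r where r: "r \<ge> 0" "(\<integral>\<^sup>+t. h t * indicator {r..} t \<partial>lborel) < ennreal (e / (2 * (C + 1)))"
      using tail_integral_small[OF hm hfin, of "ennreal (e / (2 * (C + 1)))"] e C by auto
    have Ctail: "ennreal C * (\<integral>\<^sup>+t. h t * indicator {s - 1..} t \<partial>lborel) \<le> ennreal (e / 2)" if s: "s - 1 \<ge> r" for s
    proof -
      have "(\<integral>\<^sup>+t. h t * indicator {s - 1..} t \<partial>lborel) \<le> (\<integral>\<^sup>+t. h t * indicator {r..} t \<partial>lborel)"
        using s by (intro nn_integral_mono) (auto simp: indicator_def)
      also have "\<dots> \<le> ennreal (e / (2 * (C + 1)))" using r by simp
      finally have "ennreal C * (\<integral>\<^sup>+t. h t * indicator {s - 1..} t \<partial>lborel) \<le> ennreal C * ennreal (e / (2 * (C + 1)))"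
        by (intro mult_left_mono) auto
      also have "\<dots> = ennreal (C * (e / (2 * (C + 1))))" using C by (rule ennreal_mult'[symmetric])
      also have "\<dots> \<le> ennreal (e / 2)" using C e by (intro ennreal_leI) (simp add: field_simps)
      finally show ?thesis .
    qed
    define \<kappa> where "\<kappa> = e / (4 * (M + 1))"
    have \<kappa>: "\<kappa> > 0" "\<kappa> * M \<le> e / 4" using e M by (auto simp: \<kappa>_def field_simps)
    \<comment> \<open>Below the frequency \<open>2 powr (- l)\<close>, boundedness in regularity \<open>1 - \<alpha>\<close> already makes \<open>u\<close> small; the
      maximum with 1 only keeps \<open>l\<close> positive when \<open>\<kappa> \<ge> 1\<close>.\<close>
    define l where "l = max 1 (- log 2 \<kappa> / (\<alpha> - 1))"
    have l: "l > 0" by (simp add: l_def)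
    have lk: "2 powr (- ((\<alpha> - 1) * l)) \<le> \<kappa>"
    proof -
      have "- log 2 \<kappa> / (\<alpha> - 1) \<le> l" by (simp add: l_def)
      then have "- log 2 \<kappa> \<le> (\<alpha> - 1) * l"
        using \<alpha> pos_divide_le_eq[of "\<alpha> - 1" "- log 2 \<kappa>" l] by (simp only: mult.commute)
      then have "2 powr (- ((\<alpha> - 1) * l)) \<le> 2 powr (log 2 \<kappa>)" by (intro powr_mono) auto
      then show ?thesis using \<kappa> by simp
    qed
    obtain s where s: "s \<ge> max (r + 1) 2" "h s \<le> ennreal (e / (4 * 2 powr (1 * l)))"
      using integrable_small_somewhere[OF hfin, of "e / (4 * 2 powr (1 * l))" "max (r + 1) 2"] e by auto
    then have s0: "s \<ge> 0" "s \<ge> 2" "s - 1 \<ge> r" by auto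
    have dUs: "dnorm (U i s) \<le> ennreal (e / 2)" for i
    proof -
      have "dnorm (U i s) \<le> bsum 0 (U i s)" by (rule dnorm_le_bsum[OF Cb_approximable[OF UC(1) s0(1)]])
      also have "\<dots> \<le> ennreal (2 powr (- ((\<alpha> - 1) * l))) * bsum (- (\<alpha> - 1)) (U i s) + ennreal (2 powr (1 * l)) * bsum 1 (U i s)"
        by (rule bsum_split) (use \<alpha> l in auto)
      also have "\<dots> \<le> ennreal \<kappa> * ennreal M + ennreal (2 powr (1 * l)) * ennreal (e / (4 * 2 powr (1 * l)))"
      proof (intro add_mono mult_mono)
        show "bsum (- (\<alpha> - 1)) (U i s) \<le> ennreal M" using M(2)[OF s0(1), of i] by simp
        show "bsum 1 (U i s) \<le> ennreal (e / (4 * 2 powr (1 * l)))" using hU[OF s0(1), of i] s(2) by (rule order_trans)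
      qed (use lk in \<open>auto intro: ennreal_leI\<close>)
      also have "\<dots> = ennreal (\<kappa> * M) + ennreal (e / 4)"
        using \<kappa> M e by (simp add: ennreal_mult'[symmetric])
      also have "\<dots> \<le> ennreal (e / 4) + ennreal (e / 4)" using \<kappa> by (intro add_mono ennreal_leI) auto
      also have "\<dots> = ennreal (e / 2)" using e by (simp add: ennreal_plus[symmetric] del: ennreal_plus)
      finally show ?thesis .
    qed
    have "Lp_norm \<infinity> (u t) \<le> ennreal (real CARD('n) * e)" if t: "t \<ge> s" for t
    proof -
      have t0: "t \<ge> 0" using t s0 by simp
      have "AE x in lborel. \<bar>u t x $ i\<bar> \<le> e" for i
      proof (rule ae_abs_le_of_moll[OF rpairable_loc_integrable[OF rp(2)[OF t0]]])
        fix \<epsilon> :: real and b assume \<epsilon>: "0 < \<epsilon>"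
        let ?a = "\<lambda>t. LINT x|lborel. u t x $ i * moll \<epsilon> b x"
        have "norm (U i s (\<lambda>x. complex_of_real (moll \<epsilon> b x))) \<le> e / 2"
          by (rule moll_le_dnorm[OF \<epsilon> dUs]) (use e in simp)
        then have as: "\<bar>?a s\<bar> \<le> e / 2" by (simp add: U_def rpairing_moll)
        have "ennreal \<bar>?a t - ?a s\<bar> \<le> ennreal C * (\<integral>\<^sup>+\<tau>. h \<tau> * indicator {s - 1..} \<tau> \<partial>lborel)"
          by (rule weak_increment_bound[OF eqnR rp(2) cont[OF \<epsilon>] C RB hm \<epsilon> s0(2) t])
        also have "\<dots> \<le> ennreal (e / 2)" by (rule Ctail[OF s0(3)])
        finally have "\<bar>?a t - ?a s\<bar> \<le> e / 2" using e by (simp add: ennreal_le_iff)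
        then show "\<bar>?a t\<bar> \<le> e" using as by linarith
      qed
      then have "AE x in lborel. \<forall>i. \<bar>u t x $ i\<bar> \<le> e" by (rule AE_all_finite)
      then have "AE x in lborel. ennreal (norm (u t x)) \<le> ennreal (real CARD('n) * e)"
      proof eventually_elim
        case (elim x)
        then show ?case by (intro ennreal_leI norm_vec_le) auto
      qed
      moreover have "u t \<in> borel_measurable borel" by (rule rpairable_vec_measurable[OF rp(2)[OF t0]])
      ultimately show ?thesis unfolding Lp_norm_def by (auto intro!: esssup_I)
    qed
    then show ?thesis by (auto simp: eventually_at_top_linorder)
  qed
  show ?thesis
  proof (rule order_tendstoI)
    fix y :: ennreal assume y: "0 < y"
    obtain q where q: "q > 0" "ennreal q < y"
    proof (cases y)
      case (real z)
      then show ?thesis using y that[of "z / 2"] by (auto simp: ennreal_less_iff)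
    next
      case top
      then show ?thesis using that[of 1] by simp
    qed
    have "\<forall>\<^sub>F t in at_top. Lp_norm \<infinity> (u t) \<le> ennreal (real CARD('n) * (q / real CARD('n)))"
      using q by (intro small) simp
    then show "\<forall>\<^sub>F t in at_top. Lp_norm \<infinity> (u t) < y"
      by (rule eventually_mono) (use q in auto)
  qed simp
qed

end

theorem corollary1p1:
  fixes chi :: "real^'n::finite \<Rightarrow> real"
    and \<alpha> \<epsilon> :: real
    and \<rho>0 :: "real^'n \<Rightarrow> real" and u0 :: "real^'n \<Rightarrow> real^'n"
    and \<rho> :: "real \<Rightarrow> real^'n \<Rightarrow> real" and u :: "real \<Rightarrow> real^'n \<Rightarrow> real^'n"
  assumes "cutoff chi"
    and "1 < \<alpha>" and "\<alpha> < 2"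
    and "\<epsilon> > 0"
    and "well_posedness_threshold chi \<alpha> \<epsilon>"
    and "admissible_data chi \<alpha> \<epsilon> \<rho>0 u0"
    and "global_solution chi \<alpha> \<rho>0 u0 \<rho> u"
  shows "((\<lambda>t. Lp_norm \<infinity> (u t)) \<longlongrightarrow> 0) at_top"
proof -
  interpret littlewood_paley chi by unfold_locales (rule assms(1))
  show ?thesis by (rule velocity_decay[OF assms(2,3,7)])
qed

end
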